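(* For any 2-category $\mathbf{A}$ and any equipment $\mathbb{E}$ with local coequalizers, there is an isomorphism of 2-categories $$\mathbf{Lax}_\ell(\mathrm{VerDbl}(\mathbf{A}),\mathbb{E})\xrightarrow{\ \cong\ }\mathbf{2Cat}_\ell(\mathbf{A},\mathbf{Cat}(\mathbb{E})).$$ In particular, there is an isomorphism of 2-categories $$\mathbf{Lax}_\ell(\mathrm{VerDbl}(\mathbf{A}),\mathbb{S}\mathrm{pan})\xrightarrow{\ \cong\ }\mathbf{2Cat}_\ell(\mathbf{A},\mathbf{Cat}).$$
   Context: Double categories are pseudo: strict in the direction of arrows, weak in the direction of proarrows. A double category $\mathbb{D}$ has underlying categories $\mathbb{D}_0$ (objects and arrows) and $\mathbb{D}_1$ (proarrows, written $m: x \nrightarrow y$, and cells). A cell $\alpha: m \to n$ from $m: x \nrightarrow y$ to $n: w \nrightarrow z$ over $(f,g)$ has source arrow $f: x\to w$ and target arrow $g: y \to z$; it is globular if $f,g$ are identities. Composition in $\mathbb{D}_0,\mathbb{D}_1$ is written $\cdot$ in diagrammatic order; external composition of proarrows and cells is written $\odot$ in diagrammatic order, with external identities $\mathrm{id}_x,\mathrm{id}_f$. Coherence isomorphisms for $\odot$ are suppressed in formulas. An equipment is a double category for which $\langle s,t\rangle:\mathbb{D}_1\to\mathbb{D}_0\times\mathbb{D}_0$ is a fibration. Local coequalizers: each hom-category $\mathbb{D}(x,y)$ (proarrows $x\nrightarrow y$, globular cells) has coequalizers, preserved by external composition in each argument. $\mathbb{S}\mathrm{pan}$ is the double category of sets,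 functions, spans, maps of spans. $\mathrm{VerDbl}(\mathbf{A})$ is the strict double category with the objects of $\mathbf{A}$, arrows the morphisms of $\mathbf{A}$, only identity proarrows, and cells $\mathrm{id}_x\to\mathrm{id}_y$ over $(f,g)$ the 2-cells $f\Rightarrow g$ of $\mathbf{A}$. Lax double functor $F:\mathbb{D}\to\mathbb{E}$: functors $F_0,F_1$ compatible with source and target, with globular laxators $F_{m,n}:Fm\odot Fn\to F(m\odot n)$ and unitors $F_x:\mathrm{id}_{Fx}\to F\mathrm{id}_x$, natural ($(F\alpha\odot F\beta)\cdot F_{m',n'}=F_{m,n}\cdot F(\alpha\odot\beta)$, $\mathrm{id}_{Ff}\cdot F_y=F_x\cdot F\mathrm{id}_f$), associative and unital. $F_{x,m}:F\mathrm{id}_x\odot Fm\to Fm$, $F_{m,y}:Fm\odot F\mathrm{id}_y\to Fm$ denote laxators at identity proarrows. Lax natural transformation $\alpha:F\Rightarrow G$ of lax functors $\mathbb{D}\to\mathbb{E}$: arrows $\alpha_x:Fx\to Gx$; cells $\alpha_m:Fm\to Gm$ over $(\alpha_x,\alpha_y)$ for $m:x\nrightarrow y$; for each arrow $f:x\to y$ a cell $\alpha_f:\mathrm{id}_{Fx}\to G\mathrm{id}_y$ over $(\alpha_x\cdot Gf,\ Ff\cdot\alpha_y)$; such that (1) for each cell $\gamma:m\to n$ over $(f,g)$, $m:x\nrightarrow y$, $n:w\nrightarrow z$: $(\alpha_f\odot(F\gamma\cdot\alpha_n))\cdot G_{w,n}=((\alpha_m\cdot G\gamma)\odot\alpha_g)\cdot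 G_{n,z}$; (2) $F_{m,n}\cdot\alpha_{m\odot n}=(\alpha_m\odot\alpha_n)\cdot G_{m,n}$ and $F_x\cdot\alpha_{\mathrm{id}_x}=\mathrm{id}_{\alpha_x}\cdot G_x$; (3) for $x\xrightarrow{f}y\xrightarrow{g}z$, $\alpha_{f\cdot g}=((\alpha_f\cdot G\mathrm{id}_g)\odot(\mathrm{id}_{Ff}\cdot\alpha_g))\cdot G_{z,z}$ and $\alpha_{1_x}=\mathrm{id}_{\alpha_x}\cdot G_x$. Composition: $(\alpha\beta)_x=\alpha_x\cdot\beta_x$, $(\alpha\beta)_m=\alpha_m\cdot\beta_m$, $(\alpha\beta)_f=((\mathrm{id}_{\alpha_x}\cdot\beta_f)\odot(\alpha_f\cdot\beta_{\mathrm{id}_y}))\cdot H_{y,y}$; the identity on $F$ has $(1_F)_f=\mathrm{id}_{Ff}\cdot F_y$ and identity components. Modulation $\mu:\alpha\Rrightarrow\beta$ of lax transformations $\alpha,\beta:F\Rightarrow G$: for each object $x$ of $\mathbb{D}$ a cell $\mu_x:\mathrm{id}_{Fx}\to G\mathrm{id}_x$ over $(\alpha_x,\beta_x)$ such that for each $m:x\nrightarrow y$, $(\mu_x\odot\beta_m)\cdot G_{x,m}=(\alpha_m\odot\mu_y)\cdot G_{m,y}$ (this common cell is denoted $\mu_m$), and for each cell $\gamma:m\to n$ over $(f,g)$, $m:x\nrightarrow y$, $n:w\nrightarrow z$, $(\alpha_f\odot(F\gamma\cdot\mu_n))\cdot G_{w,n}=((\mu_m\cdot G\gamma)\odot\beta_g)\cdot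 G_{n,z}$. Compositions: $(\mu\cdot\nu)_x=(\mu_x\odot\nu_x)\cdot G_{x,x}$ for $\mu:\alpha\Rrightarrow\beta$, $\nu:\beta\Rrightarrow\gamma$; identities $(1_\alpha)_x=\mathrm{id}_{\alpha_x}\cdot G_x$; and $(\mu*\nu)_x=\mu_x\cdot\nu_{\mathrm{id}_x}$ along transformations $F\Rightarrow G\Rightarrow H$. $\mathbf{Lax}_\ell(\mathbb{D},\mathbb{E})$ is the resulting 2-category of lax functors, lax natural transformations and modulations. $\mathbf{Cat}(\mathbb{E})$ is the 2-category of category objects in $\mathbb{E}$: objects $(x,r,\mu,\upsilon)$ with $r:x\nrightarrow x$ and globular $\mu:r\odot r\to r$, $\upsilon:\mathrm{id}_x\to r$, associative and unital; morphisms (functors) $(f,\phi):(x,r,\mu,\upsilon)\to(y,s,\nu,\theta)$ with $f:x\to y$ and $\phi:r\to s$ over $(f,f)$, $(\phi\odot\phi)\cdot\nu=\mu\cdot\phi$, $\mathrm{id}_f\cdot\theta=\upsilon\cdot\phi$; 2-morphisms $(f,\phi)\Rightarrow(g,\psi)$ the cells $\alpha:\mathrm{id}_x\to s$ over $(f,g)$ with $(\alpha\odot\psi)\cdot\nu=(\phi\odot\alpha)\cdot\nu$; composition is the evident one. $\mathbf{Cat}$ is the 2-category of small categories. $\mathbf{2Cat}_\ell(\mathbf{A},\mathbf{B})$ is the 2-category of (strict) 2-functors $\mathbf{A}\to\mathbf{B}$, lax natural transformations (with comparison 2-cells $\alpha_f:\alpha_x\cdot Gf\Rightarrow Ff\cdot\alpha_y$)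 and modifications. *)

theory Defs
  imports Main "HOL-Library.FuncSet"
begin

text \<open>
  Conventions. All structures are records with carriers; axioms constrain the operations on the
  carriers only. Composition is written in diagrammatic order. Data that are functions on a carrier
  (functors, transformations, maps of sets) are required to take the value \<^term>\<open>undefined\<close> off that
  carrier, so that equality of records is equality of the mathematical objects.
\<close>

section \<open>Categories\<close>

record ('o, 'a) cat =
  Obj :: "'o set"
  Arr :: "'a set"
  Dom :: "'a \<Rightarrow> 'o"
  Cod :: "'a \<Rightarrow> 'o"
  Ide :: "'o \<Rightarrow> 'a"
  Comp :: "'a \<Rightarrow> 'a \<Rightarrow> 'a" (infixl "\<cdot>\<index>" 70)

definition in_hom :: "('o, 'a) cat \<Rightarrow> 'a \<Rightarrow> 'o \<Rightarrow> 'o \<Rightarrow> bool" where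
  "in_hom C f x y \<longleftrightarrow> f \<in> Arr C \<and> Dom C f = x \<and> Cod C f = y"

definition composable :: "('o, 'a) cat \<Rightarrow> 'a \<Rightarrow> 'a \<Rightarrow> bool" where
  "composable C f g \<longleftrightarrow> f \<in> Arr C \<and> g \<in> Arr C \<and> Cod C f = Dom C g"

locale category =
  fixes C :: "('o, 'a) cat" (structure)
  assumes dom_obj: "f \<in> Arr C \<Longrightarrow> Dom C f \<in> Obj C"
    and cod_obj: "f \<in> Arr C \<Longrightarrow> Cod C f \<in> Obj C"
    and ide_hom: "x \<in> Obj C \<Longrightarrow> in_hom C (Ide C x) x x"
    and comp_hom: "composable C f g \<Longrightarrow> in_hom C (f \<cdot> g) (Dom C f) (Cod C g)"
    and ide_comp: "f \<in> Arr C \<Longrightarrow> Ide C (Dom C f) \<cdot> f = f"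
    and comp_ide: "f \<in> Arr C \<Longrightarrow> f \<cdot> Ide C (Cod C f) = f"
    and comp_assoc: "composable C f g \<Longrightarrow> composable C g h \<Longrightarrow> (f \<cdot> g) \<cdot> h = f \<cdot> (g \<cdot> h)"

definition cat_functor ::
  "('o, 'a) cat \<Rightarrow> ('x, 'b) cat \<Rightarrow> ('o \<Rightarrow> 'x) \<Rightarrow> ('a \<Rightarrow> 'b) \<Rightarrow> bool" where
  "cat_functor C D F0 F1 \<longleftrightarrow>
     (\<forall>x \<in> Obj C. F0 x \<in> Obj D) \<and>
     (\<forall>f \<in> Arr C. in_hom D (F1 f) (F0 (Dom C f)) (F0 (Cod C f))) \<and>
     (\<forall>x \<in> Obj C. F1 (Ide C x) = Ide D (F0 x)) \<and>
     (\<forall>f g. composable C f g \<longrightarrow> F1 (f \<cdot>\<^bsub>C\<^esub> g) = F1 f \<cdot>\<^bsub>D\<^esub> F1 g)"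

definition is_inverse :: "('o, 'a) cat \<Rightarrow> 'a \<Rightarrow> 'a \<Rightarrow> bool" where
  "is_inverse C f g \<longleftrightarrow>
     f \<in> Arr C \<and> in_hom C g (Cod C f) (Dom C f) \<and>
     f \<cdot>\<^bsub>C\<^esub> g = Ide C (Dom C f) \<and> g \<cdot>\<^bsub>C\<^esub> f = Ide C (Cod C f)"

definition is_iso :: "('o, 'a) cat \<Rightarrow> 'a \<Rightarrow> bool" where
  "is_iso C f \<longleftrightarrow> (\<exists>g. is_inverse C f g)"

definition inv_arr :: "('o, 'a) cat \<Rightarrow> 'a \<Rightarrow> 'a" where
  "inv_arr C f = (THE g. is_inverse C f g)"

definition prod_cat :: "('o, 'a) cat \<Rightarrow> ('x, 'b) cat \<Rightarrow> ('o \<times> 'x, 'a \<times> 'b) cat" where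
  "prod_cat C D =
     \<lparr> Obj = Obj C \<times> Obj D, Arr = Arr C \<times> Arr D,
       Dom = (\<lambda>(f, g). (Dom C f, Dom D g)), Cod = (\<lambda>(f, g). (Cod C f, Cod D g)),
       Ide = (\<lambda>(x, y). (Ide C x, Ide D y)),
       Comp = (\<lambda>(f, g) (f', g'). (f \<cdot>\<^bsub>C\<^esub> f', g \<cdot>\<^bsub>D\<^esub> g')) \<rparr>"

definition cartesian_arr :: "('o, 'a) cat \<Rightarrow> ('x, 'b) cat \<Rightarrow> ('a \<Rightarrow> 'b) \<Rightarrow> 'a \<Rightarrow> bool" where
  "cartesian_arr C B P1 h \<longleftrightarrow>
     h \<in> Arr C \<and>
     (\<forall>k \<in> Arr C. \<forall>u. Cod C k = Cod C h \<and> composable B u (P1 h) \<and> P1 k = u \<cdot>\<^bsub>B\<^esub> P1 h \<longrightarrow>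
        (\<exists>!v. in_hom C v (Dom C k) (Dom C h) \<and> P1 v = u \<and> v \<cdot>\<^bsub>C\<^esub> h = k))"

definition fibration ::
  "('o, 'a) cat \<Rightarrow> ('x, 'b) cat \<Rightarrow> ('o \<Rightarrow> 'x) \<Rightarrow> ('a \<Rightarrow> 'b) \<Rightarrow> bool" where
  "fibration C B P0 P1 \<longleftrightarrow>
     category C \<and> category B \<and> cat_functor C B P0 P1 \<and>
     (\<forall>e \<in> Obj C. \<forall>u \<in> Arr B. Cod B u = P0 e \<longrightarrow>
        (\<exists>h. cartesian_arr C B P1 h \<and> Cod C h = e \<and> P1 h = u))"

definition is_coequalizer :: "('o, 'a) cat \<Rightarrow> 'a \<Rightarrow> 'a \<Rightarrow> 'a \<Rightarrow> bool" where
  "is_coequalizer C a b q \<longleftrightarrow>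
     a \<in> Arr C \<and> in_hom C b (Dom C a) (Cod C a) \<and> composable C a q \<and>
     a \<cdot>\<^bsub>C\<^esub> q = b \<cdot>\<^bsub>C\<^esub> q \<and>
     (\<forall>k. composable C a k \<and> a \<cdot>\<^bsub>C\<^esub> k = b \<cdot>\<^bsub>C\<^esub> k \<longrightarrow>
        (\<exists>!v. in_hom C v (Cod C q) (Cod C k) \<and> q \<cdot>\<^bsub>C\<^esub> v = k))"

definition has_coequalizers :: "('o, 'a) cat \<Rightarrow> bool" where
  "has_coequalizers C \<longleftrightarrow>
     (\<forall>a b. a \<in> Arr C \<and> in_hom C b (Dom C a) (Cod C a) \<longrightarrow> (\<exists>q. is_coequalizer C a b q))"


section \<open>2-categories\<close>

record ('o, 'a, 'c) two_cat =
  under :: "('o, 'a) cat"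
  Cells :: "'c set"
  Src :: "'c \<Rightarrow> 'a"
  Trg :: "'c \<Rightarrow> 'a"
  VId :: "'a \<Rightarrow> 'c"
  VComp :: "'c \<Rightarrow> 'c \<Rightarrow> 'c"
  HComp :: "'c \<Rightarrow> 'c \<Rightarrow> 'c"

definition two_cell :: "('o, 'a, 'c) two_cat \<Rightarrow> 'c \<Rightarrow> 'a \<Rightarrow> 'a \<Rightarrow> bool" where
  "two_cell A \<sigma> f g \<longleftrightarrow> \<sigma> \<in> Cells A \<and> Src A \<sigma> = f \<and> Trg A \<sigma> = g"

definition vert_cat :: "('o, 'a, 'c) two_cat \<Rightarrow> ('a, 'c) cat" where
  "vert_cat A =
     \<lparr> Obj = Arr (under A), Arr = Cells A, Dom = Src A, Cod = Trg A,
       Ide = VId A, Comp = VComp A \<rparr>"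

definition horiz_cat :: "('o, 'a, 'c) two_cat \<Rightarrow> ('o, 'c) cat" where
  "horiz_cat A =
     \<lparr> Obj = Obj (under A), Arr = Cells A,
       Dom = (\<lambda>\<sigma>. Dom (under A) (Src A \<sigma>)), Cod = (\<lambda>\<sigma>. Cod (under A) (Src A \<sigma>)),
       Ide = (\<lambda>x. VId A (Ide (under A) x)), Comp = HComp A \<rparr>"

locale two_category =
  fixes A :: "('o, 'a, 'c) two_cat"
  assumes under_category: "category (under A)"
    and vert_category: "category (vert_cat A)"
    and horiz_category: "category (horiz_cat A)"
    and globular_dom: "\<sigma> \<in> Cells A \<Longrightarrow> Dom (under A) (Src A \<sigma>) = Dom (under A) (Trg A \<sigma>)"
    and globular_cod: "\<sigma> \<in> Cells A \<Longrightarrow> Cod (under A) (Src A \<sigma>) = Cod (under A) (Trg A \<sigma>)"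
    and src_hcomp: "composable (horiz_cat A) \<sigma> \<tau> \<Longrightarrow>
      Src A (HComp A \<sigma> \<tau>) = Src A \<sigma> \<cdot>\<^bsub>under A\<^esub> Src A \<tau>"
    and trg_hcomp: "composable (horiz_cat A) \<sigma> \<tau> \<Longrightarrow>
      Trg A (HComp A \<sigma> \<tau>) = Trg A \<sigma> \<cdot>\<^bsub>under A\<^esub> Trg A \<tau>"
    and vid_hcomp: "composable (under A) f g \<Longrightarrow>
      HComp A (VId A f) (VId A g) = VId A (f \<cdot>\<^bsub>under A\<^esub> g)"
    and interchange: "composable (vert_cat A) \<sigma> \<sigma>' \<Longrightarrow> composable (vert_cat A) \<tau> \<tau>' \<Longrightarrow>
      composable (horiz_cat A) \<sigma> \<tau> \<Longrightarrow>
      HComp A (VComp A \<sigma> \<sigma>') (VComp A \<tau> \<tau>') = VComp A (HComp A \<sigma> \<tau>) (HComp A \<sigma>' \<tau>')"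

record ('o, 'a, 'c, 'x, 'b, 'd) two_functor =
  tf_obj :: "'o \<Rightarrow> 'x"
  tf_arr :: "'a \<Rightarrow> 'b"
  tf_cell :: "'c \<Rightarrow> 'd"

definition is_two_functor ::
  "('o, 'a, 'c) two_cat \<Rightarrow> ('x, 'b, 'd) two_cat \<Rightarrow> ('o, 'a, 'c, 'x, 'b, 'd) two_functor \<Rightarrow> bool" where
  "is_two_functor A B F \<longleftrightarrow>
     tf_obj F \<in> extensional (Obj (under A)) \<and>
     tf_arr F \<in> extensional (Arr (under A)) \<and>
     tf_cell F \<in> extensional (Cells A) \<and>
     cat_functor (under A) (under B) (tf_obj F) (tf_arr F) \<and>
     cat_functor (vert_cat A) (vert_cat B) (tf_arr F) (tf_cell F) \<and>
     cat_functor (horiz_cat A) (horiz_cat B) (tf_obj F) (tf_cell F)"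

definition two_functor_id :: "('o, 'a, 'c) two_cat \<Rightarrow> ('o, 'a, 'c, 'o, 'a, 'c) two_functor" where
  "two_functor_id A =
     \<lparr> tf_obj = (\<lambda>x \<in> Obj (under A). x), tf_arr = (\<lambda>f \<in> Arr (under A). f),
       tf_cell = (\<lambda>\<sigma> \<in> Cells A. \<sigma>) \<rparr>"

definition two_functor_comp ::
  "('o, 'a, 'c) two_cat \<Rightarrow> ('o, 'a, 'c, 'x, 'b, 'd) two_functor \<Rightarrow>
   ('x, 'b, 'd, 'y, 'e, 'h) two_functor \<Rightarrow> ('o, 'a, 'c, 'y, 'e, 'h) two_functor" where
  "two_functor_comp A F G =
     \<lparr> tf_obj = (\<lambda>x \<in> Obj (under A). tf_obj G (tf_obj F x)),
       tf_arr = (\<lambda>f \<in> Arr (under A). tf_arr G (tf_arr F f)),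
       tf_cell = (\<lambda>\<sigma> \<in> Cells A. tf_cell G (tf_cell F \<sigma>)) \<rparr>"

definition isomorphic_two_cats :: "('o, 'a, 'c) two_cat \<Rightarrow> ('x, 'b, 'd) two_cat \<Rightarrow> bool" where
  "isomorphic_two_cats A B \<longleftrightarrow>
     two_category A \<and> two_category B \<and>
     (\<exists>F G. is_two_functor A B F \<and> is_two_functor B A G \<and>
        two_functor_comp A F G = two_functor_id A \<and>
        two_functor_comp B G F = two_functor_id B)"


section \<open>The 2-category of 2-functors, lax natural transformations and modifications\<close>

record ('o, 'a, 'c, 'x, 'b, 'd) lax_nat =
  ln_dom :: "('o, 'a, 'c, 'x, 'b, 'd) two_functor"
  ln_cod :: "('o, 'a, 'c, 'x, 'b, 'd) two_functor"
  ln_obj :: "'o \<Rightarrow> 'b"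
  ln_arr :: "'a \<Rightarrow> 'd"

definition is_lax_nat ::
  "('o, 'a, 'c) two_cat \<Rightarrow> ('x, 'b, 'd) two_cat \<Rightarrow> ('o, 'a, 'c, 'x, 'b, 'd) lax_nat \<Rightarrow> bool" where
  "is_lax_nat A B \<alpha> \<longleftrightarrow>
    (let F = ln_dom \<alpha>; G = ln_cod \<alpha>; ob = ln_obj \<alpha>; ar = ln_arr \<alpha>; A1 = under A; B1 = under B in
     is_two_functor A B F \<and> is_two_functor A B G \<and>
     ob \<in> extensional (Obj A1) \<and> ar \<in> extensional (Arr A1) \<and>
     (\<forall>x \<in> Obj A1. in_hom B1 (ob x) (tf_obj F x) (tf_obj G x)) \<and>
     (\<forall>f \<in> Arr A1. two_cell B (ar f)
        (ob (Dom A1 f) \<cdot>\<^bsub>B1\<^esub> tf_arr G f) (tf_arr F f \<cdot>\<^bsub>B1\<^esub> ob (Cod A1 f))) \<and>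
     (\<forall>\<sigma> \<in> Cells A.
        VComp B (HComp B (VId B (ob (Dom A1 (Src A \<sigma>)))) (tf_cell G \<sigma>)) (ar (Trg A \<sigma>)) =
        VComp B (ar (Src A \<sigma>)) (HComp B (tf_cell F \<sigma>) (VId B (ob (Cod A1 (Src A \<sigma>)))))) \<and>
     (\<forall>f g. composable A1 f g \<longrightarrow>
        ar (f \<cdot>\<^bsub>A1\<^esub> g) =
        VComp B (HComp B (ar f) (VId B (tf_arr G g))) (HComp B (VId B (tf_arr F f)) (ar g))) \<and>
     (\<forall>x \<in> Obj A1. ar (Ide A1 x) = VId B (ob x)))"

definition lax_nat_id ::
  "('o, 'a, 'c) two_cat \<Rightarrow> ('x, 'b, 'd) two_cat \<Rightarrow> ('o, 'a, 'c, 'x, 'b, 'd) two_functor \<Rightarrow>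
   ('o, 'a, 'c, 'x, 'b, 'd) lax_nat" where
  "lax_nat_id A B F =
     \<lparr> ln_dom = F, ln_cod = F,
       ln_obj = (\<lambda>x \<in> Obj (under A). Ide (under B) (tf_obj F x)),
       ln_arr = (\<lambda>f \<in> Arr (under A). VId B (tf_arr F f)) \<rparr>"

definition lax_nat_comp ::
  "('o, 'a, 'c) two_cat \<Rightarrow> ('x, 'b, 'd) two_cat \<Rightarrow> ('o, 'a, 'c, 'x, 'b, 'd) lax_nat \<Rightarrow>
   ('o, 'a, 'c, 'x, 'b, 'd) lax_nat \<Rightarrow> ('o, 'a, 'c, 'x, 'b, 'd) lax_nat" where
  "lax_nat_comp A B \<alpha> \<beta> =
     \<lparr> ln_dom = ln_dom \<alpha>, ln_cod = ln_cod \<beta>,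
       ln_obj = (\<lambda>x \<in> Obj (under A). ln_obj \<alpha> x \<cdot>\<^bsub>under B\<^esub> ln_obj \<beta> x),
       ln_arr = (\<lambda>f \<in> Arr (under A).
         VComp B (HComp B (VId B (ln_obj \<alpha> (Dom (under A) f))) (ln_arr \<beta> f))
                 (HComp B (ln_arr \<alpha> f) (VId B (ln_obj \<beta> (Cod (under A) f))))) \<rparr>"

record ('o, 'a, 'c, 'x, 'b, 'd) modif =
  mf_dom :: "('o, 'a, 'c, 'x, 'b, 'd) lax_nat"
  mf_cod :: "('o, 'a, 'c, 'x, 'b, 'd) lax_nat"
  mf_obj :: "'o \<Rightarrow> 'd"

definition is_modif ::
  "('o, 'a, 'c) two_cat \<Rightarrow> ('x, 'b, 'd) two_cat \<Rightarrow> ('o, 'a, 'c, 'x, 'b, 'd) modif \<Rightarrow> bool" where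
  "is_modif A B \<mu> \<longleftrightarrow>
    (let \<alpha> = mf_dom \<mu>; \<beta> = mf_cod \<mu>; m = mf_obj \<mu>; F = ln_dom \<alpha>; G = ln_cod \<alpha> in
     is_lax_nat A B \<alpha> \<and> is_lax_nat A B \<beta> \<and> ln_dom \<beta> = F \<and> ln_cod \<beta> = G \<and>
     m \<in> extensional (Obj (under A)) \<and>
     (\<forall>x \<in> Obj (under A). two_cell B (m x) (ln_obj \<alpha> x) (ln_obj \<beta> x)) \<and>
     (\<forall>f \<in> Arr (under A).
        VComp B (ln_arr \<alpha> f) (HComp B (VId B (tf_arr F f)) (m (Cod (under A) f))) =
        VComp B (HComp B (m (Dom (under A) f)) (VId B (tf_arr G f))) (ln_arr \<beta> f)))"

definition TwoCat_lax ::
  "('o, 'a, 'c) two_cat \<Rightarrow> ('x, 'b, 'd) two_cat \<Rightarrow>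
   (('o, 'a, 'c, 'x, 'b, 'd) two_functor, ('o, 'a, 'c, 'x, 'b, 'd) lax_nat,
    ('o, 'a, 'c, 'x, 'b, 'd) modif) two_cat" where
  "TwoCat_lax A B =
     \<lparr> under =
         \<lparr> Obj = {F. is_two_functor A B F}, Arr = {\<alpha>. is_lax_nat A B \<alpha>},
           Dom = ln_dom, Cod = ln_cod, Ide = lax_nat_id A B, Comp = lax_nat_comp A B \<rparr>,
       Cells = {\<mu>. is_modif A B \<mu>}, Src = mf_dom, Trg = mf_cod,
       VId = (\<lambda>\<alpha>. \<lparr> mf_dom = \<alpha>, mf_cod = \<alpha>,
                    mf_obj = (\<lambda>x \<in> Obj (under A). VId B (ln_obj \<alpha> x)) \<rparr>),
       VComp = (\<lambda>\<mu> \<nu>. \<lparr> mf_dom = mf_dom \<mu>, mf_cod = mf_cod \<nu>,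
                    mf_obj = (\<lambda>x \<in> Obj (under A). VComp B (mf_obj \<mu> x) (mf_obj \<nu> x)) \<rparr>),
       HComp = (\<lambda>\<mu> \<nu>. \<lparr> mf_dom = lax_nat_comp A B (mf_dom \<mu>) (mf_dom \<nu>),
                    mf_cod = lax_nat_comp A B (mf_cod \<mu>) (mf_cod \<nu>),
                    mf_obj = (\<lambda>x \<in> Obj (under A). HComp B (mf_obj \<mu> x) (mf_obj \<nu> x)) \<rparr>) \<rparr>"


section \<open>Double categories\<close>

text \<open>
  Objects of \<open>D1\<close> are the proarrows, arrows of \<open>D1\<close> the cells. A cell from \<open>m\<close> to \<open>n\<close> over
  \<open>(f, g)\<close> has domain \<open>m\<close> and codomain \<open>n\<close> in \<open>D1\<close>, source arrow \<open>f\<close> and target arrow \<open>g\<close>.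
\<close>

record ('o, 'a, 'p, 'c) dbl =
  D0 :: "('o, 'a) cat"
  D1 :: "('p, 'c) cat"
  psrc :: "'p \<Rightarrow> 'o"
  ptgt :: "'p \<Rightarrow> 'o"
  csrc :: "'c \<Rightarrow> 'a"
  ctgt :: "'c \<Rightarrow> 'a"
  pid :: "'o \<Rightarrow> 'p"
  cid :: "'a \<Rightarrow> 'c"
  pcomp :: "'p \<Rightarrow> 'p \<Rightarrow> 'p" (infixl "\<odot>\<index>" 75)
  ccomp :: "'c \<Rightarrow> 'c \<Rightarrow> 'c" (infixl "\<otimes>\<index>" 75)
  passoc :: "'p \<Rightarrow> 'p \<Rightarrow> 'p \<Rightarrow> 'c"
  lunit :: "'p \<Rightarrow> 'c"
  runit :: "'p \<Rightarrow> 'c"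

abbreviation cell_comp :: "('o, 'a, 'p, 'c) dbl \<Rightarrow> 'c \<Rightarrow> 'c \<Rightarrow> 'c" (infixl "\<bullet>\<index>" 70) where
  "\<alpha> \<bullet>\<^bsub>D\<^esub> \<beta> \<equiv> Comp (D1 D) \<alpha> \<beta>"

abbreviation cell_id :: "('o, 'a, 'p, 'c) dbl \<Rightarrow> 'p \<Rightarrow> 'c" where
  "cell_id D m \<equiv> Ide (D1 D) m"

definition proarrow :: "('o, 'a, 'p, 'c) dbl \<Rightarrow> 'p \<Rightarrow> 'o \<Rightarrow> 'o \<Rightarrow> bool" where
  "proarrow D m x y \<longleftrightarrow> m \<in> Obj (D1 D) \<and> psrc D m = x \<and> ptgt D m = y"

definition cell_over ::
  "('o, 'a, 'p, 'c) dbl \<Rightarrow> 'c \<Rightarrow> 'p \<Rightarrow> 'p \<Rightarrow> 'a \<Rightarrow> 'a \<Rightarrow> bool" where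
  "cell_over D \<alpha> m n f g \<longleftrightarrow> in_hom (D1 D) \<alpha> m n \<and> csrc D \<alpha> = f \<and> ctgt D \<alpha> = g"

definition globular_cell :: "('o, 'a, 'p, 'c) dbl \<Rightarrow> 'c \<Rightarrow> 'p \<Rightarrow> 'p \<Rightarrow> bool" where
  "globular_cell D \<alpha> m n \<longleftrightarrow>
     cell_over D \<alpha> m n (Ide (D0 D) (psrc D m)) (Ide (D0 D) (ptgt D m))"

definition pcomposable :: "('o, 'a, 'p, 'c) dbl \<Rightarrow> 'p \<Rightarrow> 'p \<Rightarrow> bool" where
  "pcomposable D m n \<longleftrightarrow> m \<in> Obj (D1 D) \<and> n \<in> Obj (D1 D) \<and> ptgt D m = psrc D n"

definition ccomposable :: "('o, 'a, 'p, 'c) dbl \<Rightarrow> 'c \<Rightarrow> 'c \<Rightarrow> bool" where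
  "ccomposable D \<alpha> \<beta> \<longleftrightarrow> \<alpha> \<in> Arr (D1 D) \<and> \<beta> \<in> Arr (D1 D) \<and> ctgt D \<alpha> = csrc D \<beta>"

text \<open>The pullback of \<open>D1\<close> with itself over \<open>D0\<close>, domain of the functor \<open>\<odot>\<close>.\<close>

definition composable_pairs :: "('o, 'a, 'p, 'c) dbl \<Rightarrow> ('p \<times> 'p, 'c \<times> 'c) cat" where
  "composable_pairs D =
     (prod_cat (D1 D) (D1 D))
       \<lparr> Obj := {(m, n). pcomposable D m n}, Arr := {(\<alpha>, \<beta>). ccomposable D \<alpha> \<beta>} \<rparr>"

locale double_category =
  fixes D :: "('o, 'a, 'p, 'c) dbl" (structure)
  assumes D0_category: "category (D0 D)"
    and D1_category: "category (D1 D)"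
    and src_functor: "cat_functor (D1 D) (D0 D) (psrc D) (csrc D)"
    and tgt_functor: "cat_functor (D1 D) (D0 D) (ptgt D) (ctgt D)"
    and id_functor: "cat_functor (D0 D) (D1 D) (pid D) (cid D)"
    and src_tgt_pid: "x \<in> Obj (D0 D) \<Longrightarrow> psrc D (pid D x) = x \<and> ptgt D (pid D x) = x"
    and src_tgt_cid: "f \<in> Arr (D0 D) \<Longrightarrow> csrc D (cid D f) = f \<and> ctgt D (cid D f) = f"
    and comp_functor: "cat_functor (composable_pairs D) (D1 D)
      (\<lambda>(m, n). m \<odot> n) (\<lambda>(\<alpha>, \<beta>). \<alpha> \<otimes> \<beta>)"
    and src_tgt_pcomp: "pcomposable D m n \<Longrightarrow>
      psrc D (m \<odot> n) = psrc D m \<and> ptgt D (m \<odot> n) = ptgt D n"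
    and src_tgt_ccomp: "ccomposable D \<alpha> \<beta> \<Longrightarrow>
      csrc D (\<alpha> \<otimes> \<beta>) = csrc D \<alpha> \<and> ctgt D (\<alpha> \<otimes> \<beta>) = ctgt D \<beta>"
    and passoc_globular: "pcomposable D m n \<Longrightarrow> pcomposable D n p \<Longrightarrow>
      globular_cell D (passoc D m n p) (m \<odot> n \<odot> p) (m \<odot> (n \<odot> p))"
    and passoc_iso: "pcomposable D m n \<Longrightarrow> pcomposable D n p \<Longrightarrow> is_iso (D1 D) (passoc D m n p)"
    and passoc_natural: "ccomposable D \<alpha> \<beta> \<Longrightarrow> ccomposable D \<beta> \<gamma> \<Longrightarrow>
      (\<alpha> \<otimes> \<beta> \<otimes> \<gamma>) \<bullet> passoc D (Cod (D1 D) \<alpha>) (Cod (D1 D) \<beta>) (Cod (D1 D) \<gamma>) =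
      passoc D (Dom (D1 D) \<alpha>) (Dom (D1 D) \<beta>) (Dom (D1 D) \<gamma>) \<bullet> (\<alpha> \<otimes> (\<beta> \<otimes> \<gamma>))"
    and lunit_globular: "proarrow D m x y \<Longrightarrow> globular_cell D (lunit D m) (pid D x \<odot> m) m"
    and lunit_iso: "m \<in> Obj (D1 D) \<Longrightarrow> is_iso (D1 D) (lunit D m)"
    and lunit_natural: "cell_over D \<alpha> m n f g \<Longrightarrow>
      (cid D f \<otimes> \<alpha>) \<bullet> lunit D n = lunit D m \<bullet> \<alpha>"
    and runit_globular: "proarrow D m x y \<Longrightarrow> globular_cell D (runit D m) (m \<odot> pid D y) m"
    and runit_iso: "m \<in> Obj (D1 D) \<Longrightarrow> is_iso (D1 D) (runit D m)"
    and runit_natural: "cell_over D \<alpha> m n f g \<Longrightarrow>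
      (\<alpha> \<otimes> cid D g) \<bullet> runit D n = runit D m \<bullet> \<alpha>"
    and pentagon: "pcomposable D m n \<Longrightarrow> pcomposable D n p \<Longrightarrow> pcomposable D p q \<Longrightarrow>
      (passoc D m n p \<otimes> cell_id D q) \<bullet> passoc D m (n \<odot> p) q \<bullet> (cell_id D m \<otimes> passoc D n p q) =
      passoc D (m \<odot> n) p q \<bullet> passoc D m n (p \<odot> q)"
    and triangle: "pcomposable D m n \<Longrightarrow>
      passoc D m (pid D (ptgt D m)) n \<bullet> (cell_id D m \<otimes> lunit D n) = runit D m \<otimes> cell_id D n"

definition lunit_inv :: "('o, 'a, 'p, 'c) dbl \<Rightarrow> 'p \<Rightarrow> 'c" where
  "lunit_inv D m = inv_arr (D1 D) (lunit D m)"

definition runit_inv :: "('o, 'a, 'p, 'c) dbl \<Rightarrow> 'p \<Rightarrow> 'c" where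
  "runit_inv D m = inv_arr (D1 D) (runit D m)"

definition equipment :: "('o, 'a, 'p, 'c) dbl \<Rightarrow> bool" where
  "equipment D \<longleftrightarrow>
     double_category D \<and>
     fibration (D1 D) (prod_cat (D0 D) (D0 D))
       (\<lambda>m. (psrc D m, ptgt D m)) (\<lambda>\<alpha>. (csrc D \<alpha>, ctgt D \<alpha>))"

definition hom_cat :: "('o, 'a, 'p, 'c) dbl \<Rightarrow> 'o \<Rightarrow> 'o \<Rightarrow> ('p, 'c) cat" where
  "hom_cat D x y =
     (D1 D) \<lparr> Obj := {m. proarrow D m x y},
              Arr := {\<alpha> \<in> Arr (D1 D). csrc D \<alpha> = Ide (D0 D) x \<and> ctgt D \<alpha> = Ide (D0 D) y} \<rparr>"

definition local_coequalizers :: "('o, 'a, 'p, 'c) dbl \<Rightarrow> bool" where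
  "local_coequalizers D \<longleftrightarrow>
     (\<forall>x \<in> Obj (D0 D). \<forall>y \<in> Obj (D0 D).
        has_coequalizers (hom_cat D x y) \<and>
        (\<forall>a b q. is_coequalizer (hom_cat D x y) a b q \<longrightarrow>
           (\<forall>z n. proarrow D n y z \<longrightarrow>
              is_coequalizer (hom_cat D x z)
                (a \<otimes>\<^bsub>D\<^esub> cell_id D n) (b \<otimes>\<^bsub>D\<^esub> cell_id D n) (q \<otimes>\<^bsub>D\<^esub> cell_id D n)) \<and>
           (\<forall>w n. proarrow D n w x \<longrightarrow>
              is_coequalizer (hom_cat D w y)
                (cell_id D n \<otimes>\<^bsub>D\<^esub> a) (cell_id D n \<otimes>\<^bsub>D\<^esub> b) (cell_id D n \<otimes>\<^bsub>D\<^esub> q))))"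

text \<open>
  In \<open>VerDbl A\<close> the only proarrow on \<open>x\<close> is its identity, which is represented by \<open>x\<close> itself.
  Composition in \<open>D1\<close> is horizontal composition of 2-cells, \<open>\<odot>\<close> is vertical composition.
\<close>

definition VerDbl :: "('o, 'a, 'c) two_cat \<Rightarrow> ('o, 'a, 'o, 'c) dbl" where
  "VerDbl A =
     \<lparr> D0 = under A, D1 = horiz_cat A,
       psrc = (\<lambda>x. x), ptgt = (\<lambda>x. x), csrc = Src A, ctgt = Trg A,
       pid = (\<lambda>x. x), cid = VId A,
       pcomp = (\<lambda>x _. x), ccomp = VComp A,
       passoc = (\<lambda>x _ _. VId A (Ide (under A) x)),
       lunit = (\<lambda>x. VId A (Ide (under A) x)),
       runit = (\<lambda>x. VId A (Ide (under A) x)) \<rparr>"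


section \<open>Lax double functors, lax natural transformations, modulations\<close>

text \<open>
  The coherence isomorphisms that the usual formulas suppress are inserted throughout: cells out of
  \<open>id \<odot> m\<close> and \<open>m \<odot> id\<close> are turned into cells out of \<open>m\<close> by precomposing with \<^const>\<open>lunit_inv\<close>
  and \<^const>\<open>runit_inv\<close>. At \<open>m = id\<close> the two agree.
\<close>

record ('o, 'a, 'p, 'c, 'x, 'b, 'q, 'd) lax_functor =
  lf_obj :: "'o \<Rightarrow> 'x"
  lf_arr :: "'a \<Rightarrow> 'b"
  lf_pro :: "'p \<Rightarrow> 'q"
  lf_cell :: "'c \<Rightarrow> 'd"
  lf_laxator :: "'p \<Rightarrow> 'p \<Rightarrow> 'd"
  lf_unitor :: "'o \<Rightarrow> 'd"

record ('o, 'a, 'p, 'c, 'x, 'b, 'q, 'd) lax_trans =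
  lt_dom :: "('o, 'a, 'p, 'c, 'x, 'b, 'q, 'd) lax_functor"
  lt_cod :: "('o, 'a, 'p, 'c, 'x, 'b, 'q, 'd) lax_functor"
  lt_obj :: "'o \<Rightarrow> 'b"
  lt_pro :: "'p \<Rightarrow> 'd"
  lt_arr :: "'a \<Rightarrow> 'd"

record ('o, 'a, 'p, 'c, 'x, 'b, 'q, 'd) modulation =
  md_dom :: "('o, 'a, 'p, 'c, 'x, 'b, 'q, 'd) lax_trans"
  md_cod :: "('o, 'a, 'p, 'c, 'x, 'b, 'q, 'd) lax_trans"
  md_obj :: "'o \<Rightarrow> 'd"

context
  fixes D :: "('o, 'a, 'p, 'c) dbl" and E :: "('x, 'b, 'q, 'd) dbl" (structure)
begin

definition is_lax_functor :: "('o, 'a, 'p, 'c, 'x, 'b, 'q, 'd) lax_functor \<Rightarrow> bool" where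
  "is_lax_functor F \<longleftrightarrow>
    (let Fo = lf_obj F; Fa = lf_arr F; Fp = lf_pro F; Fc = lf_cell F;
         L = lf_laxator F; U = lf_unitor F in
     Fo \<in> extensional (Obj (D0 D)) \<and> Fa \<in> extensional (Arr (D0 D)) \<and>
     Fp \<in> extensional (Obj (D1 D)) \<and> Fc \<in> extensional (Arr (D1 D)) \<and>
     (\<forall>m n. \<not> pcomposable D m n \<longrightarrow> L m n = undefined) \<and>
     U \<in> extensional (Obj (D0 D)) \<and>
     cat_functor (D0 D) (D0 E) Fo Fa \<and>
     cat_functor (D1 D) (D1 E) Fp Fc \<and>
     (\<forall>m \<in> Obj (D1 D). psrc E (Fp m) = Fo (psrc D m) \<and> ptgt E (Fp m) = Fo (ptgt D m)) \<and>
     (\<forall>\<alpha> \<in> Arr (D1 D). csrc E (Fc \<alpha>) = Fa (csrc D \<alpha>) \<and> ctgt E (Fc \<alpha>) = Fa (ctgt D \<alpha>)) \<and>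
     (\<forall>m n. pcomposable D m n \<longrightarrow> globular_cell E (L m n) (Fp m \<odot> Fp n) (Fp (m \<odot>\<^bsub>D\<^esub> n))) \<and>
     (\<forall>x \<in> Obj (D0 D). globular_cell E (U x) (pid E (Fo x)) (Fp (pid D x))) \<and>
     (\<forall>\<alpha> \<beta>. ccomposable D \<alpha> \<beta> \<longrightarrow>
        (Fc \<alpha> \<otimes> Fc \<beta>) \<bullet> L (Cod (D1 D) \<alpha>) (Cod (D1 D) \<beta>) =
        L (Dom (D1 D) \<alpha>) (Dom (D1 D) \<beta>) \<bullet> Fc (\<alpha> \<otimes>\<^bsub>D\<^esub> \<beta>)) \<and>
     (\<forall>f \<in> Arr (D0 D). cid E (Fa f) \<bullet> U (Cod (D0 D) f) = U (Dom (D0 D) f) \<bullet> Fc (cid D f)) \<and>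
     (\<forall>m n p. pcomposable D m n \<and> pcomposable D n p \<longrightarrow>
        (L m n \<otimes> cell_id E (Fp p)) \<bullet> L (m \<odot>\<^bsub>D\<^esub> n) p \<bullet> Fc (passoc D m n p) =
        passoc E (Fp m) (Fp n) (Fp p) \<bullet> (cell_id E (Fp m) \<otimes> L n p) \<bullet> L m (n \<odot>\<^bsub>D\<^esub> p)) \<and>
     (\<forall>m x y. proarrow D m x y \<longrightarrow>
        (U x \<otimes> cell_id E (Fp m)) \<bullet> L (pid D x) m \<bullet> Fc (lunit D m) = lunit E (Fp m) \<and>
        (cell_id E (Fp m) \<otimes> U y) \<bullet> L m (pid D y) \<bullet> Fc (runit D m) = runit E (Fp m)))"

text \<open>
  For \<open>m\<close> from \<open>x\<close> to \<open>y\<close>, the cells \<open>F id\<^sub>x \<odot> F m \<rightarrow> F m\<close> and \<open>F m \<odot> F id\<^sub>y \<rightarrow> F m\<close>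
  usually written \<open>F\<^bsub>x,m\<^esub>\<close> and \<open>F\<^bsub>m,y\<^esub>\<close>.
\<close>

definition laxator_l :: "('o, 'a, 'p, 'c, 'x, 'b, 'q, 'd) lax_functor \<Rightarrow> 'p \<Rightarrow> 'd" where
  "laxator_l F m = lf_laxator F (pid D (psrc D m)) m \<bullet> lf_cell F (lunit D m)"

definition laxator_r :: "('o, 'a, 'p, 'c, 'x, 'b, 'q, 'd) lax_functor \<Rightarrow> 'p \<Rightarrow> 'd" where
  "laxator_r F m = lf_laxator F m (pid D (ptgt D m)) \<bullet> lf_cell F (runit D m)"

definition is_lax_trans :: "('o, 'a, 'p, 'c, 'x, 'b, 'q, 'd) lax_trans \<Rightarrow> bool" where
  "is_lax_trans \<alpha> \<longleftrightarrow>
    (let F = lt_dom \<alpha>; G = lt_cod \<alpha>; ob = lt_obj \<alpha>; pr = lt_pro \<alpha>; ar = lt_arr \<alpha> in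
     is_lax_functor F \<and> is_lax_functor G \<and>
     ob \<in> extensional (Obj (D0 D)) \<and> pr \<in> extensional (Obj (D1 D)) \<and>
     ar \<in> extensional (Arr (D0 D)) \<and>
     (\<forall>x \<in> Obj (D0 D). in_hom (D0 E) (ob x) (lf_obj F x) (lf_obj G x)) \<and>
     (\<forall>m x y. proarrow D m x y \<longrightarrow> cell_over E (pr m) (lf_pro F m) (lf_pro G m) (ob x) (ob y)) \<and>
     (\<forall>f x y. in_hom (D0 D) f x y \<longrightarrow>
        cell_over E (ar f) (pid E (lf_obj F x)) (lf_pro G (pid D y))
          (ob x \<cdot>\<^bsub>D0 E\<^esub> lf_arr G f) (lf_arr F f \<cdot>\<^bsub>D0 E\<^esub> ob y)) \<and>
     (\<forall>\<gamma> m n f g. cell_over D \<gamma> m n f g \<longrightarrow>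
        lunit_inv E (lf_pro F m) \<bullet> (ar f \<otimes> (lf_cell F \<gamma> \<bullet> pr n)) \<bullet> laxator_l G n =
        runit_inv E (lf_pro F m) \<bullet> ((pr m \<bullet> lf_cell G \<gamma>) \<otimes> ar g) \<bullet> laxator_r G n) \<and>
     (\<forall>m n. pcomposable D m n \<longrightarrow>
        lf_laxator F m n \<bullet> pr (m \<odot>\<^bsub>D\<^esub> n) = (pr m \<otimes> pr n) \<bullet> lf_laxator G m n) \<and>
     (\<forall>x \<in> Obj (D0 D). lf_unitor F x \<bullet> pr (pid D x) = cid E (ob x) \<bullet> lf_unitor G x) \<and>
     (\<forall>f g x y z. in_hom (D0 D) f x y \<and> in_hom (D0 D) g y z \<longrightarrow>
        ar (f \<cdot>\<^bsub>D0 D\<^esub> g) =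
        lunit_inv E (pid E (lf_obj F x)) \<bullet>
          ((ar f \<bullet> lf_cell G (cid D g)) \<otimes> (cid E (lf_arr F f) \<bullet> ar g)) \<bullet>
          laxator_l G (pid D z)) \<and>
     (\<forall>x \<in> Obj (D0 D). ar (Ide (D0 D) x) = cid E (ob x) \<bullet> lf_unitor G x))"

definition lax_trans_id ::
  "('o, 'a, 'p, 'c, 'x, 'b, 'q, 'd) lax_functor \<Rightarrow> ('o, 'a, 'p, 'c, 'x, 'b, 'q, 'd) lax_trans" where
  "lax_trans_id F =
     \<lparr> lt_dom = F, lt_cod = F,
       lt_obj = (\<lambda>x \<in> Obj (D0 D). Ide (D0 E) (lf_obj F x)),
       lt_pro = (\<lambda>m \<in> Obj (D1 D). cell_id E (lf_pro F m)),
       lt_arr = (\<lambda>f \<in> Arr (D0 D). cid E (lf_arr F f) \<bullet> lf_unitor F (Cod (D0 D) f)) \<rparr>"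

definition lax_trans_comp ::
  "('o, 'a, 'p, 'c, 'x, 'b, 'q, 'd) lax_trans \<Rightarrow> ('o, 'a, 'p, 'c, 'x, 'b, 'q, 'd) lax_trans \<Rightarrow>
   ('o, 'a, 'p, 'c, 'x, 'b, 'q, 'd) lax_trans" where
  "lax_trans_comp \<alpha> \<beta> =
     \<lparr> lt_dom = lt_dom \<alpha>, lt_cod = lt_cod \<beta>,
       lt_obj = (\<lambda>x \<in> Obj (D0 D). lt_obj \<alpha> x \<cdot>\<^bsub>D0 E\<^esub> lt_obj \<beta> x),
       lt_pro = (\<lambda>m \<in> Obj (D1 D). lt_pro \<alpha> m \<bullet> lt_pro \<beta> m),
       lt_arr = (\<lambda>f \<in> Arr (D0 D).
         let x = Dom (D0 D) f; y = Cod (D0 D) f in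
         lunit_inv E (pid E (lf_obj (lt_dom \<alpha>) x)) \<bullet>
           ((cid E (lt_obj \<alpha> x) \<bullet> lt_arr \<beta> f) \<otimes> (lt_arr \<alpha> f \<bullet> lt_pro \<beta> (pid D y))) \<bullet>
           laxator_l (lt_cod \<beta>) (pid D y)) \<rparr>"

text \<open>The common composite \<open>\<mu>\<^sub>m\<close> of the first modulation axiom.\<close>

definition md_pro :: "('o, 'a, 'p, 'c, 'x, 'b, 'q, 'd) modulation \<Rightarrow> 'p \<Rightarrow> 'd" where
  "md_pro \<mu> m =
     lunit_inv E (lf_pro (lt_dom (md_dom \<mu>)) m) \<bullet>
       (md_obj \<mu> (psrc D m) \<otimes> lt_pro (md_cod \<mu>) m) \<bullet> laxator_l (lt_cod (md_dom \<mu>)) m"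

definition is_modulation :: "('o, 'a, 'p, 'c, 'x, 'b, 'q, 'd) modulation \<Rightarrow> bool" where
  "is_modulation \<mu> \<longleftrightarrow>
    (let \<alpha> = md_dom \<mu>; \<beta> = md_cod \<mu>; ob = md_obj \<mu>; F = lt_dom \<alpha>; G = lt_cod \<alpha> in
     is_lax_trans \<alpha> \<and> is_lax_trans \<beta> \<and> lt_dom \<beta> = F \<and> lt_cod \<beta> = G \<and>
     ob \<in> extensional (Obj (D0 D)) \<and>
     (\<forall>x \<in> Obj (D0 D).
        cell_over E (ob x) (pid E (lf_obj F x)) (lf_pro G (pid D x)) (lt_obj \<alpha> x) (lt_obj \<beta> x)) \<and>
     (\<forall>m x y. proarrow D m x y \<longrightarrow>
        lunit_inv E (lf_pro F m) \<bullet> (ob x \<otimes> lt_pro \<beta> m) \<bullet> laxator_l G m =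
        runit_inv E (lf_pro F m) \<bullet> (lt_pro \<alpha> m \<otimes> ob y) \<bullet> laxator_r G m) \<and>
     (\<forall>\<gamma> m n f g. cell_over D \<gamma> m n f g \<longrightarrow>
        lunit_inv E (lf_pro F m) \<bullet> (lt_arr \<alpha> f \<otimes> (lf_cell F \<gamma> \<bullet> md_pro \<mu> n)) \<bullet> laxator_l G n =
        runit_inv E (lf_pro F m) \<bullet> ((md_pro \<mu> m \<bullet> lf_cell G \<gamma>) \<otimes> lt_arr \<beta> g) \<bullet> laxator_r G n))"

definition modulation_id ::
  "('o, 'a, 'p, 'c, 'x, 'b, 'q, 'd) lax_trans \<Rightarrow> ('o, 'a, 'p, 'c, 'x, 'b, 'q, 'd) modulation" where
  "modulation_id \<alpha> =
     \<lparr> md_dom = \<alpha>, md_cod = \<alpha>,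
       md_obj = (\<lambda>x \<in> Obj (D0 D). cid E (lt_obj \<alpha> x) \<bullet> lf_unitor (lt_cod \<alpha>) x) \<rparr>"

definition modulation_vcomp ::
  "('o, 'a, 'p, 'c, 'x, 'b, 'q, 'd) modulation \<Rightarrow> ('o, 'a, 'p, 'c, 'x, 'b, 'q, 'd) modulation \<Rightarrow>
   ('o, 'a, 'p, 'c, 'x, 'b, 'q, 'd) modulation" where
  "modulation_vcomp \<mu> \<nu> =
     \<lparr> md_dom = md_dom \<mu>, md_cod = md_cod \<nu>,
       md_obj = (\<lambda>x \<in> Obj (D0 D).
         lunit_inv E (pid E (lf_obj (lt_dom (md_dom \<mu>)) x)) \<bullet>
           (md_obj \<mu> x \<otimes> md_obj \<nu> x) \<bullet> laxator_l (lt_cod (md_dom \<mu>)) (pid D x)) \<rparr>"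

definition modulation_hcomp ::
  "('o, 'a, 'p, 'c, 'x, 'b, 'q, 'd) modulation \<Rightarrow> ('o, 'a, 'p, 'c, 'x, 'b, 'q, 'd) modulation \<Rightarrow>
   ('o, 'a, 'p, 'c, 'x, 'b, 'q, 'd) modulation" where
  "modulation_hcomp \<mu> \<nu> =
     \<lparr> md_dom = lax_trans_comp (md_dom \<mu>) (md_dom \<nu>),
       md_cod = lax_trans_comp (md_cod \<mu>) (md_cod \<nu>),
       md_obj = (\<lambda>x \<in> Obj (D0 D). md_obj \<mu> x \<bullet> md_pro \<nu> (pid D x)) \<rparr>"

definition Lax_l ::
  "(('o, 'a, 'p, 'c, 'x, 'b, 'q, 'd) lax_functor, ('o, 'a, 'p, 'c, 'x, 'b, 'q, 'd) lax_trans,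
    ('o, 'a, 'p, 'c, 'x, 'b, 'q, 'd) modulation) two_cat" where
  "Lax_l =
     \<lparr> under =
         \<lparr> Obj = {F. is_lax_functor F}, Arr = {\<alpha>. is_lax_trans \<alpha>},
           Dom = lt_dom, Cod = lt_cod, Ide = lax_trans_id, Comp = lax_trans_comp \<rparr>,
       Cells = {\<mu>. is_modulation \<mu>}, Src = md_dom, Trg = md_cod,
       VId = modulation_id, VComp = modulation_vcomp, HComp = modulation_hcomp \<rparr>"

end


section \<open>Category objects in a double category\<close>

record ('x, 'q, 'd) cat_object =
  co_obj :: 'x
  co_pro :: 'q
  co_mult :: 'd
  co_unit :: 'd

record ('x, 'b, 'q, 'd) cat_object_functor =
  cf_dom :: "('x, 'q, 'd) cat_object"
  cf_cod :: "('x, 'q, 'd) cat_object"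
  cf_arr :: 'b
  cf_cell :: 'd

record ('x, 'b, 'q, 'd) cat_object_trans =
  ct_dom :: "('x, 'b, 'q, 'd) cat_object_functor"
  ct_cod :: "('x, 'b, 'q, 'd) cat_object_functor"
  ct_cell :: 'd

context
  fixes E :: "('x, 'b, 'q, 'd) dbl" (structure)
begin

definition is_cat_object :: "('x, 'q, 'd) cat_object \<Rightarrow> bool" where
  "is_cat_object X \<longleftrightarrow>
    (let x = co_obj X; r = co_pro X; \<mu> = co_mult X; \<upsilon> = co_unit X in
     x \<in> Obj (D0 E) \<and> proarrow E r x x \<and>
     globular_cell E \<mu> (r \<odot> r) r \<and> globular_cell E \<upsilon> (pid E x) r \<and>
     (\<mu> \<otimes> cell_id E r) \<bullet> \<mu> = passoc E r r r \<bullet> (cell_id E r \<otimes> \<mu>) \<bullet> \<mu> \<and>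
     (\<upsilon> \<otimes> cell_id E r) \<bullet> \<mu> = lunit E r \<and>
     (cell_id E r \<otimes> \<upsilon>) \<bullet> \<mu> = runit E r)"

definition is_cat_object_functor :: "('x, 'b, 'q, 'd) cat_object_functor \<Rightarrow> bool" where
  "is_cat_object_functor F \<longleftrightarrow>
    (let X = cf_dom F; Y = cf_cod F; f = cf_arr F; \<phi> = cf_cell F in
     is_cat_object X \<and> is_cat_object Y \<and>
     in_hom (D0 E) f (co_obj X) (co_obj Y) \<and>
     cell_over E \<phi> (co_pro X) (co_pro Y) f f \<and>
     (\<phi> \<otimes> \<phi>) \<bullet> co_mult Y = co_mult X \<bullet> \<phi> \<and>
     cid E f \<bullet> co_unit Y = co_unit X \<bullet> \<phi>)"

definition is_cat_object_trans :: "('x, 'b, 'q, 'd) cat_object_trans \<Rightarrow> bool" where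
  "is_cat_object_trans T \<longleftrightarrow>
    (let F = ct_dom T; G = ct_cod T; \<alpha> = ct_cell T; X = cf_dom F; Y = cf_cod F in
     is_cat_object_functor F \<and> is_cat_object_functor G \<and> cf_dom G = X \<and> cf_cod G = Y \<and>
     cell_over E \<alpha> (pid E (co_obj X)) (co_pro Y) (cf_arr F) (cf_arr G) \<and>
     lunit_inv E (co_pro X) \<bullet> (\<alpha> \<otimes> cf_cell G) \<bullet> co_mult Y =
     runit_inv E (co_pro X) \<bullet> (cf_cell F \<otimes> \<alpha>) \<bullet> co_mult Y)"

definition cat_object_functor_comp ::
  "('x, 'b, 'q, 'd) cat_object_functor \<Rightarrow> ('x, 'b, 'q, 'd) cat_object_functor \<Rightarrow>
   ('x, 'b, 'q, 'd) cat_object_functor" where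
  "cat_object_functor_comp F G =
     \<lparr> cf_dom = cf_dom F, cf_cod = cf_cod G,
       cf_arr = cf_arr F \<cdot>\<^bsub>D0 E\<^esub> cf_arr G, cf_cell = cf_cell F \<bullet> cf_cell G \<rparr>"

text \<open>
  The horizontal composite of \<open>\<alpha> : F \<Rightarrow> G\<close> from \<open>X\<close> to \<open>Y\<close> and \<open>\<beta> : H \<Rightarrow> K\<close> from \<open>Y\<close> to \<open>Z\<close>
  follows \<open>\<alpha>\<close> by the cell \<open>\<beta> \<odot> K\<close>, multiplied in \<open>Z\<close>; for ordinary categories this is
  \<open>x \<mapsto> \<beta>\<^bsub>F x\<^esub> \<cdot> K \<alpha>\<^sub>x\<close>.
\<close>

definition CatObj ::
  "(('x, 'q, 'd) cat_object, ('x, 'b, 'q, 'd) cat_object_functor,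
    ('x, 'b, 'q, 'd) cat_object_trans) two_cat" where
  "CatObj =
     \<lparr> under =
         \<lparr> Obj = {X. is_cat_object X}, Arr = {F. is_cat_object_functor F},
           Dom = cf_dom, Cod = cf_cod,
           Ide = (\<lambda>X. \<lparr> cf_dom = X, cf_cod = X,
                        cf_arr = Ide (D0 E) (co_obj X), cf_cell = cell_id E (co_pro X) \<rparr>),
           Comp = cat_object_functor_comp \<rparr>,
       Cells = {T. is_cat_object_trans T}, Src = ct_dom, Trg = ct_cod,
       VId = (\<lambda>F. \<lparr> ct_dom = F, ct_cod = F,
                    ct_cell = cid E (cf_arr F) \<bullet> co_unit (cf_cod F) \<rparr>),
       VComp = (\<lambda>S T. \<lparr> ct_dom = ct_dom S, ct_cod = ct_cod T,
                    ct_cell = lunit_inv E (pid E (co_obj (cf_dom (ct_dom S)))) \<bullet>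
                      (ct_cell S \<otimes> ct_cell T) \<bullet> co_mult (cf_cod (ct_dom S)) \<rparr>),
       HComp = (\<lambda>S T. \<lparr> ct_dom = cat_object_functor_comp (ct_dom S) (ct_dom T),
                    ct_cod = cat_object_functor_comp (ct_cod S) (ct_cod T),
                    ct_cell = ct_cell S \<bullet>
                      (lunit_inv E (co_pro (cf_dom (ct_dom T))) \<bullet>
                       (ct_cell T \<otimes> cf_cell (ct_cod T)) \<bullet> co_mult (cf_cod (ct_dom T))) \<rparr>) \<rparr>"

end


section \<open>Sets, spans and small categories\<close>

text \<open>
  The small sets are the members of a universe \<open>U\<close> of subsets of a type \<open>'u\<close>, equipped with a coding
  \<open>p\<close> of ordered pairs, which is used for the apex of a composite span. Only closure under subsets,
  images and binary products is required. In particular, \<open>U\<close> may consist of all subsets of an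
  infinite type, or of the subsets of cardinality less than \<open>\<kappa>\<close> of a type of inaccessible
  cardinality \<open>\<kappa>\<close>.
\<close>

locale set_universe =
  fixes U :: "'u set set" and p :: "'u \<times> 'u \<Rightarrow> 'u"
  assumes pair_inj: "inj p"
    and singleton_small: "{u} \<in> U"
    and subset_small: "X \<in> U \<Longrightarrow> Y \<subseteq> X \<Longrightarrow> Y \<in> U"
    and image_small: "X \<in> U \<Longrightarrow> h ` X \<in> U"
    and product_small: "X \<in> U \<Longrightarrow> Y \<in> U \<Longrightarrow> p ` (X \<times> Y) \<in> U"

record 'u fn =
  fn_dom :: "'u set"
  fn_cod :: "'u set"
  fn_map :: "'u \<Rightarrow> 'u"

definition fn_comp :: "'u fn \<Rightarrow> 'u fn \<Rightarrow> 'u fn" where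
  "fn_comp f g = \<lparr> fn_dom = fn_dom f, fn_cod = fn_cod g,
                   fn_map = (\<lambda>a \<in> fn_dom f. fn_map g (fn_map f a)) \<rparr>"

definition Set_cat :: "'u set set \<Rightarrow> ('u set, 'u fn) cat" where
  "Set_cat U =
     \<lparr> Obj = U,
       Arr = {f. fn_dom f \<in> U \<and> fn_cod f \<in> U \<and> fn_map f \<in> fn_dom f \<rightarrow>\<^sub>E fn_cod f},
       Dom = fn_dom, Cod = fn_cod,
       Ide = (\<lambda>X. \<lparr> fn_dom = X, fn_cod = X, fn_map = (\<lambda>a \<in> X. a) \<rparr>),
       Comp = fn_comp \<rparr>"

record 'u span =
  sp_src :: "'u set"
  sp_tgt :: "'u set"
  sp_apex :: "'u set"
  sp_left :: "'u \<Rightarrow> 'u"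
  sp_right :: "'u \<Rightarrow> 'u"

record 'u span_map =
  sm_dom :: "'u span"
  sm_cod :: "'u span"
  sm_src :: "'u fn"
  sm_tgt :: "'u fn"
  sm_map :: "'u \<Rightarrow> 'u"

definition is_span :: "'u set set \<Rightarrow> 'u span \<Rightarrow> bool" where
  "is_span U m \<longleftrightarrow>
     sp_src m \<in> U \<and> sp_tgt m \<in> U \<and> sp_apex m \<in> U \<and>
     sp_left m \<in> sp_apex m \<rightarrow>\<^sub>E sp_src m \<and> sp_right m \<in> sp_apex m \<rightarrow>\<^sub>E sp_tgt m"

definition is_span_map :: "'u set set \<Rightarrow> 'u span_map \<Rightarrow> bool" where
  "is_span_map U \<alpha> \<longleftrightarrow>
    (let m = sm_dom \<alpha>; n = sm_cod \<alpha>; f = sm_src \<alpha>; g = sm_tgt \<alpha>; h = sm_map \<alpha> in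
     is_span U m \<and> is_span U n \<and>
     in_hom (Set_cat U) f (sp_src m) (sp_src n) \<and> in_hom (Set_cat U) g (sp_tgt m) (sp_tgt n) \<and>
     h \<in> sp_apex m \<rightarrow>\<^sub>E sp_apex n \<and>
     (\<forall>a \<in> sp_apex m. sp_left n (h a) = fn_map f (sp_left m a) \<and>
                      sp_right n (h a) = fn_map g (sp_right m a)))"

definition span_id :: "'u set \<Rightarrow> 'u span" where
  "span_id X = \<lparr> sp_src = X, sp_tgt = X, sp_apex = X,
                 sp_left = (\<lambda>a \<in> X. a), sp_right = (\<lambda>a \<in> X. a) \<rparr>"

definition globular_span_map :: "'u set set \<Rightarrow> 'u span \<Rightarrow> 'u span \<Rightarrow> ('u \<Rightarrow> 'u) \<Rightarrow> 'u span_map" where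
  "globular_span_map U m n h =
     \<lparr> sm_dom = m, sm_cod = n,
       sm_src = Ide (Set_cat U) (sp_src m), sm_tgt = Ide (Set_cat U) (sp_tgt m),
       sm_map = (\<lambda>a \<in> sp_apex m. h a) \<rparr>"

context
  fixes U :: "'u set set" and p :: "'u \<times> 'u \<Rightarrow> 'u"
begin

definition unpair1 :: "'u \<Rightarrow> 'u" where "unpair1 c = fst (inv p c)"
definition unpair2 :: "'u \<Rightarrow> 'u" where "unpair2 c = snd (inv p c)"

definition pullback_apex :: "'u span \<Rightarrow> 'u span \<Rightarrow> 'u set" where
  "pullback_apex m n =
     {p (a, b) | a b. a \<in> sp_apex m \<and> b \<in> sp_apex n \<and> sp_right m a = sp_left n b}"

definition span_comp :: "'u span \<Rightarrow> 'u span \<Rightarrow> 'u span" where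
  "span_comp m n =
     \<lparr> sp_src = sp_src m, sp_tgt = sp_tgt n, sp_apex = pullback_apex m n,
       sp_left = (\<lambda>c \<in> pullback_apex m n. sp_left m (unpair1 c)),
       sp_right = (\<lambda>c \<in> pullback_apex m n. sp_right n (unpair2 c)) \<rparr>"

definition Span :: "('u set, 'u fn, 'u span, 'u span_map) dbl" where
  "Span =
     \<lparr> D0 = Set_cat U,
       D1 =
         \<lparr> Obj = {m. is_span U m}, Arr = {\<alpha>. is_span_map U \<alpha>},
           Dom = sm_dom, Cod = sm_cod,
           Ide = (\<lambda>m. globular_span_map U m m (\<lambda>a. a)),
           Comp = (\<lambda>\<alpha> \<beta>. \<lparr> sm_dom = sm_dom \<alpha>, sm_cod = sm_cod \<beta>,
                           sm_src = fn_comp (sm_src \<alpha>) (sm_src \<beta>),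
                           sm_tgt = fn_comp (sm_tgt \<alpha>) (sm_tgt \<beta>),
                           sm_map = (\<lambda>a \<in> sp_apex (sm_dom \<alpha>). sm_map \<beta> (sm_map \<alpha> a)) \<rparr>) \<rparr>,
       psrc = sp_src, ptgt = sp_tgt, csrc = sm_src, ctgt = sm_tgt,
       pid = span_id,
       cid = (\<lambda>f. \<lparr> sm_dom = span_id (fn_dom f), sm_cod = span_id (fn_cod f),
                    sm_src = f, sm_tgt = f, sm_map = fn_map f \<rparr>),
       pcomp = span_comp,
       ccomp = (\<lambda>\<alpha> \<beta>. \<lparr> sm_dom = span_comp (sm_dom \<alpha>) (sm_dom \<beta>),
                        sm_cod = span_comp (sm_cod \<alpha>) (sm_cod \<beta>),
                        sm_src = sm_src \<alpha>, sm_tgt = sm_tgt \<beta>,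
                        sm_map = (\<lambda>c \<in> pullback_apex (sm_dom \<alpha>) (sm_dom \<beta>).
                          p (sm_map \<alpha> (unpair1 c), sm_map \<beta> (unpair2 c))) \<rparr>),
       passoc = (\<lambda>m n q.
         globular_span_map U (span_comp (span_comp m n) q) (span_comp m (span_comp n q))
           (\<lambda>c. p (unpair1 (unpair1 c), p (unpair2 (unpair1 c), unpair2 c)))),
       lunit = (\<lambda>m. globular_span_map U (span_comp (span_id (sp_src m)) m) m unpair2),
       runit = (\<lambda>m. globular_span_map U (span_comp m (span_id (sp_tgt m))) m unpair1) \<rparr>"

end

definition small_category :: "'u set set \<Rightarrow> ('u, 'u) cat \<Rightarrow> bool" where
  "small_category U C \<longleftrightarrow>
     category C \<and> Obj C \<in> U \<and> Arr C \<in> U \<and>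
     Dom C \<in> extensional (Arr C) \<and> Cod C \<in> extensional (Arr C) \<and>
     Ide C \<in> extensional (Obj C) \<and>
     (\<forall>f g. \<not> composable C f g \<longrightarrow> f \<cdot>\<^bsub>C\<^esub> g = undefined)"

record 'u small_functor =
  sf_dom :: "('u, 'u) cat"
  sf_cod :: "('u, 'u) cat"
  sf_obj :: "'u \<Rightarrow> 'u"
  sf_arr :: "'u \<Rightarrow> 'u"

record 'u small_nat =
  sn_dom :: "'u small_functor"
  sn_cod :: "'u small_functor"
  sn_map :: "'u \<Rightarrow> 'u"

definition is_small_functor :: "'u set set \<Rightarrow> 'u small_functor \<Rightarrow> bool" where
  "is_small_functor U F \<longleftrightarrow>
     small_category U (sf_dom F) \<and> small_category U (sf_cod F) \<and>
     sf_obj F \<in> extensional (Obj (sf_dom F)) \<and> sf_arr F \<in> extensional (Arr (sf_dom F)) \<and>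
     cat_functor (sf_dom F) (sf_cod F) (sf_obj F) (sf_arr F)"

definition is_small_nat :: "'u set set \<Rightarrow> 'u small_nat \<Rightarrow> bool" where
  "is_small_nat U \<tau> \<longleftrightarrow>
    (let F = sn_dom \<tau>; G = sn_cod \<tau>; t = sn_map \<tau>; C = sf_dom F; D = sf_cod F in
     is_small_functor U F \<and> is_small_functor U G \<and> sf_dom G = C \<and> sf_cod G = D \<and>
     t \<in> extensional (Obj C) \<and>
     (\<forall>x \<in> Obj C. in_hom D (t x) (sf_obj F x) (sf_obj G x)) \<and>
     (\<forall>f \<in> Arr C. sf_arr F f \<cdot>\<^bsub>D\<^esub> t (Cod C f) = t (Dom C f) \<cdot>\<^bsub>D\<^esub> sf_arr G f))"

definition small_functor_comp :: "'u small_functor \<Rightarrow> 'u small_functor \<Rightarrow> 'u small_functor" where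
  "small_functor_comp F G =
     \<lparr> sf_dom = sf_dom F, sf_cod = sf_cod G,
       sf_obj = (\<lambda>x \<in> Obj (sf_dom F). sf_obj G (sf_obj F x)),
       sf_arr = (\<lambda>f \<in> Arr (sf_dom F). sf_arr G (sf_arr F f)) \<rparr>"

definition Cat :: "'u set set \<Rightarrow> (('u, 'u) cat, 'u small_functor, 'u small_nat) two_cat" where
  "Cat U =
     \<lparr> under =
         \<lparr> Obj = {C. small_category U C}, Arr = {F. is_small_functor U F},
           Dom = sf_dom, Cod = sf_cod,
           Ide = (\<lambda>C. \<lparr> sf_dom = C, sf_cod = C,
                        sf_obj = (\<lambda>x \<in> Obj C. x), sf_arr = (\<lambda>f \<in> Arr C. f) \<rparr>),
           Comp = small_functor_comp \<rparr>,
       Cells = {\<tau>. is_small_nat U \<tau>}, Src = sn_dom, Trg = sn_cod,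
       VId = (\<lambda>F. \<lparr> sn_dom = F, sn_cod = F,
                    sn_map = (\<lambda>x \<in> Obj (sf_dom F). Ide (sf_cod F) (sf_obj F x)) \<rparr>),
       VComp = (\<lambda>\<sigma> \<tau>. \<lparr> sn_dom = sn_dom \<sigma>, sn_cod = sn_cod \<tau>,
                    sn_map = (\<lambda>x \<in> Obj (sf_dom (sn_dom \<sigma>)).
                      sn_map \<sigma> x \<cdot>\<^bsub>sf_cod (sn_dom \<sigma>)\<^esub> sn_map \<tau> x) \<rparr>),
       HComp = (\<lambda>\<sigma> \<tau>. \<lparr> sn_dom = small_functor_comp (sn_dom \<sigma>) (sn_dom \<tau>),
                    sn_cod = small_functor_comp (sn_cod \<sigma>) (sn_cod \<tau>),
                    sn_map = (\<lambda>x \<in> Obj (sf_dom (sn_dom \<sigma>)).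
                      sn_map \<tau> (sf_obj (sn_dom \<sigma>) x) \<cdot>\<^bsub>sf_cod (sn_dom \<tau>)\<^esub>
                      sf_arr (sn_cod \<tau>) (sn_map \<sigma> x)) \<rparr>) \<rparr>"

end

theory Submission
  imports Defs
begin

text \<open>
  A lax functor out of \<open>VerDbl A\<close> has only identity proarrows to act on, so its laxators and
  unitors make each \<open>F id\<^sub>x\<close> a category object on \<open>F x\<close>, and naturality makes the cells \<open>F id\<^sub>f\<close>
  functors. A cell \<open>\<sigma> : id\<^sub>x \<rightarrow> s\<close> into a category object acts by multiplication, from the left and
  from the right, on the cells \<open>m \<rightarrow> s\<close>. A 2-cell \<open>\<sigma> : (f, \<phi>) \<Rightarrow> (g, \<psi>)\<close> of category objects from
  \<open>r\<close> to \<open>s\<close> is the same thing as the cell \<open>hat \<sigma> : r \<rightarrow> s\<close> given by either side of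
  \<open>\<sigma> \<cdot> \<psi> = \<phi> \<cdot> \<sigma>\<close>, because \<open>\<sigma>\<close> is the restriction of \<open>hat \<sigma>\<close> along the unit of \<open>r\<close>. Horizontal
  composites of 2-cells become composites of hats, and the value of a lax functor at a 2-cell is a
  hat; this translates the axioms on the two sides into each other.
\<close>

lemma composable_iff [simp]:
  "composable C f g \<longleftrightarrow> f \<in> Arr C \<and> g \<in> Arr C \<and> Cod C f = Dom C g"
  by (simp add: composable_def)

lemma in_hom_iff [simp]: "in_hom C f x y \<longleftrightarrow> f \<in> Arr C \<and> Dom C f = x \<and> Cod C f = y"
  by (simp add: in_hom_def)

context category
begin

lemma dom_cod_obj [simp]:
  assumes "f \<in> Arr C" shows "Dom C f \<in> Obj C" "Cod C f \<in> Obj C"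
  using assms by (simp_all add: dom_obj cod_obj)

lemma ide_simps [simp]:
  assumes "x \<in> Obj C" shows "Ide C x \<in> Arr C" "Dom C (Ide C x) = x" "Cod C (Ide C x) = x"
  using ide_hom[OF assms] by simp_all

lemma comp_simps [simp]:
  assumes "f \<in> Arr C" "g \<in> Arr C" "Cod C f = Dom C g"
  shows "f \<cdot> g \<in> Arr C" "Dom C (f \<cdot> g) = Dom C f" "Cod C (f \<cdot> g) = Cod C g"
  using comp_hom[of f g] assms by simp_all

lemma ide_comp' [simp]: "f \<in> Arr C \<Longrightarrow> Dom C f = x \<Longrightarrow> Ide C x \<cdot> f = f"
  using ide_comp by auto

lemma comp_ide' [simp]: "f \<in> Arr C \<Longrightarrow> Cod C f = x \<Longrightarrow> f \<cdot> Ide C x = f"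
  using comp_ide by auto

lemma comp_assoc' [simp]:
  assumes "f \<in> Arr C" "g \<in> Arr C" "h \<in> Arr C" "Cod C f = Dom C g" "Cod C g = Dom C h"
  shows "f \<cdot> g \<cdot> h = f \<cdot> (g \<cdot> h)"
  using comp_assoc[of f g h] assms by simp

lemma inverse_unique:
  assumes "is_inverse C f g" "is_inverse C f h" shows "g = h"
proof -
  have "g = g \<cdot> (f \<cdot> h)" using assms by (simp add: is_inverse_def)
  also have "\<dots> = (g \<cdot> f) \<cdot> h" using assms unfolding is_inverse_def by (subst comp_assoc') simp_all
  also have "\<dots> = h" using assms by (simp add: is_inverse_def)
  finally show ?thesis .
qed

lemma inv_arr_eqI: "is_inverse C f g \<Longrightarrow> inv_arr C f = g"
  unfolding inv_arr_def using inverse_unique by blast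

lemma inv_arr_inverse: "is_iso C f \<Longrightarrow> is_inverse C f (inv_arr C f)"
  using inv_arr_eqI unfolding is_iso_def by blast

lemma inv_arr_simps [simp]:
  assumes "is_iso C f"
  shows "inv_arr C f \<in> Arr C" "Dom C (inv_arr C f) = Cod C f" "Cod C (inv_arr C f) = Dom C f"
    "f \<cdot> inv_arr C f = Ide C (Dom C f)" "inv_arr C f \<cdot> f = Ide C (Cod C f)"
  using inv_arr_inverse[OF assms] by (simp_all add: is_inverse_def)

end

section \<open>Transport of structure\<close>

text \<open>
  The operations of the source are images under \<open>\<Psi>\<close> of those of the target, so that closure of the
  source under them need not be known beforehand.
\<close>

locale cat_transport =
  D: category D for C :: "('o, 'a) cat" and D :: "('x, 'b) cat" +
  fixes \<Phi>0 :: "'o \<Rightarrow> 'x" and \<Phi>1 :: "'a \<Rightarrow> 'b" and \<Psi>0 :: "'x \<Rightarrow> 'o" and \<Psi>1 :: "'b \<Rightarrow> 'a"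
  assumes obj [simp]: "x \<in> Obj C \<Longrightarrow> \<Phi>0 x \<in> Obj D" "x \<in> Obj C \<Longrightarrow> \<Psi>0 (\<Phi>0 x) = x"
    and obj' [simp]: "y \<in> Obj D \<Longrightarrow> \<Psi>0 y \<in> Obj C" "y \<in> Obj D \<Longrightarrow> \<Phi>0 (\<Psi>0 y) = y"
    and arr [simp]: "f \<in> Arr C \<Longrightarrow> \<Phi>1 f \<in> Arr D" "f \<in> Arr C \<Longrightarrow> \<Psi>1 (\<Phi>1 f) = f"
    and arr' [simp]: "g \<in> Arr D \<Longrightarrow> \<Psi>1 g \<in> Arr C" "g \<in> Arr D \<Longrightarrow> \<Phi>1 (\<Psi>1 g) = g"
    and dom [simp]: "f \<in> Arr C \<Longrightarrow> Dom C f \<in> Obj C" "f \<in> Arr C \<Longrightarrow> Dom D (\<Phi>1 f) = \<Phi>0 (Dom C f)"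
    and cod [simp]: "f \<in> Arr C \<Longrightarrow> Cod C f \<in> Obj C" "f \<in> Arr C \<Longrightarrow> Cod D (\<Phi>1 f) = \<Phi>0 (Cod C f)"
    and ide: "x \<in> Obj C \<Longrightarrow> Ide C x = \<Psi>1 (Ide D (\<Phi>0 x))"
    and comp: "composable C f f' \<Longrightarrow> f \<cdot>\<^bsub>C\<^esub> f' = \<Psi>1 (\<Phi>1 f \<cdot>\<^bsub>D\<^esub> \<Phi>1 f')"
begin

lemma dom_cod' [simp]:
  assumes "g \<in> Arr D" shows "Dom C (\<Psi>1 g) = \<Psi>0 (Dom D g)" "Cod C (\<Psi>1 g) = \<Psi>0 (Cod D g)"
  using assms dom(2)[of "\<Psi>1 g"] cod(2)[of "\<Psi>1 g"] by simp_all

lemma category: "category C"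
  by unfold_locales (simp_all add: ide comp)

lemma functors: "cat_functor C D \<Phi>0 \<Phi>1" "cat_functor D C \<Psi>0 \<Psi>1"
  by (auto simp: cat_functor_def ide comp)

end

section \<open>2-categories\<close>

lemma cat_functor_cong:
  assumes "cat_functor C D F0 F1" "category C"
    "\<And>x. x \<in> Obj C \<Longrightarrow> F0 x = G0 x" "\<And>f. f \<in> Arr C \<Longrightarrow> F1 f = G1 f"
  shows "cat_functor C D G0 G1"
proof -
  interpret category C by fact
  show ?thesis using assms(1) unfolding cat_functor_def by (simp add: assms(3,4)[symmetric])
qed

lemma cat_functor_comp:
  assumes "cat_functor C D F0 F1" "cat_functor D E G0 G1"
  shows "cat_functor C E (\<lambda>x. G0 (F0 x)) (\<lambda>f. G1 (F1 f))"
  using assms unfolding cat_functor_def by auto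

lemma vert_cat_simps [simp]:
  "Obj (vert_cat A) = Arr (under A)" "Arr (vert_cat A) = Cells A" "Dom (vert_cat A) = Src A"
  "Cod (vert_cat A) = Trg A" "Ide (vert_cat A) = VId A" "Comp (vert_cat A) = VComp A"
  by (simp_all add: vert_cat_def)

lemma horiz_cat_simps [simp]:
  "Obj (horiz_cat A) = Obj (under A)" "Arr (horiz_cat A) = Cells A"
  "Dom (horiz_cat A) \<sigma> = Dom (under A) (Src A \<sigma>)" "Cod (horiz_cat A) \<sigma> = Cod (under A) (Src A \<sigma>)"
  "Ide (horiz_cat A) x = VId A (Ide (under A) x)" "Comp (horiz_cat A) = HComp A"
  by (simp_all add: horiz_cat_def)

lemma is_two_functor_cat_functors:
  assumes "is_two_functor A B F"
  shows "cat_functor (under A) (under B) (tf_obj F) (tf_arr F)"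
    "cat_functor (vert_cat A) (vert_cat B) (tf_arr F) (tf_cell F)"
    "cat_functor (horiz_cat A) (horiz_cat B) (tf_obj F) (tf_cell F)"
  using assms by (simp_all add: is_two_functor_def)

lemma two_functor_comp_is_two_functor:
  assumes "two_category A" and F: "is_two_functor A B F" and G: "is_two_functor B C G"
  shows "is_two_functor A C (two_functor_comp A F G)"
proof -
  interpret two_category A by fact
  note cf = cat_functor_comp[OF is_two_functor_cat_functors(1)[OF F]
    is_two_functor_cat_functors(1)[OF G]]
    cat_functor_comp[OF is_two_functor_cat_functors(2)[OF F] is_two_functor_cat_functors(2)[OF G]]
    cat_functor_comp[OF is_two_functor_cat_functors(3)[OF F] is_two_functor_cat_functors(3)[OF G]]
  show ?thesis
    unfolding is_two_functor_def two_functor_comp_def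
    using cf[THEN cat_functor_cong] under_category vert_category horiz_category by simp
qed

locale two_cat_transport =
  fixes A :: "('o, 'a, 'c) two_cat" and B :: "('x, 'b, 'd) two_cat"
    and \<Phi>0 \<Phi>1 \<Phi>2 \<Psi>0 \<Psi>1 \<Psi>2
  assumes B: "two_category B"
    and obj: "x \<in> Obj (under A) \<Longrightarrow> \<Phi>0 x \<in> Obj (under B)" "x \<in> Obj (under A) \<Longrightarrow> \<Psi>0 (\<Phi>0 x) = x"
    and obj': "y \<in> Obj (under B) \<Longrightarrow> \<Psi>0 y \<in> Obj (under A)" "y \<in> Obj (under B) \<Longrightarrow> \<Phi>0 (\<Psi>0 y) = y"
    and arr: "f \<in> Arr (under A) \<Longrightarrow> \<Phi>1 f \<in> Arr (under B)" "f \<in> Arr (under A) \<Longrightarrow> \<Psi>1 (\<Phi>1 f) = f"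
    and arr': "g \<in> Arr (under B) \<Longrightarrow> \<Psi>1 g \<in> Arr (under A)" "g \<in> Arr (under B) \<Longrightarrow> \<Phi>1 (\<Psi>1 g) = g"
    and cell: "\<sigma> \<in> Cells A \<Longrightarrow> \<Phi>2 \<sigma> \<in> Cells B" "\<sigma> \<in> Cells A \<Longrightarrow> \<Psi>2 (\<Phi>2 \<sigma>) = \<sigma>"
    and cell': "\<tau> \<in> Cells B \<Longrightarrow> \<Psi>2 \<tau> \<in> Cells A" "\<tau> \<in> Cells B \<Longrightarrow> \<Phi>2 (\<Psi>2 \<tau>) = \<tau>"
    and dom: "f \<in> Arr (under A) \<Longrightarrow> Dom (under A) f \<in> Obj (under A)"
      "f \<in> Arr (under A) \<Longrightarrow> Dom (under B) (\<Phi>1 f) = \<Phi>0 (Dom (under A) f)"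
    and cod: "f \<in> Arr (under A) \<Longrightarrow> Cod (under A) f \<in> Obj (under A)"
      "f \<in> Arr (under A) \<Longrightarrow> Cod (under B) (\<Phi>1 f) = \<Phi>0 (Cod (under A) f)"
    and src: "\<sigma> \<in> Cells A \<Longrightarrow> Src A \<sigma> \<in> Arr (under A)"
      "\<sigma> \<in> Cells A \<Longrightarrow> Src B (\<Phi>2 \<sigma>) = \<Phi>1 (Src A \<sigma>)"
    and trg: "\<sigma> \<in> Cells A \<Longrightarrow> Trg A \<sigma> \<in> Arr (under A)"
      "\<sigma> \<in> Cells A \<Longrightarrow> Trg B (\<Phi>2 \<sigma>) = \<Phi>1 (Trg A \<sigma>)"
    and ide: "x \<in> Obj (under A) \<Longrightarrow> Ide (under A) x = \<Psi>1 (Ide (under B) (\<Phi>0 x))"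
    and comp: "composable (under A) f f' \<Longrightarrow>
      f \<cdot>\<^bsub>under A\<^esub> f' = \<Psi>1 (\<Phi>1 f \<cdot>\<^bsub>under B\<^esub> \<Phi>1 f')"
    and vid: "f \<in> Arr (under A) \<Longrightarrow> VId A f = \<Psi>2 (VId B (\<Phi>1 f))"
    and vcomp: "composable (vert_cat A) \<sigma> \<sigma>' \<Longrightarrow> VComp A \<sigma> \<sigma>' = \<Psi>2 (VComp B (\<Phi>2 \<sigma>) (\<Phi>2 \<sigma>'))"
    and hcomp: "composable (horiz_cat A) \<sigma> \<sigma>' \<Longrightarrow> HComp A \<sigma> \<sigma>' = \<Psi>2 (HComp B (\<Phi>2 \<sigma>) (\<Phi>2 \<sigma>'))"
begin

interpretation B: two_category B by (rule B)
interpretation U: cat_transport "under A" "under B" \<Phi>0 \<Phi>1 \<Psi>0 \<Psi>1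
  by (intro cat_transport.intro B.under_category, unfold_locales)
    (simp_all add: obj obj' arr arr' dom cod ide comp)
interpretation V: cat_transport "vert_cat A" "vert_cat B" \<Phi>1 \<Phi>2 \<Psi>1 \<Psi>2
  by (intro cat_transport.intro B.vert_category, unfold_locales)
    (simp_all add: arr arr' cell cell' src trg vid vcomp)
interpretation H: cat_transport "horiz_cat A" "horiz_cat B" \<Phi>0 \<Phi>2 \<Psi>0 \<Psi>2
proof (intro cat_transport.intro B.horiz_category, unfold_locales)
  fix x assume x: "x \<in> Obj (horiz_cat A)"
  show "Ide (horiz_cat A) x = \<Psi>2 (Ide (horiz_cat B) (\<Phi>0 x))"
    using x B.under_category[THEN category.ide_hom, of "\<Phi>0 x"] by (simp add: vid ide obj dom arr')
qed (simp_all add: obj obj' cell cell' src dom cod hcomp)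

lemma two_category: "two_category A"
proof (intro two_category.intro)
  note simps = B.under_category[THEN category.comp_simps(1)]
    B.under_category[THEN category.comp_simps(2)]
    B.under_category[THEN category.comp_simps(3)]
  have srcB: "\<tau> \<in> Cells B \<Longrightarrow> Src A (\<Psi>2 \<tau>) = \<Psi>1 (Src B \<tau>)" for \<tau>
    using V.dom_cod'(1)[of \<tau>] by simp
  have trgB: "\<tau> \<in> Cells B \<Longrightarrow> Trg A (\<Psi>2 \<tau>) = \<Psi>1 (Trg B \<tau>)" for \<tau>
    using V.dom_cod'(2)[of \<tau>] by simp
  have gd: "Dom (under B) (Src B \<sigma>) = Dom (under B) (Trg B \<sigma>)" 
    "Cod (under B) (Src B \<sigma>) = Cod (under B) (Trg B \<sigma>)" if "\<sigma> \<in> Cells B" for \<sigma>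
    using that by (simp_all add: B.globular_dom B.globular_cod)
  show gdA: "Dom (under A) (Src A \<sigma>) = Dom (under A) (Trg A \<sigma>)" if "\<sigma> \<in> Cells A" for \<sigma>
    using gd(1)[of "\<Phi>2 \<sigma>"] that by (simp add: src trg dom cell) (metis dom(1) src(1) trg(1) obj(2))
  show gcA: "Cod (under A) (Src A \<sigma>) = Cod (under A) (Trg A \<sigma>)" if "\<sigma> \<in> Cells A" for \<sigma>
    using gd(2)[of "\<Phi>2 \<sigma>"] that by (simp add: src trg cod cell) (metis cod(1) src(1) trg(1) obj(2))
  note hB = category.comp_simps(1)[OF B.horiz_category, simplified]
  note vB = category.comp_simps[OF B.vert_category, simplified]
  show "Src A (HComp A \<sigma> \<tau>) = Src A \<sigma> \<cdot>\<^bsub>under A\<^esub> Src A \<tau>" 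
    "Trg A (HComp A \<sigma> \<tau>) = Trg A \<sigma> \<cdot>\<^bsub>under A\<^esub> Trg A \<tau>"
    if "composable (horiz_cat A) \<sigma> \<tau>" for \<sigma> \<tau>
    using that by (simp_all add: hcomp srcB trgB hB cell src trg dom cod comp B.src_hcomp
      B.trg_hcomp
        flip: gdA gcA)
  show "HComp A (VId A f) (VId A g) = VId A (f \<cdot>\<^bsub>under A\<^esub> g)" if "composable (under A) f g" for f g
  proof -
    have *: "VId A f \<in> Cells A" "Src A (VId A f) = f" if "f \<in> Arr (under A)" for f
      using V.category[THEN category.ide_simps(1), of f]
        V.category[THEN category.ide_simps(2), of f] that by simp_all
    have **: "VId B g \<in> Cells B" if "g \<in> Arr (under B)" for g
      using B.vert_category[THEN category.ide_simps(1), of g] that by simp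
    show ?thesis using that B.vid_hcomp[of "\<Phi>1 f" "\<Phi>1 g"]
      by (simp add: hcomp * U.category[THEN category.comp_simps(1)])
        (simp add: vid ** cell' arr comp arr' dom cod simps)
  qed
  show "HComp A (VComp A \<sigma> \<sigma>') (VComp A \<tau> \<tau>') = VComp A (HComp A \<sigma> \<tau>) (HComp A \<sigma>' \<tau>')"
    if "composable (vert_cat A) \<sigma> \<sigma>'" "composable (vert_cat A) \<tau> \<tau>'" "composable (horiz_cat A) \<sigma> \<tau>"
    for \<sigma> \<sigma>' \<tau> \<tau>'
  proof -
    have c: "Cod (under A) (Src A \<sigma>') = Dom (under A) (Src A \<tau>')"
      using that gdA gcA by (metis composable_iff horiz_cat_simps(3,4) vert_cat_simps(2-4))
    have "Trg A (HComp A \<sigma> \<tau>) = Src A (HComp A \<sigma>' \<tau>')"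
      using that c by (simp add: hcomp srcB trgB hB cell src trg dom cod B.src_hcomp B.trg_hcomp)
    then show ?thesis
      using that c B.interchange[of "\<Phi>2 \<sigma>" "\<Phi>2 \<sigma>'" "\<Phi>2 \<tau>" "\<Phi>2 \<tau>'"]
        V.category[THEN category.comp_simps(1), of \<sigma> \<sigma>']
          V.category[THEN category.comp_simps(1), of \<tau> \<tau>']
        V.category[THEN category.comp_simps(2), of \<sigma> \<sigma>']
          V.category[THEN category.comp_simps(2), of \<tau> \<tau>']
        H.category[THEN category.comp_simps(1), of \<sigma> \<tau>]
          H.category[THEN category.comp_simps(1), of \<sigma>' \<tau>']
      by (simp add: hcomp) (simp add: hcomp vcomp cell cell' cod dom src trg hB vB)
  qed
qed (simp_all add: U.category V.category H.category)

lemma isomorphic: "isomorphic_two_cats A B"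
proof -
  interpret A: two_category A by (rule two_category)
  define F where "F = \<lparr> tf_obj = restrict \<Phi>0 (Obj (under A)), tf_arr = restrict \<Phi>1 (Arr (under A)),
    tf_cell = restrict \<Phi>2 (Cells A) \<rparr>"
  define G where "G = \<lparr> tf_obj = restrict \<Psi>0 (Obj (under B)), tf_arr = restrict \<Psi>1 (Arr (under B)),
    tf_cell = restrict \<Psi>2 (Cells B) \<rparr>"
  have "is_two_functor A B F"
    unfolding is_two_functor_def F_def
    using U.functors(1)[THEN cat_functor_cong] V.functors(1)[THEN cat_functor_cong]
      H.functors(1)[THEN cat_functor_cong] A.under_category A.vert_category A.horiz_category by simp
  moreover have "is_two_functor B A G"
    unfolding is_two_functor_def G_def
    using U.functors(2)[THEN cat_functor_cong] V.functors(2)[THEN cat_functor_cong]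
      H.functors(2)[THEN cat_functor_cong] B.under_category B.vert_category B.horiz_category by simp
  moreover have "two_functor_comp A F G = two_functor_id A"
    "two_functor_comp B G F = two_functor_id B"
    unfolding two_functor_comp_def two_functor_id_def F_def G_def
    by (simp_all add: obj obj' arr arr' cell cell' cong: restrict_cong)
  ultimately show ?thesis
    unfolding isomorphic_two_cats_def using B two_category by blast
qed

end

context
  fixes A :: "('o, 'a, 'c) two_cat" and B :: "('x, 'b, 'd) two_cat"
    and F :: "('o, 'a, 'c, 'x, 'b, 'd) two_functor"
  assumes F: "is_two_functor A B F"
begin

lemma tf_carrier [simp]:
  "x \<in> Obj (under A) \<Longrightarrow> tf_obj F x \<in> Obj (under B)"
  "f \<in> Arr (under A) \<Longrightarrow> tf_arr F f \<in> Arr (under B)"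
  "\<sigma> \<in> Cells A \<Longrightarrow> tf_cell F \<sigma> \<in> Cells B"
  using is_two_functor_cat_functors[OF F] by (simp_all add: cat_functor_def)

lemma two_functor_comp_assoc:
  "two_functor_comp A (two_functor_comp A F G) H = two_functor_comp A F (two_functor_comp B G H)"
  by (simp add: two_functor_comp_def cong: restrict_cong)

lemma two_functor_comp_id: "two_functor_comp A F (two_functor_id B) = F"
  using F by (intro two_functor.equality ext)
    (auto simp: two_functor_comp_def two_functor_id_def is_two_functor_def extensional_def)

lemma two_functor_id_comp: "two_functor_comp A (two_functor_id A) F = F"
  using F by (intro two_functor.equality ext)
    (auto simp: two_functor_comp_def two_functor_id_def is_two_functor_def extensional_def)

end

lemma isomorphic_two_cats_trans:
  assumes "isomorphic_two_cats A B" "isomorphic_two_cats B C"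
  shows "isomorphic_two_cats A C"
proof -
  obtain F G where F: "is_two_functor A B F" "is_two_functor B A G"
    "two_functor_comp A F G = two_functor_id A" "two_functor_comp B G F = two_functor_id B"
    "two_category A" "two_category B"
    using assms(1) unfolding isomorphic_two_cats_def by blast
  obtain H K where H: "is_two_functor B C H" "is_two_functor C B K"
    "two_functor_comp B H K = two_functor_id B" "two_functor_comp C K H = two_functor_id C"
    "two_category C"
    using assms(2) unfolding isomorphic_two_cats_def by blast
  let ?P = "two_functor_comp A F H" and ?Q = "two_functor_comp C K G"
  have PQ: "is_two_functor A C ?P" "is_two_functor C A ?Q"
    using F H two_functor_comp_is_two_functor by blast+
  have "two_functor_comp B H (two_functor_comp C K G) = G"
    "two_functor_comp B G (two_functor_comp A F H) = H"
    using two_functor_comp_assoc[OF H(1), of K G] two_functor_comp_assoc[OF F(2), of F H] F H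
    by (simp_all add: two_functor_id_comp)
  then have "two_functor_comp A ?P ?Q = two_functor_id A"
    "two_functor_comp C ?Q ?P = two_functor_id C"
    using F H by (simp_all add: two_functor_comp_assoc)
  with PQ show ?thesis unfolding isomorphic_two_cats_def
    using F(5) H(5) by blast
qed

section \<open>Pasting and the 2-category of lax transformations\<close>

sublocale two_category \<subseteq> under: category "under A" by (rule under_category)

context two_category
begin

abbreviation hom_comp (infixr "\<circ>\<circ>" 75) where "f \<circ>\<circ> g \<equiv> f \<cdot>\<^bsub>under A\<^esub> g"
abbreviation vcomp (infixr "\<diamondop>" 60) where "\<sigma> \<diamondop> \<tau> \<equiv> VComp A \<sigma> \<tau>"
abbreviation hcomp (infixr "\<star>" 70) where "\<sigma> \<star> \<tau> \<equiv> HComp A \<sigma> \<tau>"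
abbreviation dom where "dom \<equiv> Dom (under A)"
abbreviation cod where "cod \<equiv> Cod (under A)"

lemma src_trg_arr [simp]:
  assumes "\<sigma> \<in> Cells A" shows "Src A \<sigma> \<in> Arr (under A)" "Trg A \<sigma> \<in> Arr (under A)"
  using category.dom_cod_obj[OF vert_category, of \<sigma>] assms by simp_all

lemma globular [simp]:
  assumes "\<sigma> \<in> Cells A"
  shows "dom (Trg A \<sigma>) = dom (Src A \<sigma>)" "cod (Trg A \<sigma>) = cod (Src A \<sigma>)"
  using globular_dom globular_cod assms by simp_all

lemma vid_simps [simp]:
  assumes "f \<in> Arr (under A)"
  shows "VId A f \<in> Cells A" "Src A (VId A f) = f" "Trg A (VId A f) = f"
  using category.ide_simps[OF vert_category, of f] assms by simp_all

lemma vcomp_simps [simp]: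
  assumes "\<sigma> \<in> Cells A" "\<tau> \<in> Cells A" "Trg A \<sigma> = Src A \<tau>"
  shows "\<sigma> \<diamondop> \<tau> \<in> Cells A" "Src A (\<sigma> \<diamondop> \<tau>) = Src A \<sigma>" "Trg A (\<sigma> \<diamondop> \<tau>) = Trg A \<tau>"
  using category.comp_simps[OF vert_category, of \<sigma> \<tau>] assms by simp_all

lemma vid_vcomp [simp]: "\<sigma> \<in> Cells A \<Longrightarrow> Src A \<sigma> = f \<Longrightarrow> VId A f \<diamondop> \<sigma> = \<sigma>"
  using category.ide_comp'[OF vert_category] by simp

lemma vcomp_vid [simp]: "\<sigma> \<in> Cells A \<Longrightarrow> Trg A \<sigma> = f \<Longrightarrow> \<sigma> \<diamondop> VId A f = \<sigma>"
  using category.comp_ide'[OF vert_category] by simp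

lemma vcomp_assoc [simp]:
  assumes "\<sigma> \<in> Cells A" "\<tau> \<in> Cells A" "\<rho> \<in> Cells A" "Trg A \<sigma> = Src A \<tau>" "Trg A \<tau> = Src A \<rho>"
  shows "(\<sigma> \<diamondop> \<tau>) \<diamondop> \<rho> = \<sigma> \<diamondop> \<tau> \<diamondop> \<rho>"
  using category.comp_assoc'[OF vert_category, of \<sigma> \<tau> \<rho>] assms by simp

lemma hcomp_simps [simp]:
  assumes "\<sigma> \<in> Cells A" "\<tau> \<in> Cells A" "cod (Src A \<sigma>) = dom (Src A \<tau>)"
  shows "\<sigma> \<star> \<tau> \<in> Cells A" "Src A (\<sigma> \<star> \<tau>) = Src A \<sigma> \<circ>\<circ> Src A \<tau>"
    "Trg A (\<sigma> \<star> \<tau>) = Trg A \<sigma> \<circ>\<circ> Trg A \<tau>"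
  using category.comp_simps(1)[OF horiz_category, of \<sigma> \<tau>] src_hcomp[of \<sigma> \<tau>] trg_hcomp[of \<sigma> \<tau>] assms
  by simp_all

lemma hcomp_assoc [simp]:
  assumes "\<sigma> \<in> Cells A" "\<tau> \<in> Cells A" "\<rho> \<in> Cells A" 
    "cod (Src A \<sigma>) = dom (Src A \<tau>)" "cod (Src A \<tau>) = dom (Src A \<rho>)"
  shows "(\<sigma> \<star> \<tau>) \<star> \<rho> = \<sigma> \<star> \<tau> \<star> \<rho>"
  using category.comp_assoc'[OF horiz_category, of \<sigma> \<tau> \<rho>] assms by simp

lemma hcomp_vid_ide [simp]: "\<sigma> \<in> Cells A \<Longrightarrow> cod (Src A \<sigma>) = x \<Longrightarrow> \<sigma> \<star> VId A (Ide (under A) x) = \<sigma>"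
  using category.comp_ide'[OF horiz_category] by simp

lemma vid_ide_hcomp [simp]: "\<sigma> \<in> Cells A \<Longrightarrow> dom (Src A \<sigma>) = x \<Longrightarrow> VId A (Ide (under A) x) \<star> \<sigma> = \<sigma>"
  using category.ide_comp'[OF horiz_category] by simp

lemma vid_hcomp_vid [simp]:
  "f \<in> Arr (under A) \<Longrightarrow> g \<in> Arr (under A) \<Longrightarrow> cod f = dom g \<Longrightarrow> VId A f \<star> VId A g = VId A (f \<circ>\<circ> g)"
  by (simp add: vid_hcomp)

lemma vid_hcomp_vid_hcomp [simp]:
  assumes "f \<in> Arr (under A)" "g \<in> Arr (under A)" "\<sigma> \<in> Cells A" "cod f = dom g"
    "cod g = dom (Src A \<sigma>)"
  shows "VId A f \<star> VId A g \<star> \<sigma> = VId A (f \<circ>\<circ> g) \<star> \<sigma>"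
  using assms by (simp flip: hcomp_assoc)

lemma interchange':
  assumes "\<sigma> \<in> Cells A" "\<sigma>' \<in> Cells A" "\<tau> \<in> Cells A" "\<tau>' \<in> Cells A"
    "Trg A \<sigma> = Src A \<sigma>'" "Trg A \<tau> = Src A \<tau>'" "cod (Src A \<sigma>) = dom (Src A \<tau>)"
  shows "(\<sigma> \<diamondop> \<sigma>') \<star> (\<tau> \<diamondop> \<tau>') = (\<sigma> \<star> \<tau>) \<diamondop> (\<sigma>' \<star> \<tau>')"
  using interchange[of \<sigma> \<sigma>' \<tau> \<tau>'] assms by simp

lemma whisker_left:
  assumes "f \<in> Arr (under A)" "\<sigma> \<in> Cells A" "\<tau> \<in> Cells A" "Trg A \<sigma> = Src A \<tau>"
    "cod f = dom (Src A \<sigma>)"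
  shows "VId A f \<star> (\<sigma> \<diamondop> \<tau>) = (VId A f \<star> \<sigma>) \<diamondop> (VId A f \<star> \<tau>)"
  using assms interchange'[of "VId A f" "VId A f" \<sigma> \<tau>] by simp

lemma whisker_right:
  assumes "f \<in> Arr (under A)" "\<sigma> \<in> Cells A" "\<tau> \<in> Cells A" "Trg A \<sigma> = Src A \<tau>"
    "cod (Src A \<sigma>) = dom f"
  shows "(\<sigma> \<diamondop> \<tau>) \<star> VId A f = (\<sigma> \<star> VId A f) \<diamondop> (\<tau> \<star> VId A f)"
  using assms interchange'[of \<sigma> \<tau> "VId A f" "VId A f"] by simp

lemma hcomp_expand:
  assumes "\<sigma> \<in> Cells A" "\<tau> \<in> Cells A" "cod (Src A \<sigma>) = dom (Src A \<tau>)"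
  shows "(\<sigma> \<star> VId A (Src A \<tau>)) \<diamondop> (VId A (Trg A \<sigma>) \<star> \<tau>) = \<sigma> \<star> \<tau>"
    "(VId A (Src A \<sigma>) \<star> \<tau>) \<diamondop> (\<sigma> \<star> VId A (Trg A \<tau>)) = \<sigma> \<star> \<tau>"
  using assms interchange'[of \<sigma> "VId A (Trg A \<sigma>)" "VId A (Src A \<tau>)" \<tau>]
    interchange'[of "VId A (Src A \<sigma>)" \<sigma> \<tau> "VId A (Trg A \<tau>)"] by simp_all

end

context
  fixes A :: "('o, 'a, 'c) two_cat" and B :: "('x, 'b, 'd) two_cat"
    and F :: "('o, 'a, 'c, 'x, 'b, 'd) two_functor"
  assumes F: "is_two_functor A B F"
begin

lemma tf_simps:
  "f \<in> Arr (under A) \<Longrightarrow> Dom (under B) (tf_arr F f) = tf_obj F (Dom (under A) f)"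
  "f \<in> Arr (under A) \<Longrightarrow> Cod (under B) (tf_arr F f) = tf_obj F (Cod (under A) f)"
  "\<sigma> \<in> Cells A \<Longrightarrow> Src B (tf_cell F \<sigma>) = tf_arr F (Src A \<sigma>)"
  "\<sigma> \<in> Cells A \<Longrightarrow> Trg B (tf_cell F \<sigma>) = tf_arr F (Trg A \<sigma>)"
  "x \<in> Obj (under A) \<Longrightarrow> tf_arr F (Ide (under A) x) = Ide (under B) (tf_obj F x)"
  "f \<in> Arr (under A) \<Longrightarrow> tf_cell F (VId A f) = VId B (tf_arr F f)"
  using is_two_functor_cat_functors[OF F] by (simp_all add: cat_functor_def)

lemma tf_comp:
  "f \<in> Arr (under A) \<Longrightarrow> g \<in> Arr (under A) \<Longrightarrow> Cod (under A) f = Dom (under A) g \<Longrightarrow>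
    tf_arr F (f \<cdot>\<^bsub>under A\<^esub> g) = tf_arr F f \<cdot>\<^bsub>under B\<^esub> tf_arr F g"
  "\<sigma> \<in> Cells A \<Longrightarrow> \<tau> \<in> Cells A \<Longrightarrow> Trg A \<sigma> = Src A \<tau> \<Longrightarrow>
    tf_cell F (VComp A \<sigma> \<tau>) = VComp B (tf_cell F \<sigma>) (tf_cell F \<tau>)"
  "\<sigma> \<in> Cells A \<Longrightarrow> \<tau> \<in> Cells A \<Longrightarrow> Cod (under A) (Src A \<sigma>) = Dom (under A) (Src A \<tau>) \<Longrightarrow>
    tf_cell F (HComp A \<sigma> \<tau>) = HComp B (tf_cell F \<sigma>) (tf_cell F \<tau>)"
  using is_two_functor_cat_functors[OF F] by (simp_all add: cat_functor_def)

lemmas two_functor_rules = tf_carrier[OF F] tf_simps tf_comp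

end

context
  fixes A :: "('o, 'a, 'c) two_cat" and B :: "('x, 'b, 'd) two_cat"
    and \<alpha> :: "('o, 'a, 'c, 'x, 'b, 'd) lax_nat"
  assumes \<alpha>: "is_lax_nat A B \<alpha>"
begin

lemma lax_nat_functors: "is_two_functor A B (ln_dom \<alpha>)" "is_two_functor A B (ln_cod \<alpha>)"
  using \<alpha> by (simp_all add: is_lax_nat_def Let_def)

lemma lax_nat_extensional: "ln_obj \<alpha> \<in> extensional (Obj (under A))"
  "ln_arr \<alpha> \<in> extensional (Arr (under A))"
  using \<alpha> by (simp_all add: is_lax_nat_def Let_def)

lemma lax_nat_simps:
  "x \<in> Obj (under A) \<Longrightarrow> ln_obj \<alpha> x \<in> Arr (under B)"
  "x \<in> Obj (under A) \<Longrightarrow> Dom (under B) (ln_obj \<alpha> x) = tf_obj (ln_dom \<alpha>) x"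
  "x \<in> Obj (under A) \<Longrightarrow> Cod (under B) (ln_obj \<alpha> x) = tf_obj (ln_cod \<alpha>) x"
  "f \<in> Arr (under A) \<Longrightarrow> ln_arr \<alpha> f \<in> Cells B"
  "f \<in> Arr (under A) \<Longrightarrow> Src B (ln_arr \<alpha> f) =
    ln_obj \<alpha> (Dom (under A) f) \<cdot>\<^bsub>under B\<^esub> tf_arr (ln_cod \<alpha>) f"
  "f \<in> Arr (under A) \<Longrightarrow> Trg B (ln_arr \<alpha> f) =
    tf_arr (ln_dom \<alpha>) f \<cdot>\<^bsub>under B\<^esub> ln_obj \<alpha> (Cod (under A) f)"
  "x \<in> Obj (under A) \<Longrightarrow> ln_arr \<alpha> (Ide (under A) x) = VId B (ln_obj \<alpha> x)"
  using \<alpha> by (simp_all add: is_lax_nat_def Let_def two_cell_def)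

lemmas lax_nat_rules = \<alpha> lax_nat_functors lax_nat_simps
  two_functor_rules[OF lax_nat_functors(1)] two_functor_rules[OF lax_nat_functors(2)]

lemma lax_nat_natural:
  "\<sigma> \<in> Cells A \<Longrightarrow> 
    VComp B (HComp B (VId B (ln_obj \<alpha> (Dom (under A) (Src A \<sigma>)))) (tf_cell (ln_cod \<alpha>) \<sigma>))
      (ln_arr \<alpha> (Trg A \<sigma>)) =
    VComp B (ln_arr \<alpha> (Src A \<sigma>))
      (HComp B (tf_cell (ln_dom \<alpha>) \<sigma>) (VId B (ln_obj \<alpha> (Cod (under A) (Src A \<sigma>)))))"
  using \<alpha> by (simp add: is_lax_nat_def Let_def)

lemma lax_nat_comp_arr:
  "f \<in> Arr (under A) \<Longrightarrow> g \<in> Arr (under A) \<Longrightarrow> Cod (under A) f = Dom (under A) g \<Longrightarrow>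
    ln_arr \<alpha> (f \<cdot>\<^bsub>under A\<^esub> g) =
      VComp B (HComp B (ln_arr \<alpha> f) (VId B (tf_arr (ln_cod \<alpha>) g)))
        (HComp B (VId B (tf_arr (ln_dom \<alpha>) f)) (ln_arr \<alpha> g))"
  using \<alpha> by (simp add: is_lax_nat_def Let_def)

end

context
  fixes A :: "('o, 'a, 'c) two_cat" and B :: "('x, 'b, 'd) two_cat"
    and \<mu> :: "('o, 'a, 'c, 'x, 'b, 'd) modif"
  assumes \<mu>: "is_modif A B \<mu>"
begin

lemma modif_simps:
  "is_lax_nat A B (mf_dom \<mu>)" "is_lax_nat A B (mf_cod \<mu>)"
  "ln_dom (mf_cod \<mu>) = ln_dom (mf_dom \<mu>)" "ln_cod (mf_cod \<mu>) = ln_cod (mf_dom \<mu>)"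
  "x \<in> Obj (under A) \<Longrightarrow> mf_obj \<mu> x \<in> Cells B"
  "x \<in> Obj (under A) \<Longrightarrow> Src B (mf_obj \<mu> x) = ln_obj (mf_dom \<mu>) x"
  "x \<in> Obj (under A) \<Longrightarrow> Trg B (mf_obj \<mu> x) = ln_obj (mf_cod \<mu>) x"
  using \<mu> by (simp_all add: is_modif_def Let_def two_cell_def)

lemmas modif_rules = \<mu> modif_simps lax_nat_rules[OF modif_simps(1)] lax_nat_rules[OF modif_simps(2)]

lemma modif_extensional: "mf_obj \<mu> \<in> extensional (Obj (under A))"
  using \<mu> by (simp_all add: is_modif_def Let_def)

lemma modif_natural:
  "f \<in> Arr (under A) \<Longrightarrow>
    VComp B (ln_arr (mf_dom \<mu>) f)
      (HComp B (VId B (tf_arr (ln_dom (mf_dom \<mu>)) f)) (mf_obj \<mu> (Cod (under A) f))) =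
    VComp B (HComp B (mf_obj \<mu> (Dom (under A) f)) (VId B (tf_arr (ln_cod (mf_dom \<mu>)) f)))
      (ln_arr (mf_cod \<mu>) f)"
  using \<mu> by (simp add: is_modif_def Let_def)

end

lemma lax_nat_id_simps [simp]:
  "ln_dom (lax_nat_id A B F) = F" "ln_cod (lax_nat_id A B F) = F"
  "x \<in> Obj (under A) \<Longrightarrow> ln_obj (lax_nat_id A B F) x = Ide (under B) (tf_obj F x)"
  "f \<in> Arr (under A) \<Longrightarrow> ln_arr (lax_nat_id A B F) f = VId B (tf_arr F f)"
  by (simp_all add: lax_nat_id_def)

lemma lax_nat_comp_simps [simp]:
  "ln_dom (lax_nat_comp A B \<alpha> \<beta>) = ln_dom \<alpha>" "ln_cod (lax_nat_comp A B \<alpha> \<beta>) = ln_cod \<beta>"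
  "x \<in> Obj (under A) \<Longrightarrow> ln_obj (lax_nat_comp A B \<alpha> \<beta>) x = ln_obj \<alpha> x \<cdot>\<^bsub>under B\<^esub> ln_obj \<beta> x"
  "f \<in> Arr (under A) \<Longrightarrow> ln_arr (lax_nat_comp A B \<alpha> \<beta>) f =
    VComp B (HComp B (VId B (ln_obj \<alpha> (Dom (under A) f))) (ln_arr \<beta> f))
            (HComp B (ln_arr \<alpha> f) (VId B (ln_obj \<beta> (Cod (under A) f))))"
  by (simp_all add: lax_nat_comp_def)

locale two_categories = A: two_category A + B: two_category B
  for A :: "('o, 'a, 'c) two_cat" and B :: "('x, 'b, 'd) two_cat"
begin

notation B.hom_comp (infixr "\<circ>\<circ>" 75)
notation B.vcomp (infixr "\<diamondop>" 60)
notation B.hcomp (infixr "\<star>" 70)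

lemma lax_nat_eqI:
  assumes "is_lax_nat A B \<alpha>" "is_lax_nat A B \<beta>" "ln_dom \<alpha> = ln_dom \<beta>" "ln_cod \<alpha> = ln_cod \<beta>"
    "\<And>x. x \<in> Obj (under A) \<Longrightarrow> ln_obj \<alpha> x = ln_obj \<beta> x"
    "\<And>f. f \<in> Arr (under A) \<Longrightarrow> ln_arr \<alpha> f = ln_arr \<beta> f"
  shows "\<alpha> = \<beta>"
  using assms lax_nat_extensional[OF assms(1)] lax_nat_extensional[OF assms(2)]
  by (intro lax_nat.equality extensionalityI) auto

lemma modif_eqI:
  assumes "is_modif A B \<mu>" "is_modif A B \<nu>" "mf_dom \<mu> = mf_dom \<nu>" "mf_cod \<mu> = mf_cod \<nu>"
    "\<And>x. x \<in> Obj (under A) \<Longrightarrow> mf_obj \<mu> x = mf_obj \<nu> x"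
  shows "\<mu> = \<nu>"
  using assms modif_extensional[OF assms(1)] modif_extensional[OF assms(2)]
  by (intro modif.equality extensionalityI) auto

lemma is_lax_nat_id [simp]: "is_two_functor A B F \<Longrightarrow> is_lax_nat A B (lax_nat_id A B F)"
  by (simp add: is_lax_nat_def Let_def two_cell_def two_functor_rules) (simp add: lax_nat_id_def)

lemma is_lax_nat_comp [simp]:
  assumes \<alpha>: "is_lax_nat A B \<alpha>" and \<beta>: "is_lax_nat A B \<beta>" and eq: "ln_cod \<alpha> = ln_dom \<beta>"
  shows "is_lax_nat A B (lax_nat_comp A B \<alpha> \<beta>)"
proof -
  let ?F = "ln_dom \<alpha>" and ?G = "ln_cod \<alpha>" and ?H = "ln_cod \<beta>" and ?\<gamma> = "lax_nat_comp A B \<alpha> \<beta>"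
  note [simp] = lax_nat_rules[OF \<alpha>] lax_nat_rules[OF \<beta>] eq[symmetric]
  have nat: "(VId B (ln_obj ?\<gamma> (A.dom (Src A \<sigma>))) \<star> tf_cell ?H \<sigma>) \<diamondop> ln_arr ?\<gamma> (Trg A \<sigma>) =
    ln_arr ?\<gamma> (Src A \<sigma>) \<diamondop> (tf_cell ?F \<sigma> \<star> VId B (ln_obj ?\<gamma> (A.cod (Src A \<sigma>))))"
    if \<sigma>[simp]: "\<sigma> \<in> Cells A" for \<sigma>
  proof -
    let ?x = "A.dom (Src A \<sigma>)" and ?y = "A.cod (Src A \<sigma>)"
    let ?ax = "VId B (ln_obj \<alpha> ?x)" and ?ay = "VId B (ln_obj \<alpha> ?y)"
    let ?bx = "VId B (ln_obj \<beta> ?x)" and ?by = "VId B (ln_obj \<beta> ?y)"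
    let ?as = "ln_arr \<alpha> (Src A \<sigma>)" and ?at = "ln_arr \<alpha> (Trg A \<sigma>)"
    let ?bs = "ln_arr \<beta> (Src A \<sigma>)" and ?bt = "ln_arr \<beta> (Trg A \<sigma>)"
    have "(VId B (ln_obj ?\<gamma> ?x) \<star> tf_cell ?H \<sigma>) \<diamondop> ln_arr ?\<gamma> (Trg A \<sigma>) =
        (?ax \<star> ((?bx \<star> tf_cell ?H \<sigma>) \<diamondop> ?bt)) \<diamondop> (?at \<star> ?by)"
      by (simp add: B.whisker_left)
    also have "\<dots> = (?ax \<star> ?bs) \<diamondop> (((?ax \<star> tf_cell ?G \<sigma>) \<diamondop> ?at) \<star> ?by)"
      by (simp add: lax_nat_natural[OF \<beta>] B.whisker_left B.whisker_right)
    also have "\<dots> = ln_arr ?\<gamma> (Src A \<sigma>) \<diamondop> (tf_cell ?F \<sigma> \<star> VId B (ln_obj ?\<gamma> ?y))"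
      by (simp add: lax_nat_natural[OF \<alpha>] lax_nat_natural[OF \<beta>] B.whisker_left B.whisker_right)
    finally show ?thesis .
  qed
  have comp: "ln_arr ?\<gamma> (f \<cdot>\<^bsub>under A\<^esub> g) =
      (ln_arr ?\<gamma> f \<star> VId B (tf_arr ?H g)) \<diamondop> (VId B (tf_arr ?F f) \<star> ln_arr ?\<gamma> g)"
    if [simp]: "f \<in> Arr (under A)" "g \<in> Arr (under A)" "A.cod f = A.dom g" for f g
  proof -
    let ?x = "A.dom f" and ?y = "A.dom g" and ?z = "A.cod g"
    let ?ax = "VId B (ln_obj \<alpha> ?x)" and ?ay = "VId B (ln_obj \<alpha> ?y)"
    let ?by = "VId B (ln_obj \<beta> ?y)" and ?bz = "VId B (ln_obj \<beta> ?z)"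
    let ?af = "ln_arr \<alpha> f" and ?ag = "ln_arr \<alpha> g" and ?bf = "ln_arr \<beta> f" and ?bg = "ln_arr \<beta> g"
    have "ln_arr ?\<gamma> (f \<cdot>\<^bsub>under A\<^esub> g) = (?ax \<star> ?bf \<star> VId B (tf_arr ?H g)) \<diamondop>
       (VId B (ln_obj \<alpha> ?x \<circ>\<circ> tf_arr ?G f) \<star> ?bg) \<diamondop> (?af \<star> VId B (tf_arr ?G g \<circ>\<circ> ln_obj \<beta> ?z)) \<diamondop>
       (VId B (tf_arr ?F f) \<star> ?ag \<star> ?bz)"
      by (simp add: lax_nat_comp_arr[OF \<alpha>] lax_nat_comp_arr[OF \<beta>] B.whisker_left B.whisker_right)
    also have "\<dots> = (?ax \<star> ?bf \<star> VId B (tf_arr ?H g)) \<diamondop>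
       (?af \<star> VId B (ln_obj \<beta> ?y \<circ>\<circ> tf_arr ?H g)) \<diamondop> (VId B (tf_arr ?F f \<circ>\<circ> ln_obj \<alpha> ?y) \<star> ?bg) \<diamondop>
       (VId B (tf_arr ?F f) \<star> ?ag \<star> ?bz)"
      using B.hcomp_expand[of ?af ?bg] by (simp flip: B.vcomp_assoc)
    also have "\<dots> = (ln_arr ?\<gamma> f \<star> VId B (tf_arr ?H g)) \<diamondop> (VId B (tf_arr ?F f) \<star> ln_arr ?\<gamma> g)"
      by (simp add: B.whisker_left B.whisker_right)
    finally show ?thesis .
  qed
  show ?thesis
    using nat comp
    by (simp add: is_lax_nat_def Let_def two_cell_def del: lax_nat_comp_simps(3,4)) 
      (simp add: lax_nat_comp_def)
qed

lemma modif_vid [simp]: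
  assumes \<alpha>: "is_lax_nat A B \<alpha>" shows "is_modif A B (VId (TwoCat_lax A B) \<alpha>)"
proof -
  note [simp] = lax_nat_rules[OF \<alpha>]
  show ?thesis by (simp add: is_modif_def Let_def two_cell_def TwoCat_lax_def)
qed

lemma modif_vcomp [simp]:
  assumes \<mu>: "is_modif A B \<mu>" and \<nu>: "is_modif A B \<nu>" and eq: "mf_cod \<mu> = mf_dom \<nu>"
  shows "is_modif A B (VComp (TwoCat_lax A B) \<mu> \<nu>)"
proof -
  note [simp] = modif_rules[OF \<mu>] modif_rules[OF \<nu>] eq[symmetric] 
  have "ln_arr (mf_dom \<mu>) f \<diamondop> (VId B (tf_arr (ln_dom (mf_dom \<mu>)) f) \<star> mf_obj \<mu> (A.cod f)) \<diamondop> 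
      (VId B (tf_arr (ln_dom (mf_dom \<mu>)) f) \<star> mf_obj \<nu> (A.cod f))
    = (mf_obj \<mu> (A.dom f) \<star> VId B (tf_arr (ln_cod (mf_dom \<mu>)) f)) \<diamondop>
      (mf_obj \<nu> (A.dom f) \<star> VId B (tf_arr (ln_cod (mf_dom \<mu>)) f)) \<diamondop> ln_arr (mf_cod \<nu>)
        f" (is "?l f = ?r f")
    if [simp]: "f \<in> Arr (under A)" for f
  proof -
    have "?l f = (ln_arr (mf_dom \<mu>) f \<diamondop>
      (VId B (tf_arr (ln_dom (mf_dom \<mu>)) f) \<star> mf_obj \<mu> (A.cod f))) \<diamondop> 
      (VId B (tf_arr (ln_dom (mf_dom \<mu>)) f) \<star> mf_obj \<nu> (A.cod f))"
      by simp
    also have "\<dots> = (mf_obj \<mu> (A.dom f) \<star> VId B (tf_arr (ln_cod (mf_dom \<mu>)) f)) \<diamondop>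
      ln_arr (mf_cod \<mu>) f \<diamondop> (VId B (tf_arr (ln_dom (mf_dom \<mu>)) f) \<star> mf_obj \<nu> (A.cod f))"
      unfolding modif_natural[OF \<mu> that] by simp
    also have "\<dots> = ?r f"
      using modif_natural[OF \<nu> that] by simp
    finally show ?thesis .
  qed
  then show ?thesis 
    by (simp add: is_modif_def Let_def two_cell_def TwoCat_lax_def B.whisker_left B.whisker_right)
qed

lemma modif_hcomp [simp]:
  assumes \<mu>: "is_modif A B \<mu>" and \<nu>: "is_modif A B \<nu>" and eq:
    "ln_cod (mf_dom \<mu>) = ln_dom (mf_dom \<nu>)"
  shows "is_modif A B (HComp (TwoCat_lax A B) \<mu> \<nu>)"
proof -
  note [simp] = modif_rules[OF \<mu>] modif_rules[OF \<nu>] eq[symmetric]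
  let ?F = "ln_dom (mf_dom \<mu>)" and ?G = "ln_cod (mf_dom \<mu>)" and ?H = "ln_cod (mf_dom \<nu>)"
  have "((VId B (ln_obj (mf_dom \<mu>) (A.dom f)) \<star> ln_arr (mf_dom \<nu>) f) \<diamondop>
        (ln_arr (mf_dom \<mu>) f \<star> VId B (ln_obj (mf_dom \<nu>) (A.cod f)))) \<diamondop>
      (VId B (tf_arr ?F f) \<star> (mf_obj \<mu> (A.cod f) \<star> mf_obj \<nu> (A.cod f)))
    = ((mf_obj \<mu> (A.dom f) \<star> mf_obj \<nu> (A.dom f)) \<star> VId B (tf_arr ?H f)) \<diamondop>
      ((VId B (ln_obj (mf_cod \<mu>) (A.dom f)) \<star> ln_arr (mf_cod \<nu>) f) \<diamondop>
        (ln_arr (mf_cod \<mu>) f \<star> VId B (ln_obj (mf_cod \<nu>) (A.cod f))))" (is "?l f = ?r f")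
    if [simp]: "f \<in> Arr (under A)" for f
  proof -
    let ?m = "mf_obj \<mu> (A.dom f)" and ?n = "mf_obj \<nu> (A.dom f)"
    let ?m' = "mf_obj \<mu> (A.cod f)" and ?n' = "mf_obj \<nu> (A.cod f)"
    let ?a = "ln_arr (mf_dom \<mu>) f" and ?a' = "ln_arr (mf_cod \<mu>) f"
    let ?b = "ln_arr (mf_dom \<nu>) f" and ?b' = "ln_arr (mf_cod \<nu>) f"
    let ?ax = "ln_obj (mf_dom \<mu>) (A.dom f)" and ?ay' = "ln_obj (mf_cod \<mu>) (A.cod f)"
    let ?ax' = "ln_obj (mf_cod \<mu>) (A.dom f)"
    let ?by = "ln_obj (mf_dom \<nu>) (A.cod f)" and ?by' = "ln_obj (mf_cod \<nu>) (A.cod f)"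
    have "?l f = (VId B ?ax \<star> ?b) \<diamondop> ((?a \<diamondop> (VId B (tf_arr ?F f) \<star> ?m')) \<star> ?n')"
      using B.interchange'[of ?a "VId B (tf_arr ?F f) \<star> ?m'" "VId B ?by" ?n'] by simp
    also have "\<dots> = (VId B ?ax \<star> ?b) \<diamondop> (((?m \<star> VId B (tf_arr ?G f)) \<diamondop> ?a') \<star> ?n')"
      unfolding modif_natural[OF \<mu> that] ..
    also have "\<dots> = (VId B ?ax \<star> ?b) \<diamondop> (?m \<star> VId B (tf_arr ?G f) \<star> ?n') \<diamondop> (?a' \<star> VId B ?by')"
      using B.interchange'[of "?m \<star> VId B (tf_arr ?G f)" ?a' ?n' "VId B ?by'"] by simp
    also have "\<dots> = (?m \<star> (?b \<diamondop> (VId B (tf_arr ?G f) \<star> ?n'))) \<diamondop> (?a' \<star> VId B ?by')"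
      using B.interchange'[of "VId B ?ax" ?m ?b "VId B (tf_arr ?G f) \<star> ?n'"] by simp
    also have "\<dots> = (?m \<star> ((?n \<star> VId B (tf_arr ?H f)) \<diamondop> ?b')) \<diamondop> (?a' \<star> VId B ?by')"
      using modif_natural[OF \<nu> that] by simp
    also have "\<dots> = ?r f"
      using B.interchange'[of ?m "VId B ?ax'" "?n \<star> VId B (tf_arr ?H f)" ?b'] by simp
    finally show ?thesis .
  qed
  then show ?thesis
    by (simp add: is_modif_def Let_def two_cell_def TwoCat_lax_def)
qed

end

lemma TwoCat_lax_simps [simp]:
  "Obj (under (TwoCat_lax A B)) = {F. is_two_functor A B F}"
  "Arr (under (TwoCat_lax A B)) = {\<alpha>. is_lax_nat A B \<alpha>}"
  "Dom (under (TwoCat_lax A B)) = ln_dom" "Cod (under (TwoCat_lax A B)) = ln_cod"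
  "Ide (under (TwoCat_lax A B)) = lax_nat_id A B"
  "Comp (under (TwoCat_lax A B)) = lax_nat_comp A B"
  "Cells (TwoCat_lax A B) = {\<mu>. is_modif A B \<mu>}"
  "Src (TwoCat_lax A B) = mf_dom" "Trg (TwoCat_lax A B) = mf_cod"
  by (simp_all add: TwoCat_lax_def)

lemma TwoCat_lax_comp_simps [simp]:
  "mf_dom (VId (TwoCat_lax A B) \<alpha>) = \<alpha>" "mf_cod (VId (TwoCat_lax A B) \<alpha>) = \<alpha>"
  "x \<in> Obj (under A) \<Longrightarrow> mf_obj (VId (TwoCat_lax A B) \<alpha>) x = VId B (ln_obj \<alpha> x)"
  "mf_dom (VComp (TwoCat_lax A B) \<mu> \<nu>) = mf_dom \<mu>" "mf_cod (VComp (TwoCat_lax A B) \<mu> \<nu>) = mf_cod \<nu>"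
  "x \<in> Obj (under A) \<Longrightarrow> mf_obj (VComp (TwoCat_lax A B) \<mu> \<nu>) x = VComp B (mf_obj \<mu> x) (mf_obj \<nu> x)"
  "mf_dom (HComp (TwoCat_lax A B) \<mu> \<nu>) = lax_nat_comp A B (mf_dom \<mu>) (mf_dom \<nu>)"
  "mf_cod (HComp (TwoCat_lax A B) \<mu> \<nu>) = lax_nat_comp A B (mf_cod \<mu>) (mf_cod \<nu>)"
  "x \<in> Obj (under A) \<Longrightarrow> mf_obj (HComp (TwoCat_lax A B) \<mu> \<nu>) x = HComp B (mf_obj \<mu> x) (mf_obj \<nu> x)"
  by (simp_all add: TwoCat_lax_def)

context two_categories
begin

lemma lax_nat_id_comp: 
  assumes \<alpha>: "is_lax_nat A B \<alpha>" 
  shows "lax_nat_comp A B (lax_nat_id A B (ln_dom \<alpha>)) \<alpha> = \<alpha>" 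
    "lax_nat_comp A B \<alpha> (lax_nat_id A B (ln_cod \<alpha>)) = \<alpha>"
proof -
  note [simp] = lax_nat_rules[OF \<alpha>]
  show "lax_nat_comp A B (lax_nat_id A B (ln_dom \<alpha>)) \<alpha> = \<alpha>" 
    "lax_nat_comp A B \<alpha> (lax_nat_id A B (ln_cod \<alpha>)) = \<alpha>"
    by (rule lax_nat_eqI; simp)+
qed

lemma lax_nat_comp_assoc:
  assumes \<alpha>: "is_lax_nat A B \<alpha>" and \<beta>: "is_lax_nat A B \<beta>" and \<gamma>: "is_lax_nat A B \<gamma>"
    and eq: "ln_cod \<alpha> = ln_dom \<beta>" "ln_cod \<beta> = ln_dom \<gamma>"
  shows "lax_nat_comp A B (lax_nat_comp A B \<alpha> \<beta>) \<gamma> = lax_nat_comp A B \<alpha> (lax_nat_comp A B \<beta> \<gamma>)"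
proof -
  note [simp] = lax_nat_rules[OF \<alpha>] lax_nat_rules[OF \<beta>] lax_nat_rules[OF \<gamma>] eq[symmetric]
  show ?thesis by (rule lax_nat_eqI) (simp_all add: B.whisker_left B.whisker_right)
qed

lemma two_category_TwoCat_lax: "two_category (TwoCat_lax A B)"
proof (intro two_category.intro)
  show "category (under (TwoCat_lax A B))"
    by (intro category.intro) (auto simp: lax_nat_functors lax_nat_id_comp lax_nat_comp_assoc)
  show "category (vert_cat (TwoCat_lax A B))"
  proof (intro category.intro)
    fix \<mu> assume "\<mu> \<in> Arr (vert_cat (TwoCat_lax A B))"
    then have \<mu>: "is_modif A B \<mu>" by simp
    note [simp] = modif_rules[OF \<mu>]
    show "Comp (vert_cat (TwoCat_lax A B))
      (Ide (vert_cat (TwoCat_lax A B)) (Dom (vert_cat (TwoCat_lax A B)) \<mu>)) \<mu> = \<mu>"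
      "Comp (vert_cat (TwoCat_lax A B)) \<mu>
        (Ide (vert_cat (TwoCat_lax A B)) (Cod (vert_cat (TwoCat_lax A B)) \<mu>)) = \<mu>"
      "Dom (vert_cat (TwoCat_lax A B)) \<mu> \<in> Obj (vert_cat (TwoCat_lax A B))"
      "Cod (vert_cat (TwoCat_lax A B)) \<mu> \<in> Obj (vert_cat (TwoCat_lax A B))"
      by ((rule modif_eqI)?; simp)+
  next
    fix \<mu> \<nu> \<rho> assume *: "composable (vert_cat (TwoCat_lax A B)) \<mu> \<nu>"
      "composable (vert_cat (TwoCat_lax A B)) \<nu> \<rho>"
    then have \<mu>: "is_modif A B \<mu>" and \<nu>: "is_modif A B \<nu>" and \<rho>: "is_modif A B \<rho>"
      and [simp]: "mf_cod \<mu> = mf_dom \<nu>" "mf_cod \<nu> = mf_dom \<rho>" by simp_all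
    note [simp] = modif_rules[OF \<mu>] modif_rules[OF \<nu>] modif_rules[OF \<rho>]
    show "Comp (vert_cat (TwoCat_lax A B)) (Comp (vert_cat (TwoCat_lax A B)) \<mu> \<nu>) \<rho> =
      Comp (vert_cat (TwoCat_lax A B)) \<mu> (Comp (vert_cat (TwoCat_lax A B)) \<nu> \<rho>)"
      by (simp, rule modif_eqI; simp flip: \<open>mf_cod \<mu> = mf_dom \<nu>\<close> \<open>mf_cod \<nu> = mf_dom \<rho>\<close>)
  qed simp_all
  show "category (horiz_cat (TwoCat_lax A B))"
  proof (intro category.intro)
    fix \<mu> assume "\<mu> \<in> Arr (horiz_cat (TwoCat_lax A B))"
    then have \<mu>: "is_modif A B \<mu>" by simp
    note [simp] = modif_rules[OF \<mu>] lax_nat_id_comp[OF modif_simps(1)[OF \<mu>]]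
      lax_nat_id_comp[OF modif_simps(2)[OF \<mu>], simplified modif_simps(3,4)[OF \<mu>]]
    show "Comp (horiz_cat (TwoCat_lax A B))
      (Ide (horiz_cat (TwoCat_lax A B)) (Dom (horiz_cat (TwoCat_lax A B)) \<mu>)) \<mu> = \<mu>"
      "Comp (horiz_cat (TwoCat_lax A B)) \<mu>
        (Ide (horiz_cat (TwoCat_lax A B)) (Cod (horiz_cat (TwoCat_lax A B)) \<mu>)) = \<mu>"
      "Dom (horiz_cat (TwoCat_lax A B)) \<mu> \<in> Obj (horiz_cat (TwoCat_lax A B))"
      "Cod (horiz_cat (TwoCat_lax A B)) \<mu> \<in> Obj (horiz_cat (TwoCat_lax A B))"
      by ((rule modif_eqI)?; simp)+
  next
    fix \<mu> \<nu> \<rho> assume *: "composable (horiz_cat (TwoCat_lax A B)) \<mu> \<nu>"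
      "composable (horiz_cat (TwoCat_lax A B)) \<nu> \<rho>"
    then have \<mu>: "is_modif A B \<mu>" and \<nu>: "is_modif A B \<nu>" and \<rho>: "is_modif A B \<rho>"
      and eq: "ln_cod (mf_dom \<mu>) = ln_dom (mf_dom \<nu>)" "ln_cod (mf_dom \<nu>) = ln_dom (mf_dom \<rho>)" by
        simp_all
    note [simp] = modif_rules[OF \<mu>] modif_rules[OF \<nu>] modif_rules[OF \<rho>] eq[symmetric]
    show "Comp (horiz_cat (TwoCat_lax A B)) (Comp (horiz_cat (TwoCat_lax A B)) \<mu> \<nu>) \<rho> =
      Comp (horiz_cat (TwoCat_lax A B)) \<mu> (Comp (horiz_cat (TwoCat_lax A B)) \<nu> \<rho>)"
      by (simp, rule modif_eqI; simp add: lax_nat_comp_assoc)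
  next
    fix F assume "F \<in> Obj (horiz_cat (TwoCat_lax A B))"
    then show "in_hom (horiz_cat (TwoCat_lax A B)) (Ide (horiz_cat (TwoCat_lax A B)) F) F F" by simp
  qed simp_all
  fix \<mu> \<mu>' \<nu> \<nu>' assume *: "composable (vert_cat (TwoCat_lax A B)) \<mu> \<mu>'"
    "composable (vert_cat (TwoCat_lax A B)) \<nu> \<nu>'" "composable (horiz_cat (TwoCat_lax A B)) \<mu> \<nu>"
  then have M: "is_modif A B \<mu>" "is_modif A B \<mu>'" "is_modif A B \<nu>" "is_modif A B \<nu>'"
    and eq: "mf_cod \<mu> = mf_dom \<mu>'" "mf_cod \<nu> = mf_dom \<nu>'" "ln_cod (mf_dom \<mu>) = ln_dom (mf_dom \<nu>)"
      by simp_all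
  note [simp] = M[THEN modif_rules(1)] M[THEN modif_rules(2)]
    modif_rules[OF M(1)] modif_rules[OF M(2)] modif_rules[OF M(3)] modif_rules[OF M(4)]
      eq[symmetric]
  show "HComp (TwoCat_lax A B) (VComp (TwoCat_lax A B) \<mu> \<mu>') (VComp (TwoCat_lax A B) \<nu> \<nu>') =
    VComp (TwoCat_lax A B) (HComp (TwoCat_lax A B) \<mu> \<nu>) (HComp (TwoCat_lax A B) \<mu>' \<nu>')"
    by (rule modif_eqI; simp add: B.interchange')
next
  fix \<alpha> \<beta> assume "composable (under (TwoCat_lax A B)) \<alpha> \<beta>"
  then have \<alpha>: "is_lax_nat A B \<alpha>" and \<beta>: "is_lax_nat A B \<beta>" and eq: "ln_cod \<alpha> = ln_dom \<beta>" by
    simp_all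
  note [simp] = lax_nat_rules[OF \<alpha>] lax_nat_rules[OF \<beta>] eq[symmetric]
  show "HComp (TwoCat_lax A B) (VId (TwoCat_lax A B) \<alpha>) (VId (TwoCat_lax A B) \<beta>) =
    VId (TwoCat_lax A B) (\<alpha> \<cdot>\<^bsub>under (TwoCat_lax A B)\<^esub> \<beta>)"
    by (simp, rule modif_eqI; simp)
qed (auto dest: modif_simps)

end

definition lax_nat_post ::
  "('o, 'a, 'c) two_cat \<Rightarrow> ('x, 'b, 'd, 'y, 'e, 'h) two_functor \<Rightarrow> ('o, 'a, 'c, 'x, 'b, 'd) lax_nat \<Rightarrow>
   ('o, 'a, 'c, 'y, 'e, 'h) lax_nat" where
  "lax_nat_post A P \<alpha> =
     \<lparr> ln_dom = two_functor_comp A (ln_dom \<alpha>) P, ln_cod = two_functor_comp A (ln_cod \<alpha>) P,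
       ln_obj = (\<lambda>x \<in> Obj (under A). tf_arr P (ln_obj \<alpha> x)),
       ln_arr = (\<lambda>f \<in> Arr (under A). tf_cell P (ln_arr \<alpha> f)) \<rparr>"

definition modif_post ::
  "('o, 'a, 'c) two_cat \<Rightarrow> ('x, 'b, 'd, 'y, 'e, 'h) two_functor \<Rightarrow> ('o, 'a, 'c, 'x, 'b, 'd) modif \<Rightarrow>
   ('o, 'a, 'c, 'y, 'e, 'h) modif" where
  "modif_post A P \<mu> =
     \<lparr> mf_dom = lax_nat_post A P (mf_dom \<mu>), mf_cod = lax_nat_post A P (mf_cod \<mu>),
       mf_obj = (\<lambda>x \<in> Obj (under A). tf_cell P (mf_obj \<mu> x)) \<rparr>"

lemma two_functor_comp_simps [simp]:
  "x \<in> Obj (under A) \<Longrightarrow> tf_obj (two_functor_comp A F G) x = tf_obj G (tf_obj F x)"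
  "f \<in> Arr (under A) \<Longrightarrow> tf_arr (two_functor_comp A F G) f = tf_arr G (tf_arr F f)"
  "\<sigma> \<in> Cells A \<Longrightarrow> tf_cell (two_functor_comp A F G) \<sigma> = tf_cell G (tf_cell F \<sigma>)"
  by (simp_all add: two_functor_comp_def)

lemma lax_nat_post_simps [simp]:
  "ln_dom (lax_nat_post A P \<alpha>) = two_functor_comp A (ln_dom \<alpha>) P"
  "ln_cod (lax_nat_post A P \<alpha>) = two_functor_comp A (ln_cod \<alpha>) P"
  "x \<in> Obj (under A) \<Longrightarrow> ln_obj (lax_nat_post A P \<alpha>) x = tf_arr P (ln_obj \<alpha> x)"
  "f \<in> Arr (under A) \<Longrightarrow> ln_arr (lax_nat_post A P \<alpha>) f = tf_cell P (ln_arr \<alpha> f)"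
  by (simp_all add: lax_nat_post_def)

lemma modif_post_simps [simp]:
  "mf_dom (modif_post A P \<mu>) = lax_nat_post A P (mf_dom \<mu>)"
  "mf_cod (modif_post A P \<mu>) = lax_nat_post A P (mf_cod \<mu>)"
  "x \<in> Obj (under A) \<Longrightarrow> mf_obj (modif_post A P \<mu>) x = tf_cell P (mf_obj \<mu> x)"
  by (simp_all add: modif_post_def)

context two_categories
begin

lemma is_lax_nat_post:
  assumes P: "is_two_functor B B' P" and \<alpha>: "is_lax_nat A B \<alpha>"
  shows "is_lax_nat A B' (lax_nat_post A P \<alpha>)"
proof -
  note [simp] = lax_nat_rules[OF \<alpha>] two_functor_rules[OF P]
  have tf: "is_two_functor A B' (two_functor_comp A F P)" if "is_two_functor A B F" for F
    using two_functor_comp_is_two_functor[OF A.two_category_axioms that P] .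
  have "VComp B' (HComp B' (VId B' (tf_arr P (ln_obj \<alpha> (A.dom (Src A \<sigma>)))))
    (tf_cell P (tf_cell (ln_cod \<alpha>) \<sigma>)))
      (tf_cell P (ln_arr \<alpha> (Trg A \<sigma>))) =
    VComp B' (tf_cell P (ln_arr \<alpha> (Src A \<sigma>)))
      (HComp B' (tf_cell P (tf_cell (ln_dom \<alpha>) \<sigma>))
        (VId B' (tf_arr P (ln_obj \<alpha> (A.cod (Src A \<sigma>))))))"
    if "\<sigma> \<in> Cells A" for \<sigma>
    using lax_nat_natural[OF \<alpha> that, THEN arg_cong, of "tf_cell P"] that by simp
  then show ?thesis
    by (simp add: is_lax_nat_def Let_def two_cell_def lax_nat_comp_arr[OF \<alpha>] tf)
      (simp add: lax_nat_post_def)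
qed

lemma is_modif_post:
  assumes P: "is_two_functor B B' P" and \<mu>: "is_modif A B \<mu>"
  shows "is_modif A B' (modif_post A P \<mu>)"
proof -
  note [simp] = modif_rules[OF \<mu>] two_functor_rules[OF P]
  have "VComp B' (tf_cell P (ln_arr (mf_dom \<mu>) f))
      (HComp B' (VId B' (tf_arr P (tf_arr (ln_dom (mf_dom \<mu>)) f)))
        (tf_cell P (mf_obj \<mu> (A.cod f)))) =
    VComp B' (HComp B' (tf_cell P (mf_obj \<mu> (A.dom f)))
      (VId B' (tf_arr P (tf_arr (ln_cod (mf_dom \<mu>)) f))))
      (tf_cell P (ln_arr (mf_cod \<mu>) f))"
    if "f \<in> Arr (under A)" for f
    using modif_natural[OF \<mu> that, THEN arg_cong, of "tf_cell P"] that by simp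
  then show ?thesis
    by (simp add: is_modif_def Let_def two_cell_def is_lax_nat_post[OF P])
      (simp add: modif_post_def)
qed

lemma post_inverse:
  assumes P: "is_two_functor B B' P" and Q: "is_two_functor B' B Q"
    and PQ: "two_functor_comp B P Q = two_functor_id B"
  shows "is_two_functor A B F \<Longrightarrow> two_functor_comp A (two_functor_comp A F P) Q = F"
    and "is_lax_nat A B \<alpha> \<Longrightarrow> lax_nat_post A Q (lax_nat_post A P \<alpha>) = \<alpha>"
    and "is_modif A B \<mu> \<Longrightarrow> modif_post A Q (modif_post A P \<mu>) = \<mu>"
proof -
  have [simp]: "f \<in> Arr (under B) \<Longrightarrow> tf_arr Q (tf_arr P f) = f"
      "\<sigma> \<in> Cells B \<Longrightarrow> tf_cell Q (tf_cell P \<sigma>) = \<sigma>" for f \<sigma>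
    using PQ[THEN arg_cong, of "\<lambda>F. tf_arr F f"] PQ[THEN arg_cong, of "\<lambda>F. tf_cell F \<sigma>"]
    by (simp_all add: two_functor_id_def)
  show tf: "two_functor_comp A (two_functor_comp A F P) Q = F" if "is_two_functor A B F" for F
    using that by (simp add: two_functor_comp_assoc PQ two_functor_comp_id)
  show ln: "lax_nat_post A Q (lax_nat_post A P \<alpha>) = \<alpha>" if \<alpha>: "is_lax_nat A B \<alpha>" for \<alpha>
  proof -
    note [simp] = lax_nat_rules[OF \<alpha>]
    have "is_lax_nat A B (lax_nat_post A Q (lax_nat_post A P \<alpha>))"
      using two_functor_comp_is_two_functor[OF B.two_category_axioms P Q] PQ
        is_lax_nat_post[OF two_functor_comp_is_two_functor[OF B.two_category_axioms P Q] \<alpha>]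
      by (simp add: lax_nat_post_def tf two_functor_comp_id cong: restrict_cong) 
        (simp add: two_functor_id_def cong: restrict_cong)
    then show ?thesis by (rule lax_nat_eqI) (simp_all add: tf)
  qed
  show "modif_post A Q (modif_post A P \<mu>) = \<mu>" if \<mu>: "is_modif A B \<mu>"
  proof -
    note [simp] = modif_rules[OF \<mu>]
    show ?thesis using \<mu> modif_extensional[OF \<mu>]
      by (intro modif.equality extensionalityI[of _ "Obj (under A)"])
        (simp_all add: ln modif_post_def)
  qed
qed

end

lemma TwoCat_lax_isomorphic:
  assumes A: "two_category A" and iso: "isomorphic_two_cats B B'"
  shows "isomorphic_two_cats (TwoCat_lax A B) (TwoCat_lax A B')"
proof -
  obtain P Q where B: "two_category B" and B': "two_category B'"
    and P: "is_two_functor B B' P" and Q: "is_two_functor B' B Q"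
    and PQ: "two_functor_comp B P Q = two_functor_id B" and QP:
      "two_functor_comp B' Q P = two_functor_id B'"
    using iso unfolding isomorphic_two_cats_def by blast
  interpret AB: two_categories A B using A B by (rule two_categories.intro)
  interpret AB': two_categories A B' using A B' by (rule two_categories.intro)
  have inv [simp]: "x \<in> Obj (under B) \<Longrightarrow> tf_obj Q (tf_obj P x) = x"
     "f \<in> Arr (under B) \<Longrightarrow> tf_arr Q (tf_arr P f) = f"
      "\<sigma> \<in> Cells B \<Longrightarrow> tf_cell Q (tf_cell P \<sigma>) = \<sigma>" for x f \<sigma>
    using PQ[THEN arg_cong, of "\<lambda>F. tf_obj F x"] PQ[THEN arg_cong, of "\<lambda>F. tf_arr F f"]
      PQ[THEN arg_cong, of "\<lambda>F. tf_cell F \<sigma>"]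
    by (simp_all add: two_functor_id_def)
  note [simp] = two_functor_rules[OF P] two_functor_rules[OF Q]
  note post = AB.post_inverse[OF P Q PQ] AB'.post_inverse[OF Q P QP] 
    AB.is_lax_nat_post[OF P] AB'.is_lax_nat_post[OF Q] AB.is_modif_post[OF P]
      AB'.is_modif_post[OF Q]
    two_functor_comp_is_two_functor[OF A _ P] two_functor_comp_is_two_functor[OF A _ Q]
  have comp: "lax_nat_comp A B \<alpha> \<beta> =
      lax_nat_post A Q (lax_nat_comp A B' (lax_nat_post A P \<alpha>) (lax_nat_post A P \<beta>))"
    if \<alpha>: "is_lax_nat A B \<alpha>" and \<beta>: "is_lax_nat A B \<beta>" and eq: "ln_cod \<alpha> = ln_dom \<beta>" for \<alpha> \<beta>
  proof -
    note [simp] = lax_nat_rules[OF \<alpha>] lax_nat_rules[OF \<beta>] eq[symmetric]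
    show ?thesis by (intro AB.lax_nat_eqI) (simp_all add: post)
  qed
  interpret two_cat_transport "TwoCat_lax A B" "TwoCat_lax A B'"
    "\<lambda>F. two_functor_comp A F P" "lax_nat_post A P" "modif_post A P"
    "\<lambda>F. two_functor_comp A F Q" "lax_nat_post A Q" "modif_post A Q"
  proof (intro two_cat_transport.intro, goal_cases)
    case 1 show ?case by (rule AB'.two_category_TwoCat_lax)
  next
    case (22 F)
    then have F: "is_two_functor A B F" by simp
    note [simp] = two_functor_rules[OF F]
    show ?case using F
      by (intro AB.lax_nat_eqI) (simp_all add: post)
  next
    case (23 \<alpha> \<beta>) then show ?case by (simp add: comp)
  next
    case (24 \<alpha>)
    then have \<alpha>: "is_lax_nat A B \<alpha>" by simp
    note [simp] = lax_nat_rules[OF \<alpha>]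
    show ?case
      by (intro AB.modif_eqI) (simp_all add: post)
  next
    case (25 \<mu> \<nu>)
    then have M: "is_modif A B \<mu>" "is_modif A B \<nu>" and eq: "mf_cod \<mu> = mf_dom \<nu>" by simp_all
    note [simp] = modif_rules[OF M(1)] modif_rules[OF M(2)] eq[symmetric]
    show ?case
      by (intro AB.modif_eqI) (simp_all add: post)
  next
    case (26 \<mu> \<nu>)
    then have M: "is_modif A B \<mu>" "is_modif A B \<nu>" and eq: "ln_cod (mf_dom \<mu>) = ln_dom (mf_dom \<nu>)"
      by simp_all
    note [simp] = modif_rules[OF M(1)] modif_rules[OF M(2)] eq[symmetric]
    show ?case
      by (intro AB.modif_eqI) (simp_all add: post comp)
  qed (auto simp: post dest: lax_nat_functors modif_simps)
  show ?thesis by (rule isomorphic)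
qed

section \<open>Double categories\<close>

lemma (in category) iso_cancel_left:
  assumes "is_iso C f" "g \<in> Arr C" "h \<in> Arr C" "Dom C g = Cod C f" "Dom C h = Cod C f"
    "f \<cdot> g = f \<cdot> h"
  shows "g = h"
proof -
  obtain k where k: "is_inverse C f k" using assms(1) unfolding is_iso_def ..
  have "k \<cdot> f \<cdot> g = k \<cdot> f \<cdot> h"
    using k assms by (subst (1 2) comp_assoc') (simp_all add: is_inverse_def)
  then show ?thesis using k assms by (simp add: is_inverse_def)
qed

lemma (in category) iso_cancel_right:
  assumes "is_iso C f" "g \<in> Arr C" "h \<in> Arr C" "Cod C g = Dom C f" "Cod C h = Dom C f"
    "g \<cdot> f = h \<cdot> f"
  shows "g = h"
proof -
  obtain k where k: "is_inverse C f k" using assms(1) unfolding is_iso_def ..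
  have "g \<cdot> f \<cdot> k = h \<cdot> f \<cdot> k"
    by (simp only: assms(6))
  then show ?thesis using k assms(2-5) by (simp add: is_inverse_def)
qed

sublocale double_category \<subseteq> D0: category "D0 D" by (rule D0_category)
sublocale double_category \<subseteq> D1: category "D1 D" by (rule D1_category)

context double_category
begin

lemma proarrow_simps [simp]:
  assumes "m \<in> Obj (D1 D)" shows "psrc D m \<in> Obj (D0 D)" "ptgt D m \<in> Obj (D0 D)"
    "csrc D (cell_id D m) = Ide (D0 D) (psrc D m)" "ctgt D (cell_id D m) = Ide (D0 D) (ptgt D m)"
  using assms src_functor tgt_functor by (simp_all add: cat_functor_def)

lemma cell_simps [simp]:
  assumes "\<alpha> \<in> Arr (D1 D)" shows "csrc D \<alpha> \<in> Arr (D0 D)" "ctgt D \<alpha> \<in> Arr (D0 D)"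
    "Dom (D0 D) (csrc D \<alpha>) = psrc D (Dom (D1 D) \<alpha>)" "Cod (D0 D) (csrc D \<alpha>) = psrc D (Cod (D1 D) \<alpha>)"
    "Dom (D0 D) (ctgt D \<alpha>) = ptgt D (Dom (D1 D) \<alpha>)" "Cod (D0 D) (ctgt D \<alpha>) = ptgt D (Cod (D1 D) \<alpha>)"
  using assms src_functor tgt_functor by (simp_all add: cat_functor_def)

lemma cell_comp_simps [simp]:
  assumes "\<alpha> \<in> Arr (D1 D)" "\<beta> \<in> Arr (D1 D)" "Cod (D1 D) \<alpha> = Dom (D1 D) \<beta>"
  shows "csrc D (\<alpha> \<bullet> \<beta>) = csrc D \<alpha> \<cdot>\<^bsub>D0 D\<^esub> csrc D \<beta>" "ctgt D (\<alpha> \<bullet> \<beta>) = ctgt D \<alpha> \<cdot>\<^bsub>D0 D\<^esub> ctgt D \<beta>"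
  using assms src_functor tgt_functor by (simp_all add: cat_functor_def)

lemma pid_simps [simp]:
  assumes "x \<in> Obj (D0 D)" shows "pid D x \<in> Obj (D1 D)" "psrc D (pid D x) = x"
    "ptgt D (pid D x) = x"
    "cid D (Ide (D0 D) x) = cell_id D (pid D x)"
  using assms id_functor src_tgt_pid by (simp_all add: cat_functor_def)

lemma cid_simps [simp]:
  assumes "f \<in> Arr (D0 D)" shows "cid D f \<in> Arr (D1 D)" "csrc D (cid D f) = f"
    "ctgt D (cid D f) = f"
    "Dom (D1 D) (cid D f) = pid D (Dom (D0 D) f)" "Cod (D1 D) (cid D f) = pid D (Cod (D0 D) f)"
  using assms id_functor src_tgt_cid by (simp_all add: cat_functor_def)

lemma cid_comp [simp]:
  "f \<in> Arr (D0 D) \<Longrightarrow> g \<in> Arr (D0 D) \<Longrightarrow> Cod (D0 D) f = Dom (D0 D) g \<Longrightarrow>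
    cid D (f \<cdot>\<^bsub>D0 D\<^esub> g) = cid D f \<bullet> cid D g"
  using id_functor by (simp add: cat_functor_def)

lemma composable_pairs_simps [simp]:
  "Obj (composable_pairs D) = {(m, n). pcomposable D m n}"
  "Arr (composable_pairs D) = {(\<alpha>, \<beta>). ccomposable D \<alpha> \<beta>}"
  "Dom (composable_pairs D) = (\<lambda>(\<alpha>, \<beta>). (Dom (D1 D) \<alpha>, Dom (D1 D) \<beta>))"
  "Cod (composable_pairs D) = (\<lambda>(\<alpha>, \<beta>). (Cod (D1 D) \<alpha>, Cod (D1 D) \<beta>))"
  "Ide (composable_pairs D) = (\<lambda>(m, n). (cell_id D m, cell_id D n))"
  "Comp (composable_pairs D) = (\<lambda>(\<alpha>, \<beta>) (\<alpha>', \<beta>'). (\<alpha> \<bullet> \<alpha>', \<beta> \<bullet> \<beta>'))"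
  by (simp_all add: composable_pairs_def prod_cat_def)

lemma pcomp_simps [simp]:
  assumes "m \<in> Obj (D1 D)" "n \<in> Obj (D1 D)" "ptgt D m = psrc D n"
  shows "m \<odot> n \<in> Obj (D1 D)" "psrc D (m \<odot> n) = psrc D m" "ptgt D (m \<odot> n) = ptgt D n"
    "cell_id D m \<otimes> cell_id D n = cell_id D (m \<odot> n)"
  using assms comp_functor src_tgt_pcomp[of m n] by (simp_all add: cat_functor_def pcomposable_def)

lemma ccomp_simps [simp]:
  assumes "\<alpha> \<in> Arr (D1 D)" "\<beta> \<in> Arr (D1 D)" "ctgt D \<alpha> = csrc D \<beta>"
  shows "\<alpha> \<otimes> \<beta> \<in> Arr (D1 D)" "csrc D (\<alpha> \<otimes> \<beta>) = csrc D \<alpha>" "ctgt D (\<alpha> \<otimes> \<beta>) = ctgt D \<beta>"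
    "Dom (D1 D) (\<alpha> \<otimes> \<beta>) = Dom (D1 D) \<alpha> \<odot> Dom (D1 D) \<beta>"
    "Cod (D1 D) (\<alpha> \<otimes> \<beta>) = Cod (D1 D) \<alpha> \<odot> Cod (D1 D) \<beta>"
  using assms comp_functor src_tgt_ccomp[of \<alpha> \<beta>] by (simp_all add: cat_functor_def ccomposable_def)

lemma ccomp_interchange:
  assumes "\<alpha> \<in> Arr (D1 D)" "\<beta> \<in> Arr (D1 D)" "\<alpha>' \<in> Arr (D1 D)" "\<beta>' \<in> Arr (D1 D)"
    "ctgt D \<alpha> = csrc D \<beta>" "ctgt D \<alpha>' = csrc D \<beta>'"
    "Cod (D1 D) \<alpha> = Dom (D1 D) \<alpha>'" "Cod (D1 D) \<beta> = Dom (D1 D) \<beta>'"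
  shows "(\<alpha> \<otimes> \<beta>) \<bullet> (\<alpha>' \<otimes> \<beta>') = (\<alpha> \<bullet> \<alpha>') \<otimes> (\<beta> \<bullet> \<beta>')"
  using assms comp_functor by (simp add: cat_functor_def ccomposable_def)

lemma ccomp_interchange_assoc:
  assumes "\<alpha> \<in> Arr (D1 D)" "\<beta> \<in> Arr (D1 D)" "\<alpha>' \<in> Arr (D1 D)" "\<beta>' \<in> Arr (D1 D)" "\<gamma> \<in> Arr (D1 D)"
    "ctgt D \<alpha> = csrc D \<beta>" "ctgt D \<alpha>' = csrc D \<beta>'"
    "Cod (D1 D) \<alpha> = Dom (D1 D) \<alpha>'" "Cod (D1 D) \<beta> = Dom (D1 D) \<beta>'"
    "Dom (D1 D) \<gamma> = Cod (D1 D) \<alpha>' \<odot> Cod (D1 D) \<beta>'"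
  shows "(\<alpha> \<otimes> \<beta>) \<bullet> ((\<alpha>' \<otimes> \<beta>') \<bullet> \<gamma>) = ((\<alpha> \<bullet> \<alpha>') \<otimes> (\<beta> \<bullet> \<beta>')) \<bullet> \<gamma>"
  using assms by (simp flip: ccomp_interchange)

lemma lunit_simps [simp]:
  assumes "m \<in> Obj (D1 D)"
  shows "lunit D m \<in> Arr (D1 D)" "Dom (D1 D) (lunit D m) = pid D (psrc D m) \<odot> m"
    "Cod (D1 D) (lunit D m) = m"
    "csrc D (lunit D m) = Ide (D0 D) (psrc D m)" "ctgt D (lunit D m) = Ide (D0 D) (ptgt D m)"
    "is_iso (D1 D) (lunit D m)"
  using assms lunit_globular[of m "psrc D m" "ptgt D m"] lunit_iso
  by (simp_all add: globular_cell_def cell_over_def proarrow_def)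

lemma runit_simps [simp]:
  assumes "m \<in> Obj (D1 D)"
  shows "runit D m \<in> Arr (D1 D)" "Dom (D1 D) (runit D m) = m \<odot> pid D (ptgt D m)"
    "Cod (D1 D) (runit D m) = m"
    "csrc D (runit D m) = Ide (D0 D) (psrc D m)" "ctgt D (runit D m) = Ide (D0 D) (ptgt D m)"
    "is_iso (D1 D) (runit D m)"
  using assms runit_globular[of m "psrc D m" "ptgt D m"] runit_iso
  by (simp_all add: globular_cell_def cell_over_def proarrow_def)

lemma passoc_simps [simp]:
  assumes "m \<in> Obj (D1 D)" "n \<in> Obj (D1 D)" "p \<in> Obj (D1 D)" "ptgt D m = psrc D n"
    "ptgt D n = psrc D p"
  shows "passoc D m n p \<in> Arr (D1 D)" "Dom (D1 D) (passoc D m n p) = m \<odot> n \<odot> p"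
    "Cod (D1 D) (passoc D m n p) = m \<odot> (n \<odot> p)"
    "csrc D (passoc D m n p) = Ide (D0 D) (psrc D m)"
      "ctgt D (passoc D m n p) = Ide (D0 D) (ptgt D p)"
    "is_iso (D1 D) (passoc D m n p)"
  using assms passoc_globular[of m n p] passoc_iso[of m n p]
  by (simp_all add: globular_cell_def cell_over_def pcomposable_def)

lemma iso_inv_globular:
  assumes f: "f \<in> Arr (D1 D)" "is_iso (D1 D) f" and x: "x \<in> Obj (D0 D)" and y: "y \<in> Obj (D0 D)"
    and g: "csrc D f = Ide (D0 D) x" "ctgt D f = Ide (D0 D) y"
  shows "csrc D (inv_arr (D1 D) f) = Ide (D0 D) x" "ctgt D (inv_arr (D1 D) f) = Ide (D0 D) y"
proof -
  note i = D1.inv_arr_simps[OF f(2)]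
  have *: "psrc D (Dom (D1 D) f) = x" "ptgt D (Dom (D1 D) f) = y"
    "psrc D (Cod (D1 D) f) = x" "ptgt D (Cod (D1 D) f) = y"
    using cell_simps(3-6)[OF f(1)] g x y by simp_all
  have "csrc D f \<cdot>\<^bsub>D0 D\<^esub> csrc D (inv_arr (D1 D) f) = Ide (D0 D) x"
    using cell_comp_simps(1)[OF f(1) i(1)] i * D1.dom_cod_obj[OF f(1)] by simp
  then show "csrc D (inv_arr (D1 D) f) = Ide (D0 D) x" using g i * by simp
  have "ctgt D f \<cdot>\<^bsub>D0 D\<^esub> ctgt D (inv_arr (D1 D) f) = Ide (D0 D) y"
    using cell_comp_simps(2)[OF f(1) i(1)] i * D1.dom_cod_obj[OF f(1)] by simp
  then show "ctgt D (inv_arr (D1 D) f) = Ide (D0 D) y" using g i * by simp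
qed

lemma lunit_inv_simps [simp]:
  assumes "m \<in> Obj (D1 D)"
  shows "lunit_inv D m \<in> Arr (D1 D)" "Dom (D1 D) (lunit_inv D m) = m"
    "Cod (D1 D) (lunit_inv D m) = pid D (psrc D m) \<odot> m"
    "csrc D (lunit_inv D m) = Ide (D0 D) (psrc D m)"
      "ctgt D (lunit_inv D m) = Ide (D0 D) (ptgt D m)"
    "lunit_inv D m \<bullet> lunit D m = cell_id D m" 
    "lunit D m \<bullet> lunit_inv D m = cell_id D (pid D (psrc D m) \<odot> m)"
  using D1.inv_arr_simps[of "lunit D m"] iso_inv_globular[of "lunit D m" "psrc D m" "ptgt D m"]
    assms
  by (simp_all add: lunit_inv_def)

lemma runit_inv_simps [simp]:
  assumes "m \<in> Obj (D1 D)"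
  shows "runit_inv D m \<in> Arr (D1 D)" "Dom (D1 D) (runit_inv D m) = m"
    "Cod (D1 D) (runit_inv D m) = m \<odot> pid D (ptgt D m)"
    "csrc D (runit_inv D m) = Ide (D0 D) (psrc D m)"
      "ctgt D (runit_inv D m) = Ide (D0 D) (ptgt D m)"
    "runit_inv D m \<bullet> runit D m = cell_id D m" 
    "runit D m \<bullet> runit_inv D m = cell_id D (m \<odot> pid D (ptgt D m))"
  using D1.inv_arr_simps[of "runit D m"] iso_inv_globular[of "runit D m" "psrc D m" "ptgt D m"]
    assms
  by (simp_all add: runit_inv_def)

lemma unit_natural:
  assumes "\<alpha> \<in> Arr (D1 D)"
  shows "(cid D (csrc D \<alpha>) \<otimes> \<alpha>) \<bullet> lunit D (Cod (D1 D) \<alpha>) = lunit D (Dom (D1 D) \<alpha>) \<bullet> \<alpha>"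
    "(\<alpha> \<otimes> cid D (ctgt D \<alpha>)) \<bullet> runit D (Cod (D1 D) \<alpha>) = runit D (Dom (D1 D) \<alpha>) \<bullet> \<alpha>"
  using lunit_natural[of \<alpha>] runit_natural[of \<alpha>] assms by (auto simp: cell_over_def)

lemma unit_inv_natural:
  assumes [simp]: "\<alpha> \<in> Arr (D1 D)"
  shows "\<alpha> \<bullet> lunit_inv D (Cod (D1 D) \<alpha>) = lunit_inv D (Dom (D1 D) \<alpha>) \<bullet> (cid D (csrc D \<alpha>) \<otimes> \<alpha>)"
    (is "?l = ?r")
    "\<alpha> \<bullet> runit_inv D (Cod (D1 D) \<alpha>) = runit_inv D (Dom (D1 D) \<alpha>) \<bullet> (\<alpha> \<otimes> cid D (ctgt D \<alpha>))"
      (is "?l' = ?r'")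
proof -
  have "lunit D (Dom (D1 D) \<alpha>) \<bullet> ?l = lunit D (Dom (D1 D) \<alpha>) \<bullet> ?r"
    by (simp flip: D1.comp_assoc' unit_natural) simp
  then show "?l = ?r" by (rule D1.iso_cancel_left[rotated -1]) simp_all
  have "runit D (Dom (D1 D) \<alpha>) \<bullet> ?l' = runit D (Dom (D1 D) \<alpha>) \<bullet> ?r'"
    by (simp flip: D1.comp_assoc' unit_natural) simp
  then show "?l' = ?r'" by (rule D1.iso_cancel_left[rotated -1]) simp_all
qed

lemmas ccomp_fuse = ccomp_interchange ccomp_interchange_assoc

lemma passoc_natural':
  assumes "\<alpha> \<in> Arr (D1 D)" "\<beta> \<in> Arr (D1 D)" "\<gamma> \<in> Arr (D1 D)" "ctgt D \<alpha> = csrc D \<beta>"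
    "ctgt D \<beta> = csrc D \<gamma>"
    "Cod (D1 D) \<alpha> = m" "Cod (D1 D) \<beta> = n" "Cod (D1 D) \<gamma> = p"
  shows "(\<alpha> \<otimes> \<beta> \<otimes> \<gamma>) \<bullet> passoc D m n p =
      passoc D (Dom (D1 D) \<alpha>) (Dom (D1 D) \<beta>) (Dom (D1 D) \<gamma>) \<bullet> (\<alpha> \<otimes> (\<beta> \<otimes> \<gamma>))"
  using passoc_natural[of \<alpha> \<beta> \<gamma>] assms by (simp add: ccomposable_def)

lemma id_ccomp_cancel:
  assumes "\<alpha> \<in> Arr (D1 D)" "\<beta> \<in> Arr (D1 D)" "csrc D \<alpha> = Ide (D0 D) x" "csrc D \<beta> = Ide (D0 D) x"
    "x \<in> Obj (D0 D)" "Dom (D1 D) \<alpha> = Dom (D1 D) \<beta>" "Cod (D1 D) \<alpha> = Cod (D1 D) \<beta>"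
    "cell_id D (pid D x) \<otimes> \<alpha> = cell_id D (pid D x) \<otimes> \<beta>"
  shows "\<alpha> = \<beta>"
  using unit_natural(1)[of \<alpha>] unit_natural(1)[of \<beta>] assms
    D1.iso_cancel_left[of "lunit D (Dom (D1 D) \<beta>)" \<alpha> \<beta>] by simp

lemma ccomp_id_cancel:
  assumes "\<alpha> \<in> Arr (D1 D)" "\<beta> \<in> Arr (D1 D)" "ctgt D \<alpha> = Ide (D0 D) x" "ctgt D \<beta> = Ide (D0 D) x"
    "x \<in> Obj (D0 D)" "Dom (D1 D) \<alpha> = Dom (D1 D) \<beta>" "Cod (D1 D) \<alpha> = Cod (D1 D) \<beta>"
    "\<alpha> \<otimes> cell_id D (pid D x) = \<beta> \<otimes> cell_id D (pid D x)"
  shows "\<alpha> = \<beta>"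
  using unit_natural(2)[of \<alpha>] unit_natural(2)[of \<beta>] assms
    D1.iso_cancel_left[of "runit D (Dom (D1 D) \<beta>)" \<alpha> \<beta>] by simp

lemma triangle':
  assumes "m \<in> Obj (D1 D)" "n \<in> Obj (D1 D)" "ptgt D m = psrc D n"
  shows "passoc D m (pid D (psrc D n)) n \<bullet> (cell_id D m \<otimes> lunit D n) = runit D m \<otimes> cell_id D n"
  using triangle[of m n] assms by (simp add: pcomposable_def)

text \<open>Kelly's argument: the pentagon for \<open>id, id, m, n\<close>, after cancelling \<open>id \<odot> -\<close>.\<close>

lemma lunit_pcomp:
  assumes [simp]: "m \<in> Obj (D1 D)" "n \<in> Obj (D1 D)" "ptgt D m = psrc D n"
  shows "passoc D (pid D (psrc D m)) m n \<bullet> lunit D (m \<odot> n) = lunit D m \<otimes> cell_id D n"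
proof (rule id_ccomp_cancel)
  let ?x = "psrc D m" and ?i = "pid D (psrc D m)"
  let ?a = "passoc D ?i ?i m \<otimes> cell_id D n" and ?b = "passoc D ?i (?i \<odot> m) n"
  let ?f = "cell_id D ?i \<otimes> (passoc D ?i m n \<bullet> lunit D (m \<odot> n))"
  let ?g = "cell_id D ?i \<otimes> (lunit D m \<otimes> cell_id D n)"
  have iso: "is_iso (D1 D) ?a"
  proof -
    note i = D1.inv_arr_simps[of "passoc D ?i ?i m"]
    have "is_inverse (D1 D) ?a (inv_arr (D1 D) (passoc D ?i ?i m) \<otimes> cell_id D n)"
      using i iso_inv_globular[of "passoc D ?i ?i m" ?x "psrc D n"] 
      by (simp add: is_inverse_def ccomp_fuse)
    then show ?thesis unfolding is_iso_def ..
  qed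
  have "?a \<bullet> (?b \<bullet> ?f) = (?a \<bullet> ?b \<bullet> (cell_id D ?i \<otimes> passoc D ?i m n)) \<bullet>
    (cell_id D ?i \<otimes> lunit D (m \<odot> n))"
    by (simp add: ccomp_fuse)
  also have "\<dots> = passoc D (?i \<odot> ?i) m n \<bullet>
    (passoc D ?i ?i (m \<odot> n) \<bullet> (cell_id D ?i \<otimes> lunit D (m \<odot> n)))"
    by (subst pentagon) (simp_all add: pcomposable_def)
  also have "\<dots> = passoc D (?i \<odot> ?i) m n \<bullet> (runit D ?i \<otimes> cell_id D (m \<odot> n))"
    using triangle'[of ?i "m \<odot> n"] by simp
  also have "\<dots> = passoc D (?i \<odot> ?i) m n \<bullet> (runit D ?i \<otimes> (cell_id D m \<otimes> cell_id D n))"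
    by simp
  also have "\<dots> = (runit D ?i \<otimes> cell_id D m \<otimes> cell_id D n) \<bullet> passoc D ?i m n"
    using passoc_natural'[of "runit D ?i" "cell_id D m" "cell_id D n"] by simp
  also have "\<dots> = ((passoc D ?i ?i m \<bullet> (cell_id D ?i \<otimes> lunit D m)) \<otimes> cell_id D n) \<bullet> passoc D ?i m n"
    using triangle'[of ?i m] by simp
  also have "\<dots> = ?a \<bullet> (((cell_id D ?i \<otimes> lunit D m) \<otimes> cell_id D n) \<bullet> passoc D ?i m n)"
    by (simp add: ccomp_fuse)
  also have "\<dots> = ?a \<bullet> (?b \<bullet> ?g)"
    by (simp add: passoc_natural')
  finally show "?f = ?g"
    using D1.iso_cancel_left[OF iso, of "?b \<bullet> ?f" "?b \<bullet> ?g"] D1.iso_cancel_left[of ?b ?f ?g] by simp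
qed simp_all

lemma lunit_pid_eq_runit:
  assumes [simp]: "x \<in> Obj (D0 D)" shows "lunit D (pid D x) = runit D (pid D x)"
proof (rule ccomp_id_cancel)
  let ?i = "pid D x"
  have "lunit D (?i \<odot> ?i) = cell_id D ?i \<otimes> lunit D ?i"
    using unit_natural(1)[of "lunit D ?i"] D1.iso_cancel_right[of "lunit D ?i"] by simp
  then show "lunit D ?i \<otimes> cell_id D ?i = runit D ?i \<otimes> cell_id D ?i"
    using lunit_pcomp[of ?i ?i] triangle'[of ?i ?i] by simp
qed simp_all

section \<open>Cells into a category object\<close>

definition mul :: "('o, 'p, 'c) cat_object \<Rightarrow> 'c \<Rightarrow> 'c \<Rightarrow> 'c" where
  "mul Y \<alpha> \<beta> = (\<alpha> \<otimes> \<beta>) \<bullet> co_mult Y"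

definition lact :: "('o, 'p, 'c) cat_object \<Rightarrow> 'c \<Rightarrow> 'c \<Rightarrow> 'c" where
  "lact Y \<alpha> \<beta> = lunit_inv D (Dom (D1 D) \<beta>) \<bullet> mul Y \<alpha> \<beta>"

definition ract :: "('o, 'p, 'c) cat_object \<Rightarrow> 'c \<Rightarrow> 'c \<Rightarrow> 'c" where
  "ract Y \<alpha> \<beta> = runit_inv D (Dom (D1 D) \<alpha>) \<bullet> mul Y \<alpha> \<beta>"

definition into :: "('o, 'p, 'c) cat_object \<Rightarrow> 'c \<Rightarrow> bool" where
  "into Y \<alpha> \<longleftrightarrow> \<alpha> \<in> Arr (D1 D) \<and> Cod (D1 D) \<alpha> = co_pro Y"

lemma cat_object_rules:
  assumes "is_cat_object D Y"
  shows "is_cat_object D Y" "co_obj Y \<in> Obj (D0 D)" "co_pro Y \<in> Obj (D1 D)" 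
    "psrc D (co_pro Y) = co_obj Y" "ptgt D (co_pro Y) = co_obj Y"
    "co_mult Y \<in> Arr (D1 D)" "Dom (D1 D) (co_mult Y) = co_pro Y \<odot> co_pro Y"
      "Cod (D1 D) (co_mult Y) = co_pro Y"
    "csrc D (co_mult Y) = Ide (D0 D) (co_obj Y)" "ctgt D (co_mult Y) = Ide (D0 D) (co_obj Y)"
    "co_unit Y \<in> Arr (D1 D)" "Dom (D1 D) (co_unit Y) = pid D (co_obj Y)"
      "Cod (D1 D) (co_unit Y) = co_pro Y"
    "csrc D (co_unit Y) = Ide (D0 D) (co_obj Y)" "ctgt D (co_unit Y) = Ide (D0 D) (co_obj Y)"
    "(co_unit Y \<otimes> cell_id D (co_pro Y)) \<bullet> co_mult Y = lunit D (co_pro Y)"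
    "(cell_id D (co_pro Y) \<otimes> co_unit Y) \<bullet> co_mult Y = runit D (co_pro Y)"
    "into Y (co_unit Y)" "into Y (cell_id D (co_pro Y))" "into Y (co_mult Y)"
  using assms by (auto simp: is_cat_object_def Let_def globular_cell_def cell_over_def
    proarrow_def into_def)

lemma intoD:
  assumes "into Y \<alpha>" shows "\<alpha> \<in> Arr (D1 D)" "Cod (D1 D) \<alpha> = co_pro Y"
  using assms by (simp_all add: into_def)

lemma into_comp [simp]:
  assumes "\<gamma> \<in> Arr (D1 D)" "into Y \<alpha>" "Cod (D1 D) \<gamma> = Dom (D1 D) \<alpha>"
  shows "into Y (\<gamma> \<bullet> \<alpha>)"
  using assms intoD[OF assms(2)] by (simp add: into_def)

end

locale cat_object_in = double_category D for D :: "('o, 'a, 'p, 'c) dbl" (structure) +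
  fixes Y :: "('o, 'p, 'c) cat_object"
  assumes Y: "is_cat_object D Y"
begin

lemmas Y_rules [simp] = cat_object_rules[OF Y]
lemmas into_Y [simp] = intoD[of Y]

lemma mul_simps [simp]:
  assumes "into Y \<alpha>" "into Y \<beta>" "ctgt D \<alpha> = csrc D \<beta>"
  shows "into Y (mul Y \<alpha> \<beta>)" "Dom (D1 D) (mul Y \<alpha> \<beta>) = Dom (D1 D) \<alpha> \<odot> Dom (D1 D) \<beta>"
    "csrc D (mul Y \<alpha> \<beta>) = csrc D \<alpha>" "ctgt D (mul Y \<alpha> \<beta>) = ctgt D \<beta>"
  using assms by (simp_all add: mul_def into_def del: into_Y)

lemma lact_simps [simp]:
  assumes "into Y \<alpha>" "into Y \<beta>" "ctgt D \<alpha> = csrc D \<beta>" "Dom (D1 D) \<alpha> = pid D (psrc D (Dom (D1 D) \<beta>))"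
  shows "into Y (lact Y \<alpha> \<beta>)" "Dom (D1 D) (lact Y \<alpha> \<beta>) = Dom (D1 D) \<beta>"
    "csrc D (lact Y \<alpha> \<beta>) = csrc D \<alpha>" "ctgt D (lact Y \<alpha> \<beta>) = ctgt D \<beta>"
proof -
  note a = intoD[OF assms(1)] and b = intoD[OF assms(2)]
  note m = mul_simps[OF assms(1-3)]
  note c = cell_simps[OF a(1)] cell_simps[OF b(1)]
  show "into Y (lact Y \<alpha> \<beta>)" "Dom (D1 D) (lact Y \<alpha> \<beta>) = Dom (D1 D) \<beta>"
    "csrc D (lact Y \<alpha> \<beta>) = csrc D \<alpha>" "ctgt D (lact Y \<alpha> \<beta>) = ctgt D \<beta>"
    using assms(3,4) a b m(2-4) intoD[OF m(1)] c
    by (simp_all add: lact_def into_def del: into_Y mul_simps)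
qed

lemma ract_simps [simp]:
  assumes "into Y \<alpha>" "into Y \<beta>" "ctgt D \<alpha> = csrc D \<beta>" "Dom (D1 D) \<beta> = pid D (ptgt D (Dom (D1 D) \<alpha>))"
  shows "into Y (ract Y \<alpha> \<beta>)" "Dom (D1 D) (ract Y \<alpha> \<beta>) = Dom (D1 D) \<alpha>"
    "csrc D (ract Y \<alpha> \<beta>) = csrc D \<alpha>" "ctgt D (ract Y \<alpha> \<beta>) = ctgt D \<beta>"
proof -
  note a = intoD[OF assms(1)] and b = intoD[OF assms(2)]
  note m = mul_simps[OF assms(1-3)]
  note c = cell_simps[OF a(1)] cell_simps[OF b(1)]
  show "into Y (ract Y \<alpha> \<beta>)" "Dom (D1 D) (ract Y \<alpha> \<beta>) = Dom (D1 D) \<alpha>"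
    "csrc D (ract Y \<alpha> \<beta>) = csrc D \<alpha>" "ctgt D (ract Y \<alpha> \<beta>) = ctgt D \<beta>"
    using assms(3,4) a b m(2-4) intoD[OF m(1)] c
    by (simp_all add: ract_def into_def del: into_Y mul_simps)
qed

lemma mul_assoc:
  assumes [simp]: "into Y \<alpha>" "into Y \<beta>" "into Y \<gamma>" "ctgt D \<alpha> = csrc D \<beta>" "ctgt D \<beta> = csrc D \<gamma>"
  shows "mul Y (mul Y \<alpha> \<beta>) \<gamma> =
    passoc D (Dom (D1 D) \<alpha>) (Dom (D1 D) \<beta>) (Dom (D1 D) \<gamma>) \<bullet> mul Y \<alpha> (mul Y \<beta> \<gamma>)"
proof -
  let ?s = "co_pro Y"
  have d: "ptgt D (Dom (D1 D) \<alpha>) = psrc D (Dom (D1 D) \<beta>)"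
    "ptgt D (Dom (D1 D) \<beta>) = psrc D (Dom (D1 D) \<gamma>)"
    using assms cell_simps(3,5) by (metis intoD(1))+
  have "mul Y (mul Y \<alpha> \<beta>) \<gamma> = (\<alpha> \<otimes> \<beta> \<otimes> \<gamma>) \<bullet> ((co_mult Y \<otimes> cell_id D ?s) \<bullet> co_mult Y)"
    by (simp add: mul_def ccomp_fuse)
  also have "\<dots> = (\<alpha> \<otimes> \<beta> \<otimes> \<gamma>) \<bullet> (passoc D ?s ?s ?s \<bullet> (cell_id D ?s \<otimes> co_mult Y) \<bullet> co_mult Y)"
    using Y by (simp add: is_cat_object_def Let_def)
  also have "\<dots> = ((\<alpha> \<otimes> \<beta> \<otimes> \<gamma>) \<bullet> passoc D ?s ?s ?s) \<bullet> ((cell_id D ?s \<otimes> co_mult Y) \<bullet> co_mult Y)"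
    by simp
  also have "\<dots> = passoc D (Dom (D1 D) \<alpha>) (Dom (D1 D) \<beta>) (Dom (D1 D) \<gamma>) \<bullet>
      ((\<alpha> \<otimes> (\<beta> \<otimes> \<gamma>)) \<bullet> ((cell_id D ?s \<otimes> co_mult Y) \<bullet> co_mult Y))"
    by (subst passoc_natural') (simp_all add: d)
  also have "\<dots> = passoc D (Dom (D1 D) \<alpha>) (Dom (D1 D) \<beta>) (Dom (D1 D) \<gamma>) \<bullet> mul Y \<alpha> (mul Y \<beta> \<gamma>)"
    by (simp add: mul_def ccomp_fuse d)
  finally show ?thesis .
qed

lemma lunit_inv_pcomp:
  assumes [simp]: "m \<in> Obj (D1 D)" "n \<in> Obj (D1 D)" "ptgt D m = psrc D n"
  shows "(lunit_inv D m \<otimes> cell_id D n) \<bullet> passoc D (pid D (psrc D m)) m n = lunit_inv D (m \<odot> n)"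
    (is "?l = ?r")
proof -
  have "?l \<bullet> lunit D (m \<odot> n) = (lunit_inv D m \<otimes> cell_id D n) \<bullet> (lunit D m \<otimes> cell_id D n)"
    by (simp add: lunit_pcomp)
  also have "\<dots> = ?r \<bullet> lunit D (m \<odot> n)" by (simp add: ccomp_fuse)
  finally show ?thesis by (rule D1.iso_cancel_right[rotated -1]) simp_all
qed

lemma triangle_inv:
  assumes [simp]: "m \<in> Obj (D1 D)" "n \<in> Obj (D1 D)" "ptgt D m = psrc D n"
  shows "(runit_inv D m \<otimes> cell_id D n) \<bullet> passoc D m (pid D (psrc D n)) n =
    cell_id D m \<otimes> lunit_inv D n"
proof -
  let ?a = "passoc D m (pid D (psrc D n)) n"
  have "(runit_inv D m \<otimes> cell_id D n) \<bullet> ?a =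
      (runit_inv D m \<otimes> cell_id D n) \<bullet>
        (?a \<bullet> ((cell_id D m \<otimes> lunit D n) \<bullet> (cell_id D m \<otimes> lunit_inv D n)))"
    by (simp add: ccomp_fuse)
  also have "\<dots> = (runit_inv D m \<otimes> cell_id D n) \<bullet>
    ((?a \<bullet> (cell_id D m \<otimes> lunit D n)) \<bullet> (cell_id D m \<otimes> lunit_inv D n))"
    by simp
  also have "\<dots> = cell_id D m \<otimes> lunit_inv D n"
    unfolding triangle'[OF assms] by (simp add: ccomp_fuse)
  finally show ?thesis .
qed

lemma lunit_inv_pid: "x \<in> Obj (D0 D) \<Longrightarrow> lunit_inv D (pid D x) = runit_inv D (pid D x)"
  by (simp add: lunit_inv_def runit_inv_def lunit_pid_eq_runit)

end

context cat_object_in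
begin

lemma into_dom:
  assumes "into Y \<alpha>" "into Y \<beta>" "ctgt D \<alpha> = csrc D \<beta>"
  shows "ptgt D (Dom (D1 D) \<alpha>) = psrc D (Dom (D1 D) \<beta>)"
  using assms cell_simps(3,5) intoD(1) by metis

lemma precomp_mul:
  assumes [simp]: "\<gamma> \<in> Arr (D1 D)" "\<delta> \<in> Arr (D1 D)" "into Y \<alpha>" "into Y \<beta>"
    "Cod (D1 D) \<gamma> = Dom (D1 D) \<alpha>"
    "Cod (D1 D) \<delta> = Dom (D1 D) \<beta>" "ctgt D \<gamma> = csrc D \<delta>" "ctgt D \<alpha> = csrc D \<beta>"
  shows "(\<gamma> \<otimes> \<delta>) \<bullet> mul Y \<alpha> \<beta> = mul Y (\<gamma> \<bullet> \<alpha>) (\<delta> \<bullet> \<beta>)"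
  by (simp add: mul_def ccomp_fuse)

lemma precomp_lact:
  assumes [simp]: "\<gamma> \<in> Arr (D1 D)" "into Y \<alpha>" "into Y \<beta>" "Cod (D1 D) \<gamma> = Dom (D1 D) \<beta>"
    "Dom (D1 D) \<alpha> = pid D (psrc D (Dom (D1 D) \<beta>))" "ctgt D \<alpha> = csrc D \<beta>"
  shows "\<gamma> \<bullet> lact Y \<alpha> \<beta> = lact Y (cid D (csrc D \<gamma>) \<bullet> \<alpha>) (\<gamma> \<bullet> \<beta>)"
proof -
  have "\<gamma> \<bullet> lact Y \<alpha> \<beta> = (\<gamma> \<bullet> lunit_inv D (Cod (D1 D) \<gamma>)) \<bullet> mul Y \<alpha> \<beta>"
    by (simp add: lact_def)
  also have "\<dots> = lunit_inv D (Dom (D1 D) \<gamma>) \<bullet> ((cid D (csrc D \<gamma>) \<otimes> \<gamma>) \<bullet> mul Y \<alpha> \<beta>)"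
    by (subst unit_inv_natural) simp_all
  also have "\<dots> = lact Y (cid D (csrc D \<gamma>) \<bullet> \<alpha>) (\<gamma> \<bullet> \<beta>)"
    by (subst precomp_mul) (simp_all add: lact_def)
  finally show ?thesis .
qed

lemma precomp_ract:
  assumes [simp]: "\<gamma> \<in> Arr (D1 D)" "into Y \<alpha>" "into Y \<beta>" "Cod (D1 D) \<gamma> = Dom (D1 D) \<alpha>"
    "Dom (D1 D) \<beta> = pid D (ptgt D (Dom (D1 D) \<alpha>))" "ctgt D \<alpha> = csrc D \<beta>"
  shows "\<gamma> \<bullet> ract Y \<alpha> \<beta> = ract Y (\<gamma> \<bullet> \<alpha>) (cid D (ctgt D \<gamma>) \<bullet> \<beta>)"
proof -
  have "\<gamma> \<bullet> ract Y \<alpha> \<beta> = (\<gamma> \<bullet> runit_inv D (Cod (D1 D) \<gamma>)) \<bullet> mul Y \<alpha> \<beta>"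
    by (simp add: ract_def)
  also have "\<dots> = runit_inv D (Dom (D1 D) \<gamma>) \<bullet> ((\<gamma> \<otimes> cid D (ctgt D \<gamma>)) \<bullet> mul Y \<alpha> \<beta>)"
    by (subst unit_inv_natural) simp_all
  also have "\<dots> = ract Y (\<gamma> \<bullet> \<alpha>) (cid D (ctgt D \<gamma>) \<bullet> \<beta>)"
    by (subst precomp_mul) (simp_all add: ract_def)
  finally show ?thesis .
qed

lemma lact_mul:
  assumes [simp]: "into Y \<alpha>" "into Y \<beta>" "into Y \<gamma>" "ctgt D \<alpha> = csrc D \<beta>" "ctgt D \<beta> = csrc D \<gamma>"
    "Dom (D1 D) \<alpha> = pid D (psrc D (Dom (D1 D) \<beta>))"
  shows "lact Y \<alpha> (mul Y \<beta> \<gamma>) = mul Y (lact Y \<alpha> \<beta>) \<gamma>"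
proof -
  note [simp] = into_dom[OF assms(2,3,5)]
  have "mul Y (lact Y \<alpha> \<beta>) \<gamma> = (lunit_inv D (Dom (D1 D) \<beta>) \<otimes> cell_id D (Dom (D1 D) \<gamma>)) \<bullet>
    mul Y (mul Y \<alpha> \<beta>) \<gamma>"
    by (subst precomp_mul) (simp_all add: lact_def)
  also have "\<dots> = ((lunit_inv D (Dom (D1 D) \<beta>) \<otimes> cell_id D (Dom (D1 D) \<gamma>)) \<bullet>
      passoc D (Dom (D1 D) \<alpha>) (Dom (D1 D) \<beta>) (Dom (D1 D) \<gamma>)) \<bullet> mul Y \<alpha> (mul Y \<beta> \<gamma>)"
    by (simp add: mul_assoc)
  also have "\<dots> = lact Y \<alpha> (mul Y \<beta> \<gamma>)"
    by (simp add: lunit_inv_pcomp lact_def del: D1.comp_assoc')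
  finally show ?thesis ..
qed

lemma mul_ract:
  assumes [simp]: "into Y \<alpha>" "into Y \<beta>" "into Y \<gamma>" "ctgt D \<alpha> = csrc D \<beta>" "ctgt D \<beta> = csrc D \<gamma>"
    "ptgt D (Dom (D1 D) \<alpha>) = x" "Dom (D1 D) \<beta> = pid D x"
  shows "mul Y (ract Y \<alpha> \<beta>) \<gamma> = mul Y \<alpha> (lact Y \<beta> \<gamma>)"
proof -
  have [simp]: "x \<in> Obj (D0 D)" using assms(6) intoD(1)[OF assms(1)] by
    (metis D1.dom_cod_obj(1) proarrow_simps(2))
  note [simp] = into_dom[OF assms(2,3,5), simplified, symmetric]
  have "mul Y (ract Y \<alpha> \<beta>) \<gamma> = (runit_inv D (Dom (D1 D) \<alpha>) \<otimes> cell_id D (Dom (D1 D) \<gamma>)) \<bullet>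
    mul Y (mul Y \<alpha> \<beta>) \<gamma>"
    by (subst precomp_mul) (simp_all add: ract_def)
  also have "\<dots> = ((runit_inv D (Dom (D1 D) \<alpha>) \<otimes> cell_id D (Dom (D1 D) \<gamma>)) \<bullet>
      passoc D (Dom (D1 D) \<alpha>) (Dom (D1 D) \<beta>) (Dom (D1 D) \<gamma>)) \<bullet> mul Y \<alpha> (mul Y \<beta> \<gamma>)"
    by (simp add: mul_assoc)
  also have "\<dots> = (cell_id D (Dom (D1 D) \<alpha>) \<otimes> lunit_inv D (Dom (D1 D) \<gamma>)) \<bullet> mul Y \<alpha> (mul Y \<beta> \<gamma>)"
    using triangle_inv[of "Dom (D1 D) \<alpha>" "Dom (D1 D) \<gamma>"] by simp
  also have "\<dots> = mul Y \<alpha> (lact Y \<beta> \<gamma>)"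
    by (subst precomp_mul) (simp_all add: lact_def)
  finally show ?thesis .
qed

lemma lact_eq_ract:
  assumes "x \<in> Obj (D0 D)" "Dom (D1 D) \<alpha> = pid D x" "Dom (D1 D) \<beta> = pid D x"
  shows "ract Y \<alpha> \<beta> = lact Y \<alpha> \<beta>"
  using assms by (simp add: lact_def ract_def lunit_inv_pid)

lemma lact_lact:
  assumes [simp]: "into Y \<alpha>" "into Y \<beta>" "into Y \<gamma>" "ctgt D \<alpha> = csrc D \<beta>" "ctgt D \<beta> = csrc D \<gamma>"
    "psrc D (Dom (D1 D) \<gamma>) = x" "Dom (D1 D) \<alpha> = pid D x" "Dom (D1 D) \<beta> = pid D x"
  shows "lact Y (lact Y \<alpha> \<beta>) \<gamma> = lact Y \<alpha> (lact Y \<beta> \<gamma>)"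
proof -
  have x [simp]: "x \<in> Obj (D0 D)" using assms(6) intoD(1)[OF assms(3)] by
    (metis D1.dom_cod_obj(1) proarrow_simps(1))
  have "lact Y (ract Y \<alpha> \<beta>) \<gamma> = lact Y \<alpha> (lact Y \<beta> \<gamma>)"
    by (simp add: lact_def[of _ _ \<gamma>] mul_ract) (simp add: lact_def)
  then show ?thesis using lact_eq_ract[OF x] by simp
qed

lemma ract_ract:
  assumes [simp]: "into Y \<alpha>" "into Y \<beta>" "into Y \<gamma>" "ctgt D \<alpha> = csrc D \<beta>" "ctgt D \<beta> = csrc D \<gamma>"
    "ptgt D (Dom (D1 D) \<alpha>) = x" "Dom (D1 D) \<beta> = pid D x" "Dom (D1 D) \<gamma> = pid D x"
  shows "ract Y (ract Y \<alpha> \<beta>) \<gamma> = ract Y \<alpha> (lact Y \<beta> \<gamma>)"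
proof -
  have [simp]: "x \<in> Obj (D0 D)" using assms(6) intoD(1)[OF assms(1)] by
    (metis D1.dom_cod_obj(1) proarrow_simps(2))
  show ?thesis by (simp add: ract_def[of _ "ract Y \<alpha> \<beta>"] mul_ract) (simp add: ract_def)
qed

lemma ract_lact:
  assumes [simp]: "into Y \<alpha>" "into Y \<beta>" "into Y \<gamma>" "ctgt D \<alpha> = csrc D \<beta>" "ctgt D \<beta> = csrc D \<gamma>"
    "Dom (D1 D) \<alpha> = pid D (psrc D (Dom (D1 D) \<beta>))" "Dom (D1 D) \<gamma> = pid D (ptgt D (Dom (D1 D) \<beta>))"
  shows "ract Y (lact Y \<alpha> \<beta>) \<gamma> = lact Y \<alpha> (ract Y \<beta> \<gamma>)"
proof -
  have "lact Y \<alpha> (ract Y \<beta> \<gamma>) = runit_inv D (Dom (D1 D) \<beta>) \<bullet> lact Y \<alpha> (mul Y \<beta> \<gamma>)"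
    by (subst precomp_lact) (simp_all add: ract_def)
  then show ?thesis by (simp add: lact_mul) (simp add: ract_def)
qed

lemma lact_unit:
  assumes [simp]: "into Y \<beta>" "csrc D \<beta> = f"
  shows "lact Y (cid D f \<bullet> co_unit Y) \<beta> = \<beta>"
proof -
  have [simp]: "f \<in> Arr (D0 D)" "Dom (D0 D) f = psrc D (Dom (D1 D) \<beta>)" "Cod (D0 D) f = co_obj Y" 
    using cell_simps[OF intoD(1)[OF assms(1)]] intoD(2)[OF assms(1)] assms by simp_all
  have "mul Y (cid D f \<bullet> co_unit Y) \<beta> = (cid D f \<otimes> \<beta>) \<bullet>
    ((co_unit Y \<otimes> cell_id D (co_pro Y)) \<bullet> co_mult Y)"
    unfolding mul_def by (subst ccomp_interchange_assoc) simp_all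
  also have "\<dots> = lunit D (Dom (D1 D) \<beta>) \<bullet> \<beta>"
    using unit_natural(1)[of \<beta>] by simp
  finally show ?thesis by (simp add: lact_def flip: D1.comp_assoc')
qed

lemma ract_unit:
  assumes [simp]: "into Y \<alpha>" "ctgt D \<alpha> = f"
  shows "ract Y \<alpha> (cid D f \<bullet> co_unit Y) = \<alpha>"
proof -
  have [simp]: "f \<in> Arr (D0 D)" "Dom (D0 D) f = ptgt D (Dom (D1 D) \<alpha>)" "Cod (D0 D) f = co_obj Y" 
    using cell_simps[OF intoD(1)[OF assms(1)]] intoD(2)[OF assms(1)] assms by simp_all
  have "mul Y \<alpha> (cid D f \<bullet> co_unit Y) = (\<alpha> \<otimes> cid D f) \<bullet>
    ((cell_id D (co_pro Y) \<otimes> co_unit Y) \<bullet> co_mult Y)"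
    unfolding mul_def by (subst ccomp_interchange_assoc) simp_all
  also have "\<dots> = runit D (Dom (D1 D) \<alpha>) \<bullet> \<alpha>"
    using unit_natural(2)[of \<alpha>] by simp
  finally show ?thesis by (simp add: ract_def flip: D1.comp_assoc')
qed

end

section \<open>The 2-category of category objects\<close>

context double_category
begin

lemma cat_object_inI: "is_cat_object D Y \<Longrightarrow> cat_object_in D Y"
  by unfold_locales

lemma act_rules [simp]:
  assumes Y: "is_cat_object D Y" and i: "into Y \<alpha>" "into Y \<beta>" "ctgt D \<alpha> = csrc D \<beta>"
  shows "Dom (D1 D) \<alpha> = pid D (psrc D (Dom (D1 D) \<beta>)) \<Longrightarrow> into Y (lact Y \<alpha> \<beta>) \<and>
      lact Y \<alpha> \<beta> \<in> Arr (D1 D) \<and> Cod (D1 D) (lact Y \<alpha> \<beta>) = co_pro Y \<and> Dom (D1 D) (lact Y \<alpha> \<beta>) = Dom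
        (D1 D) \<beta> \<and>
      csrc D (lact Y \<alpha> \<beta>) = csrc D \<alpha> \<and> ctgt D (lact Y \<alpha> \<beta>) = ctgt D \<beta>"
    and "Dom (D1 D) \<beta> = pid D (ptgt D (Dom (D1 D) \<alpha>)) \<Longrightarrow> into Y (ract Y \<alpha> \<beta>) \<and>
      ract Y \<alpha> \<beta> \<in> Arr (D1 D) \<and> Cod (D1 D) (ract Y \<alpha> \<beta>) = co_pro Y \<and> Dom (D1 D) (ract Y \<alpha> \<beta>) = Dom
        (D1 D) \<alpha> \<and>
      csrc D (ract Y \<alpha> \<beta>) = csrc D \<alpha> \<and> ctgt D (ract Y \<alpha> \<beta>) = ctgt D \<beta>"
  using cat_object_in.lact_simps[OF cat_object_inI[OF Y] i]
    cat_object_in.ract_simps[OF cat_object_inI[OF Y] i]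
    intoD[of Y "lact Y \<alpha> \<beta>"] intoD[of Y "ract Y \<alpha> \<beta>"] by blast+

lemma cf_rules:
  assumes F: "is_cat_object_functor D F"
  shows "is_cat_object_functor D F"
    "cf_arr F \<in> Arr (D0 D)" "Dom (D0 D) (cf_arr F) = co_obj (cf_dom F)"
      "Cod (D0 D) (cf_arr F) = co_obj (cf_cod F)"
    "into (cf_cod F) (cf_cell F)"
    "cf_cell F \<in> Arr (D1 D)" "Dom (D1 D) (cf_cell F) = co_pro (cf_dom F)"
      "Cod (D1 D) (cf_cell F) = co_pro (cf_cod F)"
    "csrc D (cf_cell F) = cf_arr F" "ctgt D (cf_cell F) = cf_arr F"
    "co_unit (cf_dom F) \<bullet> cf_cell F = cid D (cf_arr F) \<bullet> co_unit (cf_cod F)"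
  using F by (simp_all add: is_cat_object_functor_def Let_def cell_over_def into_def)

lemma cf_cat_objects:
  assumes F: "is_cat_object_functor D F"
  shows "is_cat_object D (cf_dom F)" "is_cat_object D (cf_cod F)"
  using F by (simp_all add: is_cat_object_functor_def Let_def)

lemmas cat_object_functor_rules = cf_rules
  cat_object_rules[OF cf_cat_objects(1)] cat_object_rules[OF cf_cat_objects(2)]

lemma postcomp_mul:
  assumes F: "is_cat_object_functor D F" 
    and i: "into (cf_dom F) \<alpha>" "into (cf_dom F) \<beta>" "ctgt D \<alpha> = csrc D \<beta>"
  shows "mul (cf_dom F) \<alpha> \<beta> \<bullet> cf_cell F = mul (cf_cod F) (\<alpha> \<bullet> cf_cell F) (\<beta> \<bullet> cf_cell F)"
proof -
  note [simp] = cat_object_functor_rules[OF F] i intoD[OF i(1)] intoD[OF i(2)]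
  have "mul (cf_dom F) \<alpha> \<beta> \<bullet> cf_cell F = (\<alpha> \<otimes> \<beta>) \<bullet> ((cf_cell F \<otimes> cf_cell F) \<bullet> co_mult (cf_cod F))"
    using F by (simp add: mul_def is_cat_object_functor_def Let_def)
  then show ?thesis by (simp add: mul_def ccomp_fuse)
qed

lemma postcomp_act:
  assumes F: "is_cat_object_functor D F" 
    and i: "into (cf_dom F) \<alpha>" "into (cf_dom F) \<beta>" "ctgt D \<alpha> = csrc D \<beta>"
  shows "Dom (D1 D) \<alpha> = pid D (psrc D (Dom (D1 D) \<beta>)) \<Longrightarrow>
      lact (cf_dom F) \<alpha> \<beta> \<bullet> cf_cell F = lact (cf_cod F) (\<alpha> \<bullet> cf_cell F) (\<beta> \<bullet> cf_cell F)"
    and "Dom (D1 D) \<beta> = pid D (ptgt D (Dom (D1 D) \<alpha>)) \<Longrightarrow>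
      ract (cf_dom F) \<alpha> \<beta> \<bullet> cf_cell F = ract (cf_cod F) (\<alpha> \<bullet> cf_cell F) (\<beta> \<bullet> cf_cell F)"
proof -
  note [simp] = cat_object_functor_rules[OF F] i intoD[OF i(1)] intoD[OF i(2)]
  interpret X: cat_object_in D "cf_dom F" by (rule cat_object_inI) simp
  show "Dom (D1 D) \<alpha> = pid D (psrc D (Dom (D1 D) \<beta>)) \<Longrightarrow>
      lact (cf_dom F) \<alpha> \<beta> \<bullet> cf_cell F = lact (cf_cod F) (\<alpha> \<bullet> cf_cell F) (\<beta> \<bullet> cf_cell F)"
    using X.into_dom[OF i] by (simp add: lact_def postcomp_mul)
  show "Dom (D1 D) \<beta> = pid D (ptgt D (Dom (D1 D) \<alpha>)) \<Longrightarrow>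
      ract (cf_dom F) \<alpha> \<beta> \<bullet> cf_cell F = ract (cf_cod F) (\<alpha> \<bullet> cf_cell F) (\<beta> \<bullet> cf_cell F)"
    using X.into_dom[OF i] by (simp add: ract_def postcomp_mul)
qed

definition hat :: "('o, 'a, 'p, 'c) cat_object_trans \<Rightarrow> 'c" where
  "hat T = lact (cf_cod (ct_dom T)) (ct_cell T) (cf_cell (ct_cod T))"

lemma ct_rules:
  assumes T: "is_cat_object_trans D T"
  shows "is_cat_object_trans D T"
    "cf_dom (ct_cod T) = cf_dom (ct_dom T)" "cf_cod (ct_cod T) = cf_cod (ct_dom T)"
    "into (cf_cod (ct_dom T)) (ct_cell T)"
    "ct_cell T \<in> Arr (D1 D)" "Dom (D1 D) (ct_cell T) = pid D (co_obj (cf_dom (ct_dom T)))"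
    "Cod (D1 D) (ct_cell T) = co_pro (cf_cod (ct_dom T))"
    "csrc D (ct_cell T) = cf_arr (ct_dom T)" "ctgt D (ct_cell T) = cf_arr (ct_cod T)"
  using T by (simp_all add: is_cat_object_trans_def Let_def cell_over_def into_def)

lemma ct_functors:
  assumes T: "is_cat_object_trans D T"
  shows "is_cat_object_functor D (ct_dom T)" "is_cat_object_functor D (ct_cod T)"
  using T by (simp_all add: is_cat_object_trans_def Let_def)

lemma ct_cod_rules:
  assumes T: "is_cat_object_trans D T"
  shows "into (cf_cod (ct_dom T)) (cf_cell (ct_cod T))"
    "co_unit (cf_dom (ct_dom T)) \<bullet> cf_cell (ct_cod T) = cid D (cf_arr (ct_cod T)) \<bullet>
      co_unit (cf_cod (ct_dom T))"
  using cf_rules[OF ct_functors(2)[OF T]] ct_rules[OF T] by simp_all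

lemmas ct_functor_rules =
  ct_rules ct_cod_rules cat_object_functor_rules[OF ct_functors(1)]
    cat_object_functor_rules[OF ct_functors(2)]

lemma act_fold:
  assumes Y: "is_cat_object D Y" and i: "into Y \<alpha>" "into Y \<beta>" "ctgt D \<alpha> = csrc D \<beta>"
  shows "Dom (D1 D) \<alpha> = pid D (psrc D (Dom (D1 D) \<beta>)) \<Longrightarrow> Dom (D1 D) \<beta> = m \<Longrightarrow>
      lunit_inv D m \<bullet> ((\<alpha> \<otimes> \<beta>) \<bullet> co_mult Y) = lact Y \<alpha> \<beta>"
    and "Dom (D1 D) \<beta> = pid D (ptgt D (Dom (D1 D) \<alpha>)) \<Longrightarrow> Dom (D1 D) \<alpha> = m \<Longrightarrow>
      runit_inv D m \<bullet> ((\<alpha> \<otimes> \<beta>) \<bullet> co_mult Y) = ract Y \<alpha> \<beta>"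
proof -
  note [simp] = cat_object_rules[OF Y] intoD[OF i(1)] intoD[OF i(2)] i(3)
  show "Dom (D1 D) \<alpha> = pid D (psrc D (Dom (D1 D) \<beta>)) \<Longrightarrow> Dom (D1 D) \<beta> = m \<Longrightarrow>
      lunit_inv D m \<bullet> ((\<alpha> \<otimes> \<beta>) \<bullet> co_mult Y) = lact Y \<alpha> \<beta>"
    by (auto simp: lact_def mul_def)
  show "Dom (D1 D) \<beta> = pid D (ptgt D (Dom (D1 D) \<alpha>)) \<Longrightarrow> Dom (D1 D) \<alpha> = m \<Longrightarrow>
      runit_inv D m \<bullet> ((\<alpha> \<otimes> \<beta>) \<bullet> co_mult Y) = ract Y \<alpha> \<beta>"
    by (auto simp: ract_def mul_def)
qed

lemma is_cat_object_trans_iff: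
  assumes F: "is_cat_object_functor D (ct_dom T)" and G: "is_cat_object_functor D (ct_cod T)"
    and eq: "cf_dom (ct_cod T) = cf_dom (ct_dom T)" "cf_cod (ct_cod T) = cf_cod (ct_dom T)"
  shows "is_cat_object_trans D T \<longleftrightarrow>
    into (cf_cod (ct_dom T)) (ct_cell T) \<and> Dom (D1 D) (ct_cell T) = pid D
      (co_obj (cf_dom (ct_dom T))) \<and>
    csrc D (ct_cell T) = cf_arr (ct_dom T) \<and> ctgt D (ct_cell T) = cf_arr (ct_cod T) \<and>
    lact (cf_cod (ct_dom T)) (ct_cell T) (cf_cell (ct_cod T)) = ract (cf_cod (ct_dom T))
      (cf_cell (ct_dom T)) (ct_cell T)"
    (is "_ \<longleftrightarrow> ?t1 \<and> ?t2 \<and> ?t3 \<and> ?t4 \<and> ?r")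
proof -
  note [simp] = cat_object_functor_rules[OF F] cat_object_functor_rules[OF G, unfolded eq] eq
  have "?thesis" if t: "?t1" "?t2" "?t3" "?t4"
  proof -
    note [simp] = t intoD[OF t(1)]
    show ?thesis
      by (simp add: is_cat_object_trans_def Let_def cell_over_def act_fold)
  qed
  moreover have ?thesis if "\<not> (?t1 \<and> ?t2 \<and> ?t3 \<and> ?t4)"
    using that ct_rules(4,6,8,9) by blast
  ultimately show ?thesis by blast
qed

lemma hat_eq:
  assumes T: "is_cat_object_trans D T"
  shows "hat T = ract (cf_cod (ct_dom T)) (cf_cell (ct_dom T)) (ct_cell T)"
  using is_cat_object_trans_iff[of T] ct_functors[OF T] ct_rules[OF T] by (simp add: hat_def)

lemma hat_rules:
  assumes T: "is_cat_object_trans D T"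
  shows "into (cf_cod (ct_dom T)) (hat T)" "hat T \<in> Arr (D1 D)"
    "Dom (D1 D) (hat T) = co_pro (cf_dom (ct_dom T))"
      "Cod (D1 D) (hat T) = co_pro (cf_cod (ct_dom T))"
    "csrc D (hat T) = cf_arr (ct_dom T)" "ctgt D (hat T) = cf_arr (ct_cod T)"
proof -
  note [simp] = ct_functor_rules[OF T]
  show "into (cf_cod (ct_dom T)) (hat T)" "hat T \<in> Arr (D1 D)"
    "Dom (D1 D) (hat T) = co_pro (cf_dom (ct_dom T))"
      "Cod (D1 D) (hat T) = co_pro (cf_cod (ct_dom T))"
    "csrc D (hat T) = cf_arr (ct_dom T)" "ctgt D (hat T) = cf_arr (ct_cod T)"
    by (simp_all add: hat_def)
qed

lemma ct_into:
  assumes T: "is_cat_object_trans D T" and Y: "cf_cod (ct_dom T) = Y"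
  shows "into Y (ct_cell T)" "into Y (hat T)" "into Y (cf_cell (ct_dom T))"
    "into Y (cf_cell (ct_cod T))"
  using ct_functor_rules[OF T] hat_rules[OF T] Y by auto

lemmas cat_object_trans_rules = ct_functor_rules hat_rules ct_into

lemma unit_hat:
  assumes T: "is_cat_object_trans D T"
  shows "co_unit (cf_dom (ct_dom T)) \<bullet> hat T = ct_cell T"
proof -
  note [simp] = cat_object_trans_rules[OF T]
  interpret Y: cat_object_in D "cf_cod (ct_dom T)" by (rule cat_object_inI) simp
  have "co_unit (cf_dom (ct_dom T)) \<bullet> hat T =
    lact (cf_cod (ct_dom T)) (ct_cell T) (cid D (cf_arr (ct_cod T)) \<bullet> co_unit (cf_cod (ct_dom T)))"
    unfolding hat_def by (subst Y.precomp_lact) simp_all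
  also have "\<dots> = ct_cell T"
    by (subst Y.lact_eq_ract[symmetric, of "co_obj (cf_dom (ct_dom T))"])
      (simp_all add: Y.ract_unit)
  finally show ?thesis .
qed

context
  fixes S :: "('o, 'a, 'p, 'c) cat_object_trans"
  assumes S: "is_cat_object_trans D S"
begin

private lemmas S_rules [simp] = cat_object_trans_rules[OF S]

lemma precomp_hat_pid:
  assumes i: "into (cf_dom (ct_dom S)) \<alpha>" and x: "x \<in> Obj (D0 D)" "Dom (D1 D) \<alpha> = pid D x"
  shows "\<alpha> \<bullet> hat S = lact (cf_cod (ct_dom S)) (cid D (csrc D \<alpha>) \<bullet> ct_cell S)
    (\<alpha> \<bullet> cf_cell (ct_cod S))"
    "\<alpha> \<bullet> hat S = lact (cf_cod (ct_dom S)) (\<alpha> \<bullet> cf_cell (ct_dom S)) (cid D (ctgt D \<alpha>) \<bullet> ct_cell S)"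
proof -
  interpret Y: cat_object_in D "cf_cod (ct_dom S)" by (rule cat_object_inI) simp
  note [simp] = i intoD[OF i] x
  have c: "Cod (D0 D) (csrc D \<alpha>) = co_obj (cf_dom (ct_dom S))"
    "Cod (D0 D) (ctgt D \<alpha>) = co_obj (cf_dom (ct_dom S))"
    "Dom (D0 D) (csrc D \<alpha>) = x" "Dom (D0 D) (ctgt D \<alpha>) = x"
    using cell_simps(3-6)[of \<alpha>] by simp_all
  show "\<alpha> \<bullet> hat S = lact (cf_cod (ct_dom S)) (cid D (csrc D \<alpha>) \<bullet> ct_cell S)
    (\<alpha> \<bullet> cf_cell (ct_cod S))"
    unfolding hat_def by (subst Y.precomp_lact) simp_all
  show "\<alpha> \<bullet> hat S = lact (cf_cod (ct_dom S)) (\<alpha> \<bullet> cf_cell (ct_dom S))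
    (cid D (ctgt D \<alpha>) \<bullet> ct_cell S)"
    unfolding hat_eq[OF S] by (subst Y.precomp_ract; simp add: c Y.lact_eq_ract[of x])
qed

lemma lact_hat:
  assumes i: "into (cf_dom (ct_dom S)) \<alpha>" "into (cf_dom (ct_dom S)) \<beta>" "ctgt D \<alpha> = csrc D \<beta>"
    "Dom (D1 D) \<alpha> = pid D (psrc D (Dom (D1 D) \<beta>))"
  shows "lact (cf_dom (ct_dom S)) \<alpha> \<beta> \<bullet> hat S = 
      lact (cf_cod (ct_dom S)) (\<alpha> \<bullet> hat S) (\<beta> \<bullet> cf_cell (ct_cod S))" (is ?A)
    "lact (cf_dom (ct_dom S)) \<alpha> \<beta> \<bullet> hat S = 
      lact (cf_cod (ct_dom S)) (\<alpha> \<bullet> cf_cell (ct_dom S)) (\<beta> \<bullet> hat S)" (is ?B)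
proof -
  let ?X = "cf_dom (ct_dom S)" and ?Y = "cf_cod (ct_dom S)"
  let ?x = "psrc D (Dom (D1 D) \<beta>)"
  let ?F = "cf_cell (ct_dom S)" and ?G = "cf_cell (ct_cod S)"
  interpret Y: cat_object_in D ?Y by (rule cat_object_inI) simp
  note [simp] = i intoD[OF i(1)] intoD[OF i(2)]
  have c [simp]: "Cod (D0 D) (csrc D \<alpha>) = co_obj ?X" "Cod (D0 D) (ctgt D \<alpha>) = co_obj ?X"
    "Dom (D0 D) (csrc D \<alpha>) = ?x" "Dom (D0 D) (ctgt D \<alpha>) = ?x"
    using cell_simps(3-6)[of \<alpha>] i(4) by simp_all
  have G: "lact ?X \<alpha> \<beta> \<bullet> ?G = lact ?Y (\<alpha> \<bullet> ?G) (\<beta> \<bullet> ?G)"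
    using postcomp_act(1)[of "ct_cod S" \<alpha> \<beta>] by simp
  have "lact ?X \<alpha> \<beta> \<bullet> hat S = lact ?Y (cid D (csrc D \<alpha>) \<bullet> ct_cell S) (lact ?X \<alpha> \<beta> \<bullet> ?G)"
    by (subst hat_def, subst Y.precomp_lact) simp_all
  also have "\<dots> = lact ?Y (lact ?Y (cid D (csrc D \<alpha>) \<bullet> ct_cell S) (\<alpha> \<bullet> ?G)) (\<beta> \<bullet> ?G)"
    unfolding G by (rule Y.lact_lact[symmetric, where x = ?x]) simp_all
  also have "\<dots> = lact ?Y (\<alpha> \<bullet> hat S) (\<beta> \<bullet> ?G)"
    by (simp add: precomp_hat_pid(1)[of \<alpha> ?x])
  finally show ?A .
  also have "\<dots> = lact ?Y (lact ?Y (\<alpha> \<bullet> ?F) (cid D (ctgt D \<alpha>) \<bullet> ct_cell S)) (\<beta> \<bullet> ?G)"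
    by (simp add: precomp_hat_pid(2)[of \<alpha> ?x])
  also have "\<dots> = lact ?Y (\<alpha> \<bullet> ?F) (lact ?Y (cid D (ctgt D \<alpha>) \<bullet> ct_cell S) (\<beta> \<bullet> ?G))"
    by (rule Y.lact_lact[where x = ?x]) simp_all
  also have "lact ?Y (cid D (ctgt D \<alpha>) \<bullet> ct_cell S) (\<beta> \<bullet> ?G) = \<beta> \<bullet> hat S"
    by (subst hat_def, subst Y.precomp_lact) simp_all
  finally show ?B .
qed

lemma ract_hat:
  assumes i: "into (cf_dom (ct_dom S)) \<alpha>" "into (cf_dom (ct_dom S)) \<beta>" "ctgt D \<alpha> = csrc D \<beta>"
    "Dom (D1 D) \<beta> = pid D (ptgt D (Dom (D1 D) \<alpha>))"
  shows "ract (cf_dom (ct_dom S)) \<alpha> \<beta> \<bullet> hat S = 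
      ract (cf_cod (ct_dom S)) (\<alpha> \<bullet> cf_cell (ct_dom S)) (\<beta> \<bullet> hat S)"
proof -
  let ?X = "cf_dom (ct_dom S)" and ?Y = "cf_cod (ct_dom S)"
  let ?x = "ptgt D (Dom (D1 D) \<alpha>)"
  let ?F = "cf_cell (ct_dom S)"
  interpret Y: cat_object_in D ?Y by (rule cat_object_inI) simp
  note [simp] = i intoD[OF i(1)] intoD[OF i(2)]
  have c [simp]: "Cod (D0 D) (csrc D \<beta>) = co_obj ?X" "Cod (D0 D) (ctgt D \<beta>) = co_obj ?X"
    "Dom (D0 D) (csrc D \<beta>) = ?x" "Dom (D0 D) (ctgt D \<beta>) = ?x"
    using cell_simps(3-6)[of \<beta>] i(4) by simp_all
  have F: "ract ?X \<alpha> \<beta> \<bullet> ?F = ract ?Y (\<alpha> \<bullet> ?F) (\<beta> \<bullet> ?F)"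
    using postcomp_act(2)[of "ct_dom S" \<alpha> \<beta>] by simp
  have "ract ?X \<alpha> \<beta> \<bullet> hat S = ract ?Y (ract ?X \<alpha> \<beta> \<bullet> ?F) (cid D (ctgt D \<beta>) \<bullet> ct_cell S)"
    by (subst hat_eq[OF S], subst Y.precomp_ract) simp_all
  also have "\<dots> = ract ?Y (\<alpha> \<bullet> ?F) (lact ?Y (\<beta> \<bullet> ?F) (cid D (ctgt D \<beta>) \<bullet> ct_cell S))"
    unfolding F by (rule Y.ract_ract[where x = ?x]) simp_all
  also have "\<dots> = ract ?Y (\<alpha> \<bullet> ?F) (\<beta> \<bullet> hat S)"
    by (simp add: precomp_hat_pid(2)[of \<beta> ?x])
  finally show ?thesis .
qed

end

lemma CatObj_simps [simp]:
  "Obj (under (CatObj D)) = {X. is_cat_object D X}"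
  "Arr (under (CatObj D)) = {F. is_cat_object_functor D F}"
  "Dom (under (CatObj D)) = cf_dom" "Cod (under (CatObj D)) = cf_cod"
  "Comp (under (CatObj D)) = cat_object_functor_comp D"
  "cf_dom (Ide (under (CatObj D)) X) = X" "cf_cod (Ide (under (CatObj D)) X) = X"
  "cf_arr (Ide (under (CatObj D)) X) = Ide (D0 D) (co_obj X)"
  "cf_cell (Ide (under (CatObj D)) X) = cell_id D (co_pro X)"
  "Cells (CatObj D) = {T. is_cat_object_trans D T}" "Src (CatObj D) = ct_dom"
    "Trg (CatObj D) = ct_cod"
  "ct_dom (VId (CatObj D) F) = F" "ct_cod (VId (CatObj D) F) = F"
  "ct_cell (VId (CatObj D) F) = cid D (cf_arr F) \<bullet> co_unit (cf_cod F)"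
  "ct_dom (VComp (CatObj D) S T) = ct_dom S" "ct_cod (VComp (CatObj D) S T) = ct_cod T"
  "ct_dom (HComp (CatObj D) S T) = cat_object_functor_comp D (ct_dom S) (ct_dom T)"
  "ct_cod (HComp (CatObj D) S T) = cat_object_functor_comp D (ct_cod S) (ct_cod T)"
  by (simp_all add: CatObj_def)

lemma cat_object_functor_comp_simps [simp]:
  "cf_dom (cat_object_functor_comp D F G) = cf_dom F"
    "cf_cod (cat_object_functor_comp D F G) = cf_cod G"
  "cf_arr (cat_object_functor_comp D F G) = cf_arr F \<cdot>\<^bsub>D0 D\<^esub> cf_arr G"
  "cf_cell (cat_object_functor_comp D F G) = cf_cell F \<bullet> cf_cell G"
  by (simp_all add: cat_object_functor_comp_def)

lemma CatObj_VComp_cell: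
  assumes S: "is_cat_object_trans D S" and T: "is_cat_object_trans D T" and eq:
    "ct_cod S = ct_dom T"
  shows "ct_cell (VComp (CatObj D) S T) = lact (cf_cod (ct_dom S)) (ct_cell S) (ct_cell T)"
proof -
  note [simp] = cat_object_trans_rules[OF S] cat_object_trans_rules[OF T] eq[symmetric]
  show ?thesis by (simp add: CatObj_def act_fold)
qed

lemma CatObj_HComp_cell:
  assumes S: "is_cat_object_trans D S" and T: "is_cat_object_trans D T" and eq:
    "cf_cod (ct_dom S) = cf_dom (ct_dom T)"
  shows "ct_cell (HComp (CatObj D) S T) = ct_cell S \<bullet> hat T"
proof -
  note [simp] = cat_object_trans_rules[OF S] cat_object_trans_rules[OF T] eq[symmetric]
  show ?thesis by (simp add: CatObj_def act_fold hat_def)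
qed

lemma cat_object_functor_id [simp]:
  assumes X: "is_cat_object D X" shows "is_cat_object_functor D (Ide (under (CatObj D)) X)"
  using X cat_object_rules[OF X] by (simp add: is_cat_object_functor_def Let_def cell_over_def)

lemma is_cat_object_functor_comp [simp]:
  assumes F: "is_cat_object_functor D F" and G: "is_cat_object_functor D G" and eq:
    "cf_cod F = cf_dom G"
  shows "is_cat_object_functor D (cat_object_functor_comp D F G)"
proof -
  note [simp] = cat_object_functor_rules[OF F] cat_object_functor_rules[OF G] eq[symmetric]
  have "((cf_cell F \<bullet> cf_cell G) \<otimes> (cf_cell F \<bullet> cf_cell G)) \<bullet> co_mult (cf_cod G) = 
      (cf_cell F \<otimes> cf_cell F) \<bullet> ((cf_cell G \<otimes> cf_cell G) \<bullet> co_mult (cf_cod G))"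
    by (simp add: ccomp_fuse)
  also have "\<dots> = ((cf_cell F \<otimes> cf_cell F) \<bullet> co_mult (cf_cod F)) \<bullet> cf_cell G"
    using G by (simp add: is_cat_object_functor_def Let_def)
  also have "\<dots> = co_mult (cf_dom F) \<bullet> (cf_cell F \<bullet> cf_cell G)"
    using F by (simp add: is_cat_object_functor_def Let_def)
  finally have m: "((cf_cell F \<bullet> cf_cell G) \<otimes> (cf_cell F \<bullet> cf_cell G)) \<bullet> co_mult (cf_cod G) =
     co_mult (cf_dom F) \<bullet> (cf_cell F \<bullet> cf_cell G)" .
  have "co_unit (cf_dom F) \<bullet> (cf_cell F \<bullet> cf_cell G) = (co_unit (cf_dom F) \<bullet> cf_cell F) \<bullet> cf_cell G"
    by (subst D1.comp_assoc') simp_all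
  also have "\<dots> = cid D (cf_arr F) \<bullet> (cid D (cf_arr G) \<bullet> co_unit (cf_cod G))"
    using cf_rules(11)[OF G] by simp
  finally have "co_unit (cf_dom F) \<bullet> (cf_cell F \<bullet> cf_cell G) =
    cid D (cf_arr F) \<bullet> (cid D (cf_arr G) \<bullet> co_unit (cf_cod G))" .
  then show ?thesis using m
    by (simp add: is_cat_object_functor_def Let_def cell_over_def)
qed

lemma cat_object_trans_id:
  assumes F: "is_cat_object_functor D F"
  shows "is_cat_object_trans D (VId (CatObj D) F)" "hat (VId (CatObj D) F) = cf_cell F"
proof -
  note [simp] = cat_object_functor_rules[OF F]
  interpret Y: cat_object_in D "cf_cod F" by (rule cat_object_inI) simp
  show "is_cat_object_trans D (VId (CatObj D) F)"
    by (subst is_cat_object_trans_iff) (simp_all add: Y.lact_unit Y.ract_unit)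
  show "hat (VId (CatObj D) F) = cf_cell F"
    by (simp add: hat_def Y.lact_unit)
qed

lemma cat_object_trans_vcomp:
  assumes S: "is_cat_object_trans D S" and T: "is_cat_object_trans D T" and eq:
    "ct_cod S = ct_dom T"
  shows "is_cat_object_trans D (VComp (CatObj D) S T)"
    "hat (VComp (CatObj D) S T) = lact (cf_cod (ct_dom S)) (ct_cell S) (hat T)"
    "hat (VComp (CatObj D) S T) = ract (cf_cod (ct_dom S)) (hat S) (ct_cell T)"
proof -
  let ?Y = "cf_cod (ct_dom S)" and ?x = "co_obj (cf_dom (ct_dom S))"
  note [simp] = cat_object_trans_rules[OF S] cat_object_trans_rules[OF T] eq[symmetric]
    CatObj_VComp_cell[OF S T eq]
  interpret Y: cat_object_in D ?Y by (rule cat_object_inI) simp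
  have l: "lact ?Y (lact ?Y (ct_cell S) (ct_cell T)) (cf_cell (ct_cod T)) =
    lact ?Y (ct_cell S) (hat T)"
    by (subst Y.lact_lact[where x = ?x]) (simp_all add: hat_def)
  have m: "ract ?Y (hat S) (ct_cell T) = lact ?Y (ct_cell S) (hat T)"
    by (simp add: hat_eq[OF T], subst hat_def, subst Y.ract_lact) simp_all
  have r: "ract ?Y (cf_cell (ct_dom S)) (lact ?Y (ct_cell S) (ct_cell T)) =
    ract ?Y (hat S) (ct_cell T)"
    by (simp add: hat_eq[OF S], subst Y.ract_ract[where x = ?x]) simp_all
  show "is_cat_object_trans D (VComp (CatObj D) S T)"
    by (subst is_cat_object_trans_iff) (simp_all add: l m r)
  show h: "hat (VComp (CatObj D) S T) = lact ?Y (ct_cell S) (hat T)"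
    by (simp add: hat_def[of "VComp _ _ _"] l)
  show "hat (VComp (CatObj D) S T) = ract ?Y (hat S) (ct_cell T)"
    by (simp add: h m)
qed

lemma cat_object_trans_hcomp:
  assumes S: "is_cat_object_trans D S" and T: "is_cat_object_trans D T" and eq:
    "cf_cod (ct_dom S) = cf_dom (ct_dom T)"
  shows "is_cat_object_trans D (HComp (CatObj D) S T)"
    "hat (HComp (CatObj D) S T) = hat S \<bullet> hat T"
proof -
  let ?Y = "cf_cod (ct_dom T)" and ?x = "co_obj (cf_dom (ct_dom S))"
  note [simp] = cat_object_trans_rules[OF S] cat_object_trans_rules[OF T] eq[symmetric]
    CatObj_HComp_cell[OF S T eq]
  interpret Y: cat_object_in D ?Y by (rule cat_object_inI) simp
  have l: "lact ?Y (ct_cell S \<bullet> hat T) (cf_cell (ct_cod S) \<bullet> cf_cell (ct_cod T)) = hat S \<bullet> hat T"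
    using lact_hat(1)[OF T, of "ct_cell S" "cf_cell (ct_cod S)"] by (simp add: hat_def[of S])
  have r: "ract ?Y (cf_cell (ct_dom S) \<bullet> cf_cell (ct_dom T)) (ct_cell S \<bullet> hat T) = hat S \<bullet> hat T"
    using ract_hat[OF T, of "cf_cell (ct_dom S)" "ct_cell S"] by (simp add: hat_eq[OF S])
  show "is_cat_object_trans D (HComp (CatObj D) S T)"
    by (subst is_cat_object_trans_iff) (simp_all add: l r)
  show "hat (HComp (CatObj D) S T) = hat S \<bullet> hat T"
    by (simp add: hat_def[of "HComp _ _ _"] l)
qed

lemma cat_object_trans_eqI:
  assumes "is_cat_object_trans D S" "is_cat_object_trans D T" "ct_dom S = ct_dom T"
    "ct_cod S = ct_cod T"
    "hat S = hat T"
  shows "S = T"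
  using unit_hat[OF assms(1)] unit_hat[OF assms(2)] assms(3-)
  by (intro cat_object_trans.equality) simp_all

lemma cat_object_functor_eqI:
  "cf_dom F = cf_dom G \<Longrightarrow> cf_cod F = cf_cod G \<Longrightarrow> cf_arr F = cf_arr G \<Longrightarrow> cf_cell F = cf_cell G \<Longrightarrow> F =
    (G :: ('o, 'a, 'p, 'c) cat_object_functor)"
  by (intro cat_object_functor.equality) simp_all

lemma CatObj_interchange:
  assumes T: "is_cat_object_trans D T" "is_cat_object_trans D T'" and S: "is_cat_object_trans D S"
    "is_cat_object_trans D S'"
    and eq: "ct_cod T = ct_dom T'" "ct_cod S = ct_dom S'" "cf_cod (ct_dom T) = cf_dom (ct_dom S)"
  shows "HComp (CatObj D) (VComp (CatObj D) T T') (VComp (CatObj D) S S') =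
    VComp (CatObj D) (HComp (CatObj D) T S) (HComp (CatObj D) T' S')"
proof (rule cat_object_trans_eqI)
  note [simp] = cat_object_trans_rules[OF T(1)] cat_object_trans_rules[OF T(2)]
    cat_object_trans_rules[OF S(1)] cat_object_trans_rules[OF S(2)] eq[symmetric]
    cat_object_trans_vcomp(1)[OF T eq(1)] cat_object_trans_vcomp(1)[OF S eq(2)]
  have eq': "cf_cod (ct_dom T') = cf_dom (ct_dom S')" by simp
  note [simp] = cat_object_trans_hcomp(1)[OF T(1) S(1) eq(3)]
    cat_object_trans_hcomp(1)[OF T(2) S(2) eq']
  let ?Z = "cf_cod (ct_dom S)" and ?Y = "cf_cod (ct_dom T)" and ?x = "co_obj (cf_dom (ct_dom T))"
  interpret Z: cat_object_in D ?Z by (rule cat_object_inI) simp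
  let ?l = "HComp (CatObj D) (VComp (CatObj D) T T') (VComp (CatObj D) S S')"
  let ?r = "VComp (CatObj D) (HComp (CatObj D) T S) (HComp (CatObj D) T' S')"
  let ?t = "lact ?Y (ct_cell T) (hat T')" and ?K = "cf_cell (ct_cod S)"
  show "is_cat_object_trans D ?l" "is_cat_object_trans D ?r" "ct_dom ?l = ct_dom ?r"
    "ct_cod ?l = ct_cod ?r"
    by (simp_all add: cat_object_trans_hcomp(1) cat_object_trans_vcomp(1))
  have "hat ?l = ?t \<bullet> lact ?Z (ct_cell S) (hat S')"
    by (simp add: cat_object_trans_hcomp(2) cat_object_trans_vcomp(2) S T)
  also have "\<dots> = lact ?Z (cid D (cf_arr (ct_dom T)) \<bullet> ct_cell S) (?t \<bullet> hat S')"
    by (subst Z.precomp_lact) simp_all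
  also have "?t \<bullet> hat S' = lact ?Z (ct_cell T \<bullet> ?K) (hat T' \<bullet> hat S')"
    using lact_hat(2)[OF S(2), of "ct_cell T" "hat T'"] by simp
  also have "lact ?Z (cid D (cf_arr (ct_dom T)) \<bullet> ct_cell S) \<dots> =
      lact ?Z (lact ?Z (cid D (cf_arr (ct_dom T)) \<bullet> ct_cell S) (ct_cell T \<bullet> ?K)) (hat T' \<bullet> hat S')"
    by (rule Z.lact_lact[symmetric, where x = ?x]) simp_all
  also have "\<dots> = lact ?Z (ct_cell T \<bullet> hat S) (hat T' \<bullet> hat S')"
    using precomp_hat_pid(1)[OF S(1), of "ct_cell T" ?x] by simp
  also have "\<dots> = hat ?r"
    by (simp add: cat_object_trans_vcomp(2) CatObj_HComp_cell cat_object_trans_hcomp(2) eq' S T)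
  finally show "hat ?l = hat ?r" .
qed

theorem two_category_CatObj: "two_category (CatObj D)"
proof (intro two_category.intro)
  show "category (under (CatObj D))"
    by (intro category.intro)
      (auto simp: cat_object_functor_rules cf_cat_objects intro!: cat_object_functor_eqI
        D0.comp_assoc' D1.comp_assoc')
  show "category (vert_cat (CatObj D))"
  proof (intro category.intro)
    fix \<mu> assume "\<mu> \<in> Arr (vert_cat (CatObj D))"
    then have \<mu>: "is_cat_object_trans D \<mu>" by simp
    note [simp] = cat_object_trans_rules[OF \<mu>] cat_object_trans_id[OF ct_functors(1)[OF \<mu>]]
      cat_object_trans_id[OF ct_functors(2)[OF \<mu>]]
    interpret Y: cat_object_in D "cf_cod (ct_dom \<mu>)" by (rule cat_object_inI) simp
    show "Comp (vert_cat (CatObj D)) (Ide (vert_cat (CatObj D)) (Dom (vert_cat (CatObj D)) \<mu>)) \<mu> =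
      \<mu>"
      by (simp, rule cat_object_trans_eqI) (simp_all add: cat_object_trans_vcomp(1,2) Y.lact_unit)
    show "Comp (vert_cat (CatObj D)) \<mu> (Ide (vert_cat (CatObj D)) (Cod (vert_cat (CatObj D)) \<mu>)) =
      \<mu>"
      by (simp, rule cat_object_trans_eqI) (simp_all add: cat_object_trans_vcomp(1,3) Y.ract_unit)
  next
    fix S T R assume "composable (vert_cat (CatObj D)) S T" "composable (vert_cat (CatObj D)) T R"
    then have S: "is_cat_object_trans D S" and T: "is_cat_object_trans D T" and R:
      "is_cat_object_trans D R"
      and eq: "ct_cod S = ct_dom T" "ct_cod T = ct_dom R" by simp_all
    note [simp] = cat_object_trans_rules[OF S] cat_object_trans_rules[OF T]
      cat_object_trans_rules[OF R] eq[symmetric]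
      cat_object_trans_vcomp(1)[OF S T eq(1)] cat_object_trans_vcomp(1)[OF T R eq(2)]
    interpret Y: cat_object_in D "cf_cod (ct_dom S)" by (rule cat_object_inI) simp
    show "Comp (vert_cat (CatObj D)) (Comp (vert_cat (CatObj D)) S T) R =
       Comp (vert_cat (CatObj D)) S (Comp (vert_cat (CatObj D)) T R)"
      by (simp, rule cat_object_trans_eqI)
        (simp_all add: cat_object_trans_vcomp(1,2) CatObj_VComp_cell
          Y.lact_lact[where x = "co_obj (cf_dom (ct_dom S))"])
  qed (auto simp: cat_object_trans_id(1) cat_object_trans_vcomp(1) ct_functors)
  show "category (horiz_cat (CatObj D))"
  proof (intro category.intro)
    fix \<mu> assume "\<mu> \<in> Arr (horiz_cat (CatObj D))"
    then have \<mu>: "is_cat_object_trans D \<mu>" by simp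
    note [simp] = cat_object_trans_rules[OF \<mu>] 
    show "Comp (horiz_cat (CatObj D)) (Ide (horiz_cat (CatObj D)) (Dom (horiz_cat (CatObj D)) \<mu>))
      \<mu> = \<mu>"
      "Comp (horiz_cat (CatObj D)) \<mu> (Ide (horiz_cat (CatObj D)) (Cod (horiz_cat (CatObj D)) \<mu>)) =
        \<mu>"
      by (simp, rule cat_object_trans_eqI; simp add: cat_object_trans_id cat_object_trans_hcomp;
        rule cat_object_functor_eqI; simp)+
  next
    fix S T R assume "composable (horiz_cat (CatObj D)) S T" "composable (horiz_cat (CatObj D)) T R"
    then have S: "is_cat_object_trans D S" and T: "is_cat_object_trans D T" and R:
      "is_cat_object_trans D R"
      and eq: "cf_cod (ct_dom S) = cf_dom (ct_dom T)" "cf_cod (ct_dom T) = cf_dom (ct_dom R)" by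
        simp_all
    note [simp] = cat_object_trans_rules[OF S] cat_object_trans_rules[OF T]
      cat_object_trans_rules[OF R] eq[symmetric]
      cat_object_trans_hcomp(1)[OF S T eq(1)] cat_object_trans_hcomp(1)[OF T R eq(2)]
    show "Comp (horiz_cat (CatObj D)) (Comp (horiz_cat (CatObj D)) S T) R =
       Comp (horiz_cat (CatObj D)) S (Comp (horiz_cat (CatObj D)) T R)"
      by (simp, rule cat_object_trans_eqI; simp add: cat_object_trans_hcomp; rule
        cat_object_functor_eqI; simp)
  qed (auto simp: cat_object_trans_id(1) cat_object_trans_hcomp(1) ct_functors cf_cat_objects)
next
  fix F G assume "composable (under (CatObj D)) F G"
  then have F: "is_cat_object_functor D F" and G: "is_cat_object_functor D G" and eq:
    "cf_cod F = cf_dom G" by simp_all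
  note [simp] = cat_object_functor_rules[OF F] cat_object_functor_rules[OF G] eq[symmetric]
    cat_object_trans_id[OF F] cat_object_trans_id[OF G]
  show "HComp (CatObj D) (VId (CatObj D) F) (VId (CatObj D) G) =
    VId (CatObj D) (F \<cdot>\<^bsub>under (CatObj D)\<^esub> G)"
    by (simp, rule cat_object_trans_eqI) (simp_all add: cat_object_trans_id cat_object_trans_hcomp)
next
  fix \<sigma> \<sigma>' \<tau> \<tau>'
  assume "composable (vert_cat (CatObj D)) \<sigma> \<sigma>'" "composable (vert_cat (CatObj D)) \<tau> \<tau>'"
    "composable (horiz_cat (CatObj D)) \<sigma> \<tau>"
  then show "HComp (CatObj D) (VComp (CatObj D) \<sigma> \<sigma>') (VComp (CatObj D) \<tau> \<tau>') =
    VComp (CatObj D) (HComp (CatObj D) \<sigma> \<tau>) (HComp (CatObj D) \<sigma>' \<tau>')"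
    by (intro CatObj_interchange) simp_all
qed (simp_all add: ct_rules(2,3))

end

section \<open>Lax functors out of a vertical double category\<close>

lemma VerDbl_simps [simp]:
  "D0 (VerDbl A) = under A" "D1 (VerDbl A) = horiz_cat A" "psrc (VerDbl A) x = x"
    "ptgt (VerDbl A) x = x"
  "csrc (VerDbl A) = Src A" "ctgt (VerDbl A) = Trg A" "pid (VerDbl A) x = x"
    "cid (VerDbl A) = VId A"
  "pcomp (VerDbl A) x y = x" "ccomp (VerDbl A) = VComp A"
  "passoc (VerDbl A) x y z = VId A (Ide (under A) x)"
  "lunit (VerDbl A) x = VId A (Ide (under A) x)" "runit (VerDbl A) x = VId A (Ide (under A) x)"
  by (simp_all add: VerDbl_def)

lemma VerDbl_typing [simp]:
  "proarrow (VerDbl A) m x y \<longleftrightarrow> m \<in> Obj (under A) \<and> m = x \<and> m = y"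
  "pcomposable (VerDbl A) m n \<longleftrightarrow> m \<in> Obj (under A) \<and> m = n"
  "ccomposable (VerDbl A) \<sigma> \<tau> \<longleftrightarrow> \<sigma> \<in> Cells A \<and> \<tau> \<in> Cells A \<and> Trg A \<sigma> = Src A \<tau>"
  "cell_over (VerDbl A) \<sigma> m n f g \<longleftrightarrow> \<sigma> \<in> Cells A \<and> Dom (under A) (Src A \<sigma>) = m \<and>
    Cod (under A) (Src A \<sigma>) = n \<and> Src A \<sigma> = f \<and> Trg A \<sigma> = g"
  by (auto simp: proarrow_def pcomposable_def ccomposable_def cell_over_def)

lemma (in double_category) hcomp_id_cell:
  assumes F: "is_cat_object_functor D F" and T: "is_cat_object_trans D T"
  shows "cf_cod F = cf_dom (ct_dom T) \<Longrightarrow> ct_cell (HComp (CatObj D) (VId (CatObj D) F) T) =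
    cid D (cf_arr F) \<bullet> ct_cell T"
    and "cf_dom F = cf_cod (ct_dom T) \<Longrightarrow> ct_cell (HComp (CatObj D) T (VId (CatObj D) F)) =
      ct_cell T \<bullet> cf_cell F"
proof -
  note [simp] = cat_object_functor_rules[OF F] cat_object_trans_rules[OF T]
    cat_object_trans_id[OF F] T
  show "ct_cell (HComp (CatObj D) (VId (CatObj D) F) T) = cid D (cf_arr F) \<bullet> ct_cell T"
    if eq: "cf_cod F = cf_dom (ct_dom T)"
    using unit_hat[OF T] by (simp add: CatObj_HComp_cell eq)
  show "ct_cell (HComp (CatObj D) T (VId (CatObj D) F)) = ct_cell T \<bullet> cf_cell F"
    if eq: "cf_dom F = cf_cod (ct_dom T)"
    by (simp add: CatObj_HComp_cell eq)
qed

lemma (in double_category) mul_hat: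
  assumes S: "is_cat_object_trans D S" and T: "is_cat_object_trans D T" and eq:
    "ct_cod S = ct_dom T"
  shows "mul (cf_cod (ct_dom S)) (hat S) (hat T) = co_mult (cf_dom (ct_dom S)) \<bullet>
    hat (VComp (CatObj D) S T)"
proof -
  let ?X = "cf_dom (ct_dom S)" and ?Y = "cf_cod (ct_dom S)"
  let ?g = "cf_cell (ct_cod S)" and ?h = "cf_cell (ct_cod T)"
  note [simp] = cat_object_trans_rules[OF S] cat_object_trans_rules[OF T] eq[symmetric]
  interpret Y: cat_object_in D ?Y by (rule cat_object_inI) simp
  have h: "mul ?Y ?h ?h = co_mult ?X \<bullet> ?h"
    using ct_functors(2)[OF T] by (simp add: is_cat_object_functor_def Let_def mul_def)
  have "mul ?Y ?g (hat T) = mul ?Y (ract ?Y ?g (ct_cell T)) ?h"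
    by (subst Y.mul_ract[where x = "co_obj ?X"]) (simp_all add: hat_def[of T])
  also have "\<dots> = mul ?Y (hat T) ?h"
    using hat_eq[OF T] by simp
  also have "\<dots> = lact ?Y (ct_cell T) (co_mult ?X \<bullet> ?h)"
    by (simp add: hat_def[of T] h[symmetric] Y.lact_mul)
  finally have "mul ?Y (hat S) (hat T) =
    lact ?Y (ct_cell S) (lact ?Y (ct_cell T) (co_mult ?X \<bullet> ?h))"
    by (simp add: hat_def[of S] Y.lact_mul[symmetric])
  also have "\<dots> = lact ?Y (lact ?Y (ct_cell S) (ct_cell T)) (co_mult ?X \<bullet> ?h)"
    by (rule Y.lact_lact[symmetric, where x = "co_obj ?X"]) simp_all
  also have "\<dots> = co_mult ?X \<bullet> lact ?Y (lact ?Y (ct_cell S) (ct_cell T)) ?h"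
    by (subst Y.precomp_lact) simp_all
  finally show ?thesis by (simp add: hat_def[of "VComp _ _ _"] CatObj_VComp_cell[OF S T eq])
qed

locale ver_lax = A: two_category A + E: double_category E
  for A :: "('o, 'a, 'c) two_cat" and E :: "('x, 'b, 'q, 'd) dbl" (structure)

sublocale ver_lax \<subseteq> C: two_category "CatObj E" by (rule E.two_category_CatObj)
sublocale ver_lax \<subseteq> AC: two_categories A "CatObj E" by unfold_locales

definition lf_cat_object ::
  "('o, 'a, 'o, 'c, 'x, 'b, 'q, 'd) lax_functor \<Rightarrow> 'o \<Rightarrow> ('x, 'q, 'd) cat_object" where
  "lf_cat_object F x =
    \<lparr> co_obj = lf_obj F x, co_pro = lf_pro F x, co_mult = lf_laxator F x x, co_unit = lf_unitor F
    x \<rparr>"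

definition lf_cat_functor ::
  "('o, 'a, 'c) two_cat \<Rightarrow> ('o, 'a, 'o, 'c, 'x, 'b, 'q, 'd) lax_functor \<Rightarrow> 'a \<Rightarrow> ('x, 'b, 'q, 'd)
    cat_object_functor" where
  "lf_cat_functor A F f =
    \<lparr> cf_dom = lf_cat_object F (Dom (under A) f), cf_cod = lf_cat_object F (Cod (under A) f),
     cf_arr = lf_arr F f, cf_cell = lf_cell F (VId A f) \<rparr>"

definition lf_cat_trans ::
  "('o, 'a, 'c) two_cat \<Rightarrow> ('x, 'b, 'q, 'd) dbl \<Rightarrow> ('o, 'a, 'o, 'c, 'x, 'b, 'q, 'd) lax_functor \<Rightarrow> 'c \<Rightarrow>
   ('x, 'b, 'q, 'd) cat_object_trans" where
  "lf_cat_trans A E F \<sigma> =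
    \<lparr> ct_dom = lf_cat_functor A F (Src A \<sigma>), ct_cod = lf_cat_functor A F (Trg A \<sigma>),
     ct_cell = lf_unitor F (Dom (under A) (Src A \<sigma>)) \<bullet>\<^bsub>E\<^esub> lf_cell F \<sigma> \<rparr>"

definition lf_to_tf ::
  "('o, 'a, 'c) two_cat \<Rightarrow> ('x, 'b, 'q, 'd) dbl \<Rightarrow> ('o, 'a, 'o, 'c, 'x, 'b, 'q, 'd) lax_functor \<Rightarrow>
   ('o, 'a, 'c, ('x, 'q, 'd) cat_object, ('x, 'b, 'q, 'd) cat_object_functor, ('x, 'b, 'q, 'd)
     cat_object_trans) two_functor" where
  "lf_to_tf A E F = \<lparr> tf_obj = (\<lambda>x \<in> Obj (under A). lf_cat_object F x),
     tf_arr = (\<lambda>f \<in> Arr (under A). lf_cat_functor A F f), tf_cell =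
       (\<lambda>\<sigma> \<in> Cells A. lf_cat_trans A E F \<sigma>) \<rparr>"

definition tf_to_lf ::
  "('o, 'a, 'c) two_cat \<Rightarrow> ('x, 'b, 'q, 'd) dbl \<Rightarrow> 
   ('o, 'a, 'c, ('x, 'q, 'd) cat_object, ('x, 'b, 'q, 'd) cat_object_functor, ('x, 'b, 'q, 'd)
     cat_object_trans) two_functor \<Rightarrow>
   ('o, 'a, 'o, 'c, 'x, 'b, 'q, 'd) lax_functor" where
  "tf_to_lf A E K = \<lparr> lf_obj = (\<lambda>x \<in> Obj (under A). co_obj (tf_obj K x)), lf_arr =
    (\<lambda>f \<in> Arr (under A). cf_arr (tf_arr K f)),
     lf_pro = (\<lambda>x \<in> Obj (under A). co_pro (tf_obj K x)),
     lf_cell = (\<lambda>\<sigma> \<in> Cells A. double_category.hat E (tf_cell K \<sigma>)),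
     lf_laxator = (\<lambda>x y. if x \<in> Obj (under A) \<and> x = y then co_mult (tf_obj K x) else undefined),
     lf_unitor = (\<lambda>x \<in> Obj (under A). co_unit (tf_obj K x)) \<rparr>"

lemma lf_cat_simps [simp]:
  "co_obj (lf_cat_object F x) = lf_obj F x" "co_pro (lf_cat_object F x) = lf_pro F x"
  "co_mult (lf_cat_object F x) = lf_laxator F x x" "co_unit (lf_cat_object F x) = lf_unitor F x"
  "cf_dom (lf_cat_functor A F f) = lf_cat_object F (Dom (under A) f)"
  "cf_cod (lf_cat_functor A F f) = lf_cat_object F (Cod (under A) f)"
  "cf_arr (lf_cat_functor A F f) = lf_arr F f"
    "cf_cell (lf_cat_functor A F f) = lf_cell F (VId A f)"
  "ct_dom (lf_cat_trans A E F \<sigma>) = lf_cat_functor A F (Src A \<sigma>)"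
  "ct_cod (lf_cat_trans A E F \<sigma>) = lf_cat_functor A F (Trg A \<sigma>)"
  "ct_cell (lf_cat_trans A E F \<sigma>) = lf_unitor F (Dom (under A) (Src A \<sigma>)) \<bullet>\<^bsub>E\<^esub> lf_cell F \<sigma>"
  by (simp_all add: lf_cat_object_def lf_cat_functor_def lf_cat_trans_def)

context ver_lax
begin

context
  fixes F :: "('o, 'a, 'o, 'c, 'x, 'b, 'q, 'd) lax_functor"
  assumes F: "is_lax_functor (VerDbl A) E F"
begin

lemma lf_extensional:
  "lf_obj F \<in> extensional (Obj (under A))" "lf_arr F \<in> extensional (Arr (under A))"
  "lf_pro F \<in> extensional (Obj (under A))" "lf_cell F \<in> extensional (Cells A)"
  "lf_unitor F \<in> extensional (Obj (under A))"
    "\<not> (x \<in> Obj (under A) \<and> x = y) \<Longrightarrow> lf_laxator F x y = undefined"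
  using F by (simp_all add: is_lax_functor_def Let_def)

lemma lf_functors:
  "cat_functor (under A) (D0 E) (lf_obj F) (lf_arr F)"
  "cat_functor (horiz_cat A) (D1 E) (lf_pro F) (lf_cell F)"
  using F by (simp_all add: is_lax_functor_def Let_def)

lemma lf_basic:
  "x \<in> Obj (under A) \<Longrightarrow> lf_obj F x \<in> Obj (D0 E)"
  "x \<in> Obj (under A) \<Longrightarrow> lf_pro F x \<in> Obj (D1 E)"
  "f \<in> Arr (under A) \<Longrightarrow> lf_arr F f \<in> Arr (D0 E)"
  "f \<in> Arr (under A) \<Longrightarrow> Dom (D0 E) (lf_arr F f) = lf_obj F (A.dom f)"
  "f \<in> Arr (under A) \<Longrightarrow> Cod (D0 E) (lf_arr F f) = lf_obj F (A.cod f)"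
  "x \<in> Obj (under A) \<Longrightarrow> lf_arr F (Ide (under A) x) = Ide (D0 E) (lf_obj F x)"
  "f \<in> Arr (under A) \<Longrightarrow> g \<in> Arr (under A) \<Longrightarrow> A.cod f = A.dom g \<Longrightarrow>
     lf_arr F (f \<cdot>\<^bsub>under A\<^esub> g) = lf_arr F f \<cdot>\<^bsub>D0 E\<^esub> lf_arr F g"
  "\<sigma> \<in> Cells A \<Longrightarrow> lf_cell F \<sigma> \<in> Arr (D1 E)"
  "\<sigma> \<in> Cells A \<Longrightarrow> Dom (D1 E) (lf_cell F \<sigma>) = lf_pro F (A.dom (Src A \<sigma>))"
  "\<sigma> \<in> Cells A \<Longrightarrow> Cod (D1 E) (lf_cell F \<sigma>) = lf_pro F (A.cod (Src A \<sigma>))"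
  "x \<in> Obj (under A) \<Longrightarrow> lf_cell F (VId A (Ide (under A) x)) = cell_id E (lf_pro F x)"
  "\<sigma> \<in> Cells A \<Longrightarrow> \<tau> \<in> Cells A \<Longrightarrow> A.cod (Src A \<sigma>) = A.dom (Src A \<tau>) \<Longrightarrow>
     lf_cell F (HComp A \<sigma> \<tau>) = lf_cell F \<sigma> \<bullet> lf_cell F \<tau>"
  using lf_functors by (simp_all add: cat_functor_def)

lemma lf_typing:
  "x \<in> Obj (under A) \<Longrightarrow> psrc E (lf_pro F x) = lf_obj F x"
  "x \<in> Obj (under A) \<Longrightarrow> ptgt E (lf_pro F x) = lf_obj F x"
  "\<sigma> \<in> Cells A \<Longrightarrow> csrc E (lf_cell F \<sigma>) = lf_arr F (Src A \<sigma>)"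
  "\<sigma> \<in> Cells A \<Longrightarrow> ctgt E (lf_cell F \<sigma>) = lf_arr F (Trg A \<sigma>)"
  "f \<in> Arr (under A) \<Longrightarrow> lf_unitor F (A.dom f) \<bullet> lf_cell F (VId A f) = cid E (lf_arr F f) \<bullet>
    lf_unitor F (A.cod f)"
  using F by (simp_all add: is_lax_functor_def Let_def)

lemma lf_laxator_natural:
  assumes "\<sigma> \<in> Cells A" "\<tau> \<in> Cells A" "Trg A \<sigma> = Src A \<tau>"
  shows "(lf_cell F \<sigma> \<otimes> lf_cell F \<tau>) \<bullet> lf_laxator F (A.cod (Src A \<sigma>)) (A.cod (Src A \<sigma>)) =
    lf_laxator F (A.dom (Src A \<sigma>)) (A.dom (Src A \<sigma>)) \<bullet> lf_cell F (VComp A \<sigma> \<tau>)"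
proof -
  have "A.cod (Src A \<sigma>) = A.cod (Src A \<tau>)" "A.dom (Src A \<sigma>) = A.dom (Src A \<tau>)"
    using A.globular[OF assms(1)] assms(3) by simp_all
  moreover have "(lf_cell F \<sigma> \<otimes> lf_cell F \<tau>) \<bullet> lf_laxator F (A.cod (Src A \<sigma>)) (A.cod (Src A \<tau>)) =
    lf_laxator F (A.dom (Src A \<sigma>)) (A.dom (Src A \<tau>)) \<bullet> lf_cell F (VComp A \<sigma> \<tau>)"
    using F assms by (simp add: is_lax_functor_def Let_def)
  ultimately show ?thesis by simp
qed

lemma is_cat_object_lf:
  assumes x: "x \<in> Obj (under A)" shows "is_cat_object E (lf_cat_object F x)"
proof -
  have "globular_cell E (lf_laxator F x x) (lf_pro F x \<odot> lf_pro F x) (lf_pro F x)"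
    "globular_cell E (lf_unitor F x) (pid E (lf_obj F x)) (lf_pro F x)"
    using F x by (simp_all add: is_lax_functor_def Let_def)
  moreover from this have "lf_laxator F x x \<bullet> cell_id E (lf_pro F x) = lf_laxator F x x"
    by (simp add: globular_cell_def cell_over_def)
  moreover have "(lf_laxator F x x \<otimes> cell_id E (lf_pro F x)) \<bullet> lf_laxator F x x \<bullet>
    cell_id E (lf_pro F x) =
      passoc E (lf_pro F x) (lf_pro F x) (lf_pro F x) \<bullet>
        (cell_id E (lf_pro F x) \<otimes> lf_laxator F x x) \<bullet> lf_laxator F x x"
    "(lf_unitor F x \<otimes> cell_id E (lf_pro F x)) \<bullet> lf_laxator F x x \<bullet> cell_id E (lf_pro F x) =
      lunit E (lf_pro F x)"
    "(cell_id E (lf_pro F x) \<otimes> lf_unitor F x) \<bullet> lf_laxator F x x \<bullet> cell_id E (lf_pro F x) =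
      runit E (lf_pro F x)"
    using F x by (simp_all add: is_lax_functor_def Let_def lf_basic(11))
  ultimately show ?thesis
    using x lf_basic lf_typing by
      (simp add: is_cat_object_def Let_def proarrow_def globular_cell_def cell_over_def)
qed

lemmas lf_rules = lf_basic lf_typing is_cat_object_lf
  E.cat_object_rules[OF is_cat_object_lf, simplified]

lemma into_lf: "\<sigma> \<in> Cells A \<Longrightarrow> y = A.cod (Src A \<sigma>) \<Longrightarrow> E.into (lf_cat_object F y) (lf_cell F \<sigma>)"
  by (simp add: E.into_def lf_rules)

lemma lact_lf:
  assumes [simp]: "\<sigma> \<in> Cells A" "\<tau> \<in> Cells A" "Trg A \<sigma> = Src A \<tau>" and y: "y = A.cod (Src A \<sigma>)"
  shows "E.lact (lf_cat_object F y) (lf_unitor F (A.dom (Src A \<sigma>)) \<bullet> lf_cell F \<sigma>) (lf_cell F \<tau>) =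
    lf_cell F (VComp A \<sigma> \<tau>)"
    "E.ract (lf_cat_object F y) (lf_cell F \<sigma>) (lf_unitor F (A.dom (Src A \<sigma>)) \<bullet> lf_cell F \<tau>) =
      lf_cell F (VComp A \<sigma> \<tau>)"
proof -
  let ?x = "A.dom (Src A \<sigma>)"
  have [simp]: "A.cod (Src A \<tau>) = y" "A.dom (Src A \<tau>) = ?x" "A.cod (Src A \<sigma>) = y"
    "y \<in> Obj (under A)"
    using A.globular[OF assms(1)] y by simp_all
  note [simp] = lf_rules into_lf
  interpret X: cat_object_in E "lf_cat_object F ?x" by (rule E.cat_object_inI) simp
  interpret Y: cat_object_in E "lf_cat_object F y" by (rule E.cat_object_inI) simp
  have "E.mul (lf_cat_object F y) (lf_unitor F ?x \<bullet> lf_cell F \<sigma>) (lf_cell F \<tau>) =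
    (lf_unitor F ?x \<otimes> cell_id E (lf_pro F ?x)) \<bullet> ((lf_cell F \<sigma> \<otimes> lf_cell F \<tau>) \<bullet> lf_laxator F y y)"
    by (simp add: E.mul_def E.ccomp_fuse)
  also have "\<dots> = ((lf_unitor F ?x \<otimes> cell_id E (lf_pro F ?x)) \<bullet> lf_laxator F ?x ?x) \<bullet>
    lf_cell F (VComp A \<sigma> \<tau>)"
    using lf_laxator_natural[of \<sigma> \<tau>] by (subst E.D1.comp_assoc') simp_all
  also have "\<dots> = lunit E (lf_pro F ?x) \<bullet> lf_cell F (VComp A \<sigma> \<tau>)" by simp
  finally show "E.lact (lf_cat_object F y) (lf_unitor F (A.dom (Src A \<sigma>)) \<bullet> lf_cell F \<sigma>)
    (lf_cell F \<tau>) = lf_cell F (VComp A \<sigma> \<tau>)"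
    by (simp add: E.lact_def flip: E.D1.comp_assoc')
  have "E.mul (lf_cat_object F y) (lf_cell F \<sigma>) (lf_unitor F ?x \<bullet> lf_cell F \<tau>) =
    (cell_id E (lf_pro F ?x) \<otimes> lf_unitor F ?x) \<bullet> ((lf_cell F \<sigma> \<otimes> lf_cell F \<tau>) \<bullet> lf_laxator F y y)"
    by (simp add: E.mul_def E.ccomp_fuse)
  also have "\<dots> = ((cell_id E (lf_pro F ?x) \<otimes> lf_unitor F ?x) \<bullet> lf_laxator F ?x ?x) \<bullet>
    lf_cell F (VComp A \<sigma> \<tau>)"
    using lf_laxator_natural[of \<sigma> \<tau>] by (subst E.D1.comp_assoc') simp_all
  also have "\<dots> = runit E (lf_pro F ?x) \<bullet> lf_cell F (VComp A \<sigma> \<tau>)" by simp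
  finally show "E.ract (lf_cat_object F y) (lf_cell F \<sigma>)
    (lf_unitor F (A.dom (Src A \<sigma>)) \<bullet> lf_cell F \<tau>) = lf_cell F (VComp A \<sigma> \<tau>)"
    by (simp add: E.ract_def flip: E.D1.comp_assoc')
qed

end

context
  fixes F :: "('o, 'a, 'o, 'c, 'x, 'b, 'q, 'd) lax_functor"
  assumes F: "is_lax_functor (VerDbl A) E F"
begin

lemma is_cat_object_functor_lf:
  assumes [simp]: "f \<in> Arr (under A)" shows "is_cat_object_functor E (lf_cat_functor A F f)"
  using lf_laxator_natural[OF F, of "VId A f" "VId A f"] 
  by (simp add: is_cat_object_functor_def Let_def lf_rules[OF F] cell_over_def)

lemma is_cat_object_trans_lf:
  assumes [simp]: "\<sigma> \<in> Cells A"
  shows "is_cat_object_trans E (lf_cat_trans A E F \<sigma>)" "E.hat (lf_cat_trans A E F \<sigma>) = lf_cell F \<sigma>"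
proof -
  note [simp] = lf_rules[OF F] is_cat_object_functor_lf
  have [simp]: "E.into (lf_cat_object F (A.cod (Src A \<sigma>)))
    (lf_unitor F (A.dom (Src A \<sigma>)) \<bullet> lf_cell F \<sigma>)"
    by (simp add: E.into_def)
  show "is_cat_object_trans E (lf_cat_trans A E F \<sigma>)"
    using lact_lf[OF F, of \<sigma> "VId A (Trg A \<sigma>)"] lact_lf[OF F, of "VId A (Src A \<sigma>)" \<sigma>]
    by (subst E.is_cat_object_trans_iff) simp_all
  show "E.hat (lf_cat_trans A E F \<sigma>) = lf_cell F \<sigma>"
    using lact_lf[OF F, of \<sigma> "VId A (Trg A \<sigma>)"] by (simp add: E.hat_def)
qed

lemma lf_cell_vid_comp:
  assumes "f \<in> Arr (under A)" "g \<in> Arr (under A)" "A.cod f = A.dom g"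
  shows "lf_cell F (VId A (f \<cdot>\<^bsub>under A\<^esub> g)) = lf_cell F (VId A f) \<bullet> lf_cell F (VId A g)"
  using lf_rules(12)[OF F, of "VId A f" "VId A g"] assms by simp

lemma is_two_functor_lf_to_tf: "is_two_functor A (CatObj E) (lf_to_tf A E F)"
proof -
  note [simp] = lf_rules[OF F] is_cat_object_functor_lf is_cat_object_trans_lf
    E.cat_object_trans_id lf_cell_vid_comp
  have "cat_functor (under A) (under (CatObj E)) (tf_obj (lf_to_tf A E F))
    (tf_arr (lf_to_tf A E F))"
    by (auto simp: cat_functor_def lf_to_tf_def intro: E.cat_object_functor_eqI)
  moreover have "cat_functor (vert_cat A) (vert_cat (CatObj E)) (tf_arr (lf_to_tf A E F))
    (tf_cell (lf_to_tf A E F))"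
    unfolding cat_functor_def
  proof (intro conjI ballI allI impI)
    fix \<sigma> \<tau> assume "composable (vert_cat A) \<sigma> \<tau>"
    then have [simp]: "\<sigma> \<in> Cells A" "\<tau> \<in> Cells A" "Trg A \<sigma> = Src A \<tau>" by simp_all
    have eq [simp]: "A.cod (Src A \<tau>) = A.cod (Src A \<sigma>)" "A.dom (Src A \<tau>) = A.dom (Src A \<sigma>)"
      using A.globular[of \<sigma>] by simp_all
    show "tf_cell (lf_to_tf A E F) (Comp (vert_cat A) \<sigma> \<tau>) = 
        Comp (vert_cat (CatObj E)) (tf_cell (lf_to_tf A E F) \<sigma>) (tf_cell (lf_to_tf A E F) \<tau>)"
      by (simp add: lf_to_tf_def, rule E.cat_object_trans_eqI)
        (simp_all add: E.cat_object_trans_vcomp lact_lf[OF F])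
  qed (auto simp: lf_to_tf_def intro: E.cat_object_trans_eqI)
  moreover have "cat_functor (horiz_cat A) (horiz_cat (CatObj E)) (tf_obj (lf_to_tf A E F))
    (tf_cell (lf_to_tf A E F))"
    unfolding cat_functor_def
  proof (intro conjI ballI allI impI)
    fix \<sigma> \<tau> assume "composable (horiz_cat A) \<sigma> \<tau>"
    then have [simp]: "\<sigma> \<in> Cells A" "\<tau> \<in> Cells A" "A.cod (Src A \<sigma>) = A.dom (Src A \<tau>)" by simp_all
    show "tf_cell (lf_to_tf A E F) (Comp (horiz_cat A) \<sigma> \<tau>) = 
        Comp (horiz_cat (CatObj E)) (tf_cell (lf_to_tf A E F) \<sigma>) (tf_cell (lf_to_tf A E F) \<tau>)"
      by (simp add: lf_to_tf_def, rule E.cat_object_trans_eqI)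
        (simp_all add: E.cat_object_trans_hcomp E.cat_object_functor_eqI)
  qed (auto simp: lf_to_tf_def intro!: E.cat_object_trans_eqI E.cat_object_functor_eqI)
  ultimately show ?thesis
    by (simp add: is_two_functor_def) (simp add: lf_to_tf_def)
qed

lemma tf_to_lf_to_tf: "tf_to_lf A E (lf_to_tf A E F) = F"
proof -
  note exts = lf_extensional[OF F]
  show ?thesis
  proof (rule lax_functor.equality)
    show "lf_laxator (tf_to_lf A E (lf_to_tf A E F)) = lf_laxator F"
      using exts(6) by (intro ext) (auto simp: tf_to_lf_def lf_to_tf_def)
  qed (use exts(1-5) in
    \<open>simp_all add: tf_to_lf_def lf_to_tf_def is_cat_object_trans_lf extensional_restrict cong:
    restrict_cong\<close>)
qed

end

context
  fixes K
  assumes K: "is_two_functor A (CatObj E) K"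
begin

lemmas tf_rules = two_functor_rules[OF K, simplified]

lemma tf_eq:
  "f \<in> Arr (under A) \<Longrightarrow> cf_dom (tf_arr K f) = tf_obj K (A.dom f)"
  "f \<in> Arr (under A) \<Longrightarrow> cf_cod (tf_arr K f) = tf_obj K (A.cod f)"
  "\<sigma> \<in> Cells A \<Longrightarrow> ct_dom (tf_cell K \<sigma>) = tf_arr K (Src A \<sigma>)"
  "\<sigma> \<in> Cells A \<Longrightarrow> ct_cod (tf_cell K \<sigma>) = tf_arr K (Trg A \<sigma>)"
  using tf_rules by simp_all

lemmas K_rules = tf_rules 
  E.cat_object_rules[OF tf_rules(1)] E.cf_rules[OF tf_rules(2), simplified tf_eq]
  E.hat_rules[OF tf_rules(3), simplified tf_eq A.src_trg_arr] E.cat_object_trans_id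

lemma lf_tf_simps:
  "x \<in> Obj (under A) \<Longrightarrow> lf_obj (tf_to_lf A E K) x = co_obj (tf_obj K x)"
  "x \<in> Obj (under A) \<Longrightarrow> lf_pro (tf_to_lf A E K) x = co_pro (tf_obj K x)"
  "f \<in> Arr (under A) \<Longrightarrow> lf_arr (tf_to_lf A E K) f = cf_arr (tf_arr K f)"
  "\<sigma> \<in> Cells A \<Longrightarrow> lf_cell (tf_to_lf A E K) \<sigma> = E.hat (tf_cell K \<sigma>)"
  "x \<in> Obj (under A) \<Longrightarrow> lf_laxator (tf_to_lf A E K) x x = co_mult (tf_obj K x)"
  "x \<in> Obj (under A) \<Longrightarrow> lf_unitor (tf_to_lf A E K) x = co_unit (tf_obj K x)"
  by (simp_all add: tf_to_lf_def)

lemma is_lax_functor_tf_to_lf: "is_lax_functor (VerDbl A) E (tf_to_lf A E K)"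
proof -
  note [simp] = K_rules lf_tf_simps
  have "cat_functor (under A) (D0 E) (lf_obj (tf_to_lf A E K)) (lf_arr (tf_to_lf A E K))"
    by (simp add: cat_functor_def)
  moreover have "cat_functor (horiz_cat A) (D1 E) (lf_pro (tf_to_lf A E K))
    (lf_cell (tf_to_lf A E K))"
    by (simp add: cat_functor_def E.cat_object_trans_hcomp)
  moreover have "(E.hat (tf_cell K \<sigma>) \<otimes> E.hat (tf_cell K \<tau>)) \<bullet>
    lf_laxator (tf_to_lf A E K) (A.cod (Src A \<sigma>)) (A.cod (Src A \<tau>)) =
      lf_laxator (tf_to_lf A E K) (A.dom (Src A \<sigma>)) (A.dom (Src A \<tau>)) \<bullet> E.hat
        (VComp (CatObj E) (tf_cell K \<sigma>) (tf_cell K \<tau>))"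
    if [simp]: "\<sigma> \<in> Cells A" "\<tau> \<in> Cells A" "Trg A \<sigma> = Src A \<tau>" for \<sigma> \<tau>
    using E.mul_hat[of "tf_cell K \<sigma>" "tf_cell K \<tau>"] A.globular[of \<sigma>] by (simp add: E.mul_def)
  moreover have "(co_mult (tf_obj K m) \<otimes> cell_id E (co_pro (tf_obj K m))) \<bullet> co_mult (tf_obj K m) =
      passoc E (co_pro (tf_obj K m)) (co_pro (tf_obj K m)) (co_pro (tf_obj K m)) \<bullet>
      (cell_id E (co_pro (tf_obj K m)) \<otimes> co_mult (tf_obj K m)) \<bullet> co_mult (tf_obj K m)" if "m \<in> Obj
        (under A)" for m
    using tf_rules(1)[OF that] by (simp add: is_cat_object_def Let_def)
  moreover have "co_unit (tf_obj K (A.dom f)) \<bullet> cf_cell (tf_arr K f) =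
    cid E (cf_arr (tf_arr K f)) \<bullet> co_unit (tf_obj K (A.cod f))"
    if "f \<in> Arr (under A)" for f
    using E.cf_rules(11)[OF tf_rules(2)[OF that]] that by simp
  moreover have "lf_obj (tf_to_lf A E K) \<in> extensional (Obj (under A))"
    "lf_arr (tf_to_lf A E K) \<in> extensional (Arr (under A))"
    "lf_pro (tf_to_lf A E K) \<in> extensional (Obj (under A))"
      "lf_cell (tf_to_lf A E K) \<in> extensional (Cells A)"
    "lf_unitor (tf_to_lf A E K) \<in> extensional (Obj (under A))"
    "\<forall>m n. (m \<in> Obj (under A) \<longrightarrow> m \<noteq> n) \<longrightarrow> lf_laxator (tf_to_lf A E K) m n = undefined"
    by (auto simp: tf_to_lf_def)
  ultimately show ?thesis
    by (simp add: is_lax_functor_def Let_def globular_cell_def cell_over_def)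
qed

lemma lf_cat_tf_to_lf:
  "x \<in> Obj (under A) \<Longrightarrow> lf_cat_object (tf_to_lf A E K) x = tf_obj K x"
  "f \<in> Arr (under A) \<Longrightarrow> lf_cat_functor A (tf_to_lf A E K) f = tf_arr K f"
  "\<sigma> \<in> Cells A \<Longrightarrow> lf_cat_trans A E (tf_to_lf A E K) \<sigma> = tf_cell K \<sigma>"
proof -
  note [simp] = K_rules lf_tf_simps
  show o: "lf_cat_object (tf_to_lf A E K) x = tf_obj K x" if "x \<in> Obj (under A)" for x
    using that by (simp add: lf_cat_object_def)
  show a: "lf_cat_functor A (tf_to_lf A E K) f = tf_arr K f" if "f \<in> Arr (under A)" for f
    using that by (intro E.cat_object_functor_eqI) (simp_all add: o)
  show "lf_cat_trans A E (tf_to_lf A E K) \<sigma> = tf_cell K \<sigma>" if "\<sigma> \<in> Cells A" for \<sigma>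
    using that E.unit_hat[of "tf_cell K \<sigma>"] by (intro cat_object_trans.equality) (simp_all add: a)
qed

lemma lf_to_tf_to_lf: "lf_to_tf A E (tf_to_lf A E K) = K"
  using K by (intro two_functor.equality)
    (simp_all add: lf_to_tf_def lf_cat_tf_to_lf is_two_functor_def extensional_restrict cong:
      restrict_cong)

end

end

definition lt_cat_functor ::
  "('o, 'a, 'o, 'c, 'x, 'b, 'q, 'd) lax_trans \<Rightarrow> 'o \<Rightarrow> ('x, 'b, 'q, 'd) cat_object_functor" where
  "lt_cat_functor \<alpha> x = \<lparr> cf_dom = lf_cat_object (lt_dom \<alpha>) x, cf_cod = lf_cat_object (lt_cod \<alpha>) x,
     cf_arr = lt_obj \<alpha> x, cf_cell = lt_pro \<alpha> x \<rparr>"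

definition lt_cat_trans ::
  "('o, 'a, 'c) two_cat \<Rightarrow> ('x, 'b, 'q, 'd) dbl \<Rightarrow> ('o, 'a, 'o, 'c, 'x, 'b, 'q, 'd) lax_trans \<Rightarrow> 'a \<Rightarrow>
   ('x, 'b, 'q, 'd) cat_object_trans" where
  "lt_cat_trans A E \<alpha> f = \<lparr>
     ct_dom = cat_object_functor_comp E (lt_cat_functor \<alpha> (Dom (under A) f))
       (lf_cat_functor A (lt_cod \<alpha>) f),
     ct_cod = cat_object_functor_comp E (lf_cat_functor A (lt_dom \<alpha>) f)
       (lt_cat_functor \<alpha> (Cod (under A) f)),
     ct_cell = lt_arr \<alpha> f \<rparr>"

definition lt_to_ln ::
  "('o, 'a, 'c) two_cat \<Rightarrow> ('x, 'b, 'q, 'd) dbl \<Rightarrow> ('o, 'a, 'o, 'c, 'x, 'b, 'q, 'd) lax_trans \<Rightarrow>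
   ('o, 'a, 'c, ('x, 'q, 'd) cat_object, ('x, 'b, 'q, 'd) cat_object_functor, ('x, 'b, 'q, 'd)
     cat_object_trans) lax_nat" where
  "lt_to_ln A E \<alpha> = \<lparr> ln_dom = lf_to_tf A E (lt_dom \<alpha>), ln_cod = lf_to_tf A E (lt_cod \<alpha>),
     ln_obj = (\<lambda>x \<in> Obj (under A). lt_cat_functor \<alpha> x), ln_arr =
       (\<lambda>f \<in> Arr (under A). lt_cat_trans A E \<alpha> f) \<rparr>"

definition ln_to_lt ::
  "('o, 'a, 'c) two_cat \<Rightarrow> ('x, 'b, 'q, 'd) dbl \<Rightarrow> 
   ('o, 'a, 'c, ('x, 'q, 'd) cat_object, ('x, 'b, 'q, 'd) cat_object_functor, ('x, 'b, 'q, 'd)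
     cat_object_trans) lax_nat \<Rightarrow>
   ('o, 'a, 'o, 'c, 'x, 'b, 'q, 'd) lax_trans" where
  "ln_to_lt A E \<beta> = \<lparr> lt_dom = tf_to_lf A E (ln_dom \<beta>), lt_cod = tf_to_lf A E (ln_cod \<beta>),
     lt_obj = (\<lambda>x \<in> Obj (under A). cf_arr (ln_obj \<beta> x)), lt_pro =
       (\<lambda>x \<in> Obj (under A). cf_cell (ln_obj \<beta> x)),
     lt_arr = (\<lambda>f \<in> Arr (under A). ct_cell (ln_arr \<beta> f)) \<rparr>"

lemma lt_cat_simps [simp]:
  "cf_dom (lt_cat_functor \<alpha> x) = lf_cat_object (lt_dom \<alpha>) x"
    "cf_cod (lt_cat_functor \<alpha> x) = lf_cat_object (lt_cod \<alpha>) x"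
  "cf_arr (lt_cat_functor \<alpha> x) = lt_obj \<alpha> x" "cf_cell (lt_cat_functor \<alpha> x) = lt_pro \<alpha> x"
  "ct_dom (lt_cat_trans A E \<alpha> f) =
    cat_object_functor_comp E (lt_cat_functor \<alpha> (Dom (under A) f)) (lf_cat_functor A (lt_cod \<alpha>) f)"
  "ct_cod (lt_cat_trans A E \<alpha> f) = 
    cat_object_functor_comp E (lf_cat_functor A (lt_dom \<alpha>) f) (lt_cat_functor \<alpha> (Cod (under A) f))"
  "ct_cell (lt_cat_trans A E \<alpha> f) = lt_arr \<alpha> f"
  by (simp_all add: lt_cat_functor_def lt_cat_trans_def)

lemma lf_to_tf_simps [simp]:
  "x \<in> Obj (under A) \<Longrightarrow> tf_obj (lf_to_tf A E F) x = lf_cat_object F x"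
  "f \<in> Arr (under A) \<Longrightarrow> tf_arr (lf_to_tf A E F) f = lf_cat_functor A F f"
  "\<sigma> \<in> Cells A \<Longrightarrow> tf_cell (lf_to_tf A E F) \<sigma> = lf_cat_trans A E F \<sigma>"
  by (simp_all add: lf_to_tf_def)

lemma lt_to_ln_simps [simp]:
  "ln_dom (lt_to_ln A E \<alpha>) = lf_to_tf A E (lt_dom \<alpha>)"
    "ln_cod (lt_to_ln A E \<alpha>) = lf_to_tf A E (lt_cod \<alpha>)"
  "x \<in> Obj (under A) \<Longrightarrow> ln_obj (lt_to_ln A E \<alpha>) x = lt_cat_functor \<alpha> x"
  "f \<in> Arr (under A) \<Longrightarrow> ln_arr (lt_to_ln A E \<alpha>) f = lt_cat_trans A E \<alpha> f"
  by (simp_all add: lt_to_ln_def)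

context ver_lax
begin

lemma laxator_simps:
  assumes F: "is_lax_functor (VerDbl A) E F" and x: "x \<in> Obj (under A)"
  shows "laxator_l (VerDbl A) E F x = lf_laxator F x x"
    "laxator_r (VerDbl A) E F x = lf_laxator F x x"
  using x lf_rules[OF F] by (simp_all add: laxator_l_def laxator_r_def)

context
  fixes \<alpha> :: "('o, 'a, 'o, 'c, 'x, 'b, 'q, 'd) lax_trans"
  assumes \<alpha>: "is_lax_trans (VerDbl A) E \<alpha>"
begin

lemma lt_functors: "is_lax_functor (VerDbl A) E (lt_dom \<alpha>)" "is_lax_functor (VerDbl A) E (lt_cod \<alpha>)"
  using \<alpha> by (simp_all add: is_lax_trans_def Let_def)

lemma lt_extensional:
  "lt_obj \<alpha> \<in> extensional (Obj (under A))" "lt_pro \<alpha> \<in> extensional (Obj (under A))"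
  "lt_arr \<alpha> \<in> extensional (Arr (under A))"
  using \<alpha> by (simp_all add: is_lax_trans_def Let_def)

lemmas lt_functor_rules = lf_rules[OF lt_functors(1)] lf_rules[OF lt_functors(2)]
  into_lf[OF lt_functors(1)] into_lf[OF lt_functors(2)]
  is_cat_object_functor_lf[OF lt_functors(1)] is_cat_object_functor_lf[OF lt_functors(2)]
  is_cat_object_trans_lf[OF lt_functors(1)] is_cat_object_trans_lf[OF lt_functors(2)]

lemma is_cat_object_functor_lt: "x \<in> Obj (under A) \<Longrightarrow> is_cat_object_functor E (lt_cat_functor \<alpha> x)"
  using \<alpha> lt_functor_rules by (simp add: is_lax_trans_def Let_def is_cat_object_functor_def)

lemmas lt_obj_rules = E.cf_rules[OF is_cat_object_functor_lt, simplified]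

lemma lt_arr_rules:
  assumes "f \<in> Arr (under A)"
  shows "lt_arr \<alpha> f \<in> Arr (D1 E)" "Dom (D1 E) (lt_arr \<alpha> f) = pid E (lf_obj (lt_dom \<alpha>) (A.dom f))"
    "Cod (D1 E) (lt_arr \<alpha> f) = lf_pro (lt_cod \<alpha>) (A.cod f)"
    "csrc E (lt_arr \<alpha> f) = lt_obj \<alpha> (A.dom f) \<cdot>\<^bsub>D0 E\<^esub> lf_arr (lt_cod \<alpha>) f"
    "ctgt E (lt_arr \<alpha> f) = lf_arr (lt_dom \<alpha>) f \<cdot>\<^bsub>D0 E\<^esub> lt_obj \<alpha> (A.cod f)"
  using \<alpha> assms by (simp_all add: is_lax_trans_def Let_def cell_over_def)

lemma into_lt_arr: "f \<in> Arr (under A) \<Longrightarrow> y = A.cod f \<Longrightarrow>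
  E.into (lf_cat_object (lt_cod \<alpha>) y) (lt_arr \<alpha> f)"
  by (simp add: E.into_def lt_arr_rules)

lemmas lt_rules = lt_functor_rules is_cat_object_functor_lt lt_obj_rules lt_arr_rules into_lt_arr

lemma lt_natural:
  assumes [simp]: "\<sigma> \<in> Cells A" 
  shows "E.lact (lf_cat_object (lt_cod \<alpha>) (A.cod (Src A \<sigma>))) (lt_arr \<alpha> (Src A \<sigma>))
      (lf_cell (lt_dom \<alpha>) \<sigma> \<bullet> lt_pro \<alpha> (A.cod (Src A \<sigma>))) =
    E.ract (lf_cat_object (lt_cod \<alpha>) (A.cod (Src A \<sigma>)))
      (lt_pro \<alpha> (A.dom (Src A \<sigma>)) \<bullet> lf_cell (lt_cod \<alpha>) \<sigma>)
      (lt_arr \<alpha> (Trg A \<sigma>))"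
proof -
  note [simp] = lt_rules laxator_simps[OF lt_functors(2)]
  have "lunit_inv E (lf_pro (lt_dom \<alpha>) (A.dom (Src A \<sigma>))) \<bullet> (lt_arr \<alpha> (Src A \<sigma>) \<otimes>
      (lf_cell (lt_dom \<alpha>) \<sigma> \<bullet> lt_pro \<alpha> (A.cod (Src A \<sigma>)))) \<bullet> laxator_l (VerDbl A) E (lt_cod \<alpha>)
        (A.cod (Src A \<sigma>)) =
    runit_inv E (lf_pro (lt_dom \<alpha>) (A.dom (Src A \<sigma>))) \<bullet>
      ((lt_pro \<alpha> (A.dom (Src A \<sigma>)) \<bullet> lf_cell (lt_cod \<alpha>) \<sigma>) \<otimes>
      lt_arr \<alpha> (Trg A \<sigma>)) \<bullet> laxator_r (VerDbl A) E (lt_cod \<alpha>) (A.cod (Src A \<sigma>))"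
    using \<alpha> assms by (simp only: is_lax_trans_def Let_def VerDbl_typing)
  then show ?thesis by (simp add: E.lact_def E.ract_def E.mul_def)
qed

lemma lt_arr_comp:
  assumes [simp]: "f \<in> Arr (under A)" "g \<in> Arr (under A)" "A.cod f = A.dom g"
  shows "lt_arr \<alpha> (f \<cdot>\<^bsub>under A\<^esub> g) = E.lact (lf_cat_object (lt_cod \<alpha>) (A.cod g))
    (lt_arr \<alpha> f \<bullet> lf_cell (lt_cod \<alpha>) (VId A g)) (cid E (lf_arr (lt_dom \<alpha>) f) \<bullet> lt_arr \<alpha> g)"
proof -
  note [simp] = lt_rules laxator_simps[OF lt_functors(2)]
  have "lt_arr \<alpha> (f \<cdot>\<^bsub>under A\<^esub> g) = lunit_inv E (pid E (lf_obj (lt_dom \<alpha>) (A.dom f))) \<bullet>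
          ((lt_arr \<alpha> f \<bullet> lf_cell (lt_cod \<alpha>) (VId A g)) \<otimes>
            (cid E (lf_arr (lt_dom \<alpha>) f) \<bullet> lt_arr \<alpha> g)) \<bullet>
          laxator_l (VerDbl A) E (lt_cod \<alpha>) (A.cod g)"
    using \<alpha> by (simp add: is_lax_trans_def Let_def)
  then show ?thesis by (simp add: E.lact_def E.mul_def)
qed

lemma lt_arr_ide: "x \<in> Obj (under A) \<Longrightarrow> lt_arr \<alpha> (Ide (under A) x) = cid E (lt_obj \<alpha> x) \<bullet>
  lf_unitor (lt_cod \<alpha>) x"
  using \<alpha> by (simp add: is_lax_trans_def Let_def)

lemma is_cat_object_trans_lt:
  assumes [simp]: "f \<in> Arr (under A)" shows "is_cat_object_trans E (lt_cat_trans A E \<alpha> f)"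
  using lt_natural[of "VId A f"] by (subst E.is_cat_object_trans_iff) (simp_all add: lt_rules)

lemma is_lax_nat_lt_to_ln: "is_lax_nat A (CatObj E) (lt_to_ln A E \<alpha>)"
proof -
  note [simp] = lt_rules is_cat_object_trans_lt E.cat_object_trans_id
  have "VComp (CatObj E)
    (HComp (CatObj E) (VId (CatObj E) (lt_cat_functor \<alpha> (A.dom (Src A \<sigma>))))
    (lf_cat_trans A E (lt_cod \<alpha>) \<sigma>))
      (lt_cat_trans A E \<alpha> (Trg A \<sigma>)) =
    VComp (CatObj E) (lt_cat_trans A E \<alpha> (Src A \<sigma>))
      (HComp (CatObj E) (lf_cat_trans A E (lt_dom \<alpha>) \<sigma>)
        (VId (CatObj E) (lt_cat_functor \<alpha> (A.cod (Src A \<sigma>)))))"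
    if [simp]: "\<sigma> \<in> Cells A" for \<sigma>
    using lt_natural[of \<sigma>]
    by (intro E.cat_object_trans_eqI)
      (simp_all add: E.cat_object_trans_hcomp E.cat_object_trans_vcomp(1)
        E.cat_object_trans_vcomp(2)[of "lt_cat_trans A E \<alpha> _"]
        E.cat_object_trans_vcomp(3)[of "HComp _ _ _"])
  moreover have "lt_cat_trans A E \<alpha> (f \<cdot>\<^bsub>under A\<^esub> g) =
     VComp (CatObj E) (HComp (CatObj E) (lt_cat_trans A E \<alpha> f)
       (VId (CatObj E) (lf_cat_functor A (lt_cod \<alpha>) g)))
       (HComp (CatObj E) (VId (CatObj E) (lf_cat_functor A (lt_dom \<alpha>) f)) (lt_cat_trans A E \<alpha> g))"
    if [simp]: "f \<in> Arr (under A)" "g \<in> Arr (under A)" "A.cod f = A.dom g" for f g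
    by (intro cat_object_trans.equality)
      (simp_all add: E.cat_object_trans_hcomp E.CatObj_VComp_cell E.hcomp_id_cell lt_arr_comp
        lf_cell_vid_comp
        lt_functors E.cat_object_functor_eqI)
  moreover have "lt_cat_trans A E \<alpha> (Ide (under A) x) = VId (CatObj E) (lt_cat_functor \<alpha> x)"
    if [simp]: "x \<in> Obj (under A)" for x
    by (intro cat_object_trans.equality) (simp_all add: lt_arr_ide E.cat_object_functor_eqI)
  ultimately show ?thesis
    by (simp add: is_lax_nat_def Let_def two_cell_def is_two_functor_lf_to_tf lt_functors)
      (simp add: lt_to_ln_def)
qed

lemma ln_to_lt_to_ln: "ln_to_lt A E (lt_to_ln A E \<alpha>) = \<alpha>"
  by (intro lax_trans.equality)
    (simp_all add: ln_to_lt_def tf_to_lf_to_tf lt_functors lt_extensional extensional_restrict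
      cong: restrict_cong)

end

end

lemma ln_to_lt_simps [simp]:
  "lt_dom (ln_to_lt A E \<beta>) = tf_to_lf A E (ln_dom \<beta>)"
    "lt_cod (ln_to_lt A E \<beta>) = tf_to_lf A E (ln_cod \<beta>)"
  "x \<in> Obj (under A) \<Longrightarrow> lt_obj (ln_to_lt A E \<beta>) x = cf_arr (ln_obj \<beta> x)"
  "x \<in> Obj (under A) \<Longrightarrow> lt_pro (ln_to_lt A E \<beta>) x = cf_cell (ln_obj \<beta> x)"
  "f \<in> Arr (under A) \<Longrightarrow> lt_arr (ln_to_lt A E \<beta>) f = ct_cell (ln_arr \<beta> f)"
  by (simp_all add: ln_to_lt_def)

context ver_lax
begin

context
  fixes \<beta>
  assumes \<beta>: "is_lax_nat A (CatObj E) \<beta>"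
begin

lemmas ln_functors = lax_nat_functors[OF \<beta>]
lemmas ln_simps = lax_nat_simps[OF \<beta>, simplified]

lemma ln_eq:
  "x \<in> Obj (under A) \<Longrightarrow> cf_dom (ln_obj \<beta> x) = tf_obj (ln_dom \<beta>) x"
  "x \<in> Obj (under A) \<Longrightarrow> cf_cod (ln_obj \<beta> x) = tf_obj (ln_cod \<beta>) x"
  "f \<in> Arr (under A) \<Longrightarrow> ct_dom (ln_arr \<beta> f) =
    cat_object_functor_comp E (ln_obj \<beta> (A.dom f)) (tf_arr (ln_cod \<beta>) f)"
  "f \<in> Arr (under A) \<Longrightarrow> ct_cod (ln_arr \<beta> f) =
    cat_object_functor_comp E (tf_arr (ln_dom \<beta>) f) (ln_obj \<beta> (A.cod f))"
  using ln_simps by simp_all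

lemmas ln_basic = K_rules[OF ln_functors(1)] K_rules[OF ln_functors(2)] tf_eq[OF ln_functors(1)]
  tf_eq[OF ln_functors(2)]
  lf_tf_simps[OF ln_functors(1)] lf_tf_simps[OF ln_functors(2)]
  lf_cat_tf_to_lf[OF ln_functors(1)] lf_cat_tf_to_lf[OF ln_functors(2)]
  is_lax_functor_tf_to_lf[OF ln_functors(1)] is_lax_functor_tf_to_lf[OF ln_functors(2)]
  laxator_simps[OF is_lax_functor_tf_to_lf[OF ln_functors(1)]]
  laxator_simps[OF is_lax_functor_tf_to_lf[OF ln_functors(2)]]
  ln_simps ln_eq

lemma ln_obj_rules:
  assumes "x \<in> Obj (under A)"
  shows "cf_arr (ln_obj \<beta> x) \<in> Arr (D0 E)"
    "Dom (D0 E) (cf_arr (ln_obj \<beta> x)) = co_obj (tf_obj (ln_dom \<beta>) x)"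
    "Cod (D0 E) (cf_arr (ln_obj \<beta> x)) = co_obj (tf_obj (ln_cod \<beta>) x)"
    "E.into (tf_obj (ln_cod \<beta>) x) (cf_cell (ln_obj \<beta> x))"
    "cf_cell (ln_obj \<beta> x) \<in> Arr (D1 E)"
      "Dom (D1 E) (cf_cell (ln_obj \<beta> x)) = co_pro (tf_obj (ln_dom \<beta>) x)"
    "Cod (D1 E) (cf_cell (ln_obj \<beta> x)) = co_pro (tf_obj (ln_cod \<beta>) x)"
    "csrc E (cf_cell (ln_obj \<beta> x)) = cf_arr (ln_obj \<beta> x)"
      "ctgt E (cf_cell (ln_obj \<beta> x)) = cf_arr (ln_obj \<beta> x)"
  using E.cf_rules[of "ln_obj \<beta> x"] assms ln_simps(1)[OF assms] by (simp_all add: ln_eq)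

lemma ln_arr_rules:
  assumes "f \<in> Arr (under A)"
  shows "ct_cell (ln_arr \<beta> f) \<in> Arr (D1 E)"
    "Dom (D1 E) (ct_cell (ln_arr \<beta> f)) = pid E (co_obj (tf_obj (ln_dom \<beta>) (A.dom f)))"
    "Cod (D1 E) (ct_cell (ln_arr \<beta> f)) = co_pro (tf_obj (ln_cod \<beta>) (A.cod f))"
    "csrc E (ct_cell (ln_arr \<beta> f)) =
      cf_arr (ln_obj \<beta> (A.dom f)) \<cdot>\<^bsub>D0 E\<^esub> cf_arr (tf_arr (ln_cod \<beta>) f)"
    "ctgt E (ct_cell (ln_arr \<beta> f)) =
      cf_arr (tf_arr (ln_dom \<beta>) f) \<cdot>\<^bsub>D0 E\<^esub> cf_arr (ln_obj \<beta> (A.cod f))"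
  using E.ct_rules[of "ln_arr \<beta> f"] assms by (simp_all add: ln_basic)

lemma into_ln:
  "f \<in> Arr (under A) \<Longrightarrow> y = A.cod f \<Longrightarrow> E.into (tf_obj (ln_cod \<beta>) y) (ct_cell (ln_arr \<beta> f))"
  "\<sigma> \<in> Cells A \<Longrightarrow> y = A.cod (Src A \<sigma>) \<Longrightarrow> E.into (tf_obj (ln_cod \<beta>) y) (E.hat (tf_cell (ln_cod \<beta>) \<sigma>))"
  "f \<in> Arr (under A) \<Longrightarrow> y = A.cod f \<Longrightarrow> E.into (tf_obj (ln_cod \<beta>) y) (cf_cell (tf_arr (ln_cod \<beta>) f))"
  using E.hat_rules[of "tf_cell (ln_cod \<beta>) \<sigma>"] E.cf_rules[of "tf_arr (ln_cod \<beta>) f"]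
  by (simp_all add: E.into_def ln_arr_rules ln_basic)

lemmas ln_rules = ln_basic ln_obj_rules ln_arr_rules into_ln

lemma hat_tf_rules:
  assumes "\<sigma> \<in> Cells A" "K = ln_dom \<beta> \<or> K = ln_cod \<beta>"
  shows "E.hat (tf_cell K \<sigma>) \<in> Arr (D1 E)"
    "Dom (D1 E) (E.hat (tf_cell K \<sigma>)) = co_pro (tf_obj K (A.dom (Src A \<sigma>)))"
    "Cod (D1 E) (E.hat (tf_cell K \<sigma>)) = co_pro (tf_obj K (A.cod (Src A \<sigma>)))"
    "csrc E (E.hat (tf_cell K \<sigma>)) = cf_arr (tf_arr K (Src A \<sigma>))"
      "ctgt E (E.hat (tf_cell K \<sigma>)) = cf_arr (tf_arr K (Trg A \<sigma>))"
  using E.hat_rules[of "tf_cell K \<sigma>"] assms by (auto simp: ln_basic)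

lemma ln_natural_hat:
  assumes [simp]: "\<sigma> \<in> Cells A"
  shows "E.lact (tf_obj (ln_cod \<beta>) (A.cod (Src A \<sigma>))) (ct_cell (ln_arr \<beta> (Src A \<sigma>)))
      (E.hat (tf_cell (ln_dom \<beta>) \<sigma>) \<bullet> cf_cell (ln_obj \<beta> (A.cod (Src A \<sigma>)))) =
    E.ract (tf_obj (ln_cod \<beta>) (A.cod (Src A \<sigma>)))
      (cf_cell (ln_obj \<beta> (A.dom (Src A \<sigma>))) \<bullet> E.hat (tf_cell (ln_cod \<beta>) \<sigma>))
        (ct_cell (ln_arr \<beta> (Trg A \<sigma>)))"
proof -
  note [simp] = ln_rules
  show ?thesis
    using lax_nat_natural[OF \<beta> assms, THEN arg_cong, of E.hat]
    by (simp add: E.cat_object_trans_hcomp E.cat_object_trans_vcomp(1)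
      E.cat_object_trans_vcomp(2)[of "ln_arr \<beta> _"]
        E.cat_object_trans_vcomp(3)[of "HComp _ _ _"])
qed

lemma is_lax_trans_ln_to_lt: "is_lax_trans (VerDbl A) E (ln_to_lt A E \<beta>)"
proof -
  let ?K = "tf_to_lf A E (ln_dom \<beta>)" and ?K' = "tf_to_lf A E (ln_cod \<beta>)"
  note [simp] = ln_rules hat_tf_rules
  have 1: "cell_over E (cf_cell (ln_obj \<beta> x)) (lf_pro ?K x) (lf_pro ?K' x) (cf_arr (ln_obj \<beta> x))
    (cf_arr (ln_obj \<beta> x))"
    if "x \<in> Obj (under A)" for x
    using that by (simp add: cell_over_def)
  have 2: "cell_over E (ct_cell (ln_arr \<beta> f)) (pid E (lf_obj ?K (A.dom f))) (lf_pro ?K' (A.cod f))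
     (cf_arr (ln_obj \<beta> (A.dom f)) \<cdot>\<^bsub>D0 E\<^esub> lf_arr ?K' f)
       (lf_arr ?K f \<cdot>\<^bsub>D0 E\<^esub> cf_arr (ln_obj \<beta> (A.cod f)))"
    if "f \<in> Arr (under A)" for f
    using that by (simp add: cell_over_def)
  have 3: "lunit_inv E (lf_pro ?K (A.dom (Src A \<sigma>))) \<bullet> (ct_cell (ln_arr \<beta> (Src A \<sigma>)) \<otimes>
        (lf_cell ?K \<sigma> \<bullet> cf_cell (ln_obj \<beta> (A.cod (Src A \<sigma>))))) \<bullet> laxator_l (VerDbl A) E ?K'
          (A.cod (Src A \<sigma>)) =
      runit_inv E (lf_pro ?K (A.dom (Src A \<sigma>))) \<bullet>
        ((cf_cell (ln_obj \<beta> (A.dom (Src A \<sigma>))) \<bullet> lf_cell ?K' \<sigma>) \<otimes> 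
        ct_cell (ln_arr \<beta> (Trg A \<sigma>))) \<bullet> laxator_r (VerDbl A) E ?K' (A.cod (Src A \<sigma>))"
    if "\<sigma> \<in> Cells A" for \<sigma>
    using ln_natural_hat[OF that] that by (simp add: E.lact_def E.ract_def E.mul_def)
  have 4: "lf_laxator ?K x x \<bullet> cf_cell (ln_obj \<beta> x) =
    (cf_cell (ln_obj \<beta> x) \<otimes> cf_cell (ln_obj \<beta> x)) \<bullet> lf_laxator ?K' x x"
     "lf_unitor ?K x \<bullet> cf_cell (ln_obj \<beta> x) = cid E (cf_arr (ln_obj \<beta> x)) \<bullet> lf_unitor ?K' x"
    if "x \<in> Obj (under A)" for x
    using ln_simps(1)[OF that] that by (simp_all add: is_cat_object_functor_def Let_def)
  have 5: "ct_cell (ln_arr \<beta> (f \<cdot>\<^bsub>under A\<^esub> g)) = lunit_inv E (pid E (lf_obj ?K (A.dom f))) \<bullet>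
          ((ct_cell (ln_arr \<beta> f) \<bullet> lf_cell ?K' (VId A g)) \<otimes>
            (cid E (lf_arr ?K f) \<bullet> ct_cell (ln_arr \<beta> g))) \<bullet>
          laxator_l (VerDbl A) E ?K' (A.cod g)"
    if [simp]: "f \<in> Arr (under A)" "g \<in> Arr (under A)" "A.cod f = A.dom g" for f g
  proof -
    have "ct_cell (ln_arr \<beta> (f \<cdot>\<^bsub>under A\<^esub> g)) = E.lact (tf_obj (ln_cod \<beta>) (A.cod g))
      (ct_cell (ln_arr \<beta> f) \<bullet> cf_cell (tf_arr (ln_cod \<beta>) g))
        (cid E (cf_arr (tf_arr (ln_dom \<beta>) f)) \<bullet> ct_cell (ln_arr \<beta> g))"
      by (simp add: lax_nat_comp_arr[OF \<beta>] E.CatObj_VComp_cell E.hcomp_id_cell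
        E.cat_object_trans_hcomp E.cat_object_functor_eqI)
    then show ?thesis by (simp add: E.lact_def E.mul_def)
  qed
  have 6: "ct_cell (ln_arr \<beta> (Ide (under A) x)) = cid E (cf_arr (ln_obj \<beta> x)) \<bullet> lf_unitor ?K' x"
    if "x \<in> Obj (under A)" for x
    using that by simp
  show ?thesis
    using 1 2 3 4 5 6
    by (simp add: is_lax_trans_def Let_def ln_to_lt_def del: lf_tf_simps)
qed

lemma lt_cat_ln_to_lt:
  "x \<in> Obj (under A) \<Longrightarrow> lt_cat_functor (ln_to_lt A E \<beta>) x = ln_obj \<beta> x"
  "f \<in> Arr (under A) \<Longrightarrow> lt_cat_trans A E (ln_to_lt A E \<beta>) f = ln_arr \<beta> f"
proof -
  note [simp] = ln_rules
  show o: "lt_cat_functor (ln_to_lt A E \<beta>) x = ln_obj \<beta> x" if "x \<in> Obj (under A)" for x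
    using that by (intro E.cat_object_functor_eqI) simp_all
  show "lt_cat_trans A E (ln_to_lt A E \<beta>) f = ln_arr \<beta> f" if "f \<in> Arr (under A)"
    using that by (intro cat_object_trans.equality) (simp_all add: o)
qed

lemma lt_to_ln_to_lt: "lt_to_ln A E (ln_to_lt A E \<beta>) = \<beta>"
proof (rule lax_nat.equality)
  show "ln_dom (lt_to_ln A E (ln_to_lt A E \<beta>)) = ln_dom \<beta>"
    "ln_cod (lt_to_ln A E (ln_to_lt A E \<beta>)) = ln_cod \<beta>"
    by (simp_all add: ln_to_lt_def lf_to_tf_to_lf ln_functors)
  show "ln_obj (lt_to_ln A E (ln_to_lt A E \<beta>)) = ln_obj \<beta>"
    "ln_arr (lt_to_ln A E (ln_to_lt A E \<beta>)) = ln_arr \<beta>"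
    by (simp_all add: lt_to_ln_def lt_cat_ln_to_lt lax_nat_extensional[OF \<beta>] extensional_restrict
      cong: restrict_cong)
qed simp

end

end

lemma (in two_categories) modif_natural_cell:
  assumes \<mu>: "is_modif A B \<mu>" and \<sigma> [simp]: "\<sigma> \<in> Cells A"
  shows "VComp B (ln_arr (mf_dom \<mu>) (Src A \<sigma>))
      (HComp B (tf_cell (ln_dom (mf_dom \<mu>)) \<sigma>) (mf_obj \<mu> (A.cod (Src A \<sigma>)))) =
    VComp B (HComp B (mf_obj \<mu> (A.dom (Src A \<sigma>))) (tf_cell (ln_cod (mf_dom \<mu>)) \<sigma>))
      (ln_arr (mf_cod \<mu>) (Trg A \<sigma>))"
proof -
  note [simp] = modif_rules[OF \<mu>]
  let ?F = "ln_dom (mf_dom \<mu>)" and ?G = "ln_cod (mf_dom \<mu>)" and ?x = "A.dom (Src A \<sigma>)" and ?y =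
    "A.cod (Src A \<sigma>)"
  let ?m = "mf_obj \<mu> ?x" and ?n = "mf_obj \<mu> ?y"
  have "ln_arr (mf_dom \<mu>) (Src A \<sigma>) \<diamondop> (tf_cell ?F \<sigma> \<star> ?n) =
    (ln_arr (mf_dom \<mu>) (Src A \<sigma>) \<diamondop> (VId B (tf_arr ?F (Src A \<sigma>)) \<star> ?n)) \<diamondop>
      (tf_cell ?F \<sigma> \<star> VId B (ln_obj (mf_cod \<mu>) ?y))"
    using B.hcomp_expand(2)[of "tf_cell ?F \<sigma>" ?n] by simp
  also have "\<dots> = (?m \<star> VId B (tf_arr ?G (Src A \<sigma>))) \<diamondop>
      (ln_arr (mf_cod \<mu>) (Src A \<sigma>) \<diamondop> (tf_cell ?F \<sigma> \<star> VId B (ln_obj (mf_cod \<mu>) ?y)))"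
    unfolding modif_natural[OF \<mu> A.src_trg_arr(1)[OF \<sigma>]] by simp
  also have "\<dots> = ((?m \<star> VId B (tf_arr ?G (Src A \<sigma>))) \<diamondop>
    (VId B (ln_obj (mf_cod \<mu>) ?x) \<star> tf_cell ?G \<sigma>)) \<diamondop>
      ln_arr (mf_cod \<mu>) (Trg A \<sigma>)"
    using lax_nat_natural[OF modif_simps(2)[OF \<mu>] \<sigma>] by simp
  also have "\<dots> = (?m \<star> tf_cell ?G \<sigma>) \<diamondop> ln_arr (mf_cod \<mu>) (Trg A \<sigma>)"
    using B.hcomp_expand(1)[of ?m "tf_cell ?G \<sigma>"] by simp
  finally show ?thesis .
qed

definition md_cat_trans ::
  "('o, 'a, 'o, 'c, 'x, 'b, 'q, 'd) modulation \<Rightarrow> 'o \<Rightarrow> ('x, 'b, 'q, 'd) cat_object_trans" where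
  "md_cat_trans \<mu> x = \<lparr> ct_dom = lt_cat_functor (md_dom \<mu>) x, ct_cod =
    lt_cat_functor (md_cod \<mu>) x, ct_cell = md_obj \<mu> x \<rparr>"

definition md_to_mf ::
  "('o, 'a, 'c) two_cat \<Rightarrow> ('x, 'b, 'q, 'd) dbl \<Rightarrow> ('o, 'a, 'o, 'c, 'x, 'b, 'q, 'd) modulation \<Rightarrow>
   ('o, 'a, 'c, ('x, 'q, 'd) cat_object, ('x, 'b, 'q, 'd) cat_object_functor, ('x, 'b, 'q, 'd)
     cat_object_trans) modif" where
  "md_to_mf A E \<mu> = \<lparr> mf_dom = lt_to_ln A E (md_dom \<mu>), mf_cod = lt_to_ln A E (md_cod \<mu>),
     mf_obj = (\<lambda>x \<in> Obj (under A). md_cat_trans \<mu> x) \<rparr>"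

definition mf_to_md ::
  "('o, 'a, 'c) two_cat \<Rightarrow> ('x, 'b, 'q, 'd) dbl \<Rightarrow>
   ('o, 'a, 'c, ('x, 'q, 'd) cat_object, ('x, 'b, 'q, 'd) cat_object_functor, ('x, 'b, 'q, 'd)
     cat_object_trans) modif \<Rightarrow>
   ('o, 'a, 'o, 'c, 'x, 'b, 'q, 'd) modulation" where
  "mf_to_md A E \<nu> = \<lparr> md_dom = ln_to_lt A E (mf_dom \<nu>), md_cod = ln_to_lt A E (mf_cod \<nu>),
     md_obj = (\<lambda>x \<in> Obj (under A). ct_cell (mf_obj \<nu> x)) \<rparr>"

lemma md_cat_simps [simp]:
  "ct_dom (md_cat_trans \<mu> x) = lt_cat_functor (md_dom \<mu>) x"
    "ct_cod (md_cat_trans \<mu> x) = lt_cat_functor (md_cod \<mu>) x"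
  "ct_cell (md_cat_trans \<mu> x) = md_obj \<mu> x"
  "mf_dom (md_to_mf A E \<mu>) = lt_to_ln A E (md_dom \<mu>)"
    "mf_cod (md_to_mf A E \<mu>) = lt_to_ln A E (md_cod \<mu>)"
  "x \<in> Obj (under A) \<Longrightarrow> mf_obj (md_to_mf A E \<mu>) x = md_cat_trans \<mu> x"
  "md_dom (mf_to_md A E \<nu>) = ln_to_lt A E (mf_dom \<nu>)"
    "md_cod (mf_to_md A E \<nu>) = ln_to_lt A E (mf_cod \<nu>)"
  "x \<in> Obj (under A) \<Longrightarrow> md_obj (mf_to_md A E \<nu>) x = ct_cell (mf_obj \<nu> x)"
  by (simp_all add: md_cat_trans_def md_to_mf_def mf_to_md_def)

context ver_lax
begin

context
  fixes \<mu> :: "('o, 'a, 'o, 'c, 'x, 'b, 'q, 'd) modulation"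
  assumes \<mu>: "is_modulation (VerDbl A) E \<mu>"
begin

lemma md_trans:
  "is_lax_trans (VerDbl A) E (md_dom \<mu>)" "is_lax_trans (VerDbl A) E (md_cod \<mu>)"
  "lt_dom (md_cod \<mu>) = lt_dom (md_dom \<mu>)" "lt_cod (md_cod \<mu>) = lt_cod (md_dom \<mu>)"
  using \<mu> by (simp_all add: is_modulation_def Let_def)

lemma md_extensional: "md_obj \<mu> \<in> extensional (Obj (under A))"
  using \<mu> by (simp add: is_modulation_def Let_def)

lemmas md_lt_rules = md_trans(3,4) lt_rules[OF md_trans(1)] lt_rules[OF md_trans(2)]
  laxator_simps[OF lt_functors(2)[OF md_trans(1)]]

lemma md_obj_rules:
  assumes "x \<in> Obj (under A)"
  shows "md_obj \<mu> x \<in> Arr (D1 E)" "Dom (D1 E) (md_obj \<mu> x) = pid E (lf_obj (lt_dom (md_dom \<mu>)) x)"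
    "Cod (D1 E) (md_obj \<mu> x) = lf_pro (lt_cod (md_dom \<mu>)) x"
    "csrc E (md_obj \<mu> x) = lt_obj (md_dom \<mu>) x" "ctgt E (md_obj \<mu> x) = lt_obj (md_cod \<mu>) x"
    "E.into (lf_cat_object (lt_cod (md_dom \<mu>)) x) (md_obj \<mu> x)"
    "E.into (lf_cat_object (lt_cod (md_dom \<mu>)) x) (lt_pro (md_cod \<mu>) x)"
  using \<mu> assms lt_obj_rules[OF md_trans(2) assms]
  by (simp_all add: is_modulation_def Let_def cell_over_def E.into_def)

lemma is_cat_object_trans_md:
  assumes x [simp]: "x \<in> Obj (under A)"
  shows "is_cat_object_trans E (md_cat_trans \<mu> x)"
proof -
  note [simp] = md_lt_rules md_obj_rules
  have "lunit_inv E (lf_pro (lt_dom (md_dom \<mu>)) x) \<bullet> (md_obj \<mu> x \<otimes> lt_pro (md_cod \<mu>) x) \<bullet>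
      laxator_l (VerDbl A) E (lt_cod (md_dom \<mu>)) x =
    runit_inv E (lf_pro (lt_dom (md_dom \<mu>)) x) \<bullet> (lt_pro (md_dom \<mu>) x \<otimes> md_obj \<mu> x) \<bullet>
      laxator_r (VerDbl A) E (lt_cod (md_dom \<mu>)) x"
    using \<mu> x by (simp only: is_modulation_def Let_def VerDbl_typing)
  then show ?thesis
    by (subst E.is_cat_object_trans_iff) (simp_all add: E.lact_def E.ract_def E.mul_def)
qed

lemma md_pro_eq_hat:
  assumes x [simp]: "x \<in> Obj (under A)"
  shows "md_pro (VerDbl A) E \<mu> x = E.hat (md_cat_trans \<mu> x)"
proof -
  note [simp] = md_lt_rules md_obj_rules
  show ?thesis by (simp add: md_pro_def E.hat_def E.lact_def E.mul_def)
qed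

lemma hat_md_rules:
  assumes "x \<in> Obj (under A)"
  shows "E.hat (md_cat_trans \<mu> x) \<in> Arr (D1 E)"
    "Dom (D1 E) (E.hat (md_cat_trans \<mu> x)) = lf_pro (lt_dom (md_dom \<mu>)) x"
    "Cod (D1 E) (E.hat (md_cat_trans \<mu> x)) = lf_pro (lt_cod (md_dom \<mu>)) x"
    "csrc E (E.hat (md_cat_trans \<mu> x)) = lt_obj (md_dom \<mu>) x"
      "ctgt E (E.hat (md_cat_trans \<mu> x)) = lt_obj (md_cod \<mu>) x"
  using E.hat_rules[OF is_cat_object_trans_md[OF assms]] by (simp_all add: md_lt_rules)

lemma is_modif_md_to_mf: "is_modif A (CatObj E) (md_to_mf A E \<mu>)"
proof -
  note [simp] = md_lt_rules md_obj_rules is_cat_object_trans_md hat_md_rules E.cat_object_trans_id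
    is_cat_object_trans_lt[OF md_trans(1)] is_cat_object_trans_lt[OF md_trans(2)]
    is_lax_nat_lt_to_ln[OF md_trans(1)] is_lax_nat_lt_to_ln[OF md_trans(2)]
  have "VComp (CatObj E) (lt_cat_trans A E (md_dom \<mu>) f)
      (HComp (CatObj E) (VId (CatObj E) (lf_cat_functor A (lt_dom (md_dom \<mu>)) f))
        (md_cat_trans \<mu> (A.cod f))) =
    VComp (CatObj E) (HComp (CatObj E) (md_cat_trans \<mu> (A.dom f))
      (VId (CatObj E) (lf_cat_functor A (lt_cod (md_dom \<mu>)) f)))
      (lt_cat_trans A E (md_cod \<mu>) f)"
    if f [simp]: "f \<in> Arr (under A)" for f
  proof -
    have "lunit_inv E (lf_pro (lt_dom (md_dom \<mu>)) (A.dom (Src A \<sigma>))) \<bullet>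
      (lt_arr (md_dom \<mu>) (Src A \<sigma>) \<otimes>
        (lf_cell (lt_dom (md_dom \<mu>)) \<sigma> \<bullet> md_pro (VerDbl A) E \<mu> (A.cod (Src A \<sigma>)))) \<bullet>
        laxator_l (VerDbl A) E (lt_cod (md_dom \<mu>)) (A.cod (Src A \<sigma>)) =
      runit_inv E (lf_pro (lt_dom (md_dom \<mu>)) (A.dom (Src A \<sigma>))) \<bullet>
        ((md_pro (VerDbl A) E \<mu> (A.dom (Src A \<sigma>)) \<bullet> lf_cell (lt_cod (md_dom \<mu>)) \<sigma>) \<otimes> lt_arr
          (md_cod \<mu>) (Trg A \<sigma>)) \<bullet>
        laxator_r (VerDbl A) E (lt_cod (md_dom \<mu>)) (A.cod (Src A \<sigma>))" if "\<sigma> \<in> Cells A" for \<sigma>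
      using \<mu> that by (simp only: is_modulation_def Let_def VerDbl_typing)
    from this[of "VId A f"] have
      "E.lact (lf_cat_object (lt_cod (md_dom \<mu>)) (A.cod f)) (lt_arr (md_dom \<mu>) f)
        (lf_cell (lt_dom (md_dom \<mu>)) (VId A f) \<bullet> E.hat (md_cat_trans \<mu> (A.cod f))) =
      E.ract (lf_cat_object (lt_cod (md_dom \<mu>)) (A.cod f))
        (E.hat (md_cat_trans \<mu> (A.dom f)) \<bullet> lf_cell (lt_cod (md_dom \<mu>)) (VId A f))
          (lt_arr (md_cod \<mu>) f)"
      by (simp add: md_pro_eq_hat E.lact_def E.ract_def E.mul_def)
    then show ?thesis
      by (intro E.cat_object_trans_eqI)
        (simp_all add: E.cat_object_trans_hcomp E.cat_object_trans_vcomp(1) 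
          E.cat_object_trans_vcomp(2)[of "lt_cat_trans A E _ _"]
          E.cat_object_trans_vcomp(3)[of "HComp _ _ _"])
  qed
  then show ?thesis
    by (simp add: is_modif_def Let_def two_cell_def) (simp add: md_to_mf_def)
qed

lemma mf_to_md_to_mf: "mf_to_md A E (md_to_mf A E \<mu>) = \<mu>"
  by (intro modulation.equality)
    (simp_all add: mf_to_md_def ln_to_lt_to_ln md_trans md_extensional extensional_restrict cong:
      restrict_cong)

end

context
  fixes \<nu>
  assumes \<nu>: "is_modif A (CatObj E) \<nu>"
begin

lemmas mf_nats = modif_simps(1,2)[OF \<nu>]
lemmas mf_simps = modif_simps(3-7)[OF \<nu>, simplified]

lemma md_cat_mf_to_md:
  "x \<in> Obj (under A) \<Longrightarrow> md_cat_trans (mf_to_md A E \<nu>) x = mf_obj \<nu> x"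
  using mf_simps by (intro cat_object_trans.equality)
    (simp_all add: lt_cat_ln_to_lt[OF mf_nats(1)] lt_cat_ln_to_lt[OF mf_nats(2)])

lemma is_modulation_mf_to_md: "is_modulation (VerDbl A) E (mf_to_md A E \<nu>)"
proof -
  let ?\<mu> = "mf_to_md A E \<nu>"
  let ?K = "tf_to_lf A E (ln_dom (mf_dom \<nu>))" and ?K' = "tf_to_lf A E (ln_cod (mf_dom \<nu>))"
  note [simp] = ln_rules[OF mf_nats(1)] ln_rules[OF mf_nats(2)] mf_simps hat_tf_rules[OF mf_nats(1)]
  have T: "is_cat_object_trans E (mf_obj \<nu> x)" "ct_dom (mf_obj \<nu> x) = ln_obj (mf_dom \<nu>) x"
      "ct_cod (mf_obj \<nu> x) = ln_obj (mf_cod \<nu>) x" if "x \<in> Obj (under A)" for x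
    using that by simp_all
  have ct: "ct_cell (mf_obj \<nu> x) \<in> Arr (D1 E)"
    "Dom (D1 E) (ct_cell (mf_obj \<nu> x)) = pid E (co_obj (tf_obj (ln_dom (mf_dom \<nu>)) x))"
     "Cod (D1 E) (ct_cell (mf_obj \<nu> x)) = co_pro (tf_obj (ln_cod (mf_dom \<nu>)) x)"
     "csrc E (ct_cell (mf_obj \<nu> x)) = cf_arr (ln_obj (mf_dom \<nu>) x)"
       "ctgt E (ct_cell (mf_obj \<nu> x)) = cf_arr (ln_obj (mf_cod \<nu>) x)"
    if "x \<in> Obj (under A)" for x
    using E.ct_rules[OF T(1)[OF that]] that by simp_all
  have hat: "E.hat (mf_obj \<nu> x) \<in> Arr (D1 E)"
    "Dom (D1 E) (E.hat (mf_obj \<nu> x)) = co_pro (tf_obj (ln_dom (mf_dom \<nu>)) x)"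
     "Cod (D1 E) (E.hat (mf_obj \<nu> x)) = co_pro (tf_obj (ln_cod (mf_dom \<nu>)) x)"
     "csrc E (E.hat (mf_obj \<nu> x)) = cf_arr (ln_obj (mf_dom \<nu>) x)"
       "ctgt E (E.hat (mf_obj \<nu> x)) = cf_arr (ln_obj (mf_cod \<nu>) x)"
    if "x \<in> Obj (under A)" for x
    using E.hat_rules[OF T(1)[OF that]] that by simp_all
  note [simp] = ct hat
  have pro: "md_pro (VerDbl A) E ?\<mu> x = E.hat (mf_obj \<nu> x)" if "x \<in> Obj (under A)" for x
    using that by (simp add: md_pro_def E.hat_def E.lact_def E.mul_def)
  have 1: "cell_over E (ct_cell (mf_obj \<nu> x)) (pid E (lf_obj ?K x)) (lf_pro ?K' x)
      (cf_arr (ln_obj (mf_dom \<nu>) x)) (cf_arr (ln_obj (mf_cod \<nu>) x))" if "x \<in> Obj (under A)" for x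
    using that by (simp add: cell_over_def)
  have 2: "lunit_inv E (lf_pro ?K x) \<bullet> (ct_cell (mf_obj \<nu> x) \<otimes> cf_cell (ln_obj (mf_cod \<nu>) x)) \<bullet>
    laxator_l (VerDbl A) E ?K' x =
      runit_inv E (lf_pro ?K x) \<bullet> (cf_cell (ln_obj (mf_dom \<nu>) x) \<otimes> ct_cell (mf_obj \<nu> x)) \<bullet>
        laxator_r (VerDbl A) E ?K' x"
    if "x \<in> Obj (under A)" for x
    using E.hat_eq[OF T(1)[OF that]] that by (simp add: E.hat_def E.lact_def E.ract_def E.mul_def)
  have 3: "lunit_inv E (lf_pro ?K (A.dom (Src A \<sigma>))) \<bullet> (ct_cell (ln_arr (mf_dom \<nu>) (Src A \<sigma>)) \<otimes>
        (lf_cell ?K \<sigma> \<bullet> md_pro (VerDbl A) E ?\<mu> (A.cod (Src A \<sigma>)))) \<bullet> laxator_l (VerDbl A) E ?K'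
          (A.cod (Src A \<sigma>)) =
      runit_inv E (lf_pro ?K (A.dom (Src A \<sigma>))) \<bullet>
        ((md_pro (VerDbl A) E ?\<mu> (A.dom (Src A \<sigma>)) \<bullet> lf_cell ?K' \<sigma>) \<otimes>
        ct_cell (ln_arr (mf_cod \<nu>) (Trg A \<sigma>))) \<bullet> laxator_r (VerDbl A) E ?K' (A.cod (Src A \<sigma>))"
    if [simp]: "\<sigma> \<in> Cells A" for \<sigma>
    using AC.modif_natural_cell[OF \<nu> that, THEN arg_cong, of E.hat]
    by (simp add: E.cat_object_trans_hcomp E.cat_object_trans_vcomp(1)
      E.cat_object_trans_vcomp(2)[of "ln_arr _ _"]
        E.cat_object_trans_vcomp(3)[of "HComp _ _ _"] pro E.lact_def E.ract_def E.mul_def)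
  have "md_obj ?\<mu> \<in> extensional (Obj (under A))" by (simp add: mf_to_md_def)
  then show ?thesis
    using 1 2 3 is_lax_trans_ln_to_lt[OF mf_nats(1)] is_lax_trans_ln_to_lt[OF mf_nats(2)]
    by (simp add: is_modulation_def Let_def del: lf_tf_simps)
qed

lemma md_to_mf_to_md: "md_to_mf A E (mf_to_md A E \<nu>) = \<nu>"
proof (rule modif.equality)
  show "mf_dom (md_to_mf A E (mf_to_md A E \<nu>)) = mf_dom \<nu>"
    "mf_cod (md_to_mf A E (mf_to_md A E \<nu>)) = mf_cod \<nu>"
    by (simp_all add: lt_to_ln_to_lt mf_nats)
  show "mf_obj (md_to_mf A E (mf_to_md A E \<nu>)) = mf_obj \<nu>"
    by (simp add: md_to_mf_def md_cat_mf_to_md modif_extensional[OF \<nu>] extensional_restrict cong: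
      restrict_cong)
qed simp

end

end

lemma Lax_l_simps [simp]:
  "Obj (under (Lax_l D E)) = {F. is_lax_functor D E F}"
    "Arr (under (Lax_l D E)) = {\<alpha>. is_lax_trans D E \<alpha>}"
  "Dom (under (Lax_l D E)) = lt_dom" "Cod (under (Lax_l D E)) = lt_cod"
    "Ide (under (Lax_l D E)) = lax_trans_id D E"
  "Comp (under (Lax_l D E)) = lax_trans_comp D E" "Cells (Lax_l D E) = {\<mu>. is_modulation D E \<mu>}"
  "Src (Lax_l D E) = md_dom" "Trg (Lax_l D E) = md_cod" "VId (Lax_l D E) = modulation_id D E"
  "VComp (Lax_l D E) = modulation_vcomp D E" "HComp (Lax_l D E) = modulation_hcomp D E"
  by (simp_all add: Lax_l_def)

context ver_lax
begin

lemma lax_trans_id_eq: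
  assumes F: "is_lax_functor (VerDbl A) E F"
  shows "lax_trans_id (VerDbl A) E F = ln_to_lt A E (lax_nat_id A (CatObj E) (lf_to_tf A E F))"
  by (intro lax_trans.equality)
    (simp_all add: lax_trans_id_def ln_to_lt_def tf_to_lf_to_tf[OF F] cong: restrict_cong)

lemma lax_trans_comp_eq:
  assumes \<alpha>: "is_lax_trans (VerDbl A) E \<alpha>" and \<beta>: "is_lax_trans (VerDbl A) E \<beta>" and eq:
    "lt_cod \<alpha> = lt_dom \<beta>"
  shows "lax_trans_comp (VerDbl A) E \<alpha> \<beta> =
    ln_to_lt A E (lax_nat_comp A (CatObj E) (lt_to_ln A E \<alpha>) (lt_to_ln A E \<beta>))" (is "_ = ?r")
proof (rule lax_trans.equality)
  note [simp] = lt_rules[OF \<alpha>] lt_rules[OF \<beta>] eq[symmetric] laxator_simps[OF lt_functors(2)[OF \<beta>]]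
    is_cat_object_trans_lt[OF \<alpha>] is_cat_object_trans_lt[OF \<beta>] E.cat_object_trans_id
  show "lt_dom (lax_trans_comp (VerDbl A) E \<alpha> \<beta>) = lt_dom ?r"
    "lt_cod (lax_trans_comp (VerDbl A) E \<alpha> \<beta>) = lt_cod ?r"
    by (simp_all add: lax_trans_comp_def tf_to_lf_to_tf[OF lt_functors(1)[OF \<alpha>]]
      tf_to_lf_to_tf[OF lt_functors(2)[OF \<beta>]])
  show "lt_obj (lax_trans_comp (VerDbl A) E \<alpha> \<beta>) = lt_obj ?r"
    "lt_pro (lax_trans_comp (VerDbl A) E \<alpha> \<beta>) = lt_pro ?r"
    by (simp_all add: lax_trans_comp_def ln_to_lt_def cong: restrict_cong)
  have "ct_cell (VComp (CatObj E)
         (HComp (CatObj E) (VId (CatObj E) (lt_cat_functor \<alpha> (A.dom f))) (lt_cat_trans A E \<beta> f))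
         (HComp (CatObj E) (lt_cat_trans A E \<alpha> f) (VId (CatObj E) (lt_cat_functor \<beta> (A.cod f))))) =
      lunit_inv E (pid E (lf_obj (lt_dom \<alpha>) (A.dom f))) \<bullet>
        ((cid E (lt_obj \<alpha> (A.dom f)) \<bullet> lt_arr \<beta> f) \<otimes> (lt_arr \<alpha> f \<bullet> lt_pro \<beta> (A.cod f))) \<bullet>
        laxator_l (VerDbl A) E (lt_cod \<beta>) (A.cod f)" if [simp]: "f \<in> Arr (under A)" for f
    by (simp add: E.CatObj_VComp_cell E.cat_object_trans_hcomp E.hcomp_id_cell
      E.cat_object_functor_eqI
        E.lact_def E.mul_def)
  then show "lt_arr (lax_trans_comp (VerDbl A) E \<alpha> \<beta>) = lt_arr ?r"
    by (simp add: lax_trans_comp_def ln_to_lt_def Let_def cong: restrict_cong)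
qed simp

lemma Lax_l_transport:
  "two_cat_transport (Lax_l (VerDbl A) E) (TwoCat_lax A (CatObj E))
    (lf_to_tf A E) (lt_to_ln A E) (md_to_mf A E) (tf_to_lf A E) (ln_to_lt A E) (mf_to_md A E)"
proof (intro two_cat_transport.intro, goal_cases)
  case 1 show ?case by (rule AC.two_category_TwoCat_lax)
next
  case (22 F) then show ?case by (simp add: lax_trans_id_eq)
next
  case (23 \<alpha> \<beta>) then show ?case by (simp add: lax_trans_comp_eq)
next
  case (24 \<alpha>)
  then have \<alpha>: "is_lax_trans (VerDbl A) E \<alpha>" by simp
  show ?case
    by (intro modulation.equality)
      (simp_all add: modulation_id_def mf_to_md_def ln_to_lt_to_ln[OF \<alpha>] cong: restrict_cong)
next
  case (25 \<mu> \<nu>)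
  then have \<mu>: "is_modulation (VerDbl A) E \<mu>" and \<nu>: "is_modulation (VerDbl A) E \<nu>" and eq:
    "md_cod \<mu> = md_dom \<nu>"
    by simp_all
  note [simp] = md_lt_rules[OF \<mu>] md_lt_rules[OF \<nu>] md_obj_rules[OF \<mu>] md_obj_rules[OF \<nu>]
    eq[symmetric]
    is_cat_object_trans_md[OF \<mu>] is_cat_object_trans_md[OF \<nu>]
  show ?case
    by (intro modulation.equality)
      (simp_all add: modulation_vcomp_def mf_to_md_def ln_to_lt_to_ln md_trans[OF \<mu>] md_trans[OF \<nu>]
        E.CatObj_VComp_cell E.lact_def E.mul_def cong: restrict_cong)
next
  case (26 \<mu> \<nu>)
  then have \<mu>: "is_modulation (VerDbl A) E \<mu>" and \<nu>: "is_modulation (VerDbl A) E \<nu>"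
    and eq: "lt_cod (md_dom \<mu>) = lt_dom (md_dom \<nu>)"
    by simp_all
  note [simp] = md_lt_rules[OF \<mu>] md_lt_rules[OF \<nu>] md_obj_rules[OF \<mu>] md_obj_rules[OF \<nu>]
    eq[symmetric]
    is_cat_object_trans_md[OF \<mu>] is_cat_object_trans_md[OF \<nu>]
  show ?case
    by (intro modulation.equality)
      (simp_all add: modulation_hcomp_def mf_to_md_def lax_trans_comp_eq md_trans[OF \<mu>]
        md_trans[OF \<nu>]
        E.CatObj_HComp_cell md_pro_eq_hat[OF \<nu>] cong: restrict_cong)
qed (simp_all add: is_two_functor_lf_to_tf tf_to_lf_to_tf is_lax_functor_tf_to_lf lf_to_tf_to_lf
    is_lax_nat_lt_to_ln ln_to_lt_to_ln is_lax_trans_ln_to_lt lt_to_ln_to_lt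
    is_modif_md_to_mf mf_to_md_to_mf is_modulation_mf_to_md md_to_mf_to_md lt_functors md_trans)

end

theorem Lax_l_isomorphic:
  assumes "two_category A" "double_category E"
  shows "isomorphic_two_cats (Lax_l (VerDbl A) E) (TwoCat_lax A (CatObj E))"
proof -
  interpret ver_lax A E using assms by (rule ver_lax.intro)
  show ?thesis by (rule two_cat_transport.isomorphic[OF Lax_l_transport])
qed

section \<open>Spans\<close>

lemma Set_cat_simps [simp]:
  "Obj (Set_cat U) = U" "Dom (Set_cat U) = fn_dom" "Cod (Set_cat U) = fn_cod"
  "Comp (Set_cat U) = fn_comp"
  "f \<in> Arr (Set_cat U) \<longleftrightarrow> fn_dom f \<in> U \<and> fn_cod f \<in> U \<and> fn_map f \<in> fn_dom f \<rightarrow>\<^sub>E fn_cod f"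
  "fn_dom (Ide (Set_cat U) X) = X" "fn_cod (Ide (Set_cat U) X) = X"
    "a \<in> X \<Longrightarrow> fn_map (Ide (Set_cat U) X) a = a"
  "fn_map (Ide (Set_cat U) X) = (\<lambda>a \<in> X. a)"
  by (simp_all add: Set_cat_def)

lemma fn_comp_simps [simp]:
  "fn_dom (fn_comp f g) = fn_dom f" "fn_cod (fn_comp f g) = fn_cod g"
  "fn_map (fn_comp f g) = (\<lambda>a \<in> fn_dom f. fn_map g (fn_map f a))"
  by (simp_all add: fn_comp_def)

lemma fn_eqI:
  assumes "fn_dom f = fn_dom g" "fn_cod f = fn_cod g" "fn_map f \<in> extensional (fn_dom f)"
    "fn_map g \<in> extensional (fn_dom g)"
    "\<And>a. a \<in> fn_dom f \<Longrightarrow> fn_map f a = fn_map g a"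
  shows "f = (g :: 'u fn)"
  using assms by (intro fn.equality extensionalityI[of _ "fn_dom f"]) auto

lemma category_Set_cat: "category (Set_cat U)"
  by (intro category.intro) (auto intro!: fn_eqI simp: PiE_iff)

lemma span_map_eqI:
  assumes "is_span_map U \<alpha>" "is_span_map U \<beta>" "sm_dom \<alpha> = sm_dom \<beta>" "sm_cod \<alpha> = sm_cod \<beta>"
    "sm_src \<alpha> = sm_src \<beta>" "sm_tgt \<alpha> = sm_tgt \<beta>"
      "\<And>a. a \<in> sp_apex (sm_dom \<alpha>) \<Longrightarrow> sm_map \<alpha> a = sm_map \<beta> a"
  shows "\<alpha> = (\<beta> :: 'u span_map)"
  using assms by (intro span_map.equality extensionalityI[of _ "sp_apex (sm_dom \<alpha>)"])
    (auto simp: is_span_map_def Let_def PiE_iff)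

context set_universe
begin

lemma unpair [simp]: "unpair1 p (p (a, b)) = a" "unpair2 p (p (a, b)) = b"
  by (simp_all add: unpair1_def unpair2_def pair_inj)

lemma p_eq_iff [simp]: "p (a, b) = p (c, d) \<longleftrightarrow> a = c \<and> b = d"
  using pair_inj by (auto dest: injD)

lemma mem_pullback [simp]:
  "p (a, b) \<in> pullback_apex p m n \<longleftrightarrow> a \<in> sp_apex m \<and> b \<in> sp_apex n \<and> sp_right m a = sp_left n b"
  by (auto simp: pullback_apex_def)

lemma pullbackE [elim!]:
  assumes "c \<in> pullback_apex p m n"
  obtains a b where "c = p (a, b)" "a \<in> sp_apex m" "b \<in> sp_apex n" "sp_right m a = sp_left n b"
  using assms by (auto simp: pullback_apex_def)

lemma Span_simps [simp]:
  "D0 (Span U p) = Set_cat U" "Obj (D1 (Span U p)) = {m. is_span U m}"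
    "Arr (D1 (Span U p)) = {\<alpha>. is_span_map U \<alpha>}"
  "Dom (D1 (Span U p)) = sm_dom" "Cod (D1 (Span U p)) = sm_cod"
  "Ide (D1 (Span U p)) m = globular_span_map U m m (\<lambda>a. a)"
  "sm_dom (\<alpha> \<bullet>\<^bsub>Span U p\<^esub> \<beta>) = sm_dom \<alpha>" "sm_cod (\<alpha> \<bullet>\<^bsub>Span U p\<^esub> \<beta>) = sm_cod \<beta>"
  "sm_src (\<alpha> \<bullet>\<^bsub>Span U p\<^esub> \<beta>) = fn_comp (sm_src \<alpha>) (sm_src \<beta>)"
  "sm_tgt (\<alpha> \<bullet>\<^bsub>Span U p\<^esub> \<beta>) = fn_comp (sm_tgt \<alpha>) (sm_tgt \<beta>)"
  "sm_map (\<alpha> \<bullet>\<^bsub>Span U p\<^esub> \<beta>) = (\<lambda>a \<in> sp_apex (sm_dom \<alpha>). sm_map \<beta> (sm_map \<alpha> a))"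
  "psrc (Span U p) = sp_src" "ptgt (Span U p) = sp_tgt" "csrc (Span U p) = sm_src"
    "ctgt (Span U p) = sm_tgt"
  "pid (Span U p) = span_id" "pcomp (Span U p) = span_comp p"
  "sm_dom (cid (Span U p) f) = span_id (fn_dom f)" "sm_cod (cid (Span U p) f) = span_id (fn_cod f)"
  "sm_src (cid (Span U p) f) = f" "sm_tgt (cid (Span U p) f) = f"
    "sm_map (cid (Span U p) f) = fn_map f"
  "sm_dom (\<alpha> \<otimes>\<^bsub>Span U p\<^esub> \<beta>) = span_comp p (sm_dom \<alpha>) (sm_dom \<beta>)"
  "sm_cod (\<alpha> \<otimes>\<^bsub>Span U p\<^esub> \<beta>) = span_comp p (sm_cod \<alpha>) (sm_cod \<beta>)"
  "sm_src (\<alpha> \<otimes>\<^bsub>Span U p\<^esub> \<beta>) = sm_src \<alpha>" "sm_tgt (\<alpha> \<otimes>\<^bsub>Span U p\<^esub> \<beta>) = sm_tgt \<beta>"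
  "sm_map (\<alpha> \<otimes>\<^bsub>Span U p\<^esub> \<beta>) = (\<lambda>c \<in> pullback_apex p (sm_dom \<alpha>) (sm_dom \<beta>).
      p (sm_map \<alpha> (unpair1 p c), sm_map \<beta> (unpair2 p c)))"
  "passoc (Span U p) m n q = 
     globular_span_map U (span_comp p (span_comp p m n) q) (span_comp p m (span_comp p n q))
           (\<lambda>c. p (unpair1 p (unpair1 p c), p (unpair2 p (unpair1 p c), unpair2 p c)))"
  "lunit (Span U p) m = globular_span_map U (span_comp p (span_id (sp_src m)) m) m (unpair2 p)"
  "runit (Span U p) m = globular_span_map U (span_comp p m (span_id (sp_tgt m))) m (unpair1 p)"
  by (simp_all add: Span_def)

lemma span_comp_simps [simp]:
  "sp_src (span_comp p m n) = sp_src m" "sp_tgt (span_comp p m n) = sp_tgt n"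
  "sp_apex (span_comp p m n) = pullback_apex p m n"
  "sp_left (span_comp p m n) = (\<lambda>c \<in> pullback_apex p m n. sp_left m (unpair1 p c))"
  "sp_right (span_comp p m n) = (\<lambda>c \<in> pullback_apex p m n. sp_right n (unpair2 p c))"
  by (simp_all add: span_comp_def)

lemma span_id_simps [simp]:
  "sp_src (span_id X) = X" "sp_tgt (span_id X) = X" "sp_apex (span_id X) = X"
  "sp_left (span_id X) = (\<lambda>a \<in> X. a)" "sp_right (span_id X) = (\<lambda>a \<in> X. a)"
  by (simp_all add: span_id_def)

lemma globular_span_map_simps [simp]:
  "sm_dom (globular_span_map U m n h) = m" "sm_cod (globular_span_map U m n h) = n"
  "sm_src (globular_span_map U m n h) = Ide (Set_cat U) (sp_src m)"
  "sm_tgt (globular_span_map U m n h) = Ide (Set_cat U) (sp_tgt m)"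
  "sm_map (globular_span_map U m n h) = (\<lambda>a \<in> sp_apex m. h a)"
  by (simp_all add: globular_span_map_def)

lemma is_span_rules:
  assumes "is_span U m"
  shows "sp_src m \<in> U" "sp_tgt m \<in> U" "sp_apex m \<in> U" 
    "sp_left m \<in> sp_apex m \<rightarrow>\<^sub>E sp_src m" "sp_right m \<in> sp_apex m \<rightarrow>\<^sub>E sp_tgt m"
    "a \<in> sp_apex m \<Longrightarrow> sp_left m a \<in> sp_src m" "a \<in> sp_apex m \<Longrightarrow> sp_right m a \<in> sp_tgt m"
  using assms by (auto simp: is_span_def)

lemma is_span_id [simp]: "X \<in> U \<Longrightarrow> is_span U (span_id X)"
  by (simp add: is_span_def)

lemma is_span_comp [simp]:
  assumes m: "is_span U m" and n: "is_span U n" shows "is_span U (span_comp p m n)"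
proof -
  have "pullback_apex p m n \<in> U"
    by (rule subset_small[OF product_small[OF is_span_rules(3)[OF m] is_span_rules(3)[OF n]]]) auto
  then show ?thesis
    using is_span_rules[OF m] is_span_rules[OF n] by (auto simp: is_span_def)
qed

lemma is_span_map_rules:
  assumes "is_span_map U \<alpha>"
  shows "is_span U (sm_dom \<alpha>)" "is_span U (sm_cod \<alpha>)"
    "fn_dom (sm_src \<alpha>) = sp_src (sm_dom \<alpha>)" "fn_cod (sm_src \<alpha>) = sp_src (sm_cod \<alpha>)"
    "fn_dom (sm_tgt \<alpha>) = sp_tgt (sm_dom \<alpha>)" "fn_cod (sm_tgt \<alpha>) = sp_tgt (sm_cod \<alpha>)"
    "fn_map (sm_src \<alpha>) \<in> sp_src (sm_dom \<alpha>) \<rightarrow>\<^sub>E sp_src (sm_cod \<alpha>)"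
    "fn_map (sm_tgt \<alpha>) \<in> sp_tgt (sm_dom \<alpha>) \<rightarrow>\<^sub>E sp_tgt (sm_cod \<alpha>)"
    "sm_map \<alpha> \<in> sp_apex (sm_dom \<alpha>) \<rightarrow>\<^sub>E sp_apex (sm_cod \<alpha>)"
    "a \<in> sp_apex (sm_dom \<alpha>) \<Longrightarrow> sm_map \<alpha> a \<in> sp_apex (sm_cod \<alpha>)"
    "x \<in> sp_src (sm_dom \<alpha>) \<Longrightarrow> fn_map (sm_src \<alpha>) x \<in> sp_src (sm_cod \<alpha>)"
    "y \<in> sp_tgt (sm_dom \<alpha>) \<Longrightarrow> fn_map (sm_tgt \<alpha>) y \<in> sp_tgt (sm_cod \<alpha>)"
    "a \<in> sp_apex (sm_dom \<alpha>) \<Longrightarrow> sp_left (sm_cod \<alpha>) (sm_map \<alpha> a) =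
      fn_map (sm_src \<alpha>) (sp_left (sm_dom \<alpha>) a)"
    "a \<in> sp_apex (sm_dom \<alpha>) \<Longrightarrow> sp_right (sm_cod \<alpha>) (sm_map \<alpha> a) =
      fn_map (sm_tgt \<alpha>) (sp_right (sm_dom \<alpha>) a)"
  using assms by (auto simp: is_span_map_def Let_def)

lemmas span_rules = is_span_map_rules is_span_rules[OF is_span_map_rules(1)]
  is_span_rules[OF is_span_map_rules(2)]

lemma is_span_map_globular [simp]:
  assumes "is_span U m" "is_span U n" "sp_src m = sp_src n" "sp_tgt m = sp_tgt n"
    "\<And>a. a \<in> sp_apex m \<Longrightarrow> h a \<in> sp_apex n \<and> sp_left n (h a) = sp_left m a \<and> sp_right n (h a) =
      sp_right m a"
  shows "is_span_map U (globular_span_map U m n h)"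
  using assms is_span_rules[OF assms(1)] by (auto simp: is_span_map_def Let_def)

lemma is_span_map_comp [simp]:
  assumes \<alpha>: "is_span_map U \<alpha>" and \<beta>: "is_span_map U \<beta>" and eq: "sm_cod \<alpha> = sm_dom \<beta>"
  shows "is_span_map U (\<alpha> \<bullet>\<^bsub>Span U p\<^esub> \<beta>)"
proof -
  note [simp] = span_rules[OF \<alpha>] span_rules[OF \<beta>] eq[symmetric]
  show ?thesis unfolding is_span_map_def Let_def by auto
qed

lemma is_span_map_ccomp [simp]:
  assumes \<alpha>: "is_span_map U \<alpha>" and \<beta>: "is_span_map U \<beta>" and eq: "sm_tgt \<alpha> = sm_src \<beta>"
  shows "is_span_map U (\<alpha> \<otimes>\<^bsub>Span U p\<^esub> \<beta>)"
proof -
  note [simp] = span_rules[OF \<alpha>] span_rules[OF \<beta>]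
  have "sp_tgt (sm_dom \<alpha>) = sp_src (sm_dom \<beta>)" "sp_tgt (sm_cod \<alpha>) = sp_src (sm_cod \<beta>)"
    using eq span_rules(3-6)[OF \<alpha>] span_rules(3-6)[OF \<beta>] by simp_all
  then show ?thesis by (auto simp: is_span_map_def Let_def eq)
qed

lemma is_span_map_cid [simp]:
  assumes "fn_dom f \<in> U" "fn_cod f \<in> U" "fn_map f \<in> fn_dom f \<rightarrow>\<^sub>E fn_cod f"
  shows "is_span_map U (cid (Span U p) f)"
  using assms by (auto simp: is_span_map_def Let_def)

lemma is_inverse_globular:
  assumes "is_span U m" "is_span U n" "sp_src m = sp_src n" "sp_tgt m = sp_tgt n"
    "\<And>a. a \<in> sp_apex m \<Longrightarrow> h a \<in> sp_apex n \<and> sp_left n (h a) = sp_left m a \<and> sp_right n (h a) =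
      sp_right m a \<and> k (h a) = a"
    "\<And>b. b \<in> sp_apex n \<Longrightarrow> k b \<in> sp_apex m \<and> h (k b) = b"
  shows "is_inverse (D1 (Span U p)) (globular_span_map U m n h) (globular_span_map U n m k)"
proof -
  have k: "sp_left m (k b) = sp_left n b" "sp_right m (k b) = sp_right n b" if "b \<in> sp_apex n" for b
    using assms(5)[of "k b"] assms(6)[OF that] by simp_all
  note [simp] = assms(1-6) k
  show ?thesis unfolding is_inverse_def
    by (auto intro!: span_map_eqI[where U = U] fn_eqI)
qed

lemma is_span_map_id [simp]: "is_span U m \<Longrightarrow> is_span_map U (globular_span_map U m m (\<lambda>a. a))"
  by (rule is_span_map_globular) simp_all

lemma apex_compE:
  assumes "c \<in> sp_apex (span_comp p m n)"
  obtains a b where "c = p (a, b)" "a \<in> sp_apex m" "b \<in> sp_apex n" "sp_right m a = sp_left n b"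
  using assms by auto

lemma category_span_maps: "category (D1 (Span U p))"
proof (intro category.intro)
  fix \<alpha> assume "\<alpha> \<in> Arr (D1 (Span U p))"
  then have \<alpha>: "is_span_map U \<alpha>" by simp
  note [simp] = \<alpha> span_rules[OF \<alpha>]
  show "Dom (D1 (Span U p)) \<alpha> \<in> Obj (D1 (Span U p))" "Cod (D1 (Span U p)) \<alpha> \<in> Obj (D1 (Span U p))"
    by simp_all
  have e: "fn_map (sm_src \<alpha>) \<in> extensional (sp_src (sm_dom \<alpha>))"
    "fn_map (sm_tgt \<alpha>) \<in> extensional (sp_tgt (sm_dom \<alpha>))"
    using span_rules(7,8)[OF \<alpha>] by (auto simp: PiE_iff)
  show "Ide (D1 (Span U p)) (Dom (D1 (Span U p)) \<alpha>) \<bullet>\<^bsub>Span U p\<^esub> \<alpha> = \<alpha>"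
    "\<alpha> \<bullet>\<^bsub>Span U p\<^esub> Ide (D1 (Span U p)) (Cod (D1 (Span U p)) \<alpha>) = \<alpha>"
    by (auto intro!: span_map_eqI[where U = U] fn_eqI simp: e)
next
  fix \<alpha> \<beta> \<gamma> assume "composable (D1 (Span U p)) \<alpha> \<beta>" "composable (D1 (Span U p)) \<beta> \<gamma>"
  then have \<alpha>: "is_span_map U \<alpha>" and \<beta>: "is_span_map U \<beta>" and \<gamma>: "is_span_map U \<gamma>"
    and eq: "sm_cod \<alpha> = sm_dom \<beta>" "sm_cod \<beta> = sm_dom \<gamma>" by simp_all
  note [simp] = \<alpha> \<beta> \<gamma> span_rules[OF \<alpha>] span_rules[OF \<beta>] span_rules[OF \<gamma>] eq[symmetric]
  show "\<alpha> \<bullet>\<^bsub>Span U p\<^esub> \<beta> \<bullet>\<^bsub>Span U p\<^esub> \<gamma> = \<alpha> \<bullet>\<^bsub>Span U p\<^esub> (\<beta> \<bullet>\<^bsub>Span U p\<^esub> \<gamma>)"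
    by (auto intro!: span_map_eqI[where U = U] fn_eqI)
qed simp_all

lemma ccomp_typing:
  assumes "is_span_map U \<alpha>" "is_span_map U \<beta>" "sm_tgt \<alpha> = sm_src \<beta>"
  shows "sp_src (sm_dom \<beta>) = sp_tgt (sm_dom \<alpha>)" "sp_src (sm_cod \<beta>) = sp_tgt (sm_cod \<alpha>)"
  using assms is_span_map_rules(3-6)[OF assms(1)] is_span_map_rules(3-6)[OF assms(2)] by simp_all

lemma passoc_inverse:
  assumes [simp]: "is_span U m" "is_span U n" "is_span U q" "sp_tgt m = sp_src n"
    "sp_tgt n = sp_src q"
  shows "is_inverse (D1 (Span U p)) (passoc (Span U p) m n q)
      (globular_span_map U (span_comp p m (span_comp p n q)) (span_comp p (span_comp p m n) q)
        (\<lambda>c. p (p (unpair1 p c, unpair1 p (unpair2 p c)), unpair2 p (unpair2 p c))))"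
  unfolding Span_simps by (rule is_inverse_globular; (elim apex_compE)?; simp)

lemma lunit_inverse:
  assumes [simp]: "is_span U m"
  shows "is_inverse (D1 (Span U p)) (lunit (Span U p) m)
      (globular_span_map U m (span_comp p (span_id (sp_src m)) m) (\<lambda>a. p (sp_left m a, a)))"
  unfolding Span_simps by (rule is_inverse_globular; (elim apex_compE)?; simp add: is_span_rules)

lemma runit_inverse:
  assumes [simp]: "is_span U m"
  shows "is_inverse (D1 (Span U p)) (runit (Span U p) m)
      (globular_span_map U m (span_comp p m (span_id (sp_tgt m))) (\<lambda>a. p (a, sp_right m a)))"
  unfolding Span_simps by (rule is_inverse_globular; (elim apex_compE)?; simp add: is_span_rules)

lemma is_inverse_span_maps:
  assumes "is_inverse (D1 (Span U p)) \<alpha> \<beta>" shows "is_span_map U \<alpha>" "is_span_map U \<beta>"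
  using assms by (simp_all add: is_inverse_def)

lemmas is_span_map_coherence [simp] =
  is_inverse_span_maps(1)[OF passoc_inverse, unfolded Span_simps]
  is_inverse_span_maps(1)[OF lunit_inverse, unfolded Span_simps]
  is_inverse_span_maps(1)[OF runit_inverse, unfolded Span_simps]
  is_inverse_span_maps(2)[OF lunit_inverse]
  is_inverse_span_maps(2)[OF runit_inverse]

theorem double_category_Span: "double_category (Span U p)"
proof (intro double_category.intro)
  show "category (D0 (Span U p))" by (simp add: category_Set_cat)
  show "category (D1 (Span U p))" by (rule category_span_maps)
  show "cat_functor (D1 (Span U p)) (D0 (Span U p)) (psrc (Span U p)) (csrc (Span U p))"
    "cat_functor (D1 (Span U p)) (D0 (Span U p)) (ptgt (Span U p)) (ctgt (Span U p))"
    by (auto simp: cat_functor_def is_span_rules is_span_map_rules)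
  show "cat_functor (D0 (Span U p)) (D1 (Span U p)) (pid (Span U p)) (cid (Span U p))"
    by (auto simp: cat_functor_def intro!: span_map_eqI[where U = U] fn_eqI)
  show "cat_functor (composable_pairs (Span U p)) (D1 (Span U p)) (\<lambda>(m, n). pcomp (Span U p) m n)
     (\<lambda>(\<alpha>, \<beta>). \<alpha> \<otimes>\<^bsub>Span U p\<^esub> \<beta>)"
    unfolding cat_functor_def
  proof (intro conjI allI ballI impI, goal_cases)
    case (4 a b)
    obtain \<alpha> \<beta> \<alpha>' \<beta>' where ab: "a = (\<alpha>, \<beta>)" "b = (\<alpha>', \<beta>')" by (cases a, cases b)
    have \<alpha>: "is_span_map U \<alpha>" and \<beta>: "is_span_map U \<beta>" and \<alpha>': "is_span_map U \<alpha>'" and \<beta>':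
      "is_span_map U \<beta>'"
      and t: "sm_tgt \<alpha> = sm_src \<beta>" "sm_tgt \<alpha>' = sm_src \<beta>'" and c: "sm_cod \<alpha> = sm_dom \<alpha>'"
        "sm_cod \<beta> = sm_dom \<beta>'"
      using 4 by (auto simp: ab composable_pairs_def prod_cat_def ccomposable_def)
    note [simp] = \<alpha> \<beta> \<alpha>' \<beta>' span_rules[OF \<alpha>] span_rules[OF \<beta>] span_rules[OF \<alpha>'] span_rules[OF \<beta>']
      c[symmetric] t
      ccomp_typing[OF \<alpha> \<beta> t(1)] ccomp_typing[OF \<alpha>' \<beta>' t(2)]
    show ?case
      unfolding ab by (simp add: composable_pairs_def prod_cat_def, rule
        span_map_eqI[where U = U]; auto)
  qed (auto simp: composable_pairs_def prod_cat_def pcomposable_def ccomposable_def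
    is_span_map_rules
      intro!: span_map_eqI[where U = U])
  show "globular_cell (Span U p) (passoc (Span U p) m n q)
    (pcomp (Span U p) (pcomp (Span U p) m n) q)
      (pcomp (Span U p) m (pcomp (Span U p) n q))"
    "is_iso (D1 (Span U p)) (passoc (Span U p) m n q)"
    if "pcomposable (Span U p) m n" "pcomposable (Span U p) n q" for m n q
  proof -
    have [simp]: "is_span U m" "is_span U n" "is_span U q" "sp_tgt m = sp_src n"
      "sp_tgt n = sp_src q"
      using that by (simp_all add: pcomposable_def)
    show "globular_cell (Span U p) (passoc (Span U p) m n q)
      (pcomp (Span U p) (pcomp (Span U p) m n) q)
        (pcomp (Span U p) m (pcomp (Span U p) n q))"
      by (simp add: globular_cell_def cell_over_def)
    show "is_iso (D1 (Span U p)) (passoc (Span U p) m n q)"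
      unfolding is_iso_def by (rule exI, rule passoc_inverse) simp_all
  qed
  show "is_iso (D1 (Span U p)) (lunit (Span U p) m)" "is_iso (D1 (Span U p)) (runit (Span U p) m)"
    if "m \<in> Obj (D1 (Span U p))" for m
  proof -
    have m: "is_span U m" using that by simp
    show "is_iso (D1 (Span U p)) (lunit (Span U p) m)"
      unfolding is_iso_def by (rule exI, rule lunit_inverse, rule m)
    show "is_iso (D1 (Span U p)) (runit (Span U p) m)"
      unfolding is_iso_def by (rule exI, rule runit_inverse, rule m)
  qed
  show "globular_cell (Span U p) (lunit (Span U p) m) (pcomp (Span U p) (pid (Span U p) x) m) m"
    "globular_cell (Span U p) (runit (Span U p) m) (pcomp (Span U p) m (pid (Span U p) y)) m"
    if "proarrow (Span U p) m x y" for m x y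
    using that by (auto simp: globular_cell_def cell_over_def proarrow_def)
  show "(\<alpha> \<otimes>\<^bsub>Span U p\<^esub> \<beta> \<otimes>\<^bsub>Span U p\<^esub> \<gamma>) \<bullet>\<^bsub>Span U p\<^esub>
      passoc (Span U p) (Cod (D1 (Span U p)) \<alpha>) (Cod (D1 (Span U p)) \<beta>) (Cod (D1 (Span U p)) \<gamma>) =
    passoc (Span U p) (Dom (D1 (Span U p)) \<alpha>) (Dom (D1 (Span U p)) \<beta>) (Dom (D1 (Span U p)) \<gamma>)
      \<bullet>\<^bsub>Span U p\<^esub>
      (\<alpha> \<otimes>\<^bsub>Span U p\<^esub> (\<beta> \<otimes>\<^bsub>Span U p\<^esub> \<gamma>))"
    if "ccomposable (Span U p) \<alpha> \<beta>" "ccomposable (Span U p) \<beta> \<gamma>" for \<alpha> \<beta> \<gamma>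
  proof -
    have \<alpha>: "is_span_map U \<alpha>" and \<beta>: "is_span_map U \<beta>" and \<gamma>: "is_span_map U \<gamma>" 
      and t: "sm_tgt \<alpha> = sm_src \<beta>" "sm_tgt \<beta> = sm_src \<gamma>"
      using that by (auto simp: ccomposable_def)
    have e: "fn_map (sm_src \<alpha>) \<in> extensional (sp_src (sm_dom \<alpha>))"
      "fn_map (sm_tgt \<gamma>) \<in> extensional (sp_tgt (sm_dom \<gamma>))"
      using span_rules(7)[OF \<alpha>] span_rules(8)[OF \<gamma>] by (auto simp: PiE_iff)
    note [simp] = \<alpha> \<beta> \<gamma> span_rules[OF \<alpha>] span_rules[OF \<beta>] span_rules[OF \<gamma>] t
      ccomp_typing[OF \<alpha> \<beta> t(1)] ccomp_typing[OF \<beta> \<gamma> t(2)]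
    show ?thesis
      by (rule span_map_eqI[where U = U];
        ((simp only: Span_simps globular_span_map_simps, elim apex_compE, simp; fail) |
          (simp; fail) | (simp, rule fn_eqI; simp add: e)))
  qed
  show "(cid (Span U p) f \<otimes>\<^bsub>Span U p\<^esub> \<alpha>) \<bullet>\<^bsub>Span U p\<^esub> lunit (Span U p) n =
    lunit (Span U p) m \<bullet>\<^bsub>Span U p\<^esub> \<alpha>"
    "(\<alpha> \<otimes>\<^bsub>Span U p\<^esub> cid (Span U p) g) \<bullet>\<^bsub>Span U p\<^esub> runit (Span U p) n = runit (Span U p) m \<bullet>\<^bsub>Span
      U p\<^esub> \<alpha>"
    if "cell_over (Span U p) \<alpha> m n f g" for \<alpha> m n f g
  proof -
    have \<alpha>: "is_span_map U \<alpha>" and eq: "m = sm_dom \<alpha>" "n = sm_cod \<alpha>" "f = sm_src \<alpha>" "g = sm_tgt \<alpha>" 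
      using that by (auto simp: cell_over_def)
    have e: "fn_map (sm_src \<alpha>) \<in> extensional (sp_src (sm_dom \<alpha>))"
      "fn_map (sm_tgt \<alpha>) \<in> extensional (sp_tgt (sm_dom \<alpha>))"
      using span_rules(7,8)[OF \<alpha>] by (auto simp: PiE_iff)
    note [simp] = \<alpha> span_rules[OF \<alpha>] eq
    show "(cid (Span U p) f \<otimes>\<^bsub>Span U p\<^esub> \<alpha>) \<bullet>\<^bsub>Span U p\<^esub> lunit (Span U p) n =
      lunit (Span U p) m \<bullet>\<^bsub>Span U p\<^esub> \<alpha>"
      by (rule span_map_eqI[where U = U];
        ((simp only: Span_simps globular_span_map_simps, elim apex_compE, simp; fail) |
          (simp; fail) | (simp, rule fn_eqI; simp add: e)))
    show "(\<alpha> \<otimes>\<^bsub>Span U p\<^esub> cid (Span U p) g) \<bullet>\<^bsub>Span U p\<^esub> runit (Span U p) n =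
      runit (Span U p) m \<bullet>\<^bsub>Span U p\<^esub> \<alpha>"
      by (rule span_map_eqI[where U = U];
        ((simp only: Span_simps globular_span_map_simps, elim apex_compE, simp; fail) |
          (simp; fail) | (simp, rule fn_eqI; simp add: e)))
  qed
  show "(passoc (Span U p) m n q \<otimes>\<^bsub>Span U p\<^esub> cell_id (Span U p) r) \<bullet>\<^bsub>Span
    U p\<^esub> passoc (Span U p) m (pcomp (Span U p) n q) r
      \<bullet>\<^bsub>Span U p\<^esub> (cell_id (Span U p) m \<otimes>\<^bsub>Span U p\<^esub> passoc (Span U p) n q r) =
    passoc (Span U p) (pcomp (Span U p) m n) q r \<bullet>\<^bsub>Span U p\<^esub> passoc (Span U p) m n
      (pcomp (Span U p) q r)"
    if "pcomposable (Span U p) m n" "pcomposable (Span U p) n q" "pcomposable (Span U p) q r" for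
      m n q r
  proof -
    have [simp]: "is_span U m" "is_span U n" "is_span U q" "is_span U r" "sp_src n = sp_tgt m"
      "sp_src q = sp_tgt n"
      "sp_src r = sp_tgt q"
      using that by (simp_all add: pcomposable_def)
    show ?thesis
      by (rule span_map_eqI[where U = U];
        ((simp only: Span_simps globular_span_map_simps, elim apex_compE, simp; fail) |
          (simp; fail) | (simp, rule fn_eqI; simp)))
  qed
  show "passoc (Span U p) m (pid (Span U p) (ptgt (Span U p) m)) n \<bullet>\<^bsub>Span U p\<^esub>
      (cell_id (Span U p) m \<otimes>\<^bsub>Span U p\<^esub> lunit (Span U p) n) =
    runit (Span U p) m \<otimes>\<^bsub>Span U p\<^esub> cell_id (Span U p) n" if "pcomposable (Span U p) m n" for m n
  proof -
    have [simp]: "is_span U m" "is_span U n" "sp_src n = sp_tgt m"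
      using that by (simp_all add: pcomposable_def)
    have [simp]: "sp_left n b \<in> sp_tgt m" if "b \<in> sp_apex n" for b
      using is_span_rules(6)[of n b] that by simp
    have [simp]: "sp_tgt m \<in> U" by (simp add: is_span_rules)
    have [simp]: "is_span_map U
      (globular_span_map U (span_comp p (span_id (sp_tgt m)) n) n (unpair2 p))"
      using is_span_map_coherence(2)[of n] by simp
    show ?thesis
      by (rule span_map_eqI[where U = U];
        ((simp only: Span_simps globular_span_map_simps, elim apex_compE, simp; fail) |
          (simp; fail) | (simp, rule fn_eqI; simp)))
  qed
qed (auto simp: pcomposable_def ccomposable_def)

end

section \<open>Small categories as category objects in spans\<close>

definition cat_span :: "('u, 'u) cat \<Rightarrow> 'u span" where
  "cat_span C = \<lparr> sp_src = Obj C, sp_tgt = Obj C, sp_apex = Arr C, sp_left = Dom C, sp_right =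
    Cod C \<rparr>"

definition cat_to_co ::
  "'u set set \<Rightarrow> ('u \<times> 'u \<Rightarrow> 'u) \<Rightarrow> ('u, 'u) cat \<Rightarrow> ('u set, 'u span, 'u span_map) cat_object" where
  "cat_to_co U p C = \<lparr> co_obj = Obj C, co_pro = cat_span C,
     co_mult = globular_span_map U (span_comp p (cat_span C) (cat_span C)) (cat_span C)
       (\<lambda>c. unpair1 p c \<cdot>\<^bsub>C\<^esub> unpair2 p c),
     co_unit = globular_span_map U (span_id (Obj C)) (cat_span C) (Ide C) \<rparr>"

definition co_to_cat ::
  "('u \<times> 'u \<Rightarrow> 'u) \<Rightarrow> ('u set, 'u span, 'u span_map) cat_object \<Rightarrow> ('u, 'u) cat" where
  "co_to_cat p X = \<lparr> Obj = co_obj X, Arr = sp_apex (co_pro X), Dom = sp_left (co_pro X), Cod =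
    sp_right (co_pro X),
     Ide = sm_map (co_unit X),
     Comp = (\<lambda>f g. if f \<in> sp_apex (co_pro X) \<and> g \<in> sp_apex (co_pro X) \<and> sp_right (co_pro X) f =
       sp_left (co_pro X) g
       then sm_map (co_mult X) (p (f, g)) else undefined) \<rparr>"

lemma cat_span_simps [simp]:
  "sp_src (cat_span C) = Obj C" "sp_tgt (cat_span C) = Obj C" "sp_apex (cat_span C) = Arr C"
  "sp_left (cat_span C) = Dom C" "sp_right (cat_span C) = Cod C"
  by (simp_all add: cat_span_def)

lemma cat_to_co_simps [simp]:
  "co_obj (cat_to_co U p C) = Obj C" "co_pro (cat_to_co U p C) = cat_span C"
  "co_mult (cat_to_co U p C) =
    globular_span_map U (span_comp p (cat_span C) (cat_span C)) (cat_span C)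
       (\<lambda>c. unpair1 p c \<cdot>\<^bsub>C\<^esub> unpair2 p c)"
  "co_unit (cat_to_co U p C) = globular_span_map U (span_id (Obj C)) (cat_span C) (Ide C)"
  by (simp_all add: cat_to_co_def)

lemma co_to_cat_simps [simp]:
  "Obj (co_to_cat p X) = co_obj X" "Arr (co_to_cat p X) = sp_apex (co_pro X)"
  "Dom (co_to_cat p X) = sp_left (co_pro X)" "Cod (co_to_cat p X) = sp_right (co_pro X)"
  "Ide (co_to_cat p X) = sm_map (co_unit X)"
  "f \<in> sp_apex (co_pro X) \<Longrightarrow> g \<in> sp_apex (co_pro X) \<Longrightarrow> sp_right (co_pro X) f = sp_left (co_pro X) g \<Longrightarrow>
    f \<cdot>\<^bsub>co_to_cat p X\<^esub> g = sm_map (co_mult X) (p (f, g))"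
  by (simp_all add: co_to_cat_def)

context set_universe
begin

lemma lunit_inv_Span:
  "is_span U m \<Longrightarrow> lunit_inv (Span U p) m =
    globular_span_map U m (span_comp p (span_id (sp_src m)) m) (\<lambda>a. p (sp_left m a, a))"
  unfolding lunit_inv_def by (intro category.inv_arr_eqI category_span_maps lunit_inverse)

lemma runit_inv_Span:
  "is_span U m \<Longrightarrow> runit_inv (Span U p) m =
    globular_span_map U m (span_comp p m (span_id (sp_tgt m))) (\<lambda>a. p (a, sp_right m a))"
  unfolding runit_inv_def by (intro category.inv_arr_eqI category_span_maps runit_inverse)

lemma is_cat_object_cat_to_co:
  assumes C: "small_category U C" shows "is_cat_object (Span U p) (cat_to_co U p C)"
proof -
  interpret category C using C by (simp add: small_category_def)
  let ?r = "cat_span C"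
  have [simp]: "Obj C \<in> U" "Arr C \<in> U" using C by (simp_all add: small_category_def)
  have r [simp]: "is_span U ?r"
    using C by (auto simp: is_span_def small_category_def PiE_iff)
  let ?\<mu> = "co_mult (cat_to_co U p C)" and ?\<upsilon> = "co_unit (cat_to_co U p C)"
  have \<mu> [simp]: "is_span_map U
    (globular_span_map U (span_comp p ?r ?r) ?r (\<lambda>c. unpair1 p c \<cdot>\<^bsub>C\<^esub> unpair2 p c))"
    by (rule is_span_map_globular; (elim apex_compE)?; simp)
  have \<upsilon> [simp]: "is_span_map U (globular_span_map U (span_id (Obj C)) ?r (Ide C))"
    by (rule is_span_map_globular; simp)
  have lu [simp]: "is_span_map U
    (globular_span_map U (span_comp p (span_id (Obj C)) ?r) ?r (unpair2 p))"
    "is_span_map U (globular_span_map U (span_comp p ?r (span_id (Obj C))) ?r (unpair1 p))"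
    using is_span_map_coherence(2,3)[of ?r] by simp_all
  have "(?\<mu> \<otimes>\<^bsub>Span U p\<^esub> cell_id (Span U p) ?r) \<bullet>\<^bsub>Span U p\<^esub> ?\<mu> =
    passoc (Span U p) ?r ?r ?r \<bullet>\<^bsub>Span U p\<^esub> (cell_id (Span U p) ?r \<otimes>\<^bsub>Span U p\<^esub> ?\<mu>) \<bullet>\<^bsub>Span U p\<^esub> ?\<mu>"
    by (rule span_map_eqI[where U = U];
      ((simp only: Span_simps globular_span_map_simps cat_to_co_simps, elim apex_compE, simp;
        fail) | (simp; fail) | (simp, rule fn_eqI; simp)))
  moreover have "(?\<upsilon> \<otimes>\<^bsub>Span U p\<^esub> cell_id (Span U p) ?r) \<bullet>\<^bsub>Span U p\<^esub> ?\<mu> = lunit (Span U p) ?r"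
    by (rule span_map_eqI[where U = U];
      ((simp only: Span_simps globular_span_map_simps cat_to_co_simps, elim apex_compE, simp;
        fail) | (simp; fail) | (simp, rule fn_eqI; simp)))
  moreover have "(cell_id (Span U p) ?r \<otimes>\<^bsub>Span U p\<^esub> ?\<upsilon>) \<bullet>\<^bsub>Span U p\<^esub> ?\<mu> = runit (Span U p) ?r"
    by (rule span_map_eqI[where U = U];
      ((simp only: Span_simps globular_span_map_simps cat_to_co_simps, elim apex_compE, simp;
        fail) | (simp; fail) | (simp, rule fn_eqI; simp)))
  ultimately show ?thesis
    by (simp add: is_cat_object_def Let_def proarrow_def globular_cell_def cell_over_def del:
      Span_simps(6-11,18-))
qed

lemma cat_object_Span_rules:
  assumes X: "is_cat_object (Span U p) X"
  shows "co_obj X \<in> U" "is_span U (co_pro X)" "sp_src (co_pro X) = co_obj X"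
    "sp_tgt (co_pro X) = co_obj X"
    "is_span_map U (co_mult X)" "sm_dom (co_mult X) = span_comp p (co_pro X) (co_pro X)"
      "sm_cod (co_mult X) = co_pro X"
    "sm_src (co_mult X) = Ide (Set_cat U) (co_obj X)"
      "sm_tgt (co_mult X) = Ide (Set_cat U) (co_obj X)"
    "is_span_map U (co_unit X)" "sm_dom (co_unit X) = span_id (co_obj X)"
      "sm_cod (co_unit X) = co_pro X"
    "sm_src (co_unit X) = Ide (Set_cat U) (co_obj X)"
      "sm_tgt (co_unit X) = Ide (Set_cat U) (co_obj X)"
  using X by (simp_all add: is_cat_object_def Let_def proarrow_def globular_cell_def cell_over_def)

context
  fixes X assumes X: "is_cat_object (Span U p) X"
begin

lemmas co_rules = cat_object_Span_rules[OF X]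

lemma co_dom_cod:
  assumes "f \<in> sp_apex (co_pro X)" shows "sp_left (co_pro X) f \<in> (co_obj X)"
    "sp_right (co_pro X) f \<in> (co_obj X)"
  using is_span_rules[OF co_rules(2)] co_rules(3,4) assms by auto

lemma co_mult_rules:
  assumes "f \<in> sp_apex (co_pro X)" "g \<in> sp_apex (co_pro X)"
    "sp_right (co_pro X) f = sp_left (co_pro X) g"
  shows "sm_map (co_mult X) (p (f, g)) \<in> sp_apex (co_pro X)"
    "sp_left (co_pro X) (sm_map (co_mult X) (p (f, g))) = sp_left (co_pro X) f"
    "sp_right (co_pro X) (sm_map (co_mult X) (p (f, g))) = sp_right (co_pro X) g"
  using is_span_map_rules(10,13,14)[OF co_rules(5), of "p (f, g)"] assms co_dom_cod by
    (simp_all add: co_rules)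

lemma co_unit_rules:
  assumes "a \<in> (co_obj X)"
  shows "sm_map (co_unit X) a \<in> sp_apex (co_pro X)"
    "sp_left (co_pro X) (sm_map (co_unit X) a) = a" "sp_right (co_pro X) (sm_map (co_unit X) a) = a"
  using is_span_map_rules(10,13,14)[OF co_rules(10), of a] assms by (simp_all add: co_rules)

lemma co_mult_assoc:
  assumes "f \<in> sp_apex (co_pro X)" "g \<in> sp_apex (co_pro X)" "h \<in> sp_apex (co_pro X)"
    "sp_right (co_pro X) f = sp_left (co_pro X) g" "sp_right (co_pro X) g = sp_left (co_pro X) h"
  shows "sm_map (co_mult X) (p (sm_map (co_mult X) (p (f, g)), h)) =
    sm_map (co_mult X) (p (f, sm_map (co_mult X) (p (g, h))))"
proof -
  have "(co_mult X \<otimes>\<^bsub>Span U p\<^esub> cell_id (Span U p) (co_pro X)) \<bullet>\<^bsub>Span U p\<^esub> co_mult X =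
      passoc (Span U p) (co_pro X) (co_pro X) (co_pro X) \<bullet>\<^bsub>Span U p\<^esub>
        (cell_id (Span U p) (co_pro X) \<otimes>\<^bsub>Span U p\<^esub> co_mult X) \<bullet>\<^bsub>Span U p\<^esub> co_mult X"
    using X by (simp only: is_cat_object_def Let_def)
  from this[THEN arg_cong, of "\<lambda>\<alpha>. sm_map \<alpha> (p (p (f, g), h))"] show ?thesis
    using assms co_mult_rules by (simp add: co_rules)
qed

lemma co_mult_unit:
  assumes "f \<in> sp_apex (co_pro X)"
  shows "sm_map (co_mult X) (p (sm_map (co_unit X) (sp_left (co_pro X) f), f)) = f"
    "sm_map (co_mult X) (p (f, sm_map (co_unit X) (sp_right (co_pro X) f))) = f"
proof -
  have l: "(co_unit X \<otimes>\<^bsub>Span U p\<^esub> cell_id (Span U p) (co_pro X)) \<bullet>\<^bsub>Span U p\<^esub> co_mult X =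
    lunit (Span U p) (co_pro X)"
    and rr: "(cell_id (Span U p) (co_pro X) \<otimes>\<^bsub>Span U p\<^esub> co_unit X) \<bullet>\<^bsub>Span U p\<^esub> co_mult X =
      runit (Span U p) (co_pro X)"
    using X by (simp_all only: is_cat_object_def Let_def)
  note [simp] = co_rules co_dom_cod co_unit_rules assms
  show "sm_map (co_mult X) (p (sm_map (co_unit X) (sp_left (co_pro X) f), f)) = f"
    using l[THEN arg_cong, of "\<lambda>\<alpha>. sm_map \<alpha> (p (sp_left (co_pro X) f, f))"] by simp
  show "sm_map (co_mult X) (p (f, sm_map (co_unit X) (sp_right (co_pro X) f))) = f"
    using rr[THEN arg_cong, of "\<lambda>\<alpha>. sm_map \<alpha> (p (f, sp_right (co_pro X) f))"] by simp
qed

lemma small_category_co_to_cat: "small_category U (co_to_cat p X)"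
  unfolding small_category_def
proof (intro conjI)
  note [simp] = co_rules co_dom_cod co_unit_rules co_mult_rules co_mult_assoc co_mult_unit
  show "category (co_to_cat p X)"
    by (intro category.intro) auto
  show "\<forall>f g. \<not> composable (co_to_cat p X) f g \<longrightarrow> f \<cdot>\<^bsub>co_to_cat p X\<^esub> g = undefined"
    by (auto simp: co_to_cat_def)
  show "Dom (co_to_cat p X) \<in> extensional (Arr (co_to_cat p X))"
    "Cod (co_to_cat p X) \<in> extensional (Arr (co_to_cat p X))"
    "Ide (co_to_cat p X) \<in> extensional (Obj (co_to_cat p X))" "Arr (co_to_cat p X) \<in> U"
    using is_span_rules[OF co_rules(2)] is_span_map_rules(9)[OF co_rules(10)] by
      (auto simp: PiE_iff)
qed (simp_all add: co_rules)

lemma co_to_cat_to_co: "cat_to_co U p (co_to_cat p X) = X"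
proof (rule cat_object.equality)
  have rr [simp]: "cat_span (co_to_cat p X) = co_pro X"
    by (intro span.equality) (simp_all add: co_rules)
  show "co_pro (cat_to_co U p (co_to_cat p X)) = co_pro X" by simp
  have e: "sm_map (co_mult X) \<in> extensional (pullback_apex p (co_pro X) (co_pro X))"
    "sm_map (co_unit X) \<in> extensional (co_obj X)"
    using is_span_map_rules(9)[OF co_rules(5)] is_span_map_rules(9)[OF co_rules(10)] by
      (simp_all add: co_rules PiE_iff)
  show "co_mult (cat_to_co U p (co_to_cat p X)) = co_mult X"
    by (intro span_map.equality extensionalityI[of _ "pullback_apex p (co_pro X) (co_pro X)"])
      (auto simp: co_rules e)
  show "co_unit (cat_to_co U p (co_to_cat p X)) = co_unit X"
    by (intro span_map.equality) (simp_all add: co_rules e extensional_restrict)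
qed simp_all

end

lemma cat_to_co_to_cat:
  assumes C: "small_category U C" shows "co_to_cat p (cat_to_co U p C) = C"
proof -
  note C' = C[unfolded small_category_def]
  show ?thesis
  proof (rule cat.equality)
    show "Comp (co_to_cat p (cat_to_co U p C)) = Comp C"
      using C' by (intro ext) (auto simp: co_to_cat_def)
  qed (use C' in \<open>simp_all add: extensional_restrict\<close>)
qed

end

lemma Cat_simps [simp]:
  "Obj (under (Cat U)) = {C. small_category U C}" "Arr (under (Cat U)) = {F. is_small_functor U F}"
  "Dom (under (Cat U)) = sf_dom" "Cod (under (Cat U)) = sf_cod"
    "Comp (under (Cat U)) = small_functor_comp"
  "Ide (under (Cat U)) C =
    \<lparr> sf_dom = C, sf_cod = C, sf_obj = (\<lambda>x \<in> Obj C. x), sf_arr = (\<lambda>f \<in> Arr C. f) \<rparr>"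
  "Cells (Cat U) = {\<tau>. is_small_nat U \<tau>}" "Src (Cat U) = sn_dom" "Trg (Cat U) = sn_cod"
  by (simp_all add: Cat_def)

definition sf_fn :: "'u small_functor \<Rightarrow> 'u fn" where
  "sf_fn F = \<lparr> fn_dom = Obj (sf_dom F), fn_cod = Obj (sf_cod F), fn_map = sf_obj F \<rparr>"

definition sf_to_cf ::
  "'u set set \<Rightarrow> ('u \<times> 'u \<Rightarrow> 'u) \<Rightarrow> 'u small_functor \<Rightarrow> ('u set, 'u fn, 'u span, 'u span_map)
    cat_object_functor" where
  "sf_to_cf U p F = \<lparr> cf_dom = cat_to_co U p (sf_dom F), cf_cod =
    cat_to_co U p (sf_cod F), cf_arr = sf_fn F,
     cf_cell = \<lparr> sm_dom = cat_span (sf_dom F), sm_cod = cat_span (sf_cod F), sm_src = sf_fn F,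
       sm_tgt = sf_fn F,
       sm_map = sf_arr F \<rparr> \<rparr>"

definition cf_to_sf ::
  "('u \<times> 'u \<Rightarrow> 'u) \<Rightarrow> ('u set, 'u fn, 'u span, 'u span_map) cat_object_functor \<Rightarrow> 'u small_functor"
    where
  "cf_to_sf p G = \<lparr> sf_dom = co_to_cat p (cf_dom G), sf_cod = co_to_cat p (cf_cod G),
     sf_obj = fn_map (cf_arr G), sf_arr = sm_map (cf_cell G) \<rparr>"

definition sn_to_ct ::
  "'u set set \<Rightarrow> ('u \<times> 'u \<Rightarrow> 'u) \<Rightarrow> 'u small_nat \<Rightarrow> ('u set, 'u fn, 'u span, 'u span_map)
    cat_object_trans" where
  "sn_to_ct U p \<tau> = \<lparr> ct_dom = sf_to_cf U p (sn_dom \<tau>), ct_cod = sf_to_cf U p (sn_cod \<tau>),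
     ct_cell = \<lparr> sm_dom = span_id (Obj (sf_dom (sn_dom \<tau>))), sm_cod = cat_span (sf_cod (sn_dom \<tau>)),
       sm_src = sf_fn (sn_dom \<tau>), sm_tgt = sf_fn (sn_cod \<tau>), sm_map = sn_map \<tau> \<rparr> \<rparr>"

definition ct_to_sn ::
  "('u \<times> 'u \<Rightarrow> 'u) \<Rightarrow> ('u set, 'u fn, 'u span, 'u span_map) cat_object_trans \<Rightarrow> 'u small_nat" where
  "ct_to_sn p T = \<lparr> sn_dom = cf_to_sf p (ct_dom T), sn_cod = cf_to_sf p (ct_cod T), sn_map =
    sm_map (ct_cell T) \<rparr>"

lemma sf_fn_simps [simp]:
  "fn_dom (sf_fn F) = Obj (sf_dom F)" "fn_cod (sf_fn F) = Obj (sf_cod F)"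
    "fn_map (sf_fn F) = sf_obj F"
  by (simp_all add: sf_fn_def)

lemma sf_to_cf_simps [simp]:
  "cf_dom (sf_to_cf U p F) = cat_to_co U p (sf_dom F)"
    "cf_cod (sf_to_cf U p F) = cat_to_co U p (sf_cod F)"
  "cf_arr (sf_to_cf U p F) = sf_fn F"
  "sm_dom (cf_cell (sf_to_cf U p F)) = cat_span (sf_dom F)"
    "sm_cod (cf_cell (sf_to_cf U p F)) = cat_span (sf_cod F)"
  "sm_src (cf_cell (sf_to_cf U p F)) = sf_fn F" "sm_tgt (cf_cell (sf_to_cf U p F)) = sf_fn F"
  "sm_map (cf_cell (sf_to_cf U p F)) = sf_arr F"
  by (simp_all add: sf_to_cf_def)

lemma cf_to_sf_simps [simp]:
  "sf_dom (cf_to_sf p G) = co_to_cat p (cf_dom G)" "sf_cod (cf_to_sf p G) = co_to_cat p (cf_cod G)"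
  "sf_obj (cf_to_sf p G) = fn_map (cf_arr G)" "sf_arr (cf_to_sf p G) = sm_map (cf_cell G)"
  by (simp_all add: cf_to_sf_def)

lemma sn_to_ct_simps [simp]:
  "ct_dom (sn_to_ct U p \<tau>) = sf_to_cf U p (sn_dom \<tau>)"
    "ct_cod (sn_to_ct U p \<tau>) = sf_to_cf U p (sn_cod \<tau>)"
  "sm_dom (ct_cell (sn_to_ct U p \<tau>)) = span_id (Obj (sf_dom (sn_dom \<tau>)))"
  "sm_cod (ct_cell (sn_to_ct U p \<tau>)) = cat_span (sf_cod (sn_dom \<tau>))"
  "sm_src (ct_cell (sn_to_ct U p \<tau>)) = sf_fn (sn_dom \<tau>)"
    "sm_tgt (ct_cell (sn_to_ct U p \<tau>)) = sf_fn (sn_cod \<tau>)"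
  "sm_map (ct_cell (sn_to_ct U p \<tau>)) = sn_map \<tau>"
  by (simp_all add: sn_to_ct_def)

lemma ct_to_sn_simps [simp]:
  "sn_dom (ct_to_sn p T) = cf_to_sf p (ct_dom T)" "sn_cod (ct_to_sn p T) = cf_to_sf p (ct_cod T)"
  "sn_map (ct_to_sn p T) = sm_map (ct_cell T)"
  by (simp_all add: ct_to_sn_def)

context set_universe
begin

lemma small_category_rules:
  assumes "small_category U C"
  shows "category C" "Obj C \<in> U" "Arr C \<in> U" "is_span U (cat_span C)"
  using assms category.dom_cod_obj[of C] by (auto simp: is_span_def small_category_def PiE_iff)

lemma small_functor_rules:
  assumes F: "is_small_functor U F"
  shows "small_category U (sf_dom F)" "small_category U (sf_cod F)"
    "sf_obj F \<in> extensional (Obj (sf_dom F))" "sf_arr F \<in> extensional (Arr (sf_dom F))"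
    "x \<in> Obj (sf_dom F) \<Longrightarrow> sf_obj F x \<in> Obj (sf_cod F)"
    "x \<in> Obj (sf_dom F) \<Longrightarrow> sf_arr F (Ide (sf_dom F) x) = Ide (sf_cod F) (sf_obj F x)"
    "f \<in> Arr (sf_dom F) \<Longrightarrow> sf_arr F f \<in> Arr (sf_cod F)"
    "f \<in> Arr (sf_dom F) \<Longrightarrow> Dom (sf_cod F) (sf_arr F f) = sf_obj F (Dom (sf_dom F) f)"
    "f \<in> Arr (sf_dom F) \<Longrightarrow> Cod (sf_cod F) (sf_arr F f) = sf_obj F (Cod (sf_dom F) f)"
    "f \<in> Arr (sf_dom F) \<Longrightarrow> g \<in> Arr (sf_dom F) \<Longrightarrow> Cod (sf_dom F) f = Dom (sf_dom F) g \<Longrightarrow>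
      sf_arr F (f \<cdot>\<^bsub>sf_dom F\<^esub> g) = sf_arr F f \<cdot>\<^bsub>sf_cod F\<^esub> sf_arr F g"
  using F by (simp_all add: is_small_functor_def cat_functor_def)

lemma is_cat_object_functor_sf_to_cf:
  assumes F: "is_small_functor U F" shows "is_cat_object_functor (Span U p) (sf_to_cf U p F)"
proof -
  note [simp] = small_functor_rules[OF F]
  let ?C = "sf_dom F" and ?D = "sf_cod F" and ?\<phi> = "cf_cell (sf_to_cf U p F)"
  note [simp] = small_category_rules[of ?C] small_category_rules[of ?D]
  interpret C: category ?C by simp
  interpret D: category ?D by simp
  note C = cat_object_Span_rules[OF is_cat_object_cat_to_co[of ?C], simplified]
  note D = cat_object_Span_rules[OF is_cat_object_cat_to_co[of ?D], simplified]
  have fn: "sf_obj F \<in> Obj ?C \<rightarrow>\<^sub>E Obj ?D" "sf_arr F \<in> Arr ?C \<rightarrow>\<^sub>E Arr ?D" by (auto simp: PiE_iff)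
  have \<phi> [simp]: "is_span_map U ?\<phi>"
    by (auto simp: is_span_map_def Let_def fn)
  have 1: "(?\<phi> \<otimes>\<^bsub>Span U p\<^esub> ?\<phi>) \<bullet>\<^bsub>Span U p\<^esub> co_mult (cat_to_co U p ?D) =
    co_mult (cat_to_co U p ?C) \<bullet>\<^bsub>Span U p\<^esub> ?\<phi>"
    by (rule span_map_eqI[where U = U];
      ((simp only: Span_simps globular_span_map_simps cat_to_co_simps sf_to_cf_simps, elim
        apex_compE, simp; fail) |
       (simp add: C D fn; fail) | (simp, rule fn_eqI; simp)))
  have 2: "cid (Span U p) (sf_fn F) \<bullet>\<^bsub>Span U p\<^esub> co_unit (cat_to_co U p ?D) =
    co_unit (cat_to_co U p ?C) \<bullet>\<^bsub>Span U p\<^esub> ?\<phi>"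
    by (rule span_map_eqI[where U = U]; ((simp add: C D fn; fail) | (simp, rule fn_eqI; simp)))
  show ?thesis
    using 1 2 by (simp add: is_cat_object_functor_def Let_def cell_over_def
      is_cat_object_cat_to_co fn del: Span_simps(6-11,18-) cat_to_co_simps(3,4))
qed

lemma cat_object_functor_Span_rules:
  assumes G: "is_cat_object_functor (Span U p) G"
  shows "is_cat_object (Span U p) (cf_dom G)" "is_cat_object (Span U p) (cf_cod G)"
    "fn_dom (cf_arr G) = co_obj (cf_dom G)" "fn_cod (cf_arr G) = co_obj (cf_cod G)"
    "fn_map (cf_arr G) \<in> co_obj (cf_dom G) \<rightarrow>\<^sub>E co_obj (cf_cod G)"
    "is_span_map U (cf_cell G)" "sm_dom (cf_cell G) = co_pro (cf_dom G)"
      "sm_cod (cf_cell G) = co_pro (cf_cod G)"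
    "sm_src (cf_cell G) = cf_arr G" "sm_tgt (cf_cell G) = cf_arr G"
  using G by (auto simp: is_cat_object_functor_def Let_def cell_over_def)

lemma is_small_functor_cf_to_sf:
  assumes G: "is_cat_object_functor (Span U p) G" shows "is_small_functor U (cf_to_sf p G)"
proof -
  note G' = cat_object_functor_Span_rules[OF G]
  note [simp] = G' co_dom_cod[OF G'(1)] co_unit_rules[OF G'(1)] co_mult_rules[OF G'(1)]
    small_category_co_to_cat cat_object_Span_rules[OF G'(1)] cat_object_Span_rules[OF G'(2)]
  have m: "f \<in> sp_apex (co_pro (cf_dom G)) \<Longrightarrow> sm_map (cf_cell G) f \<in> sp_apex (co_pro (cf_cod G))"
    "f \<in> sp_apex (co_pro (cf_dom G)) \<Longrightarrow> sp_left (co_pro (cf_cod G)) (sm_map (cf_cell G) f) =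
      fn_map (cf_arr G) (sp_left (co_pro (cf_dom G)) f)"
    "f \<in> sp_apex (co_pro (cf_dom G)) \<Longrightarrow> sp_right (co_pro (cf_cod G)) (sm_map (cf_cell G) f) =
      fn_map (cf_arr G) (sp_right (co_pro (cf_dom G)) f)" for f
    using is_span_map_rules(10,13,14)[OF G'(6), of f] by simp_all
  have o: "fn_map (cf_arr G) a \<in> co_obj (cf_cod G)" if "a \<in> co_obj (cf_dom G)" for a
    using PiE_mem[OF G'(5) that] .
  note [simp] = m o
  have e1: "(cf_cell G \<otimes>\<^bsub>Span U p\<^esub> cf_cell G) \<bullet>\<^bsub>Span U p\<^esub> co_mult (cf_cod G) =
    co_mult (cf_dom G) \<bullet>\<^bsub>Span U p\<^esub> cf_cell G"
    using G by (simp only: is_cat_object_functor_def Let_def)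
  have 1: "f \<in> sp_apex (co_pro (cf_dom G)) \<Longrightarrow> g \<in> sp_apex (co_pro (cf_dom G)) \<Longrightarrow>
      sp_right (co_pro (cf_dom G)) f = sp_left (co_pro (cf_dom G)) g \<Longrightarrow>
      sm_map (cf_cell G) (sm_map (co_mult (cf_dom G)) (p (f, g))) =
      sm_map (co_mult (cf_cod G)) (p (sm_map (cf_cell G) f, sm_map (cf_cell G) g))" for f g
    using e1[THEN arg_cong, of "\<lambda>\<alpha>. sm_map \<alpha> (p (f, g))"] by simp
  have e2: "cid (Span U p) (cf_arr G) \<bullet>\<^bsub>Span U p\<^esub> co_unit (cf_cod G) = co_unit (cf_dom G) \<bullet>\<^bsub>Span
    U p\<^esub> cf_cell G"
    using G by (simp only: is_cat_object_functor_def Let_def)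
  have 2: "a \<in> co_obj (cf_dom G) \<Longrightarrow> sm_map (cf_cell G) (sm_map (co_unit (cf_dom G)) a) =
      sm_map (co_unit (cf_cod G)) (fn_map (cf_arr G) a)" for a
    using e2[THEN arg_cong, of "\<lambda>\<alpha>. sm_map \<alpha> a"] by simp
  have "fn_map (cf_arr G) \<in> extensional (co_obj (cf_dom G))"
    "sm_map (cf_cell G) \<in> extensional (sp_apex (co_pro (cf_dom G)))"
    using G'(5) is_span_map_rules(9)[OF G'(6)] by (simp_all add: PiE_iff del: G')  (simp add: G'(7))
  then show ?thesis
    by (simp add: is_small_functor_def cat_functor_def 1 2)
qed

lemma sf_to_cf_to_sf: "is_small_functor U F \<Longrightarrow> cf_to_sf p (sf_to_cf U p F) = F"
  by (intro small_functor.equality) (simp_all add: cat_to_co_to_cat small_functor_rules)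

lemma cf_to_sf_to_cf:
  assumes G: "is_cat_object_functor (Span U p) G" shows "sf_to_cf U p (cf_to_sf p G) = G"
proof -
  note [simp] = cat_object_functor_Span_rules[OF G] co_to_cat_to_co
  have s: "cat_span (co_to_cat p X) = co_pro X" if "is_cat_object (Span U p) X" for X
    using co_to_cat_to_co[OF that, THEN arg_cong, of co_pro] by (simp only: cat_to_co_simps)
  have f: "sf_fn (cf_to_sf p G) = cf_arr G"
    by (intro fn.equality) simp_all
  show ?thesis
    by (intro cat_object_functor.equality span_map.equality) (simp_all add: s f)
qed

lemma small_nat_rules:
  assumes "is_small_nat U \<tau>"
  shows "is_small_functor U (sn_dom \<tau>)" "is_small_functor U (sn_cod \<tau>)"
    "sf_dom (sn_cod \<tau>) = sf_dom (sn_dom \<tau>)" "sf_cod (sn_cod \<tau>) = sf_cod (sn_dom \<tau>)"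
    "sn_map \<tau> \<in> extensional (Obj (sf_dom (sn_dom \<tau>)))"
    "x \<in> Obj (sf_dom (sn_dom \<tau>)) \<Longrightarrow> sn_map \<tau> x \<in> Arr (sf_cod (sn_dom \<tau>))"
    "x \<in> Obj (sf_dom (sn_dom \<tau>)) \<Longrightarrow> Dom (sf_cod (sn_dom \<tau>)) (sn_map \<tau> x) = sf_obj (sn_dom \<tau>) x"
    "x \<in> Obj (sf_dom (sn_dom \<tau>)) \<Longrightarrow> Cod (sf_cod (sn_dom \<tau>)) (sn_map \<tau> x) = sf_obj (sn_cod \<tau>) x"
    "f \<in> Arr (sf_dom (sn_dom \<tau>)) \<Longrightarrow>
      sf_arr (sn_dom \<tau>) f \<cdot>\<^bsub>sf_cod (sn_dom \<tau>)\<^esub> sn_map \<tau> (Cod (sf_dom (sn_dom \<tau>)) f) =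
      sn_map \<tau> (Dom (sf_dom (sn_dom \<tau>)) f) \<cdot>\<^bsub>sf_cod (sn_dom \<tau>)\<^esub> sf_arr (sn_cod \<tau>) f"
  using assms by (simp_all add: is_small_nat_def Let_def)

lemma small_nat_functor_rules:
  assumes "is_small_nat U \<tau>" "F = sn_dom \<tau> \<or> F = sn_cod \<tau>"
  shows "sf_obj F \<in> Obj (sf_dom (sn_dom \<tau>)) \<rightarrow>\<^sub>E Obj (sf_cod (sn_dom \<tau>))"
    "sf_arr F \<in> Arr (sf_dom (sn_dom \<tau>)) \<rightarrow>\<^sub>E Arr (sf_cod (sn_dom \<tau>))"
    "x \<in> Obj (sf_dom (sn_dom \<tau>)) \<Longrightarrow> sf_obj F x \<in> Obj (sf_cod (sn_dom \<tau>))"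
    "f \<in> Arr (sf_dom (sn_dom \<tau>)) \<Longrightarrow> sf_arr F f \<in> Arr (sf_cod (sn_dom \<tau>))"
    "f \<in> Arr (sf_dom (sn_dom \<tau>)) \<Longrightarrow> Dom (sf_cod (sn_dom \<tau>)) (sf_arr F f) =
      sf_obj F (Dom (sf_dom (sn_dom \<tau>)) f)"
    "f \<in> Arr (sf_dom (sn_dom \<tau>)) \<Longrightarrow> Cod (sf_cod (sn_dom \<tau>)) (sf_arr F f) =
      sf_obj F (Cod (sf_dom (sn_dom \<tau>)) f)"
  using assms(2) small_functor_rules[OF small_nat_rules(1)[OF assms(1)]]
    small_functor_rules[OF small_nat_rules(2)[OF assms(1)]]
    small_nat_rules(3,4)[OF assms(1)]
  by (auto simp: PiE_iff)

lemma is_span_map_sf_to_cf: "is_small_functor U F \<Longrightarrow> is_span_map U (cf_cell (sf_to_cf U p F))"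
  using cat_object_functor_Span_rules(6)[OF is_cat_object_functor_sf_to_cf] .

lemma is_cat_object_trans_sn_to_ct:
  assumes \<tau>: "is_small_nat U \<tau>" shows "is_cat_object_trans (Span U p) (sn_to_ct U p \<tau>)"
proof -
  let ?F = "sn_dom \<tau>" and ?G = "sn_cod \<tau>" 
  let ?C = "sf_dom ?F" and ?D = "sf_cod ?F" and ?\<alpha> = "ct_cell (sn_to_ct U p \<tau>)"
  note F = small_functor_rules[OF small_nat_rules(1)[OF \<tau>]]
  note [simp] = small_nat_rules[OF \<tau>] small_nat_functor_rules[OF \<tau>] F(1,2)
    small_category_rules[OF F(1)] small_category_rules[OF F(2)]
    is_span_map_sf_to_cf[OF small_nat_rules(1)[OF \<tau>]]
      is_span_map_sf_to_cf[OF small_nat_rules(2)[OF \<tau>]]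
  interpret C: category ?C by simp
  interpret D: category ?D by simp
  note X = cat_object_Span_rules[OF is_cat_object_cat_to_co[of ?C], simplified]
  note Y = cat_object_Span_rules[OF is_cat_object_cat_to_co[of ?D], simplified]
  have map: "sn_map \<tau> \<in> Obj ?C \<rightarrow>\<^sub>E Arr ?D"
    by (auto simp: PiE_iff)
  have \<alpha> [simp]: "is_span_map U ?\<alpha>"
    by (simp add: is_span_map_def Let_def map)
  have inv: "is_span_map U
    (globular_span_map U (cat_span ?C) (span_comp p (span_id (Obj ?C)) (cat_span ?C))
    (\<lambda>a. p (Dom ?C a, a)))"
    "is_span_map U (globular_span_map U (cat_span ?C)
      (span_comp p (cat_span ?C) (span_id (Obj ?C))) (\<lambda>a. p (a, Cod ?C a)))"
    using is_span_map_coherence(4,5)[of "cat_span ?C"] by simp_all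
  have "lunit_inv (Span U p) (cat_span ?C) \<bullet>\<^bsub>Span
    U p\<^esub> (?\<alpha> \<otimes>\<^bsub>Span U p\<^esub> cf_cell (sf_to_cf U p ?G)) \<bullet>\<^bsub>Span U p\<^esub> co_mult (cat_to_co U p ?D) =
    runit_inv (Span U p) (cat_span ?C) \<bullet>\<^bsub>Span U p\<^esub> (cf_cell (sf_to_cf U p ?F) \<otimes>\<^bsub>Span U p\<^esub> ?\<alpha>)
      \<bullet>\<^bsub>Span U p\<^esub> co_mult (cat_to_co U p ?D)"
    by (rule span_map_eqI[where U = U];
      ((simp add: lunit_inv_Span runit_inv_Span inv Y; fail) |
        (simp add: lunit_inv_Span runit_inv_Span, rule fn_eqI; simp)))
  then show ?thesis
    by (simp add: is_cat_object_trans_def Let_def cell_over_def is_cat_object_functor_sf_to_cf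
        del: Span_simps(6-11,18-) cat_to_co_simps(3,4))
qed

lemma cat_object_trans_Span_rules:
  assumes T: "is_cat_object_trans (Span U p) T"
  shows "is_cat_object_functor (Span U p) (ct_dom T)" "is_cat_object_functor (Span U p) (ct_cod T)"
    "cf_dom (ct_cod T) = cf_dom (ct_dom T)" "cf_cod (ct_cod T) = cf_cod (ct_dom T)"
    "is_span_map U (ct_cell T)" "sm_dom (ct_cell T) = span_id (co_obj (cf_dom (ct_dom T)))" 
    "sm_cod (ct_cell T) = co_pro (cf_cod (ct_dom T))"
    "sm_src (ct_cell T) = cf_arr (ct_dom T)" "sm_tgt (ct_cell T) = cf_arr (ct_cod T)"
  using T by (simp_all add: is_cat_object_trans_def Let_def cell_over_def)

lemma is_small_nat_ct_to_sn:
  assumes T: "is_cat_object_trans (Span U p) T" shows "is_small_nat U (ct_to_sn p T)"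
proof -
  note T' = cat_object_trans_Span_rules[OF T]
  note F = cat_object_functor_Span_rules[OF T'(1)] and G = cat_object_functor_Span_rules[OF T'(2)]
  let ?r = "co_pro (cf_dom (ct_dom T))" and ?s = "co_pro (cf_cod (ct_dom T))" and ?x =
    "co_obj (cf_dom (ct_dom T))"
  note [simp] = T' F(1-4,6-) G(1-4,6-) cat_object_Span_rules[OF F(1)] cat_object_Span_rules[OF F(2)]
    co_dom_cod[OF F(1)]
  have t: "sm_map (ct_cell T) a \<in> sp_apex ?s"
    "sp_left ?s (sm_map (ct_cell T) a) = fn_map (cf_arr (ct_dom T)) a"
    "sp_right ?s (sm_map (ct_cell T) a) = fn_map (cf_arr (ct_cod T)) a" if "a \<in> ?x" for a
    using is_span_map_rules(10,13,14)[OF T'(5), of a] that by simp_all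
  have f: "sm_map (cf_cell (ct_dom T)) f \<in> sp_apex ?s"
     "sp_right ?s (sm_map (cf_cell (ct_dom T)) f) = fn_map (cf_arr (ct_dom T)) (sp_right ?r f)"
     "sm_map (cf_cell (ct_cod T)) f \<in> sp_apex ?s"
     "sp_left ?s (sm_map (cf_cell (ct_cod T)) f) = fn_map (cf_arr (ct_cod T)) (sp_left ?r f)" if
       "f \<in> sp_apex ?r" for f
    using is_span_map_rules(10,14)[OF F(6), of f] is_span_map_rules(10,13)[OF G(6), of f] that by
      simp_all
  note [simp] = t f
  have e: "lunit_inv (Span U p) ?r \<bullet>\<^bsub>Span U p\<^esub> (ct_cell T \<otimes>\<^bsub>Span U p\<^esub> cf_cell (ct_cod T)) \<bullet>\<^bsub>Span
    U p\<^esub> co_mult (cf_cod (ct_dom T)) =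
    runit_inv (Span U p) ?r \<bullet>\<^bsub>Span U p\<^esub> (cf_cell (ct_dom T) \<otimes>\<^bsub>Span U p\<^esub> ct_cell T) \<bullet>\<^bsub>Span U p\<^esub>
      co_mult (cf_cod (ct_dom T))"
    using T by (simp only: is_cat_object_trans_def Let_def)
  have "sm_map (co_mult (cf_cod (ct_dom T)))
    (p (sm_map (ct_cell T) (sp_left ?r f), sm_map (cf_cell (ct_cod T)) f)) =
     sm_map (co_mult (cf_cod (ct_dom T)))
       (p (sm_map (cf_cell (ct_dom T)) f, sm_map (ct_cell T) (sp_right ?r f)))"
    if "f \<in> sp_apex ?r" for f
    using e[THEN arg_cong, of "\<lambda>\<alpha>. sm_map \<alpha> f"] that by (simp add: lunit_inv_Span runit_inv_Span)
  moreover have "sm_map (ct_cell T) \<in> extensional ?x"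
    using is_span_map_rules(9)[OF T'(5)] by (simp add: PiE_iff)
  ultimately show ?thesis
    by (simp add: is_small_nat_def Let_def is_small_functor_cf_to_sf)
qed

lemma sn_to_ct_to_sn: "is_small_nat U \<tau> \<Longrightarrow> ct_to_sn p (sn_to_ct U p \<tau>) = \<tau>"
  by (intro small_nat.equality) (simp_all add: sf_to_cf_to_sf small_nat_rules)

lemma cat_span_co_to_cat: "is_cat_object (Span U p) X \<Longrightarrow> cat_span (co_to_cat p X) = co_pro X"
  using co_to_cat_to_co[of X, THEN arg_cong, of co_pro] by (simp only: cat_to_co_simps)

lemma ct_to_sn_to_ct:
  assumes T: "is_cat_object_trans (Span U p) T" shows "sn_to_ct U p (ct_to_sn p T) = T"
proof -
  note T' [simp] = cat_object_trans_Span_rules[OF T]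
  have f: "sf_fn (cf_to_sf p G) = cf_arr G" if "is_cat_object_functor (Span U p) G" for G
    using cat_object_functor_Span_rules[OF that] by (intro fn.equality) simp_all
  show ?thesis
    using cat_object_functor_Span_rules(2)[OF T'(1)]
    by (intro cat_object_trans.equality span_map.equality)
      (simp_all add: cf_to_sf_to_cf f cat_span_co_to_cat)
qed

lemma Cat_transport:
  "two_cat_transport (Cat U) (CatObj (Span U p)) (cat_to_co U p) (sf_to_cf U p) (sn_to_ct U p)
    (co_to_cat p) (cf_to_sf p) (ct_to_sn p)"
proof -
  note simps = double_category.CatObj_simps[OF double_category_Span]
    double_category.cat_object_functor_comp_simps[OF double_category_Span]
  show ?thesis
  proof (intro two_cat_transport.intro, goal_cases)
    case 1 show ?case by (rule double_category.two_category_CatObj[OF double_category_Span])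
  next
    case (22 C)
    then show ?case
      by (intro small_functor.equality) (simp_all add: simps cat_to_co_to_cat)
  next
    case (23 F G)
    then show ?case
      by (intro small_functor.equality)
        (simp_all add: simps small_functor_comp_def cat_to_co_to_cat small_functor_rules)
  next
    case (24 F)
    then have F: "is_small_functor U F" by simp
    show ?case
      by (intro small_nat.equality)
        (simp_all add: simps Cat_def sf_to_cf_to_sf[OF F] small_functor_rules[OF F] cong:
          restrict_cong)
  next
    case (25 \<sigma> \<tau>)
    then have \<sigma>: "is_small_nat U \<sigma>" and \<tau>: "is_small_nat U \<tau>" and eq: "sn_cod \<sigma> = sn_dom \<tau>" by
      simp_all
    note F = small_functor_rules[OF small_nat_rules(1)[OF \<sigma>]]
    note [simp] = small_nat_rules[OF \<sigma>] small_nat_rules[OF \<tau>] eq[symmetric]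
      small_category_rules[OF F(1)] small_category_rules[OF F(2)]
    have [simp]: "sn_map \<tau> x \<in> Arr (sf_cod (sn_dom \<sigma>))"
      "Dom (sf_cod (sn_dom \<sigma>)) (sn_map \<tau> x) = sf_obj (sn_cod \<sigma>) x"
      if "x \<in> Obj (sf_dom (sn_dom \<sigma>))" for x
      using small_nat_rules(6,7)[OF \<tau>, of x] that by simp_all
    show ?case
      by (intro small_nat.equality)
        (simp_all add: CatObj_def Cat_def sf_to_cf_to_sf lunit_inv_Span cong: restrict_cong)
  next
    case (26 \<sigma> \<tau>)
    then have \<sigma>: "is_small_nat U \<sigma>" and \<tau>: "is_small_nat U \<tau>" and eq:
      "sf_cod (sn_dom \<sigma>) = sf_dom (sn_dom \<tau>)" by simp_all
    note F = small_functor_rules[OF small_nat_rules(1)[OF \<sigma>]] and H =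
      small_functor_rules[OF small_nat_rules(1)[OF \<tau>]]
    have comp: "small_functor_comp F G =
      cf_to_sf p (cat_object_functor_comp (Span U p) (sf_to_cf U p F) (sf_to_cf U p G))"
      if "is_small_functor U F" "is_small_functor U G" "sf_cod F = sf_dom G" for F G
      using that by (intro small_functor.equality)
        (simp_all add: simps small_functor_comp_def cat_to_co_to_cat small_functor_rules)
    note [simp] = small_nat_rules[OF \<sigma>] small_nat_rules[OF \<tau>] eq[symmetric]
      small_category_rules[OF F(1)] small_category_rules[OF F(2)]
      small_category_rules[OF H(1)] small_category_rules[OF H(2)] small_nat_functor_rules[OF \<sigma>]
        small_nat_functor_rules[OF \<tau>]
    show ?case
      by (intro small_nat.equality)
        (simp_all add: CatObj_def Cat_def comp lunit_inv_Span cong: restrict_cong)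
  qed (simp_all add: simps is_cat_object_cat_to_co cat_to_co_to_cat small_category_co_to_cat
    co_to_cat_to_co
      is_cat_object_functor_sf_to_cf sf_to_cf_to_sf is_small_functor_cf_to_sf cf_to_sf_to_cf
      is_cat_object_trans_sn_to_ct sn_to_ct_to_sn is_small_nat_ct_to_sn ct_to_sn_to_ct
      small_functor_rules small_nat_rules)
qed

lemma Cat_isomorphic: "isomorphic_two_cats (CatObj (Span U p)) (Cat U)"
proof -
  interpret two_cat_transport "Cat U" "CatObj (Span U p)" "cat_to_co U p" "sf_to_cf U p"
    "sn_to_ct U p"
    "co_to_cat p" "cf_to_sf p" "ct_to_sn p" by (rule Cat_transport)
  show ?thesis using isomorphic unfolding isomorphic_two_cats_def by blast
qed

end

theorem corollary8p10:
  fixes A :: "('o, 'a, 'c) two_cat"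
    and E :: "('x, 'b, 'q, 'd) dbl"
    and U :: "'u set set" and p :: "'u \<times> 'u \<Rightarrow> 'u"
  assumes "two_category A"
  shows "(equipment E \<and> local_coequalizers E \<longrightarrow>
            isomorphic_two_cats (Lax_l (VerDbl A) E) (TwoCat_lax A (CatObj E))) \<and>
         (set_universe U p \<longrightarrow>
            isomorphic_two_cats (Lax_l (VerDbl A) (Span U p)) (TwoCat_lax A (Cat U)))"
proof (intro conjI impI)
  assume "equipment E \<and> local_coequalizers E"
  then show "isomorphic_two_cats (Lax_l (VerDbl A) E) (TwoCat_lax A (CatObj E))"
    using assms by (simp add: equipment_def Lax_l_isomorphic)
next
  assume "set_universe U p"
  then interpret set_universe U p .
  show "isomorphic_two_cats (Lax_l (VerDbl A) (Span U p)) (TwoCat_lax A (Cat U))"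
    using Lax_l_isomorphic[OF assms double_category_Span]
      TwoCat_lax_isomorphic[OF assms Cat_isomorphic]
    by (rule isomorphic_two_cats_trans)
qed

end
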